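(* Let $\omega$ be a radial weight and $1<p<\infty$, with $\frac1p+\frac1{p'}=1$. Let $X_p,Y_p\in\{H(\infty,p),H^p,D^p_{p-1},HL(p)\}$ and $T\in\{H_\omega,\widetilde{H_\omega}\}$. Then the following statements are equivalent: (i) $T:X_p\to Y_p$ is bounded; (ii) $\omega\in\mathcal{D}$ and $M_p(\omega)<\infty$, where $$M_p(\omega)=\sup_{N\in\mathbb{N}}\left(\sum_{n=0}^N\frac{1}{(n+1)^2\omega_{2n+1}^p}\right)^{1/p}\left(\sum_{n=N}^\infty\omega_{2n+1}^{p'}(n+1)^{p'-2}\right)^{1/p'};$$ (iii) $\omega\in\widehat{\mathcal{D}}$ and $M_p(\omega)<\infty$; (iv) $\omega\in\widehat{\mathcal{D}}$ and $$M_{p,c}(\omega)=\sup_{0<r<1}\left(\int_0^r\frac{1}{\widehat{\omega}(t)^p}\,dt\right)^{1/p}\left(\int_r^1\left(\frac{\widehat{\omega}(t)}{1-t}\right)^{p'}dt\right)^{1/p'}<\infty.$$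
   Context: $\mathbb{D}$ is the open unit disc of $\mathbb{C}$, $\mathcal{H}(\mathbb{D})$ the space of analytic functions on $\mathbb{D}$, $dA=\frac{dx\,dy}{\pi}$, $\mathbb{N}=\{1,2,\dots\}$. Radial weights: a radial weight is a nonnegative $\omega\in L^1([0,1))$, extended to $\mathbb{D}$ by $\omega(z)=\omega(|z|)$; standing assumption: $\widehat{\omega}(r)=\int_r^1\omega(s)\,ds>0$ for all $0\le r<1$. Moments: $\omega_x=\int_0^1 r^x\omega(r)\,dr$, $x\ge0$. $\omega\in\widehat{\mathcal{D}}$ if there is $C>1$ with $\widehat{\omega}(r)\le C\,\widehat{\omega}(\frac{1+r}{2})$ for all $0\le r<1$. $\omega\in\check{\mathcal{D}}$ if there are $K>1$, $C>1$ with $\widehat{\omega}(r)\ge C\,\widehat{\omega}(1-\frac{1-r}{K})$ for all $0\le r<1$. $\mathcal{D}=\widehat{\mathcal{D}}\cap\check{\mathcal{D}}$. Operators: $B^\omega_z(\zeta)=\sum_{n\ge0}\frac{(\overline{z}\zeta)^n}{2\omega_{2n+1}}$ is the reproducing kernel of the Bergman space $A^2_\omega=\{f\in\mathcal{H}(\mathbb{D}):\int_{\mathbb{D}}|f|^2\omega\,dA<\infty\}$, and $$H_\omega(f)(z)=\int_0^1 f(t)\left(\frac1z\int_0^zB^\omega_t(\zeta)\,d\zeta\right)\omega(t)\,dt,\qquad \widetilde{H_\omega}(f)(z)=\int_0^1|f(t)|\left(\frac1z\int_0^zB^\omega_t(\zeta)\,d\zeta\right)\omega(t)\,dt.$$ $T:X\to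 Y$ is bounded if $T(f)$ is well defined and belongs to $Y$ for every $f\in X$, and $\sup_{\|f\|_X\le1}\|T(f)\|_Y<\infty$. Spaces (of $f(z)=\sum_{n\ge 0}\widehat f(n)z^n\in\mathcal{H}(\mathbb{D})$ with finite norm), where $M_p(r,f)=\left(\frac1{2\pi}\int_0^{2\pi}|f(re^{i\theta})|^pd\theta\right)^{1/p}$ and $M_\infty(r,f)=\max_\theta|f(re^{i\theta})|$: $H^p$: $\|f\|_{H^p}=\sup_{0<r<1}M_p(r,f)$; $D^p_{p-1}$: $\|f\|^p=|f(0)|^p+\int_{\mathbb{D}}|f'(z)|^p(1-|z|)^{p-1}dA(z)$; $HL(p)$: $\|f\|^p=\sum_{n\ge0}|\widehat f(n)|^p(n+1)^{p-2}$; $H(\infty,p)$: $\|f\|^p=\int_0^1M_\infty^p(r,f)\,dr$. *)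

theory Defs
  imports "HOL-Complex_Analysis.Complex_Analysis"
begin

text \<open>Meant for positive exponents only: \<open>epowr \<infinity> a = \<infinity>\<close> for every \<open>a\<close>.\<close>

definition epowr :: "ennreal \<Rightarrow> real \<Rightarrow> ennreal" where
  "epowr x a = (if x = \<infinity> then \<infinity> else ennreal (enn2real x powr a))"

text \<open>The standing assumption that the tail integral never vanishes is part of
  \<open>radial_weight\<close>.\<close>

definition weight_tail :: "(real \<Rightarrow> real) \<Rightarrow> real \<Rightarrow> real" where
  "weight_tail \<omega> r = (LINT s:{r..<1}|lebesgue. \<omega> s)"

definition radial_weight :: "(real \<Rightarrow> real) \<Rightarrow> bool" where
  "radial_weight \<omega> \<longleftrightarrow>
     (\<forall>r\<in>{0..<1}. 0 \<le> \<omega> r) \<and> set_integrable lebesgue {0..<1} \<omega> \<and>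
     (\<forall>r\<in>{0..<1}. 0 < weight_tail \<omega> r)"

definition moment :: "(real \<Rightarrow> real) \<Rightarrow> real \<Rightarrow> real" where
  "moment \<omega> x = (LINT r:{0..<1}|lebesgue. r powr x * \<omega> r)"

definition D_hat :: "(real \<Rightarrow> real) set" where
  "D_hat = {\<omega>. \<exists>C>1. \<forall>r\<in>{0..<1}. weight_tail \<omega> r \<le> C * weight_tail \<omega> ((1 + r) / 2)}"

definition D_check :: "(real \<Rightarrow> real) set" where
  "D_check = {\<omega>. \<exists>K>1. \<exists>C>1. \<forall>r\<in>{0..<1}.
     weight_tail \<omega> r \<ge> C * weight_tail \<omega> (1 - (1 - r) / K)}"

definition D_class :: "(real \<Rightarrow> real) set" where
  "D_class = D_hat \<inter> D_check"

definition bergman_kernel :: "(real \<Rightarrow> real) \<Rightarrow> complex \<Rightarrow> complex \<Rightarrow> complex" where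
  "bergman_kernel \<omega> z \<zeta> =
     (\<Sum>n. (cnj z * \<zeta>) ^ n / of_real (2 * moment \<omega> (2 * real n + 1)))"

text \<open>The mean of the kernel over the segment from \<open>0\<close> to \<open>z\<close>. Its singularity at
  \<open>z = 0\<close> is removable, and the value there is the limit.\<close>

definition averaged_kernel :: "(real \<Rightarrow> real) \<Rightarrow> real \<Rightarrow> complex \<Rightarrow> complex" where
  "averaged_kernel \<omega> t z =
     (if z = 0 then bergman_kernel \<omega> (of_real t) 0
      else 1 / z * contour_integral (linepath 0 z) (bergman_kernel \<omega> (of_real t)))"

text \<open>The operators are partial: the image of a function is defined if the
  integral converges absolutely at every point of the disc.\<close>

definition kernel_op ::
    "(real \<Rightarrow> complex \<Rightarrow> complex) \<Rightarrow> (real \<Rightarrow> real) \<Rightarrow> (real \<Rightarrow> complex)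
      \<Rightarrow> (complex \<Rightarrow> complex) option" where
  "kernel_op K \<omega> g =
     (if \<forall>z\<in>ball 0 1. set_integrable lebesgue {0..<1} (\<lambda>t. g t * K t z * of_real (\<omega> t))
      then Some (\<lambda>z. LINT t:{0..<1}|lebesgue. g t * K t z * of_real (\<omega> t))
      else None)"

definition hilbert_op ::
    "(real \<Rightarrow> real) \<Rightarrow> (complex \<Rightarrow> complex) \<rightharpoonup> (complex \<Rightarrow> complex)" where
  "hilbert_op \<omega> f = kernel_op (averaged_kernel \<omega>) \<omega> (\<lambda>t. f (of_real t))"

definition sublinear_hilbert_op ::
    "(real \<Rightarrow> real) \<Rightarrow> (complex \<Rightarrow> complex) \<rightharpoonup> (complex \<Rightarrow> complex)" where
  "sublinear_hilbert_op \<omega> f =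
     kernel_op (averaged_kernel \<omega>) \<omega> (\<lambda>t. of_real (norm (f (of_real t))))"

definition integral_mean :: "real \<Rightarrow> real \<Rightarrow> (complex \<Rightarrow> complex) \<Rightarrow> real" where
  "integral_mean p r f =
     (1 / (2 * pi) * (LINT \<theta>:{0..2 * pi}|lborel. norm (f (rcis r \<theta>)) powr p)) powr (1 / p)"

definition max_mean :: "real \<Rightarrow> (complex \<Rightarrow> complex) \<Rightarrow> real" where
  "max_mean r f = (SUP \<theta>\<in>{0..2 * pi}. norm (f (rcis r \<theta>)))"

definition taylor_coeff :: "(complex \<Rightarrow> complex) \<Rightarrow> nat \<Rightarrow> complex" where
  "taylor_coeff f n = (deriv ^^ n) f 0 / fact n"

definition Hardy_norm :: "real \<Rightarrow> (complex \<Rightarrow> complex) \<Rightarrow> ennreal" where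
  "Hardy_norm p f = (SUP r\<in>{0<..<1}. ennreal (integral_mean p r f))"

text \<open>The factor \<open>1 / pi\<close> normalizes the area measure of the disc.\<close>

definition Dirichlet_norm :: "real \<Rightarrow> (complex \<Rightarrow> complex) \<Rightarrow> ennreal" where
  "Dirichlet_norm p f =
     epowr (ennreal (norm (f 0) powr p) +
        (\<integral>\<^sup>+z\<in>ball 0 1. ennreal (1 / pi * (norm (deriv f z) powr p * (1 - norm z) powr (p - 1))) \<partial>lborel))
       (1 / p)"

definition HL_norm :: "real \<Rightarrow> (complex \<Rightarrow> complex) \<Rightarrow> ennreal" where
  "HL_norm p f =
     epowr (\<Sum>n. ennreal (norm (taylor_coeff f n) powr p * (real n + 1) powr (p - 2))) (1 / p)"

definition Hinf_norm :: "real \<Rightarrow> (complex \<Rightarrow> complex) \<Rightarrow> ennreal" where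
  "Hinf_norm p f =
     epowr (\<integral>\<^sup>+r\<in>{0<..<1}. ennreal (max_mean r f powr p) \<partial>lborel) (1 / p)"

definition disc_space :: "((complex \<Rightarrow> complex) \<Rightarrow> ennreal) \<Rightarrow> (complex \<Rightarrow> complex) set" where
  "disc_space N = {f. f holomorphic_on ball 0 1 \<and> N f < \<infinity>}"

text \<open>A space is represented by its extended norm, so \<open>NX\<close> and \<open>NY\<close> stand for the domain
  and the codomain. \<open>T\<close> need not be linear.\<close>

definition bounded_op ::
    "((complex \<Rightarrow> complex) \<rightharpoonup> (complex \<Rightarrow> complex)) \<Rightarrow> ((complex \<Rightarrow> complex) \<Rightarrow> ennreal)
      \<Rightarrow> ((complex \<Rightarrow> complex) \<Rightarrow> ennreal) \<Rightarrow> bool" where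
  "bounded_op T NX NY \<longleftrightarrow>
     (\<forall>f\<in>disc_space NX. \<exists>g\<in>disc_space NY. T f = Some g) \<and>
     (SUP f\<in>{f \<in> disc_space NX. NX f \<le> 1}. NY (the (T f))) < \<infinity>"

text \<open>In both definitions \<open>q\<close> stands for the conjugate exponent of \<open>p\<close>. In the discrete
  one the tail sum starting at \<open>N\<close> is written as a series shifted by \<open>N\<close>.\<close>

definition M_discrete :: "real \<Rightarrow> real \<Rightarrow> (real \<Rightarrow> real) \<Rightarrow> ennreal" where
  "M_discrete p q \<omega> = (SUP N\<in>{1::nat..}.
     epowr (\<Sum>n=0..N. ennreal (1 / ((real n + 1)\<^sup>2 * moment \<omega> (2 * real n + 1) powr p))) (1 / p) *
     epowr (\<Sum>k. let n = k + N in
        ennreal (moment \<omega> (2 * real n + 1) powr q * (real n + 1) powr (q - 2))) (1 / q))"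

definition M_continuous :: "real \<Rightarrow> real \<Rightarrow> (real \<Rightarrow> real) \<Rightarrow> ennreal" where
  "M_continuous p q \<omega> = (SUP r\<in>{0<..<1}.
     epowr (\<integral>\<^sup>+t\<in>{0<..<r}. ennreal (1 / weight_tail \<omega> t powr p) \<partial>lborel) (1 / p) *
     epowr (\<integral>\<^sup>+t\<in>{r<..<1}. ennreal ((weight_tail \<omega> t / (1 - t)) powr q) \<partial>lborel) (1 / q))"

end

theory Submission
  imports Defs
begin

text \<open>All four norms can be handled alike: each dominates the sum of \<open>2\<^sup>-\<^sup>k M(r\<^sub>k, f)\<^sup>p\<close> over the radii
  \<open>r\<^sub>k = 1 - 2\<^sup>-\<^sup>k\<close>, where \<open>M\<close> is the maximum modulus, and each is controlled by a similar sum that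
  involves only bounds for \<open>(1 - z) g'(z)\<close> on \<open>\<bar>z\<bar> \<le> r\<^sub>k\<^sub>+\<^sub>1\<close> and for the Taylor coefficients of \<open>g\<close>. For
  images under the operators these bounds come from summation by parts, since the kernel coefficients
  and the moments are monotone.

  For a doubling weight both suprema are finite iff \<open>\<Sum>\<^sub>k\<^sub>\<ge>\<^sub>j u\<^sub>k\<^sup>q \<le> C u\<^sub>j\<^sup>q\<close>, where \<open>u\<^sub>k\<close> is \<open>2\<^sup>k\<^sup>/\<^sup>p\<close> times the
  tail of the weight at \<open>r\<^sub>k\<close>. This condition improves itself to geometric decay of \<open>u\<close>, which gives
  the reverse doubling condition, and boundedness through a discrete Young inequality. Conversely,
  boundedness is tested on sums of the polynomials \<open>1 + z + \<dots> + z\<^sup>n\<^sup>-\<^sup>1\<close> with \<open>n\<close> a power of two: a single one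
  forces doubling, and the extremal sequence for the duality of \<open>\<ell>\<^sup>p\<close> and \<open>\<ell>\<^sup>q\<close> gives the sum condition.\<close>

subsection \<open>Powers of extended reals and a discrete Young inequality\<close>

text \<open>The four norms are never compared in both directions on the same functions. Of the
  domain norm only a lower bound by maximum moduli is used, of the target norm only an upper bound
  for functions concentrated at the point 1; for necessity the roles are exchanged, since test
  functions must be small in \<open>X\<close> and their images large in \<open>Y\<close>. On
  functions of this kind the two bounds match, so the answer does not depend on the spaces. Complex
  values of \<open>f\<close> do no harm because the operators see \<open>f\<close> only through its
  moments on the interval: the successive differences of the complex moments are dominated by those
  of the moments of \<open>norm f\<close>, which are positive and decreasing. One estimate therefore
  serves both operators, and on test functions, which are nonnegative on the interval, the operators
  coincide. The obstacle for necessity is that nothing is known about the weight at the start.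
  Moments are comparable with tails only once doubling holds, so doubling has to be won from an
  inequality between moments of different orders.\<close>

lemma epowr_ennreal [simp]: "0 \<le> x \<Longrightarrow> epowr (ennreal x) a = ennreal (x powr a)"
  by (simp add: epowr_def)

lemma epowr_top [simp]: "epowr top a = top"
  by (simp add: epowr_def)

lemma epowr_0 [simp]: "epowr 0 a = 0"
  by (simp add: epowr_def)

lemma epowr_one [simp]: "epowr x 1 = x"
  by (cases x) auto

lemma epowr_mono: "x \<le> y \<Longrightarrow> 0 \<le> a \<Longrightarrow> epowr x a \<le> epowr y a"
  by (cases x; cases y) (auto intro!: ennreal_leI powr_mono2 simp: top_unique)

lemma epowr_less_top_iff [simp]: "epowr x a < top \<longleftrightarrow> x < top"
  by (cases x) auto

lemma epowr_epowr: "epowr (epowr x a) b = epowr x (a * b)"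
  by (cases x) (auto simp: powr_powr)

lemma epowr_mult: "0 < a \<Longrightarrow> epowr (x * y) a = epowr x a * epowr y a"
proof (cases x; cases y)
  fix r s assume "0 < a" "0 \<le> r" "x = ennreal r" "0 \<le> s" "y = ennreal s"
  then show ?thesis
    by (simp add: powr_mult flip: ennreal_mult)
next
  fix r assume a: "0 < a" "0 \<le> r" "x = ennreal r" "y = top"
  then show ?thesis
    by (cases "r = 0") (auto simp: ennreal_mult_top)
next
  fix r assume a: "0 < a" "0 \<le> r" "y = ennreal r" "x = top"
  then show ?thesis
    by (cases "r = 0") (auto simp: ennreal_top_mult)
qed auto

lemma epowr_le_imp_le:
  assumes "epowr x a \<le> y" "0 < a"
  shows "x \<le> epowr y (1 / a)"
proof -
  have "epowr (epowr x a) (1 / a) \<le> epowr y (1 / a)"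
    using assms by (intro epowr_mono) auto
  then show ?thesis
    using assms by (simp add: epowr_epowr)
qed

lemma epowr_inverse_le:
  assumes "x \<le> epowr y (1 / a)" "0 < a"
  shows "epowr x a \<le> y"
proof -
  have "epowr x a \<le> epowr (epowr y (1 / a)) a"
    using assms by (intro epowr_mono) auto
  then show ?thesis
    using assms by (simp add: epowr_epowr)
qed

lemma epowr_measurable [measurable]:
  assumes [measurable]: "f \<in> borel_measurable M"
  shows "(\<lambda>x. epowr (f x) a) \<in> borel_measurable M"
  unfolding epowr_def by measurable

lemma epowr_add_le:
  assumes "0 < p"
  shows "epowr (x + y) p \<le> ennreal (2 powr p) * (epowr x p + epowr y p)"
proof -
  have "epowr (x + y) p \<le> epowr (2 * max x y) p"
    using assms by (intro epowr_mono) (auto simp: mult_2 intro!: add_mono)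
  also have "\<dots> = ennreal (2 powr p) * epowr (max x y) p"
    using assms epowr_ennreal[of 2 p] by (simp add: epowr_mult)
  also have "epowr (max x y) p \<le> epowr x p + epowr y p"
    by (cases "x \<le> y") (auto simp: max_def intro: add_increasing add_increasing2)
  finally show ?thesis
    by (simp add: mult_left_mono)
qed

section \<open>Jensen's inequality for extended nonnegative functions\<close>

text \<open>The tangent to \<open>s powr p\<close> at the mean lies below the power, and integrating
  it against the finite measure with density \<open>k\<close> gives the claim. Boundedness of
  \<open>x\<close> makes all three integrals real numbers, so that a term may be moved across the
  inequality.\<close>

lemma nn_jensen_bounded:
  fixes k x :: "'a \<Rightarrow> ennreal" and n :: real
  assumes [measurable]: "k \<in> borel_measurable M" "x \<in> borel_measurable M"
    and W: "(\<integral>\<^sup>+t. k t \<partial>M) < top" and p: "1 < p" and bd: "\<And>t. x t \<le> ennreal n" and n: "0 \<le> n"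
  shows "epowr (\<integral>\<^sup>+t. k t * x t \<partial>M) p
    \<le> epowr (\<integral>\<^sup>+t. k t \<partial>M) (p - 1) * (\<integral>\<^sup>+t. k t * epowr (x t) p \<partial>M)"
proof -
  define W I J where "W = (\<integral>\<^sup>+t. k t \<partial>M)" and "I = (\<integral>\<^sup>+t. k t * x t \<partial>M)"
    and "J = (\<integral>\<^sup>+t. k t * epowr (x t) p \<partial>M)"
  have "I \<le> (\<integral>\<^sup>+t. k t * ennreal n \<partial>M)"
    unfolding I_def by (intro nn_integral_mono mult_left_mono bd) auto
  also have "\<dots> = W * ennreal n"
    unfolding W_def by (simp add: nn_integral_multc)
  finally have IW: "I \<le> W * ennreal n" .
  then have Ifin: "I < top"
    using W by (auto simp: W_def ennreal_mult_less_top intro: le_less_trans)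
  have bd': "epowr (x t) p \<le> ennreal (n powr p)" for t
    using epowr_mono[OF bd[of t], of p] p n by simp
  have "J \<le> (\<integral>\<^sup>+t. k t * ennreal (n powr p) \<partial>M)"
    unfolding J_def by (intro nn_integral_mono mult_left_mono bd') auto
  also have "\<dots> = W * ennreal (n powr p)"
    unfolding W_def by (simp add: nn_integral_multc)
  finally have Jfin: "J < top"
    using W by (auto simp: W_def ennreal_mult_less_top intro: le_less_trans)
  obtain w where w: "W = ennreal w" "0 \<le> w" using W by (cases W) (auto simp: W_def)
  obtain i where i: "I = ennreal i" "0 \<le> i" using Ifin by (cases I) auto
  obtain j where j: "J = ennreal j" "0 \<le> j" using Jfin by (cases J) auto
  have "epowr I p \<le> epowr W (p - 1) * J"
  proof (cases "i = 0")
    case True then show ?thesis by (simp add: i)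
  next
    case False
    with i have i0: "i > 0" by auto
    have w0: "w > 0"
    proof (rule ccontr)
      assume "\<not> w > 0"
      with w IW have "I \<le> 0" by auto
      with i0 i show False by auto
    qed
    \<comment> \<open>\<open>m\<close> is the \<open>k\<close>-average of \<open>x\<close>. With
      this choice the linear term integrates to \<open>w * m powr p\<close>, and cancelling leaves
      \<open>w * m powr p \<le> j\<close>.\<close>
    define m where "m = i / w"
    have m: "m > 0" using i0 w0 by (simp add: m_def)
    have young: "ennreal (m powr (p - 1)) * x t \<le> ennreal (1 / p) * epowr (x t) p + ennreal (m powr p * (1 - 1 / p))" for t
    proof -
      obtain y where y: "x t = ennreal y" "0 \<le> y"
        using bd[of t] by (cases "x t") (auto simp: top_unique)
      have "y * m powr (p - 1) \<le> y powr p / p + (m powr (p - 1)) powr (p / (p - 1)) / (p / (p - 1))"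
        using y m p by (intro Youngs_inequality) (auto simp: field_simps)
      also have "(m powr (p - 1)) powr (p / (p - 1)) = m powr p"
        using p by (simp add: powr_powr)
      finally have "y * m powr (p - 1) \<le> 1 / p * y powr p + m powr p * (1 - 1 / p)"
        using p by (simp add: field_simps)
      then show ?thesis
        using y p by (simp add: mult.commute flip: ennreal_mult ennreal_plus)
    qed
    have "ennreal (m powr (p - 1)) * I = (\<integral>\<^sup>+t. k t * (ennreal (m powr (p - 1)) * x t) \<partial>M)"
      unfolding I_def by (subst nn_integral_cmult[symmetric]) (auto simp: ac_simps)
    also have "\<dots> \<le> (\<integral>\<^sup>+t. k t * (ennreal (1 / p) * epowr (x t) p + ennreal (m powr p * (1 - 1 / p))) \<partial>M)"
      by (intro nn_integral_mono mult_left_mono young) auto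
    also have "\<dots> = (\<integral>\<^sup>+t. ennreal (1 / p) * (k t * epowr (x t) p) + k t * ennreal (m powr p * (1 - 1 / p)) \<partial>M)"
      by (intro nn_integral_cong) (auto simp: distrib_left ac_simps)
    also have "\<dots> = ennreal (1 / p) * J + W * ennreal (m powr p * (1 - 1 / p))"
      unfolding J_def W_def by (simp add: nn_integral_add nn_integral_cmult nn_integral_multc)
    finally have "m powr (p - 1) * i \<le> 1 / p * j + w * (m powr p * (1 - 1 / p))"
      using p i j w by (simp flip: ennreal_mult ennreal_plus)
    moreover have "m powr (p - 1) * i = w * m powr p"
      using w0 m powr_add[of m "p - 1" 1] i0 by (simp add: m_def)
    ultimately have "w * m powr p \<le> 1 / p * j + (1 - 1 / p) * (w * m powr p)"
      by (simp add: mult_ac)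
    then have "1 / p * (w * m powr p) \<le> 1 / p * j"
      by (simp add: algebra_simps)
    then have "w * m powr p \<le> j"
      using p by (simp add: divide_le_cancel)
    then have "w powr (p - 1) * (w * m powr p) \<le> w powr (p - 1) * j"
      by (intro mult_left_mono) auto
    moreover have "w powr (p - 1) * (w * m powr p) = i powr p"
    proof -
      have "w powr (p - 1) * (w * m powr p) = (w powr (p - 1) * w powr 1) * m powr p"
        using w0 by (simp only: powr_one mult.assoc less_imp_le)
      also have "w powr (p - 1) * w powr 1 = w powr p"
        by (subst powr_add[symmetric]) simp
      also have "w powr p * m powr p = (w * m) powr p"
        using w0 m by (simp add: powr_mult)
      finally show ?thesis using w0 by (simp add: m_def)
    qed
    ultimately show ?thesis
      using i j w by (simp flip: ennreal_mult)
  qed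
  then show ?thesis by (simp add: W_def I_def J_def)
qed

text \<open>Truncation at \<open>n\<close> and monotone convergence. The supremum is compared with
  the \<open>p\<close>-th root of the bound, so that no continuity of \<open>epowr\<close> has to be
  shown.\<close>

lemma nn_jensen:
  fixes k x :: "'a \<Rightarrow> ennreal"
  assumes [measurable]: "k \<in> borel_measurable M" "x \<in> borel_measurable M"
    and W: "(\<integral>\<^sup>+t. k t \<partial>M) < top" and p: "1 < p"
  shows "epowr (\<integral>\<^sup>+t. k t * x t \<partial>M) p
    \<le> epowr (\<integral>\<^sup>+t. k t \<partial>M) (p - 1) * (\<integral>\<^sup>+t. k t * epowr (x t) p \<partial>M)" (is "_ \<le> ?B")
proof -
  have x_SUP: "x t = (SUP n. min (x t) (ennreal (real n)))" for t
  proof -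
    have "(SUP n. min (x t) (ennreal (real n))) = min (x t) (SUP n. ennreal (real n))"
      by (simp flip: inf_min add: inf_SUP)
    also have "(SUP n. ennreal (real n)) = top"
      by (simp add: ennreal_SUP_of_nat_eq_top flip: ennreal_of_nat_eq_real_of_nat)
    finally show ?thesis by simp
  qed
  have "(\<integral>\<^sup>+t. k t * x t \<partial>M) = (\<integral>\<^sup>+t. (SUP n. k t * min (x t) (ennreal (real n))) \<partial>M)"
    by (subst x_SUP, subst SUP_mult_left_ennreal) simp
  also have "\<dots> = (SUP n. \<integral>\<^sup>+t. k t * min (x t) (ennreal (real n)) \<partial>M)"
    by (intro nn_integral_monotone_convergence_SUP)
       (auto simp: incseq_def le_fun_def intro!: mult_left_mono min.mono ennreal_leI)
  also have "\<dots> \<le> epowr ?B (1 / p)"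
  proof (rule SUP_least)
    fix n
    have "epowr (\<integral>\<^sup>+t. k t * min (x t) (ennreal (real n)) \<partial>M) p
      \<le> epowr (\<integral>\<^sup>+t. k t \<partial>M) (p - 1) * (\<integral>\<^sup>+t. k t * epowr (min (x t) (ennreal (real n))) p \<partial>M)"
      by (intro nn_jensen_bounded[where n = "real n"]) (auto simp: W p)
    also have "\<dots> \<le> ?B"
      using p by (intro mult_left_mono nn_integral_mono epowr_mono) auto
    finally show "(\<integral>\<^sup>+t. k t * min (x t) (ennreal (real n)) \<partial>M) \<le> epowr ?B (1 / p)"
      using p by (intro epowr_le_imp_le) auto
  qed
  finally show ?thesis
    using p by (intro epowr_inverse_le) auto
qed

lemma suminf_jensen:
  fixes k x :: "nat \<Rightarrow> ennreal"
  assumes "(\<Sum>n. k n) \<le> ennreal W" "1 < p" "0 \<le> W"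
  shows "epowr (\<Sum>n. k n * x n) p \<le> ennreal (W powr (p - 1)) * (\<Sum>n. k n * epowr (x n) p)"
proof -
  have "(\<Sum>n. k n) < top"
    using assms(1) by (auto intro: le_less_trans)
  then have "epowr (\<Sum>n. k n * x n) p \<le> epowr (\<Sum>n. k n) (p - 1) * (\<Sum>n. k n * epowr (x n) p)"
    using nn_jensen[of k "count_space UNIV" x p] assms(2) by (simp add: nn_integral_count_space_nat)
  also have "epowr (\<Sum>n. k n) (p - 1) \<le> ennreal (W powr (p - 1))"
    using epowr_mono[OF assms(1), of "p - 1"] assms by simp
  finally show ?thesis by (simp add: mult_right_mono)
qed

lemma ennreal_le_suminf:
  fixes f :: "nat \<Rightarrow> ennreal"
  shows "f i \<le> (\<Sum>i. f i)"
  using sum_le_suminf[of f "{i}"] by simp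

lemma suminf_swap_ennreal:
  fixes f :: "nat \<Rightarrow> nat \<Rightarrow> ennreal"
  shows "(\<Sum>i. \<Sum>j. f i j) = (\<Sum>j. \<Sum>i. f i j)"
proof -
  have "(\<Sum>i. \<Sum>j. f i j) = (\<integral>\<^sup>+i. (\<Sum>j. f i j) \<partial>count_space UNIV)"
    by (simp add: nn_integral_count_space_nat)
  also have "\<dots> = (\<Sum>j. \<integral>\<^sup>+i. f i j \<partial>count_space UNIV)"
    by (rule nn_integral_suminf) simp
  finally show ?thesis by (simp add: nn_integral_count_space_nat)
qed

section \<open>Convolution with a geometric kernel\<close>

text \<open>The distance of two natural numbers: with truncated subtraction one of the summands is
  \<open>0\<close>.\<close>

definition ndist :: "nat \<Rightarrow> nat \<Rightarrow> nat" where
  "ndist j k = (j - k) + (k - j)"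

lemma ndist_commute: "ndist j k = ndist k j"
  by (simp add: ndist_def)

lemma geometric_row_sum:
  assumes "0 < g" "g < 1"
  shows "(\<Sum>k. ennreal (g ^ ndist j k)) \<le> ennreal (2 / (1 - g))"
proof -
  have s: "summable (\<lambda>n. g ^ n)" using assms by (intro summable_geometric) auto
  have "(\<Sum>k. ennreal (g ^ ndist j k)) = (\<Sum>k. ennreal (g ^ ndist j (k + j))) + (\<Sum>k<j. ennreal (g ^ ndist j k))"
    by (rule suminf_offset) simp
  also have "(\<Sum>k. ennreal (g ^ ndist j (k + j))) = (\<Sum>k. ennreal (g ^ k))"
    by (simp add: ndist_def)
  also have "\<dots> = ennreal (1 / (1 - g))"
    using assms s by (subst suminf_ennreal2) (auto simp: suminf_geometric)
  also have "(\<Sum>k<j. ennreal (g ^ ndist j k)) \<le> ennreal (1 / (1 - g))"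
  proof -
    have "(\<Sum>k<j. ennreal (g ^ ndist j k)) = ennreal (\<Sum>k<j. g ^ (j - k))"
      using assms by (subst sum_ennreal) (auto simp: ndist_def)
    also have "(\<Sum>k<j. g ^ (j - k)) = (\<Sum>k<j. g ^ Suc k)"
      by (rule sum.reindex_bij_witness[of _ "\<lambda>k. j - Suc k" "\<lambda>k. j - Suc k"]) (auto simp: Suc_diff_Suc simp flip: power_Suc)
    also have "\<dots> \<le> (\<Sum>k<j. g ^ k)"
      using assms by (intro sum_mono) (auto simp: mult_left_le_one_le)
    also have "\<dots> \<le> (\<Sum>k. g ^ k)"
      using assms s by (intro sum_le_suminf) auto
    also have "\<dots> = 1 / (1 - g)"
      using assms by (intro suminf_geometric) auto
    finally show ?thesis by (simp add: ennreal_leI)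
  qed
  also have "ennreal (1 / (1 - g)) + ennreal (1 / (1 - g)) = ennreal (2 / (1 - g))"
    using assms by (simp flip: ennreal_plus)
  finally show ?thesis by (simp add: add_left_mono)
qed

text \<open>A Schur test: Jensen turns each row into an average weighted by that row, and after the
  sums are exchanged the column sums are again row sums, since \<open>ndist\<close> is symmetric.
  Most norm estimates below are reduced to this bound by exhibiting a kernel that decays off the
  diagonal.\<close>

lemma geometric_convolution:
  fixes x y :: "nat \<Rightarrow> ennreal"
  assumes g: "0 < g" "g < 1" and p: "1 < p" and D: "0 \<le> D"
    and y: "\<And>j. y j \<le> ennreal D * (\<Sum>k. ennreal (g ^ ndist j k) * x k)"
  shows "(\<Sum>j. epowr (y j) p) \<le> ennreal ((D * 2 / (1 - g)) powr p) * (\<Sum>k. epowr (x k) p)"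
proof -
  let ?W = "2 / (1 - g)"
  have W: "0 < ?W" using g by auto
  have "(\<Sum>j. epowr (y j) p)
     \<le> (\<Sum>j. ennreal (D powr p * ?W powr (p - 1)) * (\<Sum>k. ennreal (g ^ ndist j k) * epowr (x k) p))"
  proof (intro suminf_le)
    fix j
    have "epowr (y j) p \<le> epowr (ennreal D * (\<Sum>k. ennreal (g ^ ndist j k) * x k)) p"
      using p by (intro epowr_mono y) auto
    also have "\<dots> = ennreal (D powr p) * epowr (\<Sum>k. ennreal (g ^ ndist j k) * x k) p"
      using p D by (simp add: epowr_mult)
    also have "\<dots> \<le> ennreal (D powr p) *
        (ennreal (?W powr (p - 1)) * (\<Sum>k. ennreal (g ^ ndist j k) * epowr (x k) p))"
      using W by (intro mult_left_mono suminf_jensen geometric_row_sum g p) auto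
    finally show "epowr (y j) p \<le> ennreal (D powr p * ?W powr (p - 1)) * (\<Sum>k. ennreal (g ^ ndist j k) * epowr (x k) p)"
      by (simp add: ennreal_mult mult.assoc)
  qed auto
  also have "\<dots> = ennreal (D powr p * ?W powr (p - 1)) * (\<Sum>j. \<Sum>k. ennreal (g ^ ndist j k) * epowr (x k) p)"
    by (simp add: ennreal_suminf_cmult)
  also have "(\<Sum>j. \<Sum>k. ennreal (g ^ ndist j k) * epowr (x k) p) = (\<Sum>k. \<Sum>j. ennreal (g ^ ndist j k) * epowr (x k) p)"
    by (rule suminf_swap_ennreal)
  also have "\<dots> = (\<Sum>k. (\<Sum>j. ennreal (g ^ ndist k j)) * epowr (x k) p)"
    by (simp add: ennreal_suminf_multc ndist_commute)
  also have "\<dots> \<le> (\<Sum>k. ennreal ?W * epowr (x k) p)"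
    by (intro suminf_le mult_right_mono geometric_row_sum g) auto
  also have "\<dots> = ennreal ?W * (\<Sum>k. epowr (x k) p)"
    by (simp add: ennreal_suminf_cmult)
  finally have "(\<Sum>j. epowr (y j) p)
      \<le> ennreal (D powr p * ?W powr (p - 1)) * (ennreal ?W * (\<Sum>k. epowr (x k) p))"
    by (simp add: mult_left_mono)
  also have "\<dots> = ennreal (D powr p * (?W powr (p - 1) * ?W)) * (\<Sum>k. epowr (x k) p)"
    unfolding ennreal_mult[of "D powr p" "?W powr (p - 1) * ?W", OF powr_ge_zero mult_nonneg_nonneg[OF powr_ge_zero less_imp_le[OF W]]]
      ennreal_mult[of "D powr p" "?W powr (p - 1)", OF powr_ge_zero powr_ge_zero]
      ennreal_mult[of "?W powr (p - 1)" ?W, OF powr_ge_zero less_imp_le[OF W]]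
    by (simp only: mult.assoc)
  also have "D powr p * (?W powr (p - 1) * ?W) = (D * 2 / (1 - g)) powr p"
    using W D powr_add[of ?W "p - 1" 1] powr_mult[of D ?W p] by simp
  finally show ?thesis .
qed

subsection \<open>Dyadic radii and the maximum modulus\<close>

definition dyad :: "nat \<Rightarrow> real" where
  "dyad k = 1 - (1 / 2) ^ k"

lemma dyad_0 [simp]: "dyad 0 = 0"
  by (simp add: dyad_def)

lemma dyad_nonneg [simp]: "0 \<le> dyad k"
  by (simp add: dyad_def power_le_one)

lemma dyad_less_1 [simp]: "dyad k < 1"
  by (simp add: dyad_def)

lemma dyad_mono: "j \<le> k \<Longrightarrow> dyad j \<le> dyad k"
  by (simp add: dyad_def power_decreasing)

lemma dyad_strict_mono: "j < k \<Longrightarrow> dyad j < dyad k"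
  by (simp add: dyad_def power_strict_decreasing)

lemma dyad_Suc_diff: "dyad (Suc k) - dyad k = (1 / 2) ^ Suc k"
  by (simp add: dyad_def)

lemma dyad_cover:
  assumes "0 \<le> r" "r < 1"
  obtains k where "dyad k \<le> r" "r < dyad (Suc k)"
proof -
  obtain n where n: "(1 / 2 :: real) ^ n < 1 - r"
    using real_arch_pow_inv[of "1 - r" "1 / 2"] assms by auto
  define m where "m = (LEAST n. r < dyad n)"
  have ex: "r < dyad n" using n by (simp add: dyad_def)
  have m: "r < dyad m" unfolding m_def by (rule LeastI[of _ n]) (rule ex)
  then obtain k where k: "m = Suc k" using assms by (cases m) auto
  then have "\<not> r < dyad k"
    unfolding m_def by (metis lessI not_less_Least)
  with m k show thesis by (intro that[of k]) auto
qed

lemma dyad_interval_disjoint: "disjoint_family (\<lambda>k. {dyad k..<dyad (Suc k)})"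
proof (unfold disjoint_family_on_def, intro ballI impI)
  fix m n :: nat assume "m \<noteq> n"
  then consider "Suc m \<le> n" | "Suc n \<le> m" by linarith
  then show "{dyad m..<dyad (Suc m)} \<inter> {dyad n..<dyad (Suc n)} = {}"
    by cases (use dyad_mono in force)+
qed

section \<open>Integrals over countable families of intervals\<close>

lemma nn_integral_UN_disjoint:
  fixes f :: "'a \<Rightarrow> ennreal"
  assumes [measurable]: "f \<in> borel_measurable M" "\<And>i::nat. A i \<in> sets M"
    and "disjoint_family A"
  shows "(\<integral>\<^sup>+x\<in>(\<Union>i. A i). f x \<partial>M) = (\<Sum>i. \<integral>\<^sup>+x\<in>A i. f x \<partial>M)"
proof -
  have "(\<integral>\<^sup>+x\<in>(\<Union>i. A i). f x \<partial>M) = (\<integral>\<^sup>+x. (\<Sum>i. f x * indicator (A i) x) \<partial>M)"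
    by (intro nn_integral_cong)
       (simp add: suminf_indicator[OF assms(3)] ennreal_suminf_cmult)
  also have "\<dots> = (\<Sum>i. \<integral>\<^sup>+x\<in>A i. f x \<partial>M)"
    by (intro nn_integral_suminf) auto
  finally show ?thesis .
qed

text \<open>The comparison with a step function is pointwise, which suits integrands such as
  \<open>max_mean\<close> and powers of the weight tail, where only monotonicity in the radius is
  known.\<close>

lemma nn_integral_le_UN:
  assumes "S \<subseteq> (\<Union>i::nat. A i)" "\<And>i. A i \<in> sets M"
    and "\<And>i x. x \<in> A i \<Longrightarrow> x \<in> S \<Longrightarrow> f x \<le> H i"
  shows "(\<integral>\<^sup>+x\<in>S. f x \<partial>M) \<le> (\<Sum>i. H i * emeasure M (A i))"
proof -
  have [measurable]: "\<And>i. A i \<in> sets M" by fact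
  have "(\<integral>\<^sup>+x\<in>S. f x \<partial>M) \<le> (\<integral>\<^sup>+x. (\<Sum>i. H i * indicator (A i) x) \<partial>M)"
  proof (rule nn_integral_mono)
    fix x
    show "f x * indicator S x \<le> (\<Sum>i. H i * indicator (A i) x)"
    proof (cases "x \<in> S")
      case True
      then obtain i where i: "x \<in> A i" using assms(1) by auto
      have "f x * indicator S x \<le> H i * indicator (A i) x" using i True assms(3) by auto
      also have "\<dots> \<le> (\<Sum>i. H i * indicator (A i) x)"
        by (rule ennreal_le_suminf)
      finally show ?thesis .
    qed auto
  qed
  also have "\<dots> = (\<Sum>i. H i * emeasure M (A i))"
    by (subst nn_integral_suminf) (auto simp: nn_integral_cmult_indicator)
  finally show ?thesis .
qed

lemma nn_integral_ge_UN:
  assumes "(\<Union>i::nat. A i) \<subseteq> S" "\<And>i. A i \<in> sets M" "disjoint_family A"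
    and "\<And>i x. x \<in> A i \<Longrightarrow> L i \<le> f x"
  shows "(\<Sum>i. L i * emeasure M (A i)) \<le> (\<integral>\<^sup>+x\<in>S. f x \<partial>M)"
proof -
  have [measurable]: "\<And>i. A i \<in> sets M" by fact
  have "(\<Sum>i. L i * emeasure M (A i)) = (\<integral>\<^sup>+x. (\<Sum>i. L i * indicator (A i) x) \<partial>M)"
    by (subst nn_integral_suminf) (auto simp: nn_integral_cmult_indicator)
  also have "\<dots> \<le> (\<integral>\<^sup>+x\<in>S. f x \<partial>M)"
  proof (rule nn_integral_mono)
    fix x
    show "(\<Sum>i. L i * indicator (A i) x) \<le> f x * indicator S x"
    proof (cases "\<exists>i. x \<in> A i")
      case True
      then obtain i where i: "x \<in> A i" by auto
      have "(\<Sum>j. L j * indicator (A j) x) = (\<Sum>j\<in>{i}. L j * indicator (A j) x)"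
        using i assms(3) by (intro suminf_finite) (auto simp: disjoint_family_on_def split: split_indicator)
      also have "\<dots> \<le> f x * indicator S x"
      proof -
        have "x \<in> S" using i assms(1) by auto
        then show ?thesis using i assms(4)[OF i] by simp
      qed
      finally show ?thesis .
    qed auto
  qed
  finally show ?thesis .
qed

section \<open>The maximum modulus on circles\<close>

lemma max_mean_attained:
  assumes "f holomorphic_on ball 0 1" "0 \<le> r" "r < 1"
  obtains z where "norm z = r" "norm (f z) = max_mean r f"
proof -
  have c: "continuous_on {0..2 * pi} (\<lambda>\<theta>. norm (f (rcis r \<theta>)))"
  proof (intro continuous_on_norm continuous_on_compose2[OF holomorphic_on_imp_continuous_on[OF assms(1)]])
    show "continuous_on {0..2 * pi} (rcis r)"
      unfolding rcis_def cis_conv_exp by (intro continuous_intros)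
    show "rcis r ` {0..2 * pi} \<subseteq> ball 0 1"
      using assms by auto
  qed
  then obtain \<theta> where "\<theta> \<in> {0..2 * pi}" "\<And>t. t \<in> {0..2 * pi} \<Longrightarrow> norm (f (rcis r t)) \<le> norm (f (rcis r \<theta>))"
    using continuous_attains_sup[OF compact_Icc _ c] by (auto simp: less_imp_le)
  then have "max_mean r f = norm (f (rcis r \<theta>))"
    unfolding max_mean_def by (intro cSup_eq_maximum) auto
  with that[of "rcis r \<theta>"] assms show thesis by auto
qed

lemma complex_rcis_exists:
  fixes z :: complex
  obtains \<theta> where "\<theta> \<in> {0..2 * pi}" "z = rcis (norm z) \<theta>"
proof -
  have "z = rcis (norm z) (Arg2pi z)"
    using Arg2pi_eq[of z] by (simp add: rcis_def cis_conv_exp)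
  moreover have "Arg2pi z \<in> {0..2 * pi}"
    using Arg2pi[of z] by auto
  ultimately show thesis using that by blast
qed

lemma norm_le_max_mean:
  assumes "f holomorphic_on ball 0 1" "norm z < 1"
  shows "norm (f z) \<le> max_mean (norm z) f"
proof -
  obtain \<theta> where t: "\<theta> \<in> {0..2 * pi}" "z = rcis (norm z) \<theta>"
    by (rule complex_rcis_exists)
  have c: "continuous_on {0..2 * pi} (\<lambda>\<theta>. norm (f (rcis (norm z) \<theta>)))"
  proof (intro continuous_on_norm continuous_on_compose2[OF holomorphic_on_imp_continuous_on[OF assms(1)]])
    show "continuous_on {0..2 * pi} (rcis (norm z))"
      unfolding rcis_def cis_conv_exp by (intro continuous_intros)
    show "rcis (norm z) ` {0..2 * pi} \<subseteq> ball 0 1"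
      using assms by auto
  qed
  have "bdd_above ((\<lambda>\<theta>. norm (f (rcis (norm z) \<theta>))) ` {0..2 * pi})"
    using compact_continuous_image[OF c compact_Icc] by (intro bounded_imp_bdd_above compact_imp_bounded)
  then have "norm (f (rcis (norm z) \<theta>)) \<le> max_mean (norm z) f"
    unfolding max_mean_def using t by (intro cSUP_upper)
  with t show ?thesis by simp
qed

lemma max_mean_nonneg:
  assumes "f holomorphic_on ball 0 1" "0 \<le> r" "r < 1"
  shows "0 \<le> max_mean r f"
  using max_mean_attained[OF assms] by (metis norm_ge_zero)

text \<open>The maximum principle on the closed disc of radius \<open>s\<close>, with
  \<open>max_mean s f\<close> as the bound on its frontier.\<close>

lemma max_mean_mono:
  assumes "f holomorphic_on ball 0 1" "0 \<le> r" "r \<le> s" "s < 1"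
  shows "max_mean r f \<le> max_mean s f"
proof -
  obtain z where z: "norm z = r" "norm (f z) = max_mean r f"
    using max_mean_attained[of f r] assms by auto
  show ?thesis
  proof (cases "r = s")
    case False
    have "norm (f z) \<le> max_mean s f"
    proof (rule maximum_modulus_frontier[where f = f and \<xi> = z and S = "cball 0 s"])
      show "f holomorphic_on interior (cball 0 s)"
        using assms by (auto intro: holomorphic_on_subset)
      show "continuous_on (closure (cball 0 s)) f"
        using assms by (auto intro!: holomorphic_on_imp_continuous_on holomorphic_on_subset[OF assms(1)])
      show "norm (f w) \<le> max_mean s f" if "w \<in> frontier (cball 0 s)" for w
        using that norm_le_max_mean[OF assms(1), of w] assms by auto
    qed (use z assms in auto)
    then show ?thesis using z by simp
  qed auto
qed

lemma norm_le_max_mean':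
  assumes "f holomorphic_on ball 0 1" "norm z \<le> r" "r < 1"
  shows "norm (f z) \<le> max_mean r f"
  using norm_le_max_mean[OF assms(1), of z] max_mean_mono[OF assms(1) norm_ge_zero assms(2,3)] assms
  by linarith

text \<open>A Riemann sum for the \<open>p\<close>-th power of \<open>Hinf_norm\<close>; no root is
  taken. The weight \<open>(1 / 2) ^ k\<close> is twice the length of the interval from
  \<open>dyad k\<close> to \<open>dyad (Suc k)\<close>.\<close>

definition dyad_norm :: "real \<Rightarrow> (complex \<Rightarrow> complex) \<Rightarrow> ennreal" where
  "dyad_norm p f = (\<Sum>k. ennreal (max_mean (dyad k) f powr p * (1 / 2) ^ k))"

lemma epowr_root: "0 < p \<Longrightarrow> epowr (epowr x (1 / p)) p = x"
  by (simp add: epowr_epowr)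

lemma Hinf_norm_le_dyad_norm:
  assumes f: "f holomorphic_on ball 0 1" and p: "1 < p"
  shows "epowr (Hinf_norm p f) p \<le> dyad_norm p f"
proof -
  have "epowr (Hinf_norm p f) p = (\<integral>\<^sup>+r\<in>{0<..<1}. ennreal (max_mean r f powr p) \<partial>lborel)"
    using p by (simp add: Hinf_norm_def epowr_root)
  also have "\<dots> \<le> (\<Sum>i. ennreal (max_mean (dyad (Suc i)) f powr p) * emeasure lborel {dyad i..<dyad (Suc i)})"
  proof (rule nn_integral_le_UN)
    show "{0<..<1} \<subseteq> (\<Union>i. {dyad i..<dyad (Suc i)})"
    proof
      fix r :: real assume "r \<in> {0<..<1}"
      then obtain k where "dyad k \<le> r" "r < dyad (Suc k)" using dyad_cover[of r] by auto
      then show "r \<in> (\<Union>i. {dyad i..<dyad (Suc i)})" by auto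
    qed
    show "ennreal (max_mean x f powr p) \<le> ennreal (max_mean (dyad (Suc i)) f powr p)"
      if "x \<in> {dyad i..<dyad (Suc i)}" "x \<in> {0<..<1}" for i x
      using that p f by (intro ennreal_leI powr_mono2 max_mean_mono max_mean_nonneg) auto
  qed auto
  also have "\<dots> = (\<Sum>i. ennreal (max_mean (dyad (Suc i)) f powr p * (1 / 2) ^ Suc i))"
    by (intro suminf_cong) (simp add: dyad_mono dyad_Suc_diff ennreal_mult del: power_Suc)
  also have "\<dots> \<le> dyad_norm p f"
    unfolding dyad_norm_def
    by (subst (2) suminf_offset[of _ 1]) auto
  finally show ?thesis .
qed

text \<open>Maximum moduli at left endpoints; the factor 2 is the ratio of the weight
  \<open>(1 / 2) ^ k\<close> to the length of the interval. The intervals are open because the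
  integral excludes \<open>0\<close>, which is \<open>dyad 0\<close>.\<close>

lemma dyad_norm_le_Hinf_norm:
  assumes f: "f holomorphic_on ball 0 1" and p: "1 < p"
  shows "dyad_norm p f \<le> 2 * epowr (Hinf_norm p f) p"
proof -
  have "(\<Sum>i. ennreal (max_mean (dyad i) f powr p) * emeasure lborel {dyad i<..<dyad (Suc i)})
     \<le> (\<integral>\<^sup>+r\<in>{0<..<1}. ennreal (max_mean r f powr p) \<partial>lborel)"
  proof (rule nn_integral_ge_UN)
    show "(\<Union>i. {dyad i<..<dyad (Suc i)}) \<subseteq> {0<..<1}"
      by (auto intro: le_less_trans[OF dyad_nonneg] less_trans[OF _ dyad_less_1])
    show "disjoint_family (\<lambda>i. {dyad i<..<dyad (Suc i)})"
      by (rule disjoint_family_on_bisimulation[OF dyad_interval_disjoint]) force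
    show "ennreal (max_mean (dyad i) f powr p) \<le> ennreal (max_mean x f powr p)"
      if "x \<in> {dyad i<..<dyad (Suc i)}" for i x
      using that p f dyad_less_1[of "Suc i"]
      by (intro ennreal_leI powr_mono2 max_mean_mono max_mean_nonneg) (auto simp del: dyad_less_1)
  qed auto
  also have "(\<Sum>i. ennreal (max_mean (dyad i) f powr p) * emeasure lborel {dyad i<..<dyad (Suc i)})
      = (\<Sum>i. ennreal (1 / 2) * ennreal (max_mean (dyad i) f powr p * (1 / 2) ^ i))"
    by (intro suminf_cong)
       (simp add: dyad_mono dyad_Suc_diff mult_ac flip: ennreal_mult del: ennreal_half)
  also have "\<dots> = ennreal (1 / 2) * dyad_norm p f"
    by (simp add: dyad_norm_def ennreal_suminf_cmult)
  also have "(\<integral>\<^sup>+r\<in>{0<..<1}. ennreal (max_mean r f powr p) \<partial>lborel) = epowr (Hinf_norm p f) p"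
    using p by (simp add: Hinf_norm_def epowr_root)
  finally have "ennreal 2 * (ennreal (1 / 2) * dyad_norm p f) \<le> ennreal 2 * epowr (Hinf_norm p f) p"
    by (intro mult_left_mono) auto
  moreover have "ennreal 2 * (ennreal (1 / 2) * x) = x" for x
    by (subst mult.assoc[symmetric], subst ennreal_mult[symmetric]) auto
  ultimately show ?thesis by simp
qed

subsection \<open>Polar coordinates\<close>

lemma lborel_complex_eq:
  "(lborel :: complex measure) = distr (lborel \<Otimes>\<^sub>M lborel) borel (\<lambda>(x, y). Complex x y)"
proof (rule lborel_eqI)
  fix l u :: complex
  assume le: "\<And>b. b \<in> Basis \<Longrightarrow> l \<bullet> b \<le> u \<bullet> b"
  have [measurable]: "(\<lambda>(x, y). Complex x y) \<in> borel_measurable (lborel \<Otimes>\<^sub>M lborel)"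
    unfolding Complex_eq case_prod_beta by measurable
  have le': "Re l \<le> Re u" "Im l \<le> Im u"
    using le[of 1] le[of \<i>] by (auto simp: Basis_complex_def)
  have "emeasure (distr (lborel \<Otimes>\<^sub>M lborel) borel (\<lambda>(x, y). Complex x y)) (box l u)
    = emeasure (lborel \<Otimes>\<^sub>M lborel) ((\<lambda>(x, y). Complex x y) -` box l u \<inter> space (lborel \<Otimes>\<^sub>M lborel))"
    by (subst emeasure_distr) auto
  also have "(\<lambda>(x, y). Complex x y) -` box l u \<inter> space (lborel \<Otimes>\<^sub>M lborel)
      = {Re l<..<Re u} \<times> {Im l<..<Im u}"
    by (auto simp: box_def Basis_complex_def space_pair_measure)
  also have "emeasure (lborel \<Otimes>\<^sub>M lborel) \<dots> = ennreal (Re u - Re l) * ennreal (Im u - Im l)"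
    using le' by (subst lborel.emeasure_pair_measure_Times) auto
  also have "\<dots> = (\<Prod>b\<in>Basis. (u - l) \<bullet> b)"
    using le' by (simp add: Basis_complex_def ennreal_mult)
  finally show "emeasure (distr (lborel \<Otimes>\<^sub>M lborel) borel (\<lambda>(x, y). Complex x y)) (box l u)
    = (\<Prod>b\<in>Basis. (u - l) \<bullet> b)" .
qed simp

lemma nn_integral_complex:
  fixes F :: "complex \<Rightarrow> ennreal"
  assumes [measurable]: "F \<in> borel_measurable borel"
  shows "(\<integral>\<^sup>+z. F z \<partial>lborel) = (\<integral>\<^sup>+x. \<integral>\<^sup>+y. F (Complex x y) \<partial>lborel \<partial>lborel)"
proof -
  have [measurable]: "(\<lambda>(x, y). Complex x y) \<in> borel_measurable (lborel \<Otimes>\<^sub>M lborel)"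
    unfolding Complex_eq case_prod_beta by measurable
  have "(\<integral>\<^sup>+z. F z \<partial>lborel) = (\<integral>\<^sup>+q. F (case q of (x, y) \<Rightarrow> Complex x y) \<partial>(lborel \<Otimes>\<^sub>M lborel))"
    by (subst lborel_complex_eq, subst nn_integral_distr) auto
  also have "\<dots> = (\<integral>\<^sup>+x. \<integral>\<^sup>+y. F (case (x, y) of (x, y) \<Rightarrow> Complex x y) \<partial>lborel \<partial>lborel)"
    by (rule lborel.nn_integral_fst[symmetric]) measurable
  finally show ?thesis by simp
qed

text \<open>The substitution \<open>u = tan \<phi>\<close>, carried out on compact symmetric
  intervals whose endpoints \<open>a n\<close> have tangent \<open>n + 1\<close>, and then monotone
  convergence on both sides.\<close>

lemma nn_integral_arctan:
  fixes G :: "real \<Rightarrow> ennreal"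
  assumes [measurable]: "G \<in> borel_measurable borel"
  shows "(\<integral>\<^sup>+u. G (arctan u) * ennreal (1 / (1 + u\<^sup>2)) \<partial>lborel) = (\<integral>\<^sup>+\<phi>\<in>{-(pi/2)<..<pi/2}. G \<phi> \<partial>lborel)"
proof -
  define f where "f u = G (arctan u) * ennreal (1 / (1 + u\<^sup>2))" for u
  define a where "a n = arctan (real n + 1)" for n :: nat
  have [measurable]: "f \<in> borel_measurable borel" unfolding f_def by measurable
  have a: "0 < a n" "a n < pi / 2" "tan (a n) = real n + 1" "tan (- a n) = - (real n + 1)" for n
    unfolding a_def using arctan[of "real n + 1"] by (auto simp: tan_arctan)
  have "(\<integral>\<^sup>+u. f u \<partial>lborel) = (\<integral>\<^sup>+u. (SUP n. f u * indicator {- (real n + 1)..real n + 1} u) \<partial>lborel)"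
  proof (intro nn_integral_cong antisym)
    fix u :: real
    obtain n :: nat where n: "\<bar>u\<bar> \<le> real n" using real_arch_simple by blast
    then have "f u = f u * indicator {- (real n + 1)..real n + 1} u" by (simp add: indicator_def abs_le_iff)
    also have "\<dots> \<le> (SUP n. f u * indicator {- (real n + 1)..real n + 1} u)" by (rule SUP_upper) auto
    finally show "f u \<le> (SUP n. f u * indicator {- (real n + 1)..real n + 1} u)" .
    show "(SUP n. f u * indicator {- (real n + 1)..real n + 1} u) \<le> f u"
      by (rule SUP_least) (auto split: split_indicator)
  qed
  also have "\<dots> = (SUP n. \<integral>\<^sup>+u. f u * indicator {- (real n + 1)..real n + 1} u \<partial>lborel)"
    by (intro nn_integral_monotone_convergence_SUP)
       (auto simp: incseq_def le_fun_def split: split_indicator)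
  also have "\<dots> = (SUP n. \<integral>\<^sup>+\<phi>. G \<phi> * indicator {- a n..a n} \<phi> \<partial>lborel)"
  proof (intro SUP_cong refl)
    fix n
    have cos_pos: "cos x > 0" if "x \<in> {- a n..a n}" for x
      using that a[of n] by (intro cos_gt_zero_pi) auto
    have "(\<integral>\<^sup>+u. f u * indicator {tan (- a n)..tan (a n)} u \<partial>lborel)
      = (\<integral>\<^sup>+x. f (tan x) * ennreal (inverse ((cos x)\<^sup>2)) * indicator {- a n..a n} x \<partial>lborel)"
    proof (rule nn_integral_substitution_aux)
      show "(tan has_real_derivative inverse ((cos x)\<^sup>2)) (at x)" if "x \<in> {- a n..a n}" for x
        using cos_pos[OF that] by (intro DERIV_tan) auto
      show "continuous_on {- a n..a n} (\<lambda>x. inverse ((cos x)\<^sup>2))"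
        using cos_pos by (intro continuous_intros) fastforce
    qed (use a[of n] in auto)
    also have "\<dots> = (\<integral>\<^sup>+\<phi>. G \<phi> * indicator {- a n..a n} \<phi> \<partial>lborel)"
    proof (intro nn_integral_cong)
      fix x
      show "f (tan x) * ennreal (inverse ((cos x)\<^sup>2)) * indicator {- a n..a n} x = G x * indicator {- a n..a n} x"
      proof (cases "x \<in> {- a n..a n}")
        case True
        then have c: "cos x > 0" by (rule cos_pos)
        have at: "arctan (tan x) = x"
          using True a[of n] by (intro arctan_tan) auto
        have "1 + (tan x)\<^sup>2 = inverse ((cos x)\<^sup>2)"
          using c tan_sec[of x] by (simp add: power_inverse)
        then have "ennreal (1 / (1 + (tan x)\<^sup>2)) * ennreal (inverse ((cos x)\<^sup>2)) = 1"
          using c by (simp flip: ennreal_mult)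
        then show ?thesis
          using True by (simp add: f_def at mult.assoc)
      qed auto
    qed
    finally show "(\<integral>\<^sup>+u. f u * indicator {- (real n + 1)..real n + 1} u \<partial>lborel) = (\<integral>\<^sup>+\<phi>. G \<phi> * indicator {- a n..a n} \<phi> \<partial>lborel)"
      by (simp only: a)
  qed
  also have "\<dots> = (\<integral>\<^sup>+\<phi>. (SUP n. G \<phi> * indicator {- a n..a n} \<phi>) \<partial>lborel)"
  proof (intro nn_integral_monotone_convergence_SUP[symmetric])
    have "a m \<le> a n" if "m \<le> n" for m n using that by (simp add: a_def arctan_le_iff)
    then show "incseq (\<lambda>n \<phi>. G \<phi> * indicator {- a n..a n} \<phi>)"
      by (fastforce simp: incseq_def le_fun_def split: split_indicator)
  qed auto
  also have "\<dots> = (\<integral>\<^sup>+\<phi>\<in>{-(pi/2)<..<pi/2}. G \<phi> \<partial>lborel)"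
  proof (intro nn_integral_cong antisym)
    fix x :: real
    show "(SUP n. G x * indicator {- a n..a n} x) \<le> G x * indicator {-(pi/2)<..<pi/2} x"
    proof (rule SUP_least)
      fix n
      show "G x * indicator {- a n..a n} x \<le> G x * indicator {-(pi/2)<..<pi/2} x"
        using a(2)[of n] by (auto split: split_indicator)
    qed
    show "G x * indicator {-(pi/2)<..<pi/2} x \<le> (SUP n. G x * indicator {- a n..a n} x)"
    proof (cases "x \<in> {-(pi/2)<..<pi/2}")
      case True
      obtain n :: nat where n: "\<bar>tan x\<bar> \<le> real n" using real_arch_simple by blast
      have at: "arctan (tan x) = x"
        using True by (intro arctan_tan) auto
      have "arctan (- (real n + 1)) \<le> arctan (tan x)" "arctan (tan x) \<le> a n"
        unfolding a_def using n by (intro arctan_monotone'; simp)+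
      then have "x \<in> {- a n..a n}" unfolding at a_def arctan_minus by simp
      then have "G x * indicator {-(pi/2)<..<pi/2} x = G x * indicator {- a n..a n} x"
        using True by simp
      also have "\<dots> \<le> (SUP n. G x * indicator {- a n..a n} x)" by (rule SUP_upper) auto
      finally show ?thesis .
    qed auto
  qed
  finally show ?thesis by (simp add: f_def)
qed

definition ray_integral :: "(complex \<Rightarrow> ennreal) \<Rightarrow> real \<Rightarrow> ennreal" where
  "ray_integral F \<phi> = (\<integral>\<^sup>+r. ennreal r * F (rcis r \<phi>) * indicator {0<..} r \<partial>lborel)"

lemma rcis_measurable2 [measurable (raw)]:
  assumes [measurable]: "f \<in> borel_measurable M" "g \<in> borel_measurable M"
  shows "(\<lambda>x. rcis (f x) (g x)) \<in> borel_measurable M"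
  unfolding rcis_def cis_conv_exp by measurable

lemma ray_integral_measurable [measurable]:
  assumes [measurable]: "F \<in> borel_measurable borel"
  shows "ray_integral F \<in> borel_measurable borel"
proof -
  have "(\<lambda>\<phi>. ray_integral F \<phi>) \<in> borel_measurable borel"
    unfolding ray_integral_def by measurable
  then show ?thesis by simp
qed

text \<open>Slopes replace angles: \<open>y = x * u\<close> turns the area element into
  \<open>x dx du\<close>, and for a fixed slope the points run along the ray of angle
  \<open>arctan u\<close>. Rescaling \<open>x\<close> to the distance from the origin produces the
  factor \<open>1 / (1 + u\<^sup>2)\<close>, which is the derivative of
  \<open>arctan\<close>.\<close>

lemma nn_integral_right_half_plane:
  fixes F :: "complex \<Rightarrow> ennreal"
  assumes [measurable]: "F \<in> borel_measurable borel"
  shows "(\<integral>\<^sup>+x. (\<integral>\<^sup>+y. F (Complex x y) \<partial>lborel) * indicator {0<..} x \<partial>lborel)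
    = (\<integral>\<^sup>+\<phi>\<in>{-(pi/2)<..<pi/2}. ray_integral F \<phi> \<partial>lborel)"
proof -
  have meas [measurable]: "(\<lambda>q. Complex (f q) (g q)) \<in> borel_measurable M"
    if [measurable]: "f \<in> borel_measurable M" "g \<in> borel_measurable M" for f g :: "'q \<Rightarrow> real" and M :: "'q measure"
    unfolding Complex_eq by measurable
  have m1 [measurable]: "(\<lambda>y. F (Complex x y)) \<in> borel_measurable borel" for x
    by (rule measurable_compose[OF meas assms]) auto
  have m3 [measurable]: "(\<lambda>y. F (Complex y (y * u))) \<in> borel_measurable borel" for u
    by (rule measurable_compose[OF meas assms]) auto
  have m2 [measurable]: "(\<lambda>q. F (Complex (fst q) (fst q * snd q))) \<in> borel_measurable (lborel \<Otimes>\<^sub>M lborel)"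
    by (rule measurable_compose[OF meas assms]) measurable
  have "(\<integral>\<^sup>+x. (\<integral>\<^sup>+y. F (Complex x y) \<partial>lborel) * indicator {0<..} x \<partial>lborel)
    = (\<integral>\<^sup>+x. \<integral>\<^sup>+u. ennreal x * F (Complex x (x * u)) * indicator {0<..} x \<partial>lborel \<partial>lborel)"
  proof (intro nn_integral_cong)
    fix x :: real
    show "(\<integral>\<^sup>+y. F (Complex x y) \<partial>lborel) * indicator {0<..} x
      = (\<integral>\<^sup>+u. ennreal x * F (Complex x (x * u)) * indicator {0<..} x \<partial>lborel)"
    proof (cases "x > 0")
      case True
      have [measurable]: "(\<lambda>u. F (Complex x (x * u))) \<in> borel_measurable borel"
        by (rule measurable_compose[OF meas assms]) auto
      show ?thesis
        using True nn_integral_real_affine[of "\<lambda>y. F (Complex x y)" x 0] by (simp add: nn_integral_cmult)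
    qed auto
  qed
  also have "\<dots> = (\<integral>\<^sup>+u. \<integral>\<^sup>+x. ennreal x * F (Complex x (x * u)) * indicator {0<..} x \<partial>lborel \<partial>lborel)"
    by (rule lborel_pair.Fubini') (simp add: case_prod_beta)
  also have "\<dots> = (\<integral>\<^sup>+u. ray_integral F (arctan u) * ennreal (1 / (1 + u\<^sup>2)) \<partial>lborel)"
  proof (intro nn_integral_cong)
    fix u :: real
    \<comment> \<open>The cosine of \<open>arctan u\<close>. One factor \<open>c\<close> comes from
      the density \<open>x\<close>, the other from \<open>dx\<close>.\<close>
    define c where "c = 1 / sqrt (1 + u\<^sup>2)"
    have c0: "c > 0" unfolding c_def by (simp add: add_pos_nonneg)
    have diff_coeff: "c * c = 1 / (1 + u\<^sup>2)" unfolding c_def by (simp add: add_pos_nonneg abs_of_nonneg)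
    have "(\<integral>\<^sup>+x. ennreal x * F (Complex x (x * u)) * indicator {0<..} x \<partial>lborel)
      = ennreal c * (\<integral>\<^sup>+r. ennreal (c * r) * F (Complex (c * r) (c * r * u)) * indicator {0<..} (c * r) \<partial>lborel)"
      using c0 by (subst nn_integral_real_affine[of _ c 0]) auto
    also have "(\<integral>\<^sup>+r. ennreal (c * r) * F (Complex (c * r) (c * r * u)) * indicator {0<..} (c * r) \<partial>lborel)
        = (\<integral>\<^sup>+r. ennreal c * (ennreal r * F (rcis r (arctan u)) * indicator {0<..} r) \<partial>lborel)"
    proof (intro nn_integral_cong)
      fix r :: real
      have "Complex (c * r) (c * r * u) = rcis r (arctan u)"
        by (simp add: rcis_def cis.code complex_eq_iff cos_arctan sin_arctan c_def)
      moreover have "indicator {0<..} (c * r) = (indicator {0<..} r :: ennreal)"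
        using c0 by (auto simp: zero_less_mult_iff split: split_indicator)
      ultimately show "ennreal (c * r) * F (Complex (c * r) (c * r * u)) * indicator {0<..} (c * r)
        = ennreal c * (ennreal r * F (rcis r (arctan u)) * indicator {0<..} r)"
        using c0 by (auto simp: ennreal_mult ennreal_neg mult_ac split: split_indicator)
    qed
    also have "\<dots> = ennreal c * ray_integral F (arctan u)"
      unfolding ray_integral_def by (rule nn_integral_cmult) measurable
    also have "ennreal c * (ennreal c * ray_integral F (arctan u)) = ray_integral F (arctan u) * ennreal (1 / (1 + u\<^sup>2))"
      unfolding diff_coeff[symmetric] using c0 by (simp add: ennreal_mult mult_ac)
    finally show "(\<integral>\<^sup>+x. ennreal x * F (Complex x (x * u)) * indicator {0<..} x \<partial>lborel)
      = ray_integral F (arctan u) * ennreal (1 / (1 + u\<^sup>2))" .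
  qed
  also have "\<dots> = (\<integral>\<^sup>+\<phi>\<in>{-(pi/2)<..<pi/2}. ray_integral F \<phi> \<partial>lborel)"
    by (rule nn_integral_arctan) measurable
  finally show ?thesis .
qed

lemma nn_integral_shift:
  fixes h :: "real \<Rightarrow> ennreal"
  assumes [measurable]: "h \<in> borel_measurable borel"
  shows "(\<integral>\<^sup>+x. h (x + t) * indicator {a..<b} x \<partial>lborel) = (\<integral>\<^sup>+x. h x * indicator {a + t..<b + t} x \<partial>lborel)"
proof -
  have "(\<integral>\<^sup>+x. h x * indicator {a + t..<b + t} x \<partial>lborel)
      = (\<integral>\<^sup>+x. h (t + x) * indicator {a + t..<b + t} (t + x) \<partial>lborel)"
    by (subst nn_integral_real_affine[of _ 1 t]) auto
  also have "\<dots> = (\<integral>\<^sup>+x. h (x + t) * indicator {a..<b} x \<partial>lborel)"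
    by (intro nn_integral_cong) (auto simp: add.commute split: split_indicator)
  finally show ?thesis ..
qed

lemma nn_integral_Ico_split:
  fixes h :: "real \<Rightarrow> ennreal"
  assumes [measurable]: "h \<in> borel_measurable borel" and "a \<le> b" "b \<le> c"
  shows "(\<integral>\<^sup>+x\<in>{a..<c}. h x \<partial>lborel) = (\<integral>\<^sup>+x\<in>{a..<b}. h x \<partial>lborel) + (\<integral>\<^sup>+x\<in>{b..<c}. h x \<partial>lborel)"
  using nn_integral_disjoint_pair[of h lborel "{a..<b}" "{b..<c}"] assms by (simp add: ivl_disj_un ivl_disj_int)

lemma nn_integral_periodic:
  fixes h :: "real \<Rightarrow> ennreal"
  assumes [measurable]: "h \<in> borel_measurable borel" and per: "\<And>x. h (x + 2 * pi) = h x"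
    and a: "- (2 * pi) \<le> a" "a \<le> 0"
  shows "(\<integral>\<^sup>+x\<in>{a..<a + 2 * pi}. h x \<partial>lborel) = (\<integral>\<^sup>+x\<in>{0..<2 * pi}. h x \<partial>lborel)"
proof -
  have "(\<integral>\<^sup>+x\<in>{a..<a + 2 * pi}. h x \<partial>lborel) = (\<integral>\<^sup>+x\<in>{a..<0}. h x \<partial>lborel) + (\<integral>\<^sup>+x\<in>{0..<a + 2 * pi}. h x \<partial>lborel)"
    using a by (intro nn_integral_Ico_split) auto
  also have "(\<integral>\<^sup>+x\<in>{a..<0}. h x \<partial>lborel) = (\<integral>\<^sup>+x\<in>{a + 2 * pi..<2 * pi}. h x \<partial>lborel)"
    using nn_integral_shift[of h "2 * pi" a 0] by (simp add: per)
  also have "\<dots> + (\<integral>\<^sup>+x\<in>{0..<a + 2 * pi}. h x \<partial>lborel) = (\<integral>\<^sup>+x\<in>{0..<2 * pi}. h x \<partial>lborel)"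
    using a nn_integral_Ico_split[of h 0 "a + 2 * pi" "2 * pi"] by (simp add: add.commute)
  finally show ?thesis .
qed

lemma rcis_add_pi: "rcis r (\<phi> + pi) = - rcis r \<phi>"
  by (simp add: rcis_def cis.code complex_eq_iff)

text \<open>The right half-plane accounts for the angles between \<open>-pi/2\<close> and
  \<open>pi/2\<close>. The left one is its image under negation, which adds \<open>pi\<close> to the
  angle; together the ranges form one period, which is shifted to start at \<open>0\<close>.\<close>

lemma nn_integral_polar:
  fixes F :: "complex \<Rightarrow> ennreal"
  assumes [measurable]: "F \<in> borel_measurable borel"
  shows "(\<integral>\<^sup>+z. F z \<partial>lborel)
    = (\<integral>\<^sup>+r\<in>{0<..}. ennreal r * (\<integral>\<^sup>+\<phi>\<in>{0..<2 * pi}. F (rcis r \<phi>) \<partial>lborel) \<partial>lborel)"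
proof -
  have meas [measurable]: "(\<lambda>q. Complex (f q) (g q)) \<in> borel_measurable M"
    if [measurable]: "f \<in> borel_measurable M" "g \<in> borel_measurable M" for f g :: "'q \<Rightarrow> real" and M :: "'q measure"
    unfolding Complex_eq by measurable
  define F' where "F' z = F (- z)" for z
  have [measurable]: "F' \<in> borel_measurable borel" unfolding F'_def by measurable
  define I where "I x = (\<integral>\<^sup>+y. F (Complex x y) \<partial>lborel)" for x
  have [measurable]: "I \<in> borel_measurable borel"
  proof -
    have "(\<lambda>q. F (Complex (fst q) (snd q))) \<in> borel_measurable (borel \<Otimes>\<^sub>M lborel)"
      by (rule measurable_compose[OF meas assms]) measurable
    then have "(\<lambda>x. I x) \<in> borel_measurable borel"
      unfolding I_def by (intro lborel.borel_measurable_nn_integral) (simp add: case_prod_beta)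
    then show ?thesis by simp
  qed
  let ?H = "{-(pi/2)..<pi/2}"
  have half: "(\<integral>\<^sup>+\<phi>\<in>{-(pi/2)<..<pi/2}. g \<phi> \<partial>lborel) = (\<integral>\<^sup>+\<phi>\<in>?H. g \<phi> \<partial>lborel)" for g :: "real \<Rightarrow> ennreal"
  proof (intro nn_integral_cong_AE)
    show "AE x in lborel. g x * indicator {-(pi/2)<..<pi/2} x = g x * indicator ?H x"
      using AE_lborel_singleton[of "-(pi/2)"] by eventually_elim (auto split: split_indicator)
  qed
  have "(\<integral>\<^sup>+z. F z \<partial>lborel) = (\<integral>\<^sup>+x. I x \<partial>lborel)"
    unfolding I_def by (rule nn_integral_complex) measurable
  also have "\<dots> = (\<integral>\<^sup>+x. I x * indicator {0<..} x + I x * indicator {..<0} x \<partial>lborel)"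
  proof (rule nn_integral_cong_AE)
    show "AE x in lborel. I x = I x * indicator {0<..} x + I x * indicator {..<0} x"
      using AE_lborel_singleton[of 0] by eventually_elim (auto split: split_indicator)
  qed
  also have "\<dots> = (\<integral>\<^sup>+x. I x * indicator {0<..} x \<partial>lborel) + (\<integral>\<^sup>+x. I x * indicator {..<0} x \<partial>lborel)"
    by (rule nn_integral_add) auto
  also have "(\<integral>\<^sup>+x. I x * indicator {0<..} x \<partial>lborel) = (\<integral>\<^sup>+\<phi>\<in>?H. ray_integral F \<phi> \<partial>lborel)"
    unfolding I_def half[symmetric] by (rule nn_integral_right_half_plane) measurable
  also have "(\<integral>\<^sup>+x. I x * indicator {..<0} x \<partial>lborel) = (\<integral>\<^sup>+x. I (- x) * indicator {..<0} (- x) \<partial>lborel)"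
    using nn_integral_real_affine[of "\<lambda>x. I x * indicator {..<0} x" "-1" 0] by simp
  also have "\<dots> = (\<integral>\<^sup>+x. (\<integral>\<^sup>+y. F' (Complex x y) \<partial>lborel) * indicator {0<..} x \<partial>lborel)"
  proof (intro nn_integral_cong)
    fix x :: real
    have [measurable]: "(\<lambda>y. F (Complex x y)) \<in> borel_measurable borel" for x
      by (rule measurable_compose[OF meas assms]) auto
    have "I (- x) = (\<integral>\<^sup>+y. F (Complex (- x) (- y)) \<partial>lborel)"
      unfolding I_def using nn_integral_real_affine[of "\<lambda>y. F (Complex (- x) y)" "-1" 0] by simp
    also have "\<dots> = (\<integral>\<^sup>+y. F' (Complex x y) \<partial>lborel)"
    proof -
      have "Complex (- x) (- y) = - Complex x y" for y by (simp add: complex_eq_iff)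
      then show ?thesis by (simp add: F'_def)
    qed
    finally show "I (- x) * indicator {..<0} (- x) = (\<integral>\<^sup>+y. F' (Complex x y) \<partial>lborel) * indicator {0<..} x"
      by (auto split: split_indicator)
  qed
  also have "\<dots> = (\<integral>\<^sup>+\<phi>\<in>?H. ray_integral F' \<phi> \<partial>lborel)"
    unfolding half[symmetric] by (rule nn_integral_right_half_plane) measurable
  also have "\<dots> = (\<integral>\<^sup>+\<phi>\<in>?H. ray_integral F (\<phi> + pi) \<partial>lborel)"
    by (simp add: ray_integral_def F'_def rcis_add_pi)
  also have "\<dots> = (\<integral>\<^sup>+\<phi>\<in>{pi/2..<3 * pi / 2}. ray_integral F \<phi> \<partial>lborel)"
    by (subst nn_integral_shift) auto
  also have "(\<integral>\<^sup>+\<phi>\<in>?H. ray_integral F \<phi> \<partial>lborel) + \<dots> = (\<integral>\<^sup>+\<phi>\<in>{-(pi/2)..<-(pi/2) + 2 * pi}. ray_integral F \<phi> \<partial>lborel)"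
    using nn_integral_Ico_split[of "ray_integral F" "-(pi/2)" "pi/2" "3 * pi / 2"] pi_gt_zero
    by simp
  also have "\<dots> = (\<integral>\<^sup>+\<phi>\<in>{0..<2 * pi}. ray_integral F \<phi> \<partial>lborel)"
    by (rule nn_integral_periodic) (auto simp: ray_integral_def rcis_def cis.code)
  also have "\<dots> = (\<integral>\<^sup>+\<phi>. \<integral>\<^sup>+r. ennreal r * F (rcis r \<phi>) * indicator {0<..} r * indicator {0..<2 * pi} \<phi> \<partial>lborel \<partial>lborel)"
    unfolding ray_integral_def by (intro nn_integral_cong nn_integral_multc[symmetric]) measurable
  also have "\<dots> = (\<integral>\<^sup>+r. \<integral>\<^sup>+\<phi>. ennreal r * F (rcis r \<phi>) * indicator {0<..} r * indicator {0..<2 * pi} \<phi> \<partial>lborel \<partial>lborel)"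
    by (rule lborel_pair.Fubini') measurable
  also have "\<dots> = (\<integral>\<^sup>+r\<in>{0<..}. ennreal r * (\<integral>\<^sup>+\<phi>\<in>{0..<2 * pi}. F (rcis r \<phi>) \<partial>lborel) \<partial>lborel)"
  proof (intro nn_integral_cong)
    fix r :: real
    have "(\<integral>\<^sup>+\<phi>. ennreal r * F (rcis r \<phi>) * indicator {0<..} r * indicator {0..<2 * pi} \<phi> \<partial>lborel)
      = (\<integral>\<^sup>+\<phi>. (ennreal r * indicator {0<..} r) * (F (rcis r \<phi>) * indicator {0..<2 * pi} \<phi>) \<partial>lborel)"
      by (simp add: mult_ac)
    also have "\<dots> = (ennreal r * indicator {0<..} r) * (\<integral>\<^sup>+\<phi>\<in>{0..<2 * pi}. F (rcis r \<phi>) \<partial>lborel)"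
      by (rule nn_integral_cmult) measurable
    finally show "(\<integral>\<^sup>+\<phi>. ennreal r * F (rcis r \<phi>) * indicator {0<..} r * indicator {0..<2 * pi} \<phi> \<partial>lborel)
      = ennreal r * (\<integral>\<^sup>+\<phi>\<in>{0..<2 * pi}. F (rcis r \<phi>) \<partial>lborel) * indicator {0<..} r"
      by (simp add: mult_ac)
  qed
  finally show ?thesis .
qed

subsection \<open>The Poisson kernel and the Hardy norm\<close>

definition poisson :: "real \<Rightarrow> complex \<Rightarrow> real \<Rightarrow> real" where
  "poisson \<rho> w \<theta> = (\<rho>\<^sup>2 - (norm w)\<^sup>2) / (norm (rcis \<rho> \<theta> - w))\<^sup>2"

lemma poisson_nonneg: "norm w \<le> \<rho> \<Longrightarrow> 0 \<le> poisson \<rho> w \<theta>"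
  by (auto simp: poisson_def intro!: divide_nonneg_nonneg power_mono)

lemma poisson_le:
  assumes "norm w < \<rho>" "\<rho> \<le> 1"
  shows "poisson \<rho> w \<theta> \<le> 2 / (\<rho> - norm w)"
proof -
  have r: "0 \<le> norm w" "0 < \<rho>" using assms norm_ge_zero[of w] by linarith+
  have "\<rho> - norm w \<le> norm (rcis \<rho> \<theta> - w)"
    using norm_triangle_ineq2[of "rcis \<rho> \<theta>" w] r by simp
  then have "(\<rho> - norm w)\<^sup>2 \<le> (norm (rcis \<rho> \<theta> - w))\<^sup>2"
    using assms by (intro power_mono) auto
  then have "poisson \<rho> w \<theta> \<le> (\<rho>\<^sup>2 - (norm w)\<^sup>2) / (\<rho> - norm w)\<^sup>2"
    unfolding poisson_def using assms r
    by (intro divide_left_mono) (auto intro!: power_mono mult_pos_pos zero_less_power)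
  also have "\<dots> = (\<rho> + norm w) / (\<rho> - norm w)"
    using assms by (simp add: power2_eq_square square_diff_square_factored)
  also have "\<dots> \<le> 2 / (\<rho> - norm w)"
    using assms by (intro divide_right_mono) auto
  finally show ?thesis .
qed

text \<open>Cauchy's formula at \<open>w\<close> for \<open>g\<close>, the product of
  \<open>f\<close> with a factor that is holomorphic on the closed disc and equals 1 at
  \<open>w\<close>. On the circle \<open>\<rho>\<^sup>2 = u * cnj u\<close>, and there the factor
  turns the Cauchy kernel into the Poisson kernel.\<close>

lemma poisson_formula:
  assumes f: "f holomorphic_on ball 0 1" and \<rho>: "norm w < \<rho>" "\<rho> < 1"
  shows "((\<lambda>\<theta>. f (rcis \<rho> \<theta>) * of_real (poisson \<rho> w \<theta>)) has_integral (2 * of_real pi * f w)) {0..2 * pi}"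
proof -
  have r: "0 < \<rho>" using assms norm_ge_zero[of w] by linarith
  define g where "g u = f u * (of_real (\<rho>\<^sup>2 - (norm w)\<^sup>2) / (of_real (\<rho>\<^sup>2) - cnj w * u))" for u
  have nz: "of_real (\<rho>\<^sup>2) - cnj w * u \<noteq> 0" if "norm u \<le> \<rho>" for u
  proof
    assume "of_real (\<rho>\<^sup>2) - cnj w * u = 0"
    then have "cmod (of_real (\<rho>\<^sup>2)) = norm w * norm u"
      by (metis complex_mod_cnj eq_iff_diff_eq_0 norm_mult)
    also have "\<dots> \<le> norm w * \<rho>"
      using that by (intro mult_left_mono) auto
    also have "\<dots> < \<rho> * \<rho>"
      using assms r by (intro mult_strict_right_mono) auto
    finally show False using r by (simp add: power2_eq_square norm_mult)
  qed
  have "g holomorphic_on cball 0 \<rho>"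
    unfolding g_def using nz \<rho> by (intro holomorphic_intros holomorphic_on_subset[OF f]) auto
  then have "((\<lambda>u. g u / (u - w)) has_contour_integral (2 * of_real pi * \<i> * g w)) (circlepath 0 \<rho>)"
    using \<rho> by (intro Cauchy_integral_circlepath holomorphic_on_imp_continuous_on)
      (auto intro: holomorphic_on_subset)
  then have "((\<lambda>t. g (of_real \<rho> * cis t) / (of_real \<rho> * cis t - w) * \<rho> * \<i> * cis t) has_integral (2 * of_real pi * \<i> * g w)) {0..2 * pi}"
    unfolding circlepath_def
    by (subst (asm) has_contour_integral_part_circlepath_iff) (auto simp: mult_ac)
  then have "((\<lambda>t. - \<i> * (g (of_real \<rho> * cis t) / (of_real \<rho> * cis t - w) * \<rho> * \<i> * cis t)) has_integral (- \<i> * (2 * of_real pi * \<i> * g w))) {0..2 * pi}"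
    by (intro has_integral_mult_right)
  also have "- \<i> * (2 * of_real pi * \<i> * g w) = 2 * of_real pi * g w" by simp
  also have "g w = f w"
  proof -
    have "of_real (\<rho>\<^sup>2 - (norm w)\<^sup>2) = of_real (\<rho>\<^sup>2) - cnj w * w"
      by (simp add: complex_norm_square mult.commute del: of_real_power)
    then show ?thesis using nz[of w] \<rho> by (simp add: g_def)
  qed
  also have "(\<lambda>t. - \<i> * (g (of_real \<rho> * cis t) / (of_real \<rho> * cis t - w) * \<rho> * \<i> * cis t))
    = (\<lambda>\<theta>. f (rcis \<rho> \<theta>) * of_real (poisson \<rho> w \<theta>))"
  proof
    fix t
    define u where "u = rcis \<rho> t"
    have nu: "norm u = \<rho>" using r by (simp add: u_def)
    have u0: "u \<noteq> 0" "u - w \<noteq> 0" using nu r \<rho> by auto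
    have rr: "of_real (\<rho>\<^sup>2) = u * cnj u"
      using nu complex_norm_square[of u] by simp
    have d: "of_real (\<rho>\<^sup>2) - cnj w * u = u * cnj (u - w)"
      unfolding rr by (simp add: algebra_simps)
    have n2: "of_real ((norm (u - w))\<^sup>2) = (u - w) * cnj (u - w)"
      using complex_norm_square[of "u - w"] by simp
    have "of_real (poisson \<rho> w t) = of_real (\<rho>\<^sup>2 - (norm w)\<^sup>2) / ((u - w) * cnj (u - w))"
      unfolding poisson_def u_def[symmetric] of_real_divide n2 ..
    moreover have "- \<i> * (G * R * \<i> * c) = G * (R * c)" for G R c :: complex
      by (simp add: complex_eq_iff algebra_simps)
    then have "- \<i> * (g u / (u - w) * of_real \<rho> * \<i> * cis t) = g u / (u - w) * u"
      unfolding u_def rcis_def .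
    moreover have "g u / (u - w) * u = f u * (of_real (\<rho>\<^sup>2 - (norm w)\<^sup>2) / ((u - w) * cnj (u - w)))"
    proof -
      have "F * (a / (u * b)) / d * u = F * (a / (d * b))" for F a b d :: complex
        using u0 by (cases "b = 0 \<or> d = 0") (auto simp: divide_simps)
      then show ?thesis unfolding g_def d .
    qed
    ultimately show "- \<i> * (g (of_real \<rho> * cis t) / (of_real \<rho> * cis t - w) * \<rho> * \<i> * cis t)
       = f (rcis \<rho> t) * of_real (poisson \<rho> w t)"
      by (simp add: u_def rcis_def)
  qed
  finally show ?thesis .
qed

lemma continuous_on_rcis: "continuous_on S (rcis r)"
  unfolding rcis_def cis_conv_exp by (intro continuous_intros)

lemma continuous_on_poisson:
  assumes "norm w < \<rho>"
  shows "continuous_on S (poisson \<rho> w)"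
proof -
  have "rcis \<rho> \<theta> - w \<noteq> 0" for \<theta>
  proof
    assume "rcis \<rho> \<theta> - w = 0"
    then have "norm w = \<bar>\<rho>\<bar>" by (metis complex_mod_rcis eq_iff_diff_eq_0)
    then show False using assms norm_ge_zero[of w] by linarith
  qed
  then show ?thesis
    unfolding poisson_def[abs_def] by (intro continuous_intros continuous_on_rcis) auto
qed

lemma continuous_on_circle:
  assumes "f holomorphic_on ball 0 1" "0 \<le> \<rho>" "\<rho> < 1"
  shows "continuous_on S (\<lambda>\<theta>. f (rcis \<rho> \<theta>))"
  using assms by (intro continuous_on_compose2[OF holomorphic_on_imp_continuous_on[OF assms(1)]] continuous_on_rcis) auto

lemma continuous_on_real_borel [intro]:
  fixes f :: "real \<Rightarrow> 'b::{second_countable_topology, real_normed_vector}"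
  shows "continuous_on UNIV f \<Longrightarrow> f \<in> borel_measurable borel"
  by (rule borel_measurable_continuous_onI)

lemma nn_integral_Icc_Ico:
  "(\<integral>\<^sup>+\<theta>\<in>{a..<b}. h \<theta> \<partial>lborel) = (\<integral>\<^sup>+\<theta>\<in>{a..b::real}. h \<theta> \<partial>lborel)"
proof (rule nn_integral_cong_AE)
  show "AE x in lborel. h x * indicator {a..<b} x = h x * indicator {a..b} x"
    using AE_lborel_singleton[of b] by eventually_elim (auto split: split_indicator)
qed

lemma nn_integral_continuous_Ico:
  fixes h :: "real \<Rightarrow> real"
  assumes "continuous_on {a..b} h" "\<And>x. x \<in> {a..b} \<Longrightarrow> 0 \<le> h x"
  shows "(\<integral>\<^sup>+\<theta>\<in>{a..<b}. ennreal (h \<theta>) \<partial>lborel) = ennreal (integral {a..b} h)"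
proof -
  have "(h has_integral integral {a..b} h) {a..b}"
    using integrable_continuous_interval[OF assms(1)] by (rule integrable_integral)
  then have "integral\<^sup>N lborel (\<lambda>x. indicator {a..b} x * h x) = integral {a..b} h"
    by (intro nn_integral_has_integral_lebesgue assms)
  moreover have "ennreal (indicator {a..b} x * h x) = ennreal (h x) * indicator {a..b} x" for x
    by (auto split: split_indicator)
  ultimately show ?thesis
    unfolding nn_integral_Icc_Ico by simp
qed

lemma nn_integral_poisson:
  assumes \<rho>: "norm w < \<rho>" "\<rho> < 1"
  shows "(\<integral>\<^sup>+\<theta>. ennreal (poisson \<rho> w \<theta> / (2 * pi)) * indicator {0..<2 * pi} \<theta> \<partial>lborel) = 1"
proof -
  have "((\<lambda>\<theta>. 1 * of_real (poisson \<rho> w \<theta>)) has_integral (2 * of_real pi * (1::complex))) {0..2 * pi}"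
    using poisson_formula[of "\<lambda>_. 1" w \<rho>] \<rho> by simp
  from has_integral_linear[OF this bounded_linear_Re]
  have "(poisson \<rho> w has_integral 2 * pi) {0..2 * pi}"
    by (simp add: o_def)
  then have "((\<lambda>\<theta>. poisson \<rho> w \<theta> * (1 / (2 * pi))) has_integral (2 * pi) * (1 / (2 * pi))) {0..2 * pi}"
    by (rule has_integral_mult_left)
  then have "((\<lambda>\<theta>. poisson \<rho> w \<theta> / (2 * pi)) has_integral 1) {0..2 * pi}"
    by simp
  then have "integral {0..2 * pi} (\<lambda>\<theta>. poisson \<rho> w \<theta> / (2 * pi)) = 1"
    by (rule integral_unique)
  moreover have "(\<integral>\<^sup>+\<theta>. ennreal (poisson \<rho> w \<theta> / (2 * pi)) * indicator {0..<2 * pi} \<theta> \<partial>lborel)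
     = ennreal (integral {0..2 * pi} (\<lambda>\<theta>. poisson \<rho> w \<theta> / (2 * pi)))"
    using \<rho> by (intro nn_integral_continuous_Ico continuous_intros continuous_on_poisson divide_nonneg_nonneg poisson_nonneg) auto
  ultimately show ?thesis by simp
qed

lemma norm_le_poisson_integral:
  assumes f: "f holomorphic_on ball 0 1" and \<rho>: "norm w < \<rho>" "\<rho> < 1"
  shows "ennreal (norm (f w)) \<le>
    (\<integral>\<^sup>+\<theta>. (ennreal (poisson \<rho> w \<theta> / (2 * pi)) * indicator {0..<2 * pi} \<theta>) * ennreal (norm (f (rcis \<rho> \<theta>))) \<partial>lborel)"
proof -
  have r: "0 < \<rho>" using assms norm_ge_zero[of w] by linarith
  let ?h = "\<lambda>\<theta>. poisson \<rho> w \<theta> / (2 * pi) * norm (f (rcis \<rho> \<theta>))"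
  have c: "continuous_on {0..2 * pi} ?h"
    using f \<rho> r by (intro continuous_intros continuous_on_poisson continuous_on_circle) auto
  have "norm (2 * of_real pi * f w) \<le> integral {0..2 * pi} (\<lambda>\<theta>. 2 * pi * ?h \<theta>)"
    unfolding integral_unique[OF poisson_formula[OF f \<rho>], symmetric]
  proof (rule integral_norm_bound_integral)
    show "(\<lambda>\<theta>. f (rcis \<rho> \<theta>) * of_real (poisson \<rho> w \<theta>)) integrable_on {0..2 * pi}"
      using poisson_formula[OF f \<rho>] by blast
    show "(\<lambda>\<theta>. 2 * pi * ?h \<theta>) integrable_on {0..2 * pi}"
      by (intro integrable_continuous_interval continuous_intros c)
    show "norm (f (rcis \<rho> x) * of_real (poisson \<rho> w x)) \<le> 2 * pi * ?h x" for x
      using poisson_nonneg[of w \<rho> x] \<rho> by (simp add: norm_mult)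
  qed
  also have "\<dots> = 2 * pi * integral {0..2 * pi} ?h" by (rule integral_mult_right)
  finally have "norm (2 * of_real pi * f w) \<le> 2 * pi * integral {0..2 * pi} ?h" .
  moreover have "norm (2 * of_real pi * f w) = 2 * pi * norm (f w)" by (simp add: norm_mult)
  ultimately have "2 * pi * norm (f w) \<le> 2 * pi * integral {0..2 * pi} ?h" by metis
  then have "norm (f w) \<le> integral {0..2 * pi} ?h"
    by (rule mult_left_le_imp_le) simp
  then have "ennreal (norm (f w)) \<le> ennreal (integral {0..2 * pi} ?h)" by (rule ennreal_leI)
  also have "\<dots> = (\<integral>\<^sup>+\<theta>\<in>{0..<2 * pi}. ennreal (?h \<theta>) \<partial>lborel)"
    using \<rho> by (intro nn_integral_continuous_Ico[symmetric] c mult_nonneg_nonneg divide_nonneg_nonneg poisson_nonneg) auto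
  also have "\<dots> = (\<integral>\<^sup>+\<theta>. (ennreal (poisson \<rho> w \<theta> / (2 * pi)) * indicator {0..<2 * pi} \<theta>) * ennreal (norm (f (rcis \<rho> \<theta>))) \<partial>lborel)"
  proof (intro nn_integral_cong)
    fix \<theta>
    have "0 \<le> poisson \<rho> w \<theta> / (2 * pi)" using \<rho> poisson_nonneg[of w \<rho> \<theta>] by simp
    then show "ennreal (?h \<theta>) * indicator {0..<2 * pi} \<theta>
      = (ennreal (poisson \<rho> w \<theta> / (2 * pi)) * indicator {0..<2 * pi} \<theta>) * ennreal (norm (f (rcis \<rho> \<theta>)))"
      by (simp only: ennreal_mult norm_ge_zero mult_ac)
  qed
  finally show ?thesis .
qed

lemma measurable_circle:
  assumes "f holomorphic_on ball 0 1" "0 \<le> \<rho>" "\<rho> < 1"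
  shows "(\<lambda>\<theta>. f (rcis \<rho> \<theta>)) \<in> borel_measurable borel"
  using continuous_on_circle[OF assms] by (rule continuous_on_real_borel)

lemma measurable_poisson: "norm w < \<rho> \<Longrightarrow> poisson \<rho> w \<in> borel_measurable borel"
  by (rule continuous_on_real_borel[OF continuous_on_poisson])

lemma nn_integral_circle_powr:
  assumes f: "f holomorphic_on ball 0 1" and \<rho>: "0 \<le> \<rho>" "\<rho> < 1" and p: "0 < p"
  shows "(\<integral>\<^sup>+\<theta>\<in>{0..<2 * pi}. ennreal (norm (f (rcis \<rho> \<theta>)) powr p) \<partial>lborel)
    = ennreal (2 * pi * integral_mean p \<rho> f powr p)"
proof -
  let ?h = "\<lambda>\<theta>. norm (f (rcis \<rho> \<theta>)) powr p"
  have c: "continuous_on {0..2 * pi} ?h"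
    using p by (intro continuous_on_powr' continuous_intros continuous_on_circle[OF f \<rho>]) auto
  have I0: "0 \<le> integral {0..2 * pi} ?h"
    using c by (intro integral_nonneg integrable_continuous_interval) auto
  have "set_integrable lborel {0..2 * pi} ?h"
    using c by (rule borel_integrable_atLeastAtMost')
  then have "(LINT \<theta>:{0..2 * pi}|lborel. ?h \<theta>) = integral {0..2 * pi} ?h"
    by (rule set_borel_integral_eq_integral)
  then have "integral_mean p \<rho> f powr p = 1 / (2 * pi) * integral {0..2 * pi} ?h"
    using p I0 by (simp add: integral_mean_def powr_powr)
  then have "2 * pi * integral_mean p \<rho> f powr p = integral {0..2 * pi} ?h" by simp
  moreover have "(\<integral>\<^sup>+\<theta>\<in>{0..<2 * pi}. ennreal (?h \<theta>) \<partial>lborel) = ennreal (integral {0..2 * pi} ?h)"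
    by (intro nn_integral_continuous_Ico c) auto
  ultimately show ?thesis by simp
qed

section \<open>The Hardy space: a weak-type estimate and its interpolation\<close>

text \<open>The discrete layer-cake formula. As \<open>N\<close> increases, the indicator selects an
  initial segment of indices, so the increments telescope; the \<open>min\<close> on the right is
  what makes the induction go through.\<close>

lemma telescope_powr_indicator:
  fixes N :: "nat \<Rightarrow> real"
  assumes N0: "N 0 = 0" and mono: "\<And>k. N k \<le> N (Suc k)" and q: "0 < q" and y: "0 \<le> y"
  shows "(\<Sum>k<n. (N (Suc k) powr q - N k powr q) * (if N (Suc k) < y then 1 else 0)) \<le> min (N n) y powr q"
proof (induction n)
  case 0
  then show ?case using N0 y by simp
next
  case (Suc n)
  have N: "0 \<le> N n" for n
    using lift_Suc_mono_le[of N 0 n, OF mono] N0 by simp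
  show ?case
  proof (cases "N (Suc n) < y")
    case True
    with mono[of n] have "min (N n) y = N n" "min (N (Suc n)) y = N (Suc n)" by auto
    with Suc True show ?thesis by simp
  next
    case False
    then have "(\<Sum>k<Suc n. (N (Suc k) powr q - N k powr q) * (if N (Suc k) < y then 1 else 0)) \<le> min (N n) y powr q"
      using Suc by simp
    also have "\<dots> \<le> min (N (Suc n)) y powr q"
      using mono[of n] N[of n] y q by (intro powr_mono2) auto
    finally show ?thesis .
  qed
qed

text \<open>Summation by parts gives an equality with the boundary term
  \<open>2 * (1 / 2) ^ n * A n\<close>, which is nonnegative and dropped.\<close>

lemma abel_dyadic:
  fixes A :: "nat \<Rightarrow> real"
  assumes "A 0 = 0" "\<And>k. 0 \<le> A k"
  shows "(\<Sum>k<n. (1 / 2) ^ k * A (Suc k)) \<le> 2 * (\<Sum>k<n. (1 / 2) ^ k * (A (Suc k) - A k))"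
proof -
  have "2 * (\<Sum>k<n. (1 / 2) ^ k * (A (Suc k) - A k)) = (\<Sum>k<n. (1 / 2) ^ k * A (Suc k)) + 2 * (1 / 2) ^ n * A n"
    using assms(1) by (induction n) (simp_all add: algebra_simps)
  then show ?thesis using assms(2)[of n] by simp
qed

text \<open>One factor \<open>b\<close> is split off the increment of the \<open>p\<close>-th power,
  because the weak-type estimate bounds the maximum modulus to the first power. What is left are
  increments of the power \<open>p - 1\<close>, which telescope. The constant comes from Young's
  inequality.\<close>

lemma powr_diff_le:
  fixes a b p :: real
  assumes "0 \<le> a" "a \<le> b" "1 < p"
  shows "b powr p - a powr p \<le> p / (p - 1) * (b * (b powr (p - 1) - a powr (p - 1)))"
proof -
  have "b * a powr (p - 1) \<le> b powr p / p + (a powr (p - 1)) powr (p / (p - 1)) / (p / (p - 1))"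
    using assms by (intro Youngs_inequality) (auto simp: field_simps)
  also have "(a powr (p - 1)) powr (p / (p - 1)) = a powr p"
    using assms by (simp add: powr_powr)
  finally have "p / (p - 1) * (b * a powr (p - 1)) \<le> p / (p - 1) * (b powr p / p + a powr p / (p / (p - 1)))"
    using assms by (intro mult_left_mono) auto
  also have "\<dots> = b powr p / (p - 1) + a powr p"
    using assms by (simp add: field_simps)
  finally have 1: "p / (p - 1) * (b * a powr (p - 1)) \<le> b powr p / (p - 1) + a powr p" .
  have 2: "b * b powr (p - 1) = b powr p"
    using assms powr_mult_base[of b "p - 1"] by (cases "b = 0") auto
  have 3: "p / (p - 1) * b powr p = b powr p / (p - 1) + b powr p"
    using assms by (simp add: field_simps)
  show ?thesis
    using 1 3 by (simp only: right_diff_distrib 2)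
qed

lemma ennreal_mult4:
  "0 \<le> a \<Longrightarrow> 0 \<le> b \<Longrightarrow> 0 \<le> c \<Longrightarrow> 0 \<le> d \<Longrightarrow>
    ennreal a * (ennreal b * (ennreal c * (ennreal d * x))) = ennreal (a * b * c * d) * x"
  by (simp add: ennreal_mult mult.assoc)

text \<open>Marcinkiewicz interpolation between a weak \<open>(1,1)\<close> bound at the dyadic radii and the
  maximum principle, with the distribution-function integral replaced by Abel summation.\<close>

lemma Hardy_embedding:
  assumes p: "1 < p"
  shows "\<exists>C>0. \<forall>f. f holomorphic_on ball 0 1 \<longrightarrow> dyad_norm p f \<le> ennreal C * epowr (Hardy_norm p f) p"
proof (intro exI conjI allI impI)
  let ?C = "(2 * (p / (p - 1))) * (4 / pi) * 2 powr (p - 1) * (2 * pi)"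
  show "0 < ?C" using p by (intro mult_pos_pos divide_pos_pos) auto
  fix f assume f: "f holomorphic_on ball 0 1"
  define M where "M k = max_mean (dyad k) f" for k
  have M0: "0 \<le> M k" for k unfolding M_def using f by (intro max_mean_nonneg) auto
  have Mmono: "M k \<le> M (Suc k)" for k
    unfolding M_def using f dyad_mono[of k "Suc k"] by (intro max_mean_mono) auto
  \<comment> \<open>The maxima shifted by one place with \<open>N 0 = 0\<close>, so that Abel
    summation and telescoping start from zero.\<close>
  define N where "N k = (case k of 0 \<Rightarrow> 0 | Suc j \<Rightarrow> M j)" for k
  have N: "N 0 = 0" "N (Suc k) = M k" for k by (auto simp: N_def)
  have Nmono: "N k \<le> N (Suc k)" for k
    using M0 Mmono by (cases k) (auto simp: N_def)
  have N0: "0 \<le> N k" for k using M0 by (cases k) (auto simp: N_def)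
  define E where "E k = N (Suc k) powr (p - 1) - N k powr (p - 1)" for k
  have E0: "0 \<le> E k" for k
    unfolding E_def using p powr_mono2[OF _ N0 Nmono, of "p - 1" k] by simp
  show "dyad_norm p f \<le> ennreal ?C * epowr (Hardy_norm p f) p"
    unfolding dyad_norm_def
  proof (rule suminf_le_const[OF summableI])
    fix n
    \<comment> \<open>A circle outside all radii \<open>dyad k\<close> with \<open>k < n\<close>, at
      distance at least \<open>(1 / 2) ^ Suc k\<close> from each of them.\<close>
    define \<rho> where "\<rho> = dyad (Suc n)"
    have \<rho>: "0 \<le> \<rho>" "\<rho> < 1" by (simp_all add: \<rho>_def)
    define \<phi> where "\<phi> \<theta> = norm (f (rcis \<rho> \<theta>))" for \<theta>
    have \<phi>0: "0 \<le> \<phi> \<theta>" for \<theta> by (simp add: \<phi>_def)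
    have [measurable]: "\<phi> \<in> borel_measurable borel"
      unfolding \<phi>_def using measurable_circle[OF f \<rho>] by measurable
    define J where "J k = (\<integral>\<^sup>+\<theta>\<in>{0..<2 * pi}. ennreal (\<phi> \<theta> * (if M k < 2 * \<phi> \<theta> then 1 else 0)) \<partial>lborel)" for k
    \<comment> \<open>Where \<open>\<phi> \<theta>\<close> is at most \<open>M k / 2\<close>, the
      Poisson average contributes at most \<open>M k / 2\<close>, as the kernel has mass one; this
      half is absorbed on the left. Elsewhere the kernel is replaced by its maximum, of order
      \<open>2 ^ k\<close>.\<close>
    have weak: "ennreal ((1 / 2) ^ k * M k) \<le> ennreal (4 / pi) * J k" if k: "k < n" for k
    proof -
      obtain w where w: "norm w = dyad k" "norm (f w) = M k"
        using max_mean_attained[OF f, of "dyad k"] by (auto simp: M_def)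
      have gap: "(1 / 2) ^ Suc k \<le> \<rho> - dyad k"
      proof -
        have "(1 / 2 :: real) ^ Suc n \<le> (1 / 2) ^ Suc k" using k by (intro power_decreasing) auto
        then show ?thesis by (simp add: \<rho>_def dyad_def)
      qed
      have wr: "norm w < \<rho>" unfolding w using gap zero_less_power[of "1 / 2 :: real" "Suc k"] by linarith
      let ?P = "\<lambda>\<theta>. ennreal (poisson \<rho> w \<theta> / (2 * pi)) * indicator {0..<2 * pi} \<theta>"
      have [measurable]: "poisson \<rho> w \<in> borel_measurable borel" by (rule measurable_poisson[OF wr])
      have Ple: "poisson \<rho> w \<theta> / (2 * pi) \<le> 2 ^ Suc k / pi" for \<theta>
      proof -
        have "poisson \<rho> w \<theta> \<le> 2 / (\<rho> - norm w)" using wr \<rho> by (intro poisson_le) auto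
        also have "\<dots> \<le> 2 / (1 / 2) ^ Suc k"
          unfolding w using gap wr w by (intro divide_left_mono mult_pos_pos) auto
        also have "\<dots> = 2 * 2 ^ Suc k" by (simp add: power_one_over)
        finally have "poisson \<rho> w \<theta> / (2 * pi) \<le> (2 * 2 ^ Suc k) / (2 * pi)"
          by (intro divide_right_mono) auto
        then show ?thesis by simp
      qed
      have "ennreal (M k) \<le> (\<integral>\<^sup>+\<theta>. ?P \<theta> * ennreal (\<phi> \<theta>) \<partial>lborel)"
        using norm_le_poisson_integral[OF f wr \<rho>(2)] by (simp add: w \<phi>_def)
      also have "\<dots> \<le> (\<integral>\<^sup>+\<theta>. ?P \<theta> * ennreal (M k / 2) + ennreal (2 ^ Suc k / pi) *
          (ennreal (\<phi> \<theta> * (if M k < 2 * \<phi> \<theta> then 1 else 0)) * indicator {0..<2 * pi} \<theta>) \<partial>lborel)"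
      proof (rule nn_integral_mono)
        fix \<theta>
        show "?P \<theta> * ennreal (\<phi> \<theta>) \<le> ?P \<theta> * ennreal (M k / 2) + ennreal (2 ^ Suc k / pi) *
          (ennreal (\<phi> \<theta> * (if M k < 2 * \<phi> \<theta> then 1 else 0)) * indicator {0..<2 * pi} \<theta>)"
        proof (cases "M k < 2 * \<phi> \<theta>")
          case False
          then have "?P \<theta> * ennreal (\<phi> \<theta>) \<le> ?P \<theta> * ennreal (M k / 2)"
            by (intro mult_left_mono ennreal_leI) auto
          then show ?thesis by (rule add_increasing2[rotated]) simp
        next
          case True
          have "?P \<theta> * ennreal (\<phi> \<theta>) \<le> (ennreal (2 ^ Suc k / pi) * indicator {0..<2 * pi} \<theta>) * ennreal (\<phi> \<theta>)"
            using Ple by (intro mult_right_mono ennreal_leI) auto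
          then show ?thesis
            using True by (intro add_increasing) (auto simp: mult_ac)
        qed
      qed
      also have "\<dots> = (\<integral>\<^sup>+\<theta>. ?P \<theta> \<partial>lborel) * ennreal (M k / 2) + ennreal (2 ^ Suc k / pi) * J k"
        unfolding J_def by (simp add: nn_integral_add nn_integral_cmult nn_integral_multc)
      also have "(\<integral>\<^sup>+\<theta>. ?P \<theta> \<partial>lborel) = 1" by (rule nn_integral_poisson[OF wr \<rho>(2)])
      finally have "ennreal (M k / 2) + ennreal (M k / 2) \<le> ennreal (M k / 2) + ennreal (2 ^ Suc k / pi) * J k"
        using M0[of k] by (simp flip: ennreal_plus)
      then have "ennreal (M k / 2) \<le> ennreal (2 ^ Suc k / pi) * J k"
        by (simp add: ennreal_add_left_cancel_le)
      then have "ennreal (2 * (1 / 2) ^ k) * ennreal (M k / 2) \<le> ennreal (2 * (1 / 2) ^ k) * (ennreal (2 ^ Suc k / pi) * J k)"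
        by (intro mult_left_mono) auto
      also have "\<dots> = ennreal (2 * (1 / 2) ^ k * (2 ^ Suc k / pi)) * J k"
        by (subst ennreal_mult) (auto simp: mult.assoc)
      also have "2 * (1 / 2) ^ k * (2 ^ Suc k / pi) = 4 / pi"
        by (simp add: power_one_over)
      also have "ennreal (2 * (1 / 2) ^ k) * ennreal (M k / 2) = ennreal ((1 / 2) ^ k * M k)"
        using M0[of k] by (subst ennreal_mult[symmetric]) auto
      finally show ?thesis .
    qed
    have "(\<Sum>k<n. ennreal (max_mean (dyad k) f powr p * (1 / 2) ^ k)) = ennreal (\<Sum>k<n. (1 / 2) ^ k * N (Suc k) powr p)"
      by (subst sum_ennreal) (auto simp: N M_def mult.commute)
    also have "\<dots> \<le> ennreal (2 * (\<Sum>k<n. (1 / 2) ^ k * (N (Suc k) powr p - N k powr p)))"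
      using abel_dyadic[of "\<lambda>k. N k powr p" n] p by (intro ennreal_leI) (auto simp: N)
    also have "\<dots> \<le> ennreal (2 * (\<Sum>k<n. (p / (p - 1)) * (((1 / 2) ^ k * M k) * E k)))"
    proof (intro ennreal_leI mult_left_mono sum_mono)
      fix k
      have "(1 / 2) ^ k * (N (Suc k) powr p - N k powr p) \<le> (1 / 2) ^ k * (p / (p - 1) * (N (Suc k) * E k))"
        unfolding E_def using N0 Nmono p by (intro mult_left_mono powr_diff_le) auto
      then show "(1 / 2) ^ k * (N (Suc k) powr p - N k powr p) \<le> p / (p - 1) * ((1 / 2) ^ k * M k * E k)"
        by (simp add: N mult_ac)
    qed auto
    also have "2 * (\<Sum>k<n. (p / (p - 1)) * (((1 / 2) ^ k * M k) * E k)) = (2 * (p / (p - 1))) * (\<Sum>k<n. ((1 / 2) ^ k * M k) * E k)"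
      by (simp add: sum_distrib_left mult_ac)
    also have "ennreal \<dots> = ennreal (2 * (p / (p - 1))) * ennreal (\<Sum>k<n. ((1 / 2) ^ k * M k) * E k)"
      using p M0 E0 by (intro ennreal_mult sum_nonneg mult_nonneg_nonneg) auto
    also have "ennreal (\<Sum>k<n. ((1 / 2) ^ k * M k) * E k) = (\<Sum>k<n. ennreal ((1 / 2) ^ k * M k) * ennreal (E k))"
      using M0 E0 by (subst sum_ennreal[symmetric]) (auto intro!: sum.cong simp: ennreal_mult)
    also have "ennreal (2 * (p / (p - 1))) * (\<Sum>k<n. ennreal ((1 / 2) ^ k * M k) * ennreal (E k))
        \<le> ennreal (2 * (p / (p - 1))) * (\<Sum>k<n. (ennreal (4 / pi) * J k) * ennreal (E k))"
      by (intro mult_left_mono sum_mono mult_right_mono weak) auto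
    also have "(\<Sum>k<n. (ennreal (4 / pi) * J k) * ennreal (E k)) = ennreal (4 / pi) * (\<Sum>k<n. ennreal (E k) * J k)"
      by (simp add: sum_distrib_left mult_ac)
    also have "(\<Sum>k<n. ennreal (E k) * J k)
      = (\<integral>\<^sup>+\<theta>. (\<Sum>k<n. ennreal (E k) * (ennreal (\<phi> \<theta> * (if M k < 2 * \<phi> \<theta> then 1 else 0)) * indicator {0..<2 * pi} \<theta>)) \<partial>lborel)"
      unfolding J_def by (subst nn_integral_sum) (auto simp: nn_integral_cmult)
    \<comment> \<open>For a fixed angle only the \<open>k\<close> with
      \<open>M k < 2 * \<phi> \<theta>\<close> count, and their increments telescope to at most
      \<open>(2 * \<phi> \<theta>) powr (p - 1)\<close>.\<close>
    also have "\<dots> \<le> (\<integral>\<^sup>+\<theta>. ennreal (2 powr (p - 1)) * (ennreal (\<phi> \<theta> powr p) * indicator {0..<2 * pi} \<theta>) \<partial>lborel)"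
    proof (rule nn_integral_mono)
      fix \<theta>
      have "(\<Sum>k<n. ennreal (E k) * (ennreal (\<phi> \<theta> * (if M k < 2 * \<phi> \<theta> then 1 else 0)) * indicator {0..<2 * pi} \<theta>))
        = ennreal (\<Sum>k<n. E k * (\<phi> \<theta> * (if M k < 2 * \<phi> \<theta> then 1 else 0))) * indicator {0..<2 * pi} \<theta>"
      proof (cases "\<theta> \<in> {0..<2 * pi}")
        case True
        have "ennreal (\<Sum>k<n. E k * (\<phi> \<theta> * (if M k < 2 * \<phi> \<theta> then 1 else 0)))
          = (\<Sum>k<n. ennreal (E k * (\<phi> \<theta> * (if M k < 2 * \<phi> \<theta> then 1 else 0))))"
          using E0 \<phi>0 by (intro sum_ennreal[symmetric]) simp
        also have "\<dots> = (\<Sum>k<n. ennreal (E k) * ennreal (\<phi> \<theta> * (if M k < 2 * \<phi> \<theta> then 1 else 0)))"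
          using E0 \<phi>0 by (intro sum.cong refl ennreal_mult) auto
        finally show ?thesis using True by (simp only: indicator_simps(1) mult_1_right)
      next
        case False
        then have z: "indicator {0..<2 * pi} \<theta> = (0 :: ennreal)" by (rule indicator_simps(2))
        show ?thesis unfolding z by simp
      qed
      also have "(\<Sum>k<n. E k * (\<phi> \<theta> * (if M k < 2 * \<phi> \<theta> then 1 else 0))) = \<phi> \<theta> * (\<Sum>k<n. (N (Suc k) powr (p - 1) - N k powr (p - 1)) * (if N (Suc k) < 2 * \<phi> \<theta> then 1 else 0))"
        by (simp add: E_def N sum_distrib_left mult_ac)
      also have "ennreal \<dots> \<le> ennreal (\<phi> \<theta> * min (N n) (2 * \<phi> \<theta>) powr (p - 1))"
        using p \<phi>0 by (intro ennreal_leI mult_left_mono telescope_powr_indicator[OF N(1) Nmono]) auto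
      also have "\<dots> \<le> ennreal (\<phi> \<theta> * (2 * \<phi> \<theta>) powr (p - 1))"
        using p \<phi>0 N0 by (intro ennreal_leI mult_left_mono powr_mono2) auto
      also have "\<phi> \<theta> * (2 * \<phi> \<theta>) powr (p - 1) = 2 powr (p - 1) * (\<phi> \<theta> * \<phi> \<theta> powr (p - 1))"
        using \<phi>0 by (simp add: powr_mult)
      also have "\<phi> \<theta> * \<phi> \<theta> powr (p - 1) = \<phi> \<theta> powr p"
        using \<phi>0[of \<theta>] powr_mult_base[of "\<phi> \<theta>" "p - 1"] by (cases "\<phi> \<theta> = 0") auto
      finally show "(\<Sum>k<n. ennreal (E k) * (ennreal (\<phi> \<theta> * (if M k < 2 * \<phi> \<theta> then 1 else 0)) * indicator {0..<2 * pi} \<theta>))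
        \<le> ennreal (2 powr (p - 1)) * (ennreal (\<phi> \<theta> powr p) * indicator {0..<2 * pi} \<theta>)"
        by (simp add: ennreal_mult mult.assoc mult_right_mono)
    qed
    also have "\<dots> = ennreal (2 powr (p - 1)) * (\<integral>\<^sup>+\<theta>\<in>{0..<2 * pi}. ennreal (\<phi> \<theta> powr p) \<partial>lborel)"
      by (intro nn_integral_cmult) auto
    also have "(\<integral>\<^sup>+\<theta>\<in>{0..<2 * pi}. ennreal (\<phi> \<theta> powr p) \<partial>lborel) = ennreal (2 * pi * integral_mean p \<rho> f powr p)"
      unfolding \<phi>_def using p by (intro nn_integral_circle_powr f \<rho>) auto
    also have "\<dots> = ennreal (2 * pi) * ennreal (integral_mean p \<rho> f powr p)"
      by (simp add: ennreal_mult)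
    also have "ennreal (integral_mean p \<rho> f powr p) \<le> epowr (Hardy_norm p f) p"
    proof -
      have "0 < \<rho>" using dyad_strict_mono[of 0 "Suc n"] by (simp add: \<rho>_def)
      then have "ennreal (integral_mean p \<rho> f) \<le> Hardy_norm p f"
        unfolding Hardy_norm_def using \<rho> by (intro SUP_upper) auto
      then have "epowr (ennreal (integral_mean p \<rho> f)) p \<le> epowr (Hardy_norm p f) p"
        using p by (intro epowr_mono) auto
      then show ?thesis by (simp add: integral_mean_def)
    qed
    finally have "(\<Sum>k<n. ennreal (max_mean (dyad k) f powr p * (1 / 2) ^ k)) \<le>
      ennreal (2 * (p / (p - 1))) * (ennreal (4 / pi) * (ennreal (2 powr (p - 1)) * (ennreal (2 * pi) * epowr (Hardy_norm p f) p)))"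
      by (simp add: mult_left_mono)
    also have "\<dots> = ennreal ?C * epowr (Hardy_norm p f) p"
      using p by (intro ennreal_mult4) auto
    finally show "(\<Sum>k<n. ennreal (max_mean (dyad k) f powr p * (1 / 2) ^ k)) \<le> ennreal ?C * epowr (Hardy_norm p f) p" .
  qed
qed

subsection \<open>The Dirichlet norm\<close>

text \<open>The \<open>p\<close>-th root of \<open>1 / 2\<close>. With it the dyadic norm becomes an
  \<open>l^p\<close> norm of \<open>max_mean (dyad k) f * gam p ^ k\<close>, and changes of scale
  appear as powers of \<open>gam p\<close>.\<close>

definition gam :: "real \<Rightarrow> real" where
  "gam p = 2 powr (- (1 / p))"

lemma gam_pos: "0 < gam p"
  by (simp add: gam_def)

lemma gam_less_1: "0 < p \<Longrightarrow> gam p < 1"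
  by (simp add: gam_def powr_less_one)

lemma half_power: "(1 / 2 :: real) ^ n = 2 powr (- real n)"
  by (simp add: powr_minus powr_realpow power_one_over inverse_eq_divide)

lemma gam_power: "gam p ^ n = 2 powr (- (real n / p))"
  by (simp add: gam_def powr_powr flip: powr_realpow)

lemma gam_power_powr: "0 < p \<Longrightarrow> (gam p ^ n) powr p = (1 / 2) ^ n"
  by (simp add: gam_power half_power powr_powr)

lemma ennreal_sum_mult:
  assumes "\<And>i. i \<in> A \<Longrightarrow> 0 \<le> a i" "\<And>i. i \<in> A \<Longrightarrow> 0 \<le> b i"
  shows "ennreal (\<Sum>i\<in>A. a i * b i) = (\<Sum>i\<in>A. ennreal (a i) * ennreal (b i))"
proof -
  have "ennreal (\<Sum>i\<in>A. a i * b i) = (\<Sum>i\<in>A. ennreal (a i * b i))"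
    using assms by (intro sum_ennreal[symmetric]) auto
  also have "\<dots> = (\<Sum>i\<in>A. ennreal (a i) * ennreal (b i))"
    using assms by (intro sum.cong refl ennreal_mult) auto
  finally show ?thesis .
qed

lemma dyad_norm_eq:
  assumes "f holomorphic_on ball 0 1" "0 < p"
  shows "dyad_norm p f = (\<Sum>k. epowr (ennreal (max_mean (dyad k) f * gam p ^ k)) p)"
  unfolding dyad_norm_def
proof (intro suminf_cong)
  fix k
  have "0 \<le> max_mean (dyad k) f" using assms by (intro max_mean_nonneg) auto
  then show "ennreal (max_mean (dyad k) f powr p * (1 / 2) ^ k) = epowr (ennreal (max_mean (dyad k) f * gam p ^ k)) p"
    using assms gam_pos[of p] by (simp add: powr_mult gam_power_powr)
qed

lemma suminf_half_power_mult:
  assumes "0 \<le> c"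
  shows "(\<Sum>k. ennreal (c * (1 / 2) ^ k)) = ennreal (2 * c)"
proof -
  have "(\<lambda>k. c * (1 / 2) ^ k) sums (c * (1 / (1 - 1 / 2 :: real)))"
    by (intro sums_mult geometric_sums) auto
  then have "(\<lambda>k. ennreal (c * (1 / 2) ^ k)) sums ennreal (c * (1 / (1 - 1 / 2)))"
    using assms by (subst sums_ennreal) auto
  then have "(\<Sum>k. ennreal (c * (1 / 2) ^ k)) = ennreal (c * (1 / (1 - 1 / 2)))"
    by (rule sums_unique[symmetric])
  then show ?thesis by (simp add: mult.commute)
qed

text \<open>Jensen with the Poisson kernel as a probability density, followed by the maximum of the
  kernel.\<close>

lemma norm_powr_le_circle_mean:
  assumes g: "g holomorphic_on ball 0 1" and \<rho>: "norm w < \<rho>" "\<rho> < 1" and p: "1 < p"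
  shows "ennreal (norm (g w) powr p) \<le> ennreal (1 / (\<rho> - norm w) / pi) *
    (\<integral>\<^sup>+\<theta>\<in>{0..<2 * pi}. ennreal (norm (g (rcis \<rho> \<theta>)) powr p) \<partial>lborel)"
proof -
  have r: "0 \<le> \<rho>" using \<rho> norm_ge_zero[of w] by linarith
  let ?P = "\<lambda>\<theta>. ennreal (poisson \<rho> w \<theta> / (2 * pi)) * indicator {0..<2 * pi} \<theta>"
  have [measurable]: "poisson \<rho> w \<in> borel_measurable borel" by (rule measurable_poisson[OF \<rho>(1)])
  have [measurable]: "(\<lambda>\<theta>. g (rcis \<rho> \<theta>)) \<in> borel_measurable borel" by (rule measurable_circle[OF g r \<rho>(2)])
  have P1: "(\<integral>\<^sup>+\<theta>. ?P \<theta> \<partial>lborel) = 1" by (rule nn_integral_poisson[OF \<rho>])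
  have "ennreal (norm (g w) powr p) = epowr (ennreal (norm (g w))) p" by simp
  also have "\<dots> \<le> epowr (\<integral>\<^sup>+\<theta>. ?P \<theta> * ennreal (norm (g (rcis \<rho> \<theta>))) \<partial>lborel) p"
    using p by (intro epowr_mono norm_le_poisson_integral g \<rho>) auto
  also have "\<dots> \<le> epowr (\<integral>\<^sup>+\<theta>. ?P \<theta> \<partial>lborel) (p - 1) * (\<integral>\<^sup>+\<theta>. ?P \<theta> * epowr (ennreal (norm (g (rcis \<rho> \<theta>)))) p \<partial>lborel)"
    using p P1 by (intro nn_jensen) auto
  also have "\<dots> = (\<integral>\<^sup>+\<theta>. ?P \<theta> * ennreal (norm (g (rcis \<rho> \<theta>)) powr p) \<partial>lborel)"
    using epowr_ennreal[of 1 "p - 1"] unfolding P1 by simp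
  also have "\<dots> \<le> (\<integral>\<^sup>+\<theta>. ennreal (1 / (\<rho> - norm w) / pi) * (ennreal (norm (g (rcis \<rho> \<theta>)) powr p) * indicator {0..<2 * pi} \<theta>) \<partial>lborel)"
  proof (rule nn_integral_mono)
    fix \<theta>
    have "poisson \<rho> w \<theta> / (2 * pi) \<le> (2 / (\<rho> - norm w)) / (2 * pi)"
      using \<rho> by (intro divide_right_mono poisson_le) auto
    also have "\<dots> = 1 / (\<rho> - norm w) / pi" by simp
    finally have "ennreal (poisson \<rho> w \<theta> / (2 * pi)) \<le> ennreal (1 / (\<rho> - norm w) / pi)" by (rule ennreal_leI)
    then have "ennreal (poisson \<rho> w \<theta> / (2 * pi)) * (ennreal (norm (g (rcis \<rho> \<theta>)) powr p) * indicator {0..<2 * pi} \<theta>)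
      \<le> ennreal (1 / (\<rho> - norm w) / pi) * (ennreal (norm (g (rcis \<rho> \<theta>)) powr p) * indicator {0..<2 * pi} \<theta>)"
      by (rule mult_right_mono) simp
    then show "?P \<theta> * ennreal (norm (g (rcis \<rho> \<theta>)) powr p)
      \<le> ennreal (1 / (\<rho> - norm w) / pi) * (ennreal (norm (g (rcis \<rho> \<theta>)) powr p) * indicator {0..<2 * pi} \<theta>)"
      by (simp only: mult_ac)
  qed
  also have "\<dots> = ennreal (1 / (\<rho> - norm w) / pi) * (\<integral>\<^sup>+\<theta>\<in>{0..<2 * pi}. ennreal (norm (g (rcis \<rho> \<theta>)) powr p) \<partial>lborel)"
    by (intro nn_integral_cmult) measurable
  finally show ?thesis .
qed

lemma nn_integral_disc_polar:
  fixes H :: "complex \<Rightarrow> real"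
  assumes c: "continuous_on (ball 0 1) H"
  shows "(\<integral>\<^sup>+z\<in>ball 0 1. ennreal (H z) \<partial>lborel)
    = (\<integral>\<^sup>+r\<in>{0<..<1}. ennreal r * (\<integral>\<^sup>+\<theta>\<in>{0..<2 * pi}. ennreal (H (rcis r \<theta>)) \<partial>lborel) \<partial>lborel)"
proof -
  define F where "F z = ennreal (indicator (ball 0 1) z * H z)" for z
  have "(\<lambda>z. indicator (ball 0 1) z *\<^sub>R H z) \<in> borel_measurable borel"
    using c by (intro borel_measurable_continuous_on_indicator) auto
  then have [measurable]: "F \<in> borel_measurable borel"
    unfolding F_def by simp
  have "(\<integral>\<^sup>+z\<in>ball 0 1. ennreal (H z) \<partial>lborel) = (\<integral>\<^sup>+z. F z \<partial>lborel)"
    unfolding F_def by (intro nn_integral_cong) (auto split: split_indicator)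
  also have "\<dots> = (\<integral>\<^sup>+r\<in>{0<..}. ennreal r * (\<integral>\<^sup>+\<phi>\<in>{0..<2 * pi}. F (rcis r \<phi>) \<partial>lborel) \<partial>lborel)"
    by (rule nn_integral_polar) measurable
  also have "\<dots> = (\<integral>\<^sup>+r\<in>{0<..<1}. ennreal r * (\<integral>\<^sup>+\<theta>\<in>{0..<2 * pi}. ennreal (H (rcis r \<theta>)) \<partial>lborel) \<partial>lborel)"
  proof (intro nn_integral_cong)
    fix r :: real
    show "ennreal r * (\<integral>\<^sup>+\<phi>\<in>{0..<2 * pi}. F (rcis r \<phi>) \<partial>lborel) * indicator {0<..} r
      = ennreal r * (\<integral>\<^sup>+\<theta>\<in>{0..<2 * pi}. ennreal (H (rcis r \<theta>)) \<partial>lborel) * indicator {0<..<1} r"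
      by (cases "0 < r"; cases "r < 1") (simp_all add: F_def)
  qed
  finally show ?thesis .
qed

lemma holomorphic_on_deriv_disc: "f holomorphic_on ball 0 1 \<Longrightarrow> deriv f holomorphic_on ball 0 1"
  by (rule holomorphic_deriv) auto

lemma continuous_on_Dirichlet_integrand:
  assumes "f holomorphic_on ball 0 1" "1 < p"
  shows "continuous_on (ball 0 1) (\<lambda>z. 1 / pi * (norm (deriv f z) powr p * (1 - norm z) powr (p - 1)))"
  using assms holomorphic_on_imp_continuous_on[OF holomorphic_on_deriv_disc[OF assms(1)]]
  by (intro continuous_intros continuous_on_powr') auto

text \<open>The maximum at radius \<open>dyad k\<close> is charged to the annulus between
  \<open>dyad (Suc k)\<close> and \<open>dyad (Suc (Suc k))\<close>. In powers of
  \<open>2 ^ k\<close>, the width of the annulus and the Poisson kernel cost 1 each and the weight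
  costs \<open>p - 1\<close>, in total \<open>p + 1 = p * (1 + 1 / p)\<close>.\<close>

lemma max_mean_deriv_dyadic_sum:
  assumes f: "f holomorphic_on ball 0 1" and p: "1 < p"
  shows "(\<Sum>k. epowr (ennreal (max_mean (dyad k) (deriv f) * 2 powr (- (real k * (1 + 1 / p))))) p)
    \<le> ennreal (2 powr (2 * p + 2)) *
      (\<integral>\<^sup>+z\<in>ball 0 1. ennreal (1 / pi * (norm (deriv f z) powr p * (1 - norm z) powr (p - 1))) \<partial>lborel)"
    (is "_ \<le> _ * ?S")
proof -
  define g where "g = deriv f"
  have g: "g holomorphic_on ball 0 1" unfolding g_def by (rule holomorphic_on_deriv_disc[OF f])
  define G where "G k = max_mean (dyad k) g" for k
  have G0: "0 \<le> G k" for k unfolding G_def using g by (intro max_mean_nonneg) auto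
  define m where "m r = (\<integral>\<^sup>+\<theta>\<in>{0..<2 * pi}. ennreal (norm (g (rcis r \<theta>)) powr p) \<partial>lborel)" for r
  \<comment> \<open>A lower bound for the radial integrand on the annulus: \<open>1 / 2\<close> for
    the density \<open>r\<close>, the least value of the weight, and the Poisson bound for the
    circle mean.\<close>
  define L where "L k = 1 / 2 * (1 / pi * ((1 / 2) ^ (k + 2)) powr (p - 1)) * (pi * (1 / 2) ^ (k + 1) * G k powr p)" for k
  have S: "?S = (\<integral>\<^sup>+r\<in>{0<..<1}. ennreal r * (\<integral>\<^sup>+\<theta>\<in>{0..<2 * pi}. ennreal (1 / pi * (norm (g (rcis r \<theta>)) powr p * (1 - norm (rcis r \<theta>)) powr (p - 1))) \<partial>lborel) \<partial>lborel)"
    unfolding g_def by (rule nn_integral_disc_polar) (rule continuous_on_Dirichlet_integrand[OF f p])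
  have low: "ennreal (L k) \<le> ennreal r * (\<integral>\<^sup>+\<theta>\<in>{0..<2 * pi}. ennreal (1 / pi * (norm (g (rcis r \<theta>)) powr p * (1 - norm (rcis r \<theta>)) powr (p - 1))) \<partial>lborel)"
    if r: "r \<in> {dyad (Suc k)..<dyad (Suc (Suc k))}" for k r
  proof -
    have half: "1 / 2 \<le> r" using r dyad_mono[of 1 "Suc k"] by (auto simp: dyad_def)
    have r1: "r < 1" using r dyad_less_1[of "Suc (Suc k)"] by (auto simp del: dyad_less_1)
    obtain w where w: "norm w = dyad k" "norm (g w) = G k"
      using max_mean_attained[OF g, of "dyad k"] by (auto simp: G_def)
    have gap: "(1 / 2) ^ (k + 1) \<le> r - norm w"
      using r dyad_Suc_diff[of k] by (simp add: w)
    then have wr: "norm w < r" using zero_less_power[of "1/2::real" "k + 1"] by linarith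
    have [measurable]: "(\<lambda>\<theta>. g (rcis r \<theta>)) \<in> borel_measurable borel"
      using half by (intro measurable_circle[OF g _ r1]) auto
    have "ennreal (G k powr p) \<le> ennreal (1 / (r - norm w) / pi) * m r"
      unfolding m_def w(2)[symmetric] by (rule norm_powr_le_circle_mean[OF g wr r1 p])
    also have "\<dots> \<le> ennreal (1 / (1 / 2) ^ (k + 1) / pi) * m r"
      using gap wr by (intro mult_right_mono ennreal_leI divide_right_mono divide_left_mono) auto
    finally have "ennreal (pi * (1 / 2) ^ (k + 1)) * ennreal (G k powr p)
      \<le> ennreal (pi * (1 / 2) ^ (k + 1)) * (ennreal (1 / (1 / 2) ^ (k + 1) / pi) * m r)"
      by (rule mult_left_mono) simp
    also have "\<dots> = ennreal (pi * (1 / 2) ^ (k + 1) * (1 / (1 / 2) ^ (k + 1) / pi)) * m r"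
      by (subst ennreal_mult) (auto simp: mult.assoc)
    also have "pi * (1 / 2) ^ (k + 1) * (1 / (1 / 2) ^ (k + 1) / pi) = 1" by simp
    finally have mr: "ennreal (pi * (1 / 2) ^ (k + 1) * G k powr p) \<le> m r"
      by (simp only: ennreal_mult powr_ge_zero mult_nonneg_nonneg pi_ge_zero zero_le_power ennreal_1 mult_1 zero_le_divide_1_iff zero_le_numeral)
    have d: "((1 / 2) ^ (k + 2)) powr (p - 1) \<le> (1 - r) powr (p - 1)"
      using r p by (intro powr_mono2) (auto simp: dyad_def)
    have "ennreal (L k) = ennreal (1 / 2 * (1 / pi * ((1 / 2) ^ (k + 2)) powr (p - 1))) * ennreal (pi * (1 / 2) ^ (k + 1) * G k powr p)"
      unfolding L_def by (rule ennreal_mult) auto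
    also have "\<dots> \<le> ennreal (r * (1 / pi * (1 - r) powr (p - 1))) * m r"
      using half d by (intro mult_mono mr ennreal_leI) auto
    also have "\<dots> = ennreal r * (ennreal (1 / pi * (1 - r) powr (p - 1)) * m r)"
      using half by (subst ennreal_mult) (auto simp: mult.assoc)
    also have "ennreal (1 / pi * (1 - r) powr (p - 1)) * m r
      = (\<integral>\<^sup>+\<theta>. ennreal (1 / pi * (1 - r) powr (p - 1)) * (ennreal (norm (g (rcis r \<theta>)) powr p) * indicator {0..<2 * pi} \<theta>) \<partial>lborel)"
      unfolding m_def by (rule nn_integral_cmult[symmetric]) measurable
    also have "\<dots> = (\<integral>\<^sup>+\<theta>\<in>{0..<2 * pi}. ennreal (1 / pi * (norm (g (rcis r \<theta>)) powr p * (1 - norm (rcis r \<theta>)) powr (p - 1))) \<partial>lborel)"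
    proof (intro nn_integral_cong)
      fix \<theta>
      have "1 / pi * (norm (g (rcis r \<theta>)) powr p * (1 - norm (rcis r \<theta>)) powr (p - 1))
        = (1 / pi * (1 - r) powr (p - 1)) * norm (g (rcis r \<theta>)) powr p"
        using half by simp
      then show "ennreal (1 / pi * (1 - r) powr (p - 1)) * (ennreal (norm (g (rcis r \<theta>)) powr p) * indicator {0..<2 * pi} \<theta>)
        = ennreal (1 / pi * (norm (g (rcis r \<theta>)) powr p * (1 - norm (rcis r \<theta>)) powr (p - 1))) * indicator {0..<2 * pi} \<theta>"
        by (simp only: ennreal_mult powr_ge_zero mult_nonneg_nonneg zero_le_divide_1_iff pi_ge_zero mult.assoc)
    qed
    finally show ?thesis .
  qed
  have Lx: "ennreal (2 powr (2 * p + 2)) * (ennreal (L k) * ennreal ((1 / 2) ^ (k + 2)))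
     = epowr (ennreal (G k * 2 powr (- (real k * (1 + 1 / p))))) p" for k
  proof -
    have "L k * (1 / 2) ^ (k + 2) = 2 powr (-1 - real (k + 2) * (p - 1) - real (k + 1) - real (k + 2)) * G k powr p"
    proof -
      have "(1 / 2 :: real) = 2 powr (-1)" by (simp add: powr_minus)
      then have "L k * (1 / 2) ^ (k + 2) = 2 powr (-1) * (2 powr (- real (k + 2))) powr (p - 1) * 2 powr (- real (k + 1)) * 2 powr (- real (k + 2)) * G k powr p"
        unfolding L_def half_power by (simp only: mult_ac) simp
      also have "\<dots> = 2 powr (-1 + - real (k + 2) * (p - 1) + - real (k + 1) + - real (k + 2)) * G k powr p"
        by (simp only: powr_powr powr_add)
      finally show ?thesis by (simp only: diff_conv_add_uminus mult_minus_left)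
    qed
    then have "2 powr (2 * p + 2) * (L k * (1 / 2) ^ (k + 2)) = (2 powr (2 * p + 2) * 2 powr (-1 - real (k + 2) * (p - 1) - real (k + 1) - real (k + 2))) * G k powr p"
      by (simp only: mult.assoc)
    also have "2 powr (2 * p + 2) * 2 powr (-1 - real (k + 2) * (p - 1) - real (k + 1) - real (k + 2)) = (2::real) powr (- (real k * (p + 1)))"
      by (subst powr_add[symmetric]) (simp add: algebra_simps)
    also have "- (real k * (p + 1)) = - (real k * (1 + 1 / p)) * p"
      using p by (simp add: field_simps)
    also have "2 powr \<dots> * G k powr p = (G k * 2 powr (- (real k * (1 + 1 / p)))) powr p"
      using G0[of k] by (simp add: powr_mult powr_powr mult.commute)
    finally have e: "2 powr (2 * p + 2) * (L k * (1 / 2) ^ (k + 2)) = (G k * 2 powr (- (real k * (1 + 1 / p)))) powr p" .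
    have L0: "0 \<le> L k" by (simp add: L_def)
    have "ennreal (2 powr (2 * p + 2)) * (ennreal (L k) * ennreal ((1 / 2) ^ (k + 2))) = ennreal (2 powr (2 * p + 2) * (L k * (1 / 2) ^ (k + 2)))"
      using L0 by (simp only: ennreal_mult powr_ge_zero mult_nonneg_nonneg zero_le_power zero_le_divide_1_iff zero_le_numeral)
    then show ?thesis using e G0[of k] by simp
  qed
  have "(\<Sum>k. ennreal (L k) * emeasure lborel {dyad (Suc k)..<dyad (Suc (Suc k))}) \<le> ?S"
    unfolding S
  proof (rule nn_integral_ge_UN)
    show "(\<Union>k. {dyad (Suc k)..<dyad (Suc (Suc k))}) \<subseteq> {0<..<1}"
    proof safe
      fix k r assume "r \<in> {dyad (Suc k)..<dyad (Suc (Suc k))}"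
      then show "r \<in> {0<..<1}"
        using dyad_strict_mono[of 0 "Suc k"] dyad_less_1[of "Suc (Suc k)"] by (auto simp del: dyad_less_1)
    qed
    show "disjoint_family (\<lambda>k. {dyad (Suc k)..<dyad (Suc (Suc k))})"
      using disjoint_family_on_bisimulation[OF dyad_interval_disjoint] dyad_interval_disjoint
      unfolding disjoint_family_on_def by (metis UNIV_I nat.inject)
  qed (use low in auto)
  then have "ennreal (2 powr (2 * p + 2)) * (\<Sum>k. ennreal (L k) * ennreal ((1 / 2) ^ (k + 2))) \<le> ennreal (2 powr (2 * p + 2)) * ?S"
    by (intro mult_left_mono) (simp_all add: dyad_mono dyad_Suc_diff)
  then show ?thesis
    by (simp only: ennreal_suminf_cmult[symmetric] Lx G_def g_def)
qed

text \<open>The derivative is integrated along a radius in dyadic steps, each estimated by the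
  maximum at its outer radius.\<close>

lemma max_mean_le_sum_deriv:
  assumes f: "f holomorphic_on ball 0 1"
  shows "max_mean (dyad k) f \<le> norm (f 0) + (\<Sum>i<k. (1 / 2) ^ Suc i * max_mean (dyad (Suc i)) (deriv f))"
proof -
  have step: "norm (f (of_real (dyad i) * u)) \<le> norm (f 0) + (\<Sum>i<i. (1 / 2) ^ Suc i * max_mean (dyad (Suc i)) (deriv f))"
    if u: "norm u = 1" for u i
  proof (induction i)
    case 0
    then show ?case by simp
  next
    case (Suc i)
    have "norm (f (of_real (dyad (Suc i)) * u) - f (of_real (dyad i) * u))
      \<le> max_mean (dyad (Suc i)) (deriv f) * norm (of_real (dyad (Suc i)) * u - of_real (dyad i) * u)"
    proof (rule field_differentiable_bound[where S = "cball 0 (dyad (Suc i))"])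
      show "(f has_field_derivative deriv f z) (at z within cball 0 (dyad (Suc i)))"
        if "z \<in> cball 0 (dyad (Suc i))" for z
      proof -
        have "z \<in> ball 0 1" using that dyad_less_1[of "Suc i"] by (auto simp del: dyad_less_1)
        then have "(f has_field_derivative deriv f z) (at z)"
          using f by (intro holomorphic_derivI[where S = "ball 0 1"]) auto
        then show ?thesis by (rule has_field_derivative_at_within)
      qed
      show "norm (deriv f z) \<le> max_mean (dyad (Suc i)) (deriv f)" if "z \<in> cball 0 (dyad (Suc i))" for z
        using that by (intro norm_le_max_mean' holomorphic_on_deriv_disc f) auto
      show "of_real (dyad (Suc i)) * u \<in> cball 0 (dyad (Suc i))"
        using u by (simp add: norm_mult)
      show "of_real (dyad i) * u \<in> cball 0 (dyad (Suc i))"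
        using u dyad_mono[of i "Suc i"] by (simp add: norm_mult)
    qed auto
    also have "norm (of_real (dyad (Suc i)) * u - of_real (dyad i) * u) = (1 / 2) ^ Suc i"
    proof -
      have "of_real (dyad (Suc i)) * u - of_real (dyad i) * u = of_real ((1 / 2) ^ Suc i) * u"
        unfolding dyad_Suc_diff[symmetric] by (simp add: algebra_simps)
      then show ?thesis using u by (simp add: norm_mult del: of_real_power power_Suc)
    qed
    finally have "norm (f (of_real (dyad (Suc i)) * u) - f (of_real (dyad i) * u)) \<le> (1 / 2) ^ Suc i * max_mean (dyad (Suc i)) (deriv f)"
      by (simp add: mult.commute)
    moreover have "norm (f (of_real (dyad (Suc i)) * u)) \<le> norm (f (of_real (dyad i) * u)) + norm (f (of_real (dyad (Suc i)) * u) - f (of_real (dyad i) * u))"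
      by (rule norm_triangle_sub)
    ultimately show ?case using Suc by simp
  qed
  obtain w where w: "norm w = dyad k" "norm (f w) = max_mean (dyad k) f"
    using max_mean_attained[OF f, of "dyad k"] by auto
  define u where "u = (if w = 0 then 1 else w / of_real (norm w))"
  have "norm u = 1" by (simp add: u_def norm_divide)
  moreover have "w = of_real (dyad k) * u"
    unfolding w(1)[symmetric] u_def by simp
  ultimately show ?thesis using step[of u k] w by simp
qed

text \<open>Radial integration of the derivative is a one-sided geometric convolution: for
  \<open>i \<le> k\<close> the factor \<open>gam p ^ k * (1 / 2) ^ i\<close> is
  \<open>gam p ^ (k - i)\<close> times the weight of the derivative at scale \<open>i\<close>. The
  value at the origin contributes a geometric series.\<close>

lemma Dirichlet_embedding:
  assumes p: "1 < p"
  shows "\<exists>C>0. \<forall>f. f holomorphic_on ball 0 1 \<longrightarrow> dyad_norm p f \<le> ennreal C * epowr (Dirichlet_norm p f) p"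
proof (intro exI conjI allI impI)
  define A where "A = (1 * 2 / (1 - gam p)) powr p * 2 powr (2 * p + 2)"
  let ?C = "2 powr p * max 2 A"
  show "0 < ?C" by simp
  fix f assume f: "f holomorphic_on ball 0 1"
  define S where "S = (\<integral>\<^sup>+z\<in>ball 0 1. ennreal (1 / pi * (norm (deriv f z) powr p * (1 - norm z) powr (p - 1))) \<partial>lborel)"
  have D: "epowr (Dirichlet_norm p f) p = ennreal (norm (f 0) powr p) + S"
    using p by (simp add: Dirichlet_norm_def S_def epowr_root)
  define M where "M k = max_mean (dyad k) f" for k
  define G where "G k = max_mean (dyad k) (deriv f)" for k
  have G0: "0 \<le> G k" for k unfolding G_def using f by (intro max_mean_nonneg holomorphic_on_deriv_disc) auto
  define x where "x k = ennreal (G k * 2 powr (- (real k * (1 + 1 / p))))" for k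
  define z where "z k = ennreal (\<Sum>i<k. gam p ^ ndist k (Suc i) * (G (Suc i) * 2 powr (- (real (Suc i) * (1 + 1 / p)))))" for k
  have Mz: "ennreal (M k * gam p ^ k) \<le> ennreal (norm (f 0) * gam p ^ k) + z k" for k
  proof -
    have "M k * gam p ^ k \<le> (norm (f 0) + (\<Sum>i<k. (1 / 2) ^ Suc i * G (Suc i))) * gam p ^ k"
      unfolding M_def G_def using gam_pos[of p] by (intro mult_right_mono max_mean_le_sum_deriv f) auto
    also have "\<dots> = norm (f 0) * gam p ^ k + (\<Sum>i<k. gam p ^ ndist k (Suc i) * (G (Suc i) * 2 powr (- (real (Suc i) * (1 + 1 / p)))))"
    proof -
      have "gam p ^ k * (1 / 2) ^ Suc i = gam p ^ ndist k (Suc i) * 2 powr (- (real (Suc i) * (1 + 1 / p)))" if "i < k" for i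
      proof -
        have n: "ndist k (Suc i) = k - Suc i" using that by (simp add: ndist_def)
        have "- (real k / p) - real (Suc i) = - (real (k - Suc i) / p) + - (real (Suc i) * (1 + 1 / p))"
          using that p by (simp add: field_simps of_nat_diff)
        then show ?thesis
          unfolding n gam_power half_power by (simp only: powr_add[symmetric] diff_conv_add_uminus)
      qed
      note e = this
      have "(1 / 2) ^ Suc i * G (Suc i) * gam p ^ k = gam p ^ ndist k (Suc i) * (G (Suc i) * 2 powr (- (real (Suc i) * (1 + 1 / p))))" if "i < k" for i
      proof -
        have "(1 / 2) ^ Suc i * G (Suc i) * gam p ^ k = (gam p ^ k * (1 / 2) ^ Suc i) * G (Suc i)"
          by (simp only: mult_ac)
        also have "\<dots> = (gam p ^ ndist k (Suc i) * 2 powr (- (real (Suc i) * (1 + 1 / p)))) * G (Suc i)"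
          by (simp only: e[OF that])
        finally show ?thesis by (simp only: mult_ac)
      qed
      then have "(\<Sum>i<k. (1 / 2) ^ Suc i * G (Suc i) * gam p ^ k) = (\<Sum>i<k. gam p ^ ndist k (Suc i) * (G (Suc i) * 2 powr (- (real (Suc i) * (1 + 1 / p)))))"
        by (intro sum.cong refl) simp
      then show ?thesis
        unfolding distrib_right sum_distrib_right by (simp only:)
    qed
    finally show ?thesis
      unfolding z_def using G0 gam_pos[of p]
      by (subst ennreal_plus[symmetric]) (auto intro!: sum_nonneg mult_nonneg_nonneg ennreal_leI)
  qed
  have zx: "z k \<le> ennreal 1 * (\<Sum>j. ennreal (gam p ^ ndist k j) * x j)" for k
  proof -
    have "z k = (\<Sum>i<k. ennreal (gam p ^ ndist k (Suc i)) * x (Suc i))"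
      unfolding z_def x_def using G0 gam_pos[of p]
      by (intro ennreal_sum_mult) auto
    also have "\<dots> = (\<Sum>j\<in>Suc ` {..<k}. ennreal (gam p ^ ndist k j) * x j)"
      by (subst sum.reindex) auto
    also have "\<dots> \<le> (\<Sum>j. ennreal (gam p ^ ndist k j) * x j)"
      by (rule sum_le_suminf) auto
    finally show ?thesis by simp
  qed
  have "dyad_norm p f = (\<Sum>k. epowr (ennreal (M k * gam p ^ k)) p)"
    using p unfolding M_def by (intro dyad_norm_eq f) auto
  also have "\<dots> \<le> (\<Sum>k. ennreal (2 powr p) * (epowr (ennreal (norm (f 0) * gam p ^ k)) p + epowr (z k) p))"
  proof (intro suminf_le)
    fix k
    have "epowr (ennreal (M k * gam p ^ k)) p \<le> epowr (ennreal (norm (f 0) * gam p ^ k) + z k) p"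
      using p by (intro epowr_mono Mz) auto
    also have "\<dots> \<le> ennreal (2 powr p) * (epowr (ennreal (norm (f 0) * gam p ^ k)) p + epowr (z k) p)"
      using p by (intro epowr_add_le) auto
    finally show "epowr (ennreal (M k * gam p ^ k)) p \<le> ennreal (2 powr p) * (epowr (ennreal (norm (f 0) * gam p ^ k)) p + epowr (z k) p)" .
  qed auto
  also have "\<dots> = ennreal (2 powr p) * ((\<Sum>k. epowr (ennreal (norm (f 0) * gam p ^ k)) p) + (\<Sum>k. epowr (z k) p))"
    by (simp add: ennreal_suminf_cmult suminf_add[symmetric])
  also have "(\<Sum>k. epowr (ennreal (norm (f 0) * gam p ^ k)) p) = (\<Sum>k. ennreal (norm (f 0) powr p * (1 / 2) ^ k))"
    using p gam_pos[of p] by (intro suminf_cong) (simp add: powr_mult gam_power_powr)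
  also have "\<dots> = ennreal (2 * norm (f 0) powr p)"
    by (rule suminf_half_power_mult) simp
  also have "(\<Sum>k. epowr (z k) p) \<le> ennreal ((1 * 2 / (1 - gam p)) powr p) * (\<Sum>k. epowr (x k) p)"
    using p gam_pos gam_less_1 zx by (intro geometric_convolution) auto
  also have "(\<Sum>k. epowr (x k) p) \<le> ennreal (2 powr (2 * p + 2)) * S"
    unfolding x_def G_def S_def by (rule max_mean_deriv_dyadic_sum[OF f p])
  finally have "dyad_norm p f \<le> ennreal (2 powr p) * (ennreal (2 * norm (f 0) powr p) + ennreal ((1 * 2 / (1 - gam p)) powr p) * (ennreal (2 powr (2 * p + 2)) * S))"
    by (simp add: mult_left_mono add_left_mono)
  also have "\<dots> = ennreal (2 powr p) * (ennreal 2 * ennreal (norm (f 0) powr p) + ennreal A * S)"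
    unfolding A_def by (simp only: ennreal_mult powr_ge_zero mult.assoc zero_le_numeral)
  also have "\<dots> \<le> ennreal (2 powr p) * (ennreal (max 2 A) * ennreal (norm (f 0) powr p) + ennreal (max 2 A) * S)"
    by (intro mult_left_mono add_mono mult_right_mono ennreal_leI) auto
  also have "\<dots> = ennreal ?C * epowr (Dirichlet_norm p f) p"
    unfolding D distrib_left[symmetric] by (subst ennreal_mult) (auto simp: mult.assoc)
  finally show "dyad_norm p f \<le> ennreal ?C * epowr (Dirichlet_norm p f) p" .
qed

subsection \<open>The coefficient norm\<close>

text \<open>The indices with \<open>n + 1\<close> between consecutive powers of 2. Shifting by one
  matches the weights in \<open>n + 1\<close> and puts the index \<open>0\<close> into a block of
  its own.\<close>

definition dblock :: "nat \<Rightarrow> nat set" where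
  "dblock i = {2 ^ i - 1..<2 ^ Suc i - 1}"

lemma finite_dblock [simp]: "finite (dblock i)"
  by (simp add: dblock_def)

lemma mem_dblock: "n \<in> dblock i \<longleftrightarrow> 2 ^ i \<le> n + 1 \<and> n + 1 < 2 ^ Suc i"
proof -
  have "(1::nat) \<le> 2 ^ i" by simp
  then show ?thesis unfolding dblock_def by auto
qed

lemma card_dblock: "card (dblock i) = 2 ^ i"
  by (simp add: dblock_def)

lemma dblock_cover: "\<exists>i. n \<in> dblock i"
  using ex_power_ivl1[of 2 "n + 1"] by (auto simp: mem_dblock)

lemma dblock_disjoint: "disjoint_family dblock"
proof (unfold disjoint_family_on_def, intro ballI impI)
  fix m n :: nat assume "m \<noteq> n"
  have *: "dblock a \<inter> dblock b = {}" if "a < b" for a b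
  proof -
    have "(2::nat) ^ Suc a \<le> 2 ^ b" using that by (intro power_increasing) auto
    then show ?thesis by (auto simp: mem_dblock)
  qed
  show "dblock m \<inter> dblock n = {}"
    using \<open>m \<noteq> n\<close> *[of m n] *[of n m] by (cases "m < n") auto
qed

lemma suminf_dblock:
  fixes f :: "nat \<Rightarrow> ennreal"
  shows "(\<Sum>n. f n) = (\<Sum>i. \<Sum>n\<in>dblock i. f n)"
proof -
  have U: "(\<Union>i. dblock i) = UNIV" using dblock_cover by auto
  have "(\<Sum>n. f n) = (\<integral>\<^sup>+n\<in>(\<Union>i. dblock i). f n \<partial>count_space UNIV)"
    unfolding U by (simp add: nn_integral_count_space_nat)
  also have "\<dots> = (\<Sum>i. \<integral>\<^sup>+n\<in>dblock i. f n \<partial>count_space UNIV)"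
    by (rule nn_integral_UN_disjoint) (auto simp: dblock_disjoint)
  also have "\<dots> = (\<Sum>i. \<Sum>n\<in>dblock i. f n)"
    by (intro suminf_cong) (simp add: nn_integral_indicator_finite one_ennreal_def[symmetric] max_def)
  finally show ?thesis .
qed

lemma real_mem_dblock:
  assumes "n \<in> dblock i"
  shows "2 ^ i \<le> real n + 1" "real n + 1 < 2 ^ Suc i"
proof -
  have "2 ^ i \<le> n + 1" "n + 1 < 2 ^ Suc i" using assms by (auto simp: mem_dblock)
  then have "real (2 ^ i) \<le> real (n + 1)" "real (n + 1) < real (2 ^ Suc i)"
    by (simp_all only: of_nat_le_iff of_nat_less_iff)
  then show "2 ^ i \<le> real n + 1" "real n + 1 < 2 ^ Suc i" by simp_all
qed

text \<open>Hoelder's inequality on a finite set, as Jensen for the counting measure.\<close>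

lemma sum_powr_le:
  fixes a :: "'i \<Rightarrow> real"
  assumes "finite B" "1 < p" "\<And>n. n \<in> B \<Longrightarrow> 0 \<le> a n"
  shows "(\<Sum>n\<in>B. a n) powr p \<le> real (card B) powr (p - 1) * (\<Sum>n\<in>B. a n powr p)"
proof -
  have "epowr (\<integral>\<^sup>+n. 1 * ennreal (a n) \<partial>count_space B) p
    \<le> epowr (\<integral>\<^sup>+n. 1 \<partial>count_space B) (p - 1) * (\<integral>\<^sup>+n. 1 * epowr (ennreal (a n)) p \<partial>count_space B)"
    using assms by (intro nn_jensen) (auto simp: nn_integral_count_space_finite of_nat_less_top)
  moreover have "(\<integral>\<^sup>+n. 1 * ennreal (a n) \<partial>count_space B) = ennreal (\<Sum>n\<in>B. a n)"
    using assms by (simp add: nn_integral_count_space_finite sum_ennreal)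
  moreover have "(\<integral>\<^sup>+n. 1 \<partial>count_space B) = ennreal (real (card B))"
    using assms by (simp add: nn_integral_count_space_finite ennreal_of_nat_eq_real_of_nat)
  moreover have "(\<integral>\<^sup>+n. 1 * epowr (ennreal (a n)) p \<partial>count_space B) = ennreal (\<Sum>n\<in>B. a n powr p)"
    using assms by (simp add: nn_integral_count_space_finite flip: sum_ennreal)
  ultimately show ?thesis
    using assms by (simp add: sum_nonneg flip: ennreal_mult)
qed

lemma powr_exponent_le:
  fixes a x b s :: real
  assumes "0 < a" "a \<le> x" "x \<le> b"
  shows "x powr s \<le> max (a powr s) (b powr s)"
proof (cases "0 \<le> s")
  case True
  then show ?thesis using powr_mono2[of s x b] assms by auto
next
  case False
  then show ?thesis using powr_mono2'[of s a x] assms by auto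
qed

lemma powr_ge_min:
  fixes a x b s :: real
  assumes "0 < a" "a \<le> x" "x \<le> b"
  shows "min (a powr s) (b powr s) \<le> x powr s"
proof (cases "0 \<le> s")
  case True
  then show ?thesis using powr_mono2[of s a x] assms by auto
next
  case False
  then show ?thesis using powr_mono2'[of s x b] assms by auto
qed

lemma dblock_powr_le:
  assumes "n \<in> dblock i"
  shows "(real n + 1) powr s \<le> 2 powr \<bar>s\<bar> * 2 powr (real i * s)"
proof -
  have "(real n + 1) powr s \<le> max ((2 ^ i) powr s) ((2 ^ Suc i) powr s)"
    using real_mem_dblock[OF assms] by (intro powr_exponent_le) auto
  also have "(2 ^ i) powr s = 1 * 2 powr (real i * s)"
    by (simp add: powr_powr flip: powr_realpow)
  also have "((2::real) ^ Suc i) powr s = 2 powr s * 2 powr (real i * s)"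
    by (simp add: powr_powr powr_add[symmetric] algebra_simps flip: powr_realpow del: power_Suc)
  also have "max (1 * 2 powr (real i * s)) (2 powr s * 2 powr (real i * s)) \<le> 2 powr \<bar>s\<bar> * 2 powr (real i * s)"
    by (intro max.boundedI mult_right_mono) (auto simp: ge_one_powr_ge_zero powr_mono)
  finally show ?thesis .
qed

lemma dblock_powr_ge:
  assumes "n \<in> dblock i"
  shows "2 powr (- \<bar>s\<bar>) * 2 powr (real i * s) \<le> (real n + 1) powr s"
proof -
  have "2 powr (- \<bar>s\<bar>) * 2 powr (real i * s) \<le> min (1 * 2 powr (real i * s)) (2 powr s * 2 powr (real i * s))"
    using powr_mono[of "- \<bar>s\<bar>" 0 2] by (intro min.boundedI mult_right_mono) (auto simp: powr_mono)
  also have "1 * 2 powr (real i * s) = (2 ^ i) powr s"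
    by (simp add: powr_powr flip: powr_realpow)
  also have "2 powr s * 2 powr (real i * s) = ((2::real) ^ Suc i) powr s"
    by (simp add: powr_powr powr_add[symmetric] algebra_simps flip: powr_realpow del: power_Suc)
  also have "min ((2 ^ i) powr s) ((2 ^ Suc i) powr s) \<le> (real n + 1) powr s"
    using real_mem_dblock[OF assms] by (intro powr_ge_min) auto
  finally show ?thesis .
qed

lemma ennreal_norm_suminf_le:
  fixes f :: "nat \<Rightarrow> 'a::banach"
  assumes "f sums s"
  shows "ennreal (norm s) \<le> (\<Sum>n. ennreal (norm (f n)))"
proof (rule tendsto_upperbound)
  show "(\<lambda>n. ennreal (norm (\<Sum>i<n. f i))) \<longlonglongrightarrow> ennreal (norm s)"
    using assms unfolding sums_def by (intro tendsto_ennrealI tendsto_norm)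
  show "\<forall>\<^sub>F n in sequentially. ennreal (norm (\<Sum>i<n. f i)) \<le> (\<Sum>n. ennreal (norm (f n)))"
  proof (intro always_eventually allI)
    fix n
    have "ennreal (norm (\<Sum>i<n. f i)) \<le> ennreal (\<Sum>i<n. norm (f i))"
      by (intro ennreal_leI norm_sum)
    also have "\<dots> = (\<Sum>i<n. ennreal (norm (f i)))" by (simp add: sum_ennreal)
    also have "\<dots> \<le> (\<Sum>n. ennreal (norm (f n)))" by (intro sum_le_suminf) auto
    finally show "ennreal (norm (\<Sum>i<n. f i)) \<le> (\<Sum>n. ennreal (norm (f n)))" .
  qed
qed auto

lemma taylor_sums:
  assumes "f holomorphic_on ball 0 1" "norm z < 1"
  shows "(\<lambda>n. taylor_coeff f n * z ^ n) sums f z"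
  using holomorphic_power_series[of f 0 1 z] assms by (simp add: taylor_coeff_def)

lemma exp_minus_le: "0 < x \<Longrightarrow> exp (- x) \<le> 2 / x\<^sup>2" for x :: real
proof -
  assume x: "0 < x"
  have "x\<^sup>2 / 2 \<le> exp x" using exp_lower_Taylor_quadratic[of x] x by simp
  then have "inverse (exp x) \<le> inverse (x\<^sup>2 / 2)"
    using x by (intro le_imp_inverse_le) auto
  then show ?thesis by (simp add: exp_minus)
qed

text \<open>Up to block \<open>k\<close> the power of the radius is estimated by 1 and the decay
  comes from \<open>gam p\<close>. Beyond it, with \<open>d = i - k\<close>, the power is of order
  \<open>exp (- (2 ^ d))\<close>; already the bound \<open>2 powr (- (2 * d))\<close> outweighs the
  growth \<open>2 powr (d / p)\<close> and leaves \<open>gam p ^ d\<close>, since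
  \<open>p > 1\<close>.\<close>

lemma dyad_power_le_kernel:
  assumes n: "n \<in> dblock i" and p: "1 < p"
  shows "dyad k ^ n * gam p ^ k * 2 powr (real i / p) \<le> 2 * exp 1 * gam p ^ ndist k i"
proof (cases "i \<le> k")
  case True
  have "dyad k ^ n * gam p ^ k * 2 powr (real i / p) \<le> 1 * gam p ^ k * 2 powr (real i / p)"
    using gam_pos[of p] by (intro mult_right_mono power_le_one) (auto intro: less_imp_le)
  also have "\<dots> = gam p ^ ndist k i"
  proof -
    have "ndist k i = k - i" using True by (simp add: ndist_def)
    moreover have "- (real k / p) + real i / p = - (real (k - i) / p)"
      using True p by (simp add: of_nat_diff field_simps)
    ultimately show ?thesis
      by (simp add: gam_power powr_add[symmetric])
  qed
  also have "1 * gam p ^ ndist k i \<le> 2 * exp 1 * gam p ^ ndist k i"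
    using gam_pos[of p] exp_ge_add_one_self[of "1::real"] by (intro mult_right_mono) auto
  finally show ?thesis by simp
next
  case False
  define d where "d = i - k"
  have d: "i = k + d" using False by (simp add: d_def)
  have "2 ^ i \<le> real n + 1" using real_mem_dblock[OF n] by simp
  then have "2 ^ i * (1/2) ^ k \<le> (real n + 1) * (1/2) ^ k" by (intro mult_right_mono) auto
  also have "2 ^ i * (1/2::real) ^ k = 2 ^ d" by (simp add: d power_add power_one_over)
  \<comment> \<open>Passing from \<open>n + 1\<close> to \<open>n\<close> costs at most 1 in the
    exponent, hence the factor \<open>exp 1\<close>.\<close>
  finally have e: "- (real n * (1/2) ^ k) \<le> 1 - 2 ^ d"
    using power_le_one[of "1/2::real" k] by (simp add: distrib_right)
  have "dyad k ^ n \<le> exp (- ((1/2) ^ k)) ^ n"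
    using exp_ge_add_one_self[of "- ((1/2::real) ^ k)"] by (intro power_mono) (auto simp: dyad_def power_le_one)
  also have "\<dots> = exp (- (real n * (1/2) ^ k))" by (simp flip: exp_of_nat_mult)
  also have "\<dots> \<le> exp (1 - 2 ^ d)" using e by simp
  also have "\<dots> = exp 1 * exp (- (2 ^ d))" by (simp add: exp_add[symmetric])
  also have "\<dots> \<le> exp 1 * (2 / (2 ^ d)\<^sup>2)" by (intro mult_left_mono exp_minus_le) auto
  finally have D: "dyad k ^ n \<le> 2 * exp 1 * 2 powr (- (2 * real d))"
    by (simp add: powr_minus powr_realpow field_simps flip: powr_powr power_mult of_nat_mult)
       (simp add: powr_realpow[symmetric] powr_add[symmetric] mult.commute power2_eq_square)?
  have "dyad k ^ n * gam p ^ k * 2 powr (real i / p) = dyad k ^ n * 2 powr (real d / p)"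
    using p by (simp add: gam_power d powr_add[symmetric] mult.assoc add_divide_distrib)
  also have "\<dots> \<le> (2 * exp 1 * 2 powr (- (2 * real d))) * 2 powr (real d / p)"
    by (intro mult_right_mono D) auto
  also have "\<dots> = 2 * exp 1 * 2 powr (- (2 * real d) + real d / p)"
    by (simp only: powr_add mult.assoc)
  also have "\<dots> \<le> 2 * exp 1 * 2 powr (- (real d / p))"
  proof (intro mult_left_mono powr_mono)
    have "2 * (real d / p) \<le> 2 * real d" using p by (simp add: divide_le_eq mult_le_cancel_left1)
    then show "- (2 * real d) + real d / p \<le> - (real d / p)" by linarith
  qed auto
  also have "2 powr (- (real d / p)) = gam p ^ ndist k i"
    by (simp add: gam_power ndist_def d)
  finally show ?thesis .
qed

text \<open>Hoelder bounds the sum of the coefficients in block \<open>i\<close> by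
  \<open>2 powr (i / p)\<close> times the share \<open>x i\<close> of the block in the norm. The
  powers of the radius then make the matrix between scales and blocks decay geometrically.\<close>

lemma HL_embedding:
  assumes p: "1 < p"
  shows "\<exists>C>0. \<forall>f. f holomorphic_on ball 0 1 \<longrightarrow> dyad_norm p f \<le> ennreal C * epowr (HL_norm p f) p"
proof (intro exI conjI allI impI)
  define c where "c = 2 powr (\<bar>2 - p\<bar> / p)"
  define D where "D = 2 * exp 1 * c"
  let ?C = "(D * 2 / (1 - gam p)) powr p"
  have c0: "0 < c" by (simp add: c_def)
  have D0: "0 < D" using c0 by (simp add: D_def)
  show "0 < ?C" using D0 gam_less_1[of p] p by simp
  fix f assume f: "f holomorphic_on ball 0 1"
  define a where "a n = norm (taylor_coeff f n)" for n
  have a0: "0 \<le> a n" for n by (simp add: a_def)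
  define s where "s i = (\<Sum>n\<in>dblock i. a n powr p * (real n + 1) powr (p - 2))" for i
  define x where "x i = s i powr (1 / p)" for i
  have s0: "0 \<le> s i" for i by (simp add: s_def sum_nonneg)
  have block: "(\<Sum>n\<in>dblock i. a n) \<le> c * 2 powr (real i / p) * x i" for i
  proof -
    have "(\<Sum>n\<in>dblock i. a n) powr p \<le> real (card (dblock i)) powr (p - 1) * (\<Sum>n\<in>dblock i. a n powr p)"
      using p a0 by (intro sum_powr_le) auto
    also have "\<dots> \<le> real (card (dblock i)) powr (p - 1) * (\<Sum>n\<in>dblock i. (a n powr p * (real n + 1) powr (p - 2)) * (2 powr \<bar>2 - p\<bar> * 2 powr (real i * (2 - p))))"
    proof (intro mult_left_mono sum_mono)
      fix n assume n: "n \<in> dblock i"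
      have "a n powr p = (a n powr p * (real n + 1) powr (p - 2)) * (real n + 1) powr (2 - p)"
        by (simp add: mult.assoc powr_add[symmetric])
      also have "\<dots> \<le> (a n powr p * (real n + 1) powr (p - 2)) * (2 powr \<bar>2 - p\<bar> * 2 powr (real i * (2 - p)))"
        by (intro mult_left_mono dblock_powr_le n) auto
      finally show "a n powr p \<le> (a n powr p * (real n + 1) powr (p - 2)) * (2 powr \<bar>2 - p\<bar> * 2 powr (real i * (2 - p)))" .
    qed auto
    also have "\<dots> = (2 powr (real i * (p - 1)) * (2 powr \<bar>2 - p\<bar> * 2 powr (real i * (2 - p)))) * s i"
      by (simp add: s_def card_dblock powr_powr sum_distrib_right[symmetric] flip: powr_realpow)
    also have "2 powr (real i * (p - 1)) * (2 powr \<bar>2 - p\<bar> * 2 powr (real i * (2 - p))) = 2 powr \<bar>2 - p\<bar> * 2 powr (real i)"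
      by (simp add: powr_add[symmetric] algebra_simps)
    finally have "((\<Sum>n\<in>dblock i. a n) powr p) powr (1 / p) \<le> (2 powr \<bar>2 - p\<bar> * 2 powr (real i) * s i) powr (1 / p)"
      using p by (intro powr_mono2) auto
    then show ?thesis
      using p a0 s0[of i] by (simp add: powr_powr powr_mult sum_nonneg c_def x_def)
  qed
  have My: "ennreal (max_mean (dyad k) f * gam p ^ k) \<le> ennreal D * (\<Sum>i. ennreal (gam p ^ ndist k i) * ennreal (x i))" for k
  proof -
    obtain w where w: "norm w = dyad k" "norm (f w) = max_mean (dyad k) f"
      using max_mean_attained[OF f, of "dyad k"] by auto
    have "ennreal (max_mean (dyad k) f) \<le> (\<Sum>n. ennreal (a n * dyad k ^ n))"
    proof -
      have "norm w < 1" by (simp add: w)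
      then have "ennreal (norm (f w)) \<le> (\<Sum>n. ennreal (norm (taylor_coeff f n * w ^ n)))"
        by (intro ennreal_norm_suminf_le taylor_sums f)
      then show ?thesis by (simp only: norm_mult norm_power w a_def)
    qed
    then have "ennreal (max_mean (dyad k) f) * ennreal (gam p ^ k) \<le> (\<Sum>n. ennreal (a n * dyad k ^ n)) * ennreal (gam p ^ k)"
      by (rule mult_right_mono) simp
    also have "\<dots> = (\<Sum>n. ennreal (a n * dyad k ^ n * gam p ^ k))"
      unfolding ennreal_suminf_multc[symmetric]
      using a0 gam_pos[of p] by (intro suminf_cong ennreal_mult[symmetric]) auto
    also have "\<dots> = (\<Sum>i. \<Sum>n\<in>dblock i. ennreal (a n * dyad k ^ n * gam p ^ k))"
      by (rule suminf_dblock)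
    also have "\<dots> \<le> (\<Sum>i. ennreal D * (ennreal (gam p ^ ndist k i) * ennreal (x i)))"
    proof (intro suminf_le)
      fix i
      define K where "K = 2 * exp 1 * gam p ^ ndist k i * 2 powr (- (real i / p))"
      have K0: "0 \<le> K" using gam_pos[of p] by (simp add: K_def)
      have "(\<Sum>n\<in>dblock i. a n * dyad k ^ n * gam p ^ k) \<le> (\<Sum>n\<in>dblock i. K * a n)"
      proof (rule sum_mono)
        fix n assume n: "n \<in> dblock i"
        have "dyad k ^ n * gam p ^ k = dyad k ^ n * gam p ^ k * 2 powr (real i / p) * 2 powr (- (real i / p))"
          by (simp add: mult.assoc powr_add[symmetric])
        also have "\<dots> \<le> K"
          unfolding K_def by (intro mult_right_mono dyad_power_le_kernel n p) auto
        finally have "a n * (dyad k ^ n * gam p ^ k) \<le> a n * K" using a0 by (intro mult_left_mono) auto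
        then show "a n * dyad k ^ n * gam p ^ k \<le> K * a n" by (simp add: mult_ac)
      qed
      also have "\<dots> = K * (\<Sum>n\<in>dblock i. a n)" by (simp add: sum_distrib_left)
      also have "\<dots> \<le> K * (c * 2 powr (real i / p) * x i)" by (intro mult_left_mono block K0)
      also have "\<dots> = (2 powr (- (real i / p)) * 2 powr (real i / p)) * (D * (gam p ^ ndist k i * x i))"
        by (simp only: K_def D_def mult_ac)
      also have "\<dots> = D * (gam p ^ ndist k i * x i)"
        by (simp add: powr_add[symmetric])
      finally have "ennreal (\<Sum>n\<in>dblock i. a n * dyad k ^ n * gam p ^ k) \<le> ennreal (D * (gam p ^ ndist k i * x i))"
        by (rule ennreal_leI)
      moreover have "(\<Sum>n\<in>dblock i. ennreal (a n * dyad k ^ n * gam p ^ k)) = ennreal (\<Sum>n\<in>dblock i. a n * dyad k ^ n * gam p ^ k)"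
        using a0 gam_pos[of p] by (intro sum_ennreal) auto
      moreover have "ennreal (D * (gam p ^ ndist k i * x i)) = ennreal D * (ennreal (gam p ^ ndist k i) * ennreal (x i))"
        using D0 gam_pos[of p] by (simp add: ennreal_mult x_def)
      ultimately show "(\<Sum>n\<in>dblock i. ennreal (a n * dyad k ^ n * gam p ^ k)) \<le> ennreal D * (ennreal (gam p ^ ndist k i) * ennreal (x i))"
        by simp
    qed auto
    finally show ?thesis
      using gam_pos[of p] f by (simp add: ennreal_suminf_cmult ennreal_mult max_mean_nonneg)
  qed
  have "dyad_norm p f = (\<Sum>k. epowr (ennreal (max_mean (dyad k) f * gam p ^ k)) p)"
    using p by (intro dyad_norm_eq f) auto
  also have "\<dots> \<le> ennreal ?C * (\<Sum>i. epowr (ennreal (x i)) p)"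
    using p D0 by (intro geometric_convolution gam_pos gam_less_1 My) auto
  also have "(\<Sum>i. epowr (ennreal (x i)) p) = (\<Sum>i. \<Sum>n\<in>dblock i. ennreal (a n powr p * (real n + 1) powr (p - 2)))"
  proof (intro suminf_cong)
    fix i
    have "epowr (ennreal (x i)) p = ennreal (s i)"
      using p s0[of i] by (simp add: x_def powr_powr)
    also have "\<dots> = (\<Sum>n\<in>dblock i. ennreal (a n powr p * (real n + 1) powr (p - 2)))"
      unfolding s_def by (intro sum_ennreal[symmetric]) auto
    finally show "epowr (ennreal (x i)) p = (\<Sum>n\<in>dblock i. ennreal (a n powr p * (real n + 1) powr (p - 2)))" .
  qed
  also have "\<dots> = (\<Sum>n. ennreal (a n powr p * (real n + 1) powr (p - 2)))"
    by (rule suminf_dblock[symmetric])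
  also have "\<dots> = epowr (HL_norm p f) p"
    using p by (simp add: HL_norm_def a_def epowr_root)
  finally show "dyad_norm p f \<le> ennreal ?C * epowr (HL_norm p f) p" .
qed

subsection \<open>Upper bounds for the norms\<close>

text \<open>The majorant \<open>\<Phi> j\<close> belongs to the disc of radius
  \<open>dyad (Suc j)\<close>. The factor \<open>1 - z\<close> admits growth near the point 1, where
  images of the operators concentrate. The derivative condition serves the Hardy and Dirichlet
  norms, the coefficient condition the other two.\<close>

definition dominated :: "(complex \<Rightarrow> complex) \<Rightarrow> (nat \<Rightarrow> real) \<Rightarrow> bool" where
  "dominated g \<Phi> \<longleftrightarrow> g holomorphic_on ball 0 1 \<and> (\<forall>j. 0 \<le> \<Phi> j) \<and>
     (\<forall>j z. norm z \<le> dyad (Suc j) \<longrightarrow> norm (deriv g z) * norm (1 - z) \<le> \<Phi> j) \<and>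
     (\<forall>j n. real n * norm (taylor_coeff g n) * dyad (Suc j) ^ n \<le> \<Phi> j)"

definition dom_sum :: "real \<Rightarrow> (complex \<Rightarrow> complex) \<Rightarrow> (nat \<Rightarrow> real) \<Rightarrow> ennreal" where
  "dom_sum p g \<Phi> = ennreal (norm (g 0) powr p) + (\<Sum>j. ennreal (\<Phi> j powr p * (1 / 2) ^ j))"

text \<open>Bernoulli's inequality bounds the power with exponent \<open>2 ^ i\<close> from below by
  \<open>1 / 2\<close>; squaring reaches the exponent \<open>2 ^ Suc i\<close>.\<close>

lemma dyad_power_ge:
  assumes "n \<le> 2 ^ Suc i"
  shows "1 / 4 \<le> dyad (Suc i) ^ n"
proof -
  have "1 + real (2 ^ i) * (- ((1 / 2) ^ Suc i)) \<le> (1 + (- ((1 / 2) ^ Suc i))) ^ (2 ^ i)"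
    using power_le_one[of "1 / 2 :: real" i] by (intro Bernoulli_inequality) simp
  moreover have "real (2 ^ i) * ((1 / 2) ^ Suc i) = 1 / 2" by (simp add: power_one_over)
  ultimately have h: "1 / 2 \<le> dyad (Suc i) ^ (2 ^ i)"
    by (simp add: dyad_def)
  have "(1 / 2 :: real) * (1 / 2) \<le> dyad (Suc i) ^ (2 ^ i) * dyad (Suc i) ^ (2 ^ i)"
    by (intro mult_mono h) auto
  also have "\<dots> = dyad (Suc i) ^ (2 ^ Suc i)"
    by (simp add: power_add[symmetric] mult_2)
  also have "\<dots> \<le> dyad (Suc i) ^ n"
    using assms by (intro power_decreasing) (auto intro: less_imp_le)
  finally show ?thesis by simp
qed

text \<open>On block \<open>j\<close> the power of the radius loses at most a factor 4, and
  \<open>n + 1 \<le> 2 * n\<close>; this gives the 8. The remaining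
  \<open>(n + 1) powr (- 2)\<close> sums over the block to at most \<open>(1 / 2) ^ j\<close>. Block
  0 holds only the index \<open>0\<close>, which the coefficient condition does not see and
  \<open>g 0\<close> covers.\<close>

lemma HL_norm_le_dominated:
  assumes p: "1 < p" and dom: "dominated g \<Phi>"
  shows "epowr (HL_norm p g) p \<le> ennreal (8 powr p) * dom_sum p g \<Phi>"
proof -
  define a where "a n = norm (taylor_coeff g n)" for n
  have a0: "0 \<le> a n" for n by (simp add: a_def)
  have \<Phi>0: "0 \<le> \<Phi> j" for j using dom by (simp add: dominated_def)
  define s where "s i = (\<Sum>n\<in>dblock i. ennreal (a n powr p * (real n + 1) powr (p - 2)))" for i
  have s_le: "s (Suc i) \<le> ennreal (8 powr p) * ennreal (\<Phi> (Suc i) powr p * (1 / 2) ^ Suc i)" for i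
  proof -
    let ?j = "Suc i"
    have "s ?j \<le> (\<Sum>n\<in>dblock ?j. ennreal ((8 * \<Phi> ?j) powr p * ((1 / 2) ^ ?j * (1 / 2) ^ ?j)))"
      unfolding s_def
    proof (intro sum_mono ennreal_leI)
      fix n assume n: "n \<in> dblock ?j"
      have n1: "2 ^ ?j \<le> real n + 1" "real n + 1 < 2 ^ Suc ?j" using real_mem_dblock[OF n] by auto
      have "(2::real) \<le> 2 ^ ?j" by simp
      then have n2: "1 \<le> real n" using n1 by linarith
      have "n \<le> 2 ^ Suc ?j" using n by (auto simp: mem_dblock)
      then have q: "1 / 4 \<le> dyad (Suc ?j) ^ n" by (rule dyad_power_ge)
      have "real n * a n * (1 / 4) \<le> real n * a n * dyad (Suc ?j) ^ n"
        using a0 q by (intro mult_left_mono) auto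
      also have "\<dots> \<le> \<Phi> ?j" using dom by (simp add: dominated_def a_def)
      finally have "2 * (real n * a n) \<le> 8 * \<Phi> ?j" by simp
      moreover have "(real n + 1) * a n \<le> (2 * real n) * a n"
        using n2 a0 by (intro mult_right_mono) auto
      ultimately have k: "(real n + 1) * a n \<le> 8 * \<Phi> ?j" by simp
      have "a n powr p * (real n + 1) powr (p - 2) = ((real n + 1) * a n) powr p * (inverse (real n + 1) * inverse (real n + 1))"
      proof -
        have "(real n + 1) powr (p - 2) = (real n + 1) powr p * (real n + 1) powr (- 2)"
          by (simp add: powr_add[symmetric])
        also have "(real n + 1) powr (- 2) = inverse (real n + 1) * inverse (real n + 1)"
          by (simp add: powr_minus power2_eq_square)
        finally show ?thesis using a0 by (simp add: powr_mult mult_ac)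
      qed
      also have "\<dots> \<le> (8 * \<Phi> ?j) powr p * ((1 / 2) ^ ?j * (1 / 2) ^ ?j)"
      proof -
        have "inverse (real n + 1) \<le> inverse (2 ^ ?j)" using n1 by (intro le_imp_inverse_le) auto
        then have i: "inverse (real n + 1) \<le> (1 / 2) ^ ?j"
          by (simp add: power_one_over inverse_eq_divide)
        have "((real n + 1) * a n) powr p \<le> (8 * \<Phi> ?j) powr p"
          using k p a0 by (intro powr_mono2) auto
        moreover have "inverse (real n + 1) * inverse (real n + 1) \<le> (1 / 2) ^ ?j * (1 / 2) ^ ?j"
          by (intro mult_mono i) auto
        ultimately show ?thesis by (rule mult_mono) auto
      qed
      finally show "a n powr p * (real n + 1) powr (p - 2) \<le> (8 * \<Phi> ?j) powr p * ((1 / 2) ^ ?j * (1 / 2) ^ ?j)" .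
    qed
    also have "\<dots> = ennreal (\<Sum>n\<in>dblock ?j. (8 * \<Phi> ?j) powr p * ((1 / 2) ^ ?j * (1 / 2) ^ ?j))"
      by (intro sum_ennreal) auto
    also have "(\<Sum>n\<in>dblock ?j. (8 * \<Phi> ?j) powr p * ((1 / 2) ^ ?j * (1 / 2) ^ ?j)) = (8 * \<Phi> ?j) powr p * (1 / 2) ^ ?j * (2 ^ ?j * (1 / 2) ^ ?j)"
      by (simp only: sum_constant card_dblock of_nat_power of_nat_numeral mult_ac)
    also have "2 ^ ?j * (1 / 2) ^ ?j = (1 :: real)" by (simp add: power_one_over)
    also have "(8 * \<Phi> ?j) powr p * (1 / 2) ^ ?j * 1 = 8 powr p * (\<Phi> ?j powr p * (1 / 2) ^ ?j)"
      using \<Phi>0 by (simp add: powr_mult)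
    also have "ennreal \<dots> = ennreal (8 powr p) * ennreal (\<Phi> ?j powr p * (1 / 2) ^ ?j)"
      by (intro ennreal_mult) auto
    finally show ?thesis .
  qed
  have s0: "s 0 = ennreal (norm (g 0) powr p)"
    by (simp add: s_def dblock_def a_def taylor_coeff_def)
  have "epowr (HL_norm p g) p = (\<Sum>n. ennreal (a n powr p * (real n + 1) powr (p - 2)))"
    using p by (simp add: HL_norm_def a_def epowr_root)
  also have "\<dots> = (\<Sum>i. s i)"
    unfolding s_def by (rule suminf_dblock)
  also have "\<dots> = (\<Sum>i. s (Suc i)) + s 0"
    using suminf_offset[of s 1] by simp
  also have "\<dots> \<le> (\<Sum>i. ennreal (8 powr p) * ennreal (\<Phi> (Suc i) powr p * (1 / 2) ^ Suc i)) + ennreal (8 powr p) * s 0"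
  proof (intro add_mono suminf_le s_le)
    have "ennreal 1 * s 0 \<le> ennreal (8 powr p) * s 0"
      using p by (intro mult_right_mono ennreal_leI ge_one_powr_ge_zero) auto
    then show "s 0 \<le> ennreal (8 powr p) * s 0" by simp
  qed auto
  also have "\<dots> = ennreal (8 powr p) * ((\<Sum>i. ennreal (\<Phi> (Suc i) powr p * (1 / 2) ^ Suc i)) + s 0)"
    unfolding ennreal_suminf_cmult by (simp add: distrib_left)
  also have "\<dots> \<le> ennreal (8 powr p) * dom_sum p g \<Phi>"
  proof (rule mult_left_mono)
    have "(\<Sum>i. ennreal (\<Phi> (Suc i) powr p * (1 / 2) ^ Suc i)) \<le> (\<Sum>i. ennreal (\<Phi> i powr p * (1 / 2) ^ i))"
      by (subst (2) suminf_offset[of _ 1]) auto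
    then show "(\<Sum>i. ennreal (\<Phi> (Suc i) powr p * (1 / 2) ^ Suc i)) + s 0 \<le> dom_sum p g \<Phi>"
      unfolding dom_sum_def s0 by (subst add.commute) (rule add_left_mono)
  qed auto
  finally show ?thesis .
qed

section \<open>Distance to the point 1 and dyadic arcs\<close>

lemma norm_one_minus_rcis_ge:
  assumes "0 \<le> r" "r \<le> 1"
  shows "1 - r \<le> norm (1 - rcis r \<theta>)"
  using norm_triangle_ineq2[of 1 "rcis r \<theta>"] assms by simp

lemma sin_ge_half:
  assumes "0 \<le> x" "x \<le> pi / 2"
  shows "x / 2 \<le> sin x"
proof -
  have "\<bar>sin x - (\<Sum>m<3. sin_coeff m * x ^ m)\<bar> \<le> inverse (fact 3) * \<bar>x\<bar> ^ 3"
    by (rule Maclaurin_sin_bound)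
  then have "\<bar>sin x - x\<bar> \<le> x ^ 3 / 6"
    using assms by (simp add: sin_coeff_def eval_nat_numeral fact_numeral)
  moreover have "x ^ 3 / 6 \<le> x / 2"
  proof -
    have "x \<le> 1.6" using assms pi_approx by simp
    then have "x * x \<le> 1.6 * 1.6" using assms by (intro mult_mono) auto
    then have "x * (x * x) \<le> x * 3" using assms by (intro mult_left_mono) auto
    then show ?thesis by (simp add: eval_nat_numeral)
  qed
  ultimately show ?thesis by linarith
qed

text \<open>The point \<open>cis \<theta>\<close> on the unit circle has distance
  \<open>2 * \<bar>sin (\<theta> / 2)\<bar>\<close> from 1. Moving inwards changes this by at most
  \<open>1 - r\<close>, which is itself bounded by the distance on the right; that halves the
  constant.\<close>

lemma norm_one_minus_rcis_ge_angle:
  assumes r: "0 \<le> r" "r \<le> 1" and \<theta>: "\<bar>\<theta>\<bar> \<le> pi"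
  shows "\<bar>\<theta>\<bar> / 4 \<le> norm (1 - rcis r \<theta>)"
proof -
  have "(norm (1 - cis \<theta>))\<^sup>2 = (1 - cos \<theta>)\<^sup>2 + (sin \<theta>)\<^sup>2"
    by (simp add: cmod_power2)
  also have "\<dots> = 2 - 2 * cos \<theta>"
    using sin_cos_squared_add[of \<theta>] by (simp add: power2_diff)
  also have "\<dots> = (2 * sin (\<theta> / 2))\<^sup>2"
    using cos_double_sin[of "\<theta> / 2"] by (simp add: power_mult_distrib)
  finally have "(norm (1 - cis \<theta>))\<^sup>2 = (2 * sin (\<theta> / 2))\<^sup>2" .
  from arg_cong[OF this, of sqrt] have "norm (1 - cis \<theta>) = \<bar>2 * sin (\<theta> / 2)\<bar>"
    by (simp only: real_sqrt_abs abs_norm_cancel)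
  moreover have "\<bar>\<theta>\<bar> / 2 \<le> \<bar>2 * sin (\<theta> / 2)\<bar>"
  proof -
    have "\<bar>\<theta>\<bar> / 2 / 2 \<le> sin (\<bar>\<theta>\<bar> / 2)" using \<theta> by (intro sin_ge_half) auto
    then show ?thesis by (cases "0 \<le> \<theta>") (auto simp: abs_if)
  qed
  ultimately have 1: "\<bar>\<theta>\<bar> / 2 \<le> norm (1 - cis \<theta>)" by simp
  have "1 - cis \<theta> = (1 - rcis r \<theta>) - of_real (1 - r) * cis \<theta>"
    by (simp add: rcis_def algebra_simps)
  then have "norm (1 - cis \<theta>) \<le> norm (1 - rcis r \<theta>) + norm (of_real (1 - r) * cis \<theta>)"
    by (simp only: norm_triangle_ineq4)
  also have "norm (of_real (1 - r) * cis \<theta>) = 1 - r"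
    using r by (simp add: norm_mult del: of_real_diff)
  finally show ?thesis using 1 norm_one_minus_rcis_ge[OF r, of \<theta>] by linarith
qed

definition arc :: "nat \<Rightarrow> real set" where
  "arc i = {\<theta>. pi * (1 / 2) ^ Suc i < \<bar>\<theta>\<bar> \<and> \<bar>\<theta>\<bar> \<le> pi * (1 / 2) ^ i}"

lemma arc_sets [measurable]: "arc i \<in> sets borel"
  unfolding arc_def by measurable

lemma arc_cover:
  assumes "\<theta> \<noteq> 0" "\<bar>\<theta>\<bar> \<le> pi"
  shows "\<exists>i. \<theta> \<in> arc i"
proof -
  have "0 \<le> 1 - \<bar>\<theta>\<bar> / pi" "1 - \<bar>\<theta>\<bar> / pi < 1" using assms by auto
  then obtain k where "dyad k \<le> 1 - \<bar>\<theta>\<bar> / pi" "1 - \<bar>\<theta>\<bar> / pi < dyad (Suc k)" by (rule dyad_cover)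
  then have "(1/2) ^ Suc k < \<bar>\<theta>\<bar> / pi" "\<bar>\<theta>\<bar> / pi \<le> (1/2) ^ k" by (auto simp: dyad_def)
  then have "\<theta> \<in> arc k" unfolding arc_def
    by (simp add: pos_less_divide_eq pos_divide_le_eq mult.commute)
  then show ?thesis ..
qed

text \<open>The distance to 1 is at least of the order of the angle and of the order of
  \<open>1 - r\<close>; the larger of the two scales has the smaller index.\<close>

lemma norm_one_minus_rcis_ge_arc:
  assumes "\<theta> \<in> arc i" "0 \<le> r" "r \<le> dyad (Suc j)"
  shows "(1 / 2) ^ (min i j + 2) \<le> norm (1 - rcis r \<theta>)"
proof -
  have r1: "r \<le> 1" using assms dyad_less_1[of "Suc j"] by linarith
  have "\<bar>\<theta>\<bar> \<le> pi * (1/2) ^ i" using assms by (simp add: arc_def)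
  also have "\<dots> \<le> pi * 1" by (intro mult_left_mono power_le_one) auto
  finally have "\<bar>\<theta>\<bar> \<le> pi" by simp
  then have a: "\<bar>\<theta>\<bar> / 4 \<le> norm (1 - rcis r \<theta>)" using assms r1 by (intro norm_one_minus_rcis_ge_angle) auto
  have "2 * (1/2) ^ Suc i \<le> pi * (1/2) ^ Suc i" using pi_ge_two by (intro mult_right_mono) auto
  moreover have "pi * (1 / 2) ^ Suc i < \<bar>\<theta>\<bar>" using assms by (simp add: arc_def)
  moreover have "(1 / 2) ^ (i + 2) = (1 / 2 :: real) ^ Suc i / 2" by simp
  ultimately have "(1 / 2) ^ (i + 2) \<le> \<bar>\<theta>\<bar> / 4" by linarith
  with a have 1: "(1 / 2) ^ (i + 2) \<le> norm (1 - rcis r \<theta>)" by linarith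
  have "(1 / 2) ^ (j + 2) \<le> (1/2::real) ^ Suc j" by (intro power_decreasing) auto
  also have "\<dots> \<le> 1 - r" using assms by (simp add: dyad_def)
  also have "\<dots> \<le> norm (1 - rcis r \<theta>)" using assms r1 by (intro norm_one_minus_rcis_ge) auto
  finally show ?thesis using 1 by (simp add: min_def)
qed

text \<open>Periodicity makes the range symmetric about the angle \<open>0\<close>, which lies in no
  arc and is a null set.\<close>

lemma nn_integral_circle_arcs:
  fixes h :: "real \<Rightarrow> ennreal"
  assumes [measurable]: "h \<in> borel_measurable borel" and per: "\<And>x. h (x + 2 * pi) = h x"
    and H: "\<And>i \<theta>. \<theta> \<in> arc i \<Longrightarrow> h \<theta> \<le> H i"
  shows "(\<integral>\<^sup>+\<theta>\<in>{0..<2 * pi}. h \<theta> \<partial>lborel) \<le> (\<Sum>i. H i * ennreal (2 * pi * (1 / 2) ^ i))"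
proof -
  have "(\<integral>\<^sup>+\<theta>\<in>{0..<2 * pi}. h \<theta> \<partial>lborel) = (\<integral>\<^sup>+\<theta>\<in>{- pi..<- pi + 2 * pi}. h \<theta> \<partial>lborel)"
    by (rule nn_integral_periodic[symmetric]) (auto simp: per)
  also have "\<dots> = (\<integral>\<^sup>+\<theta>\<in>{- pi..<- pi + 2 * pi} - {0}. h \<theta> \<partial>lborel)"
  proof (rule nn_integral_cong_AE)
    show "AE x in lborel. h x * indicator {- pi..<- pi + 2 * pi} x = h x * indicator ({- pi..<- pi + 2 * pi} - {0}) x"
      using AE_lborel_singleton[of 0] by eventually_elim (auto split: split_indicator)
  qed
  also have "\<dots> \<le> (\<Sum>i. H i * emeasure lborel (arc i))"
  proof (rule nn_integral_le_UN)
    show "{- pi..<- pi + 2 * pi} - {0} \<subseteq> (\<Union>i. arc i)"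
      using arc_cover by fastforce
  qed (use H in auto)
  also have "\<dots> \<le> (\<Sum>i. H i * ennreal (2 * pi * (1 / 2) ^ i))"
  proof (intro suminf_le mult_left_mono)
    fix i
    have "emeasure lborel (arc i) \<le> emeasure lborel {- (pi * (1/2) ^ i)..pi * (1/2) ^ i}"
      by (intro emeasure_mono) (auto simp: arc_def)
    also have "\<dots> = ennreal (2 * pi * (1 / 2) ^ i)" by simp
    finally show "emeasure lborel (arc i) \<le> ennreal (2 * pi * (1 / 2) ^ i)" .
  qed auto
  finally show ?thesis .
qed

lemma dominated_deriv_le:
  assumes dom: "dominated g \<Phi>" and a: "\<theta> \<in> arc i" "0 \<le> r" "r \<le> dyad (Suc j)"
  shows "norm (deriv g (rcis r \<theta>)) \<le> 4 * 2 ^ min i j * \<Phi> j"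
proof -
  let ?z = "rcis r \<theta>"
  have "norm (deriv g ?z) * (1 / 2) ^ (min i j + 2) \<le> norm (deriv g ?z) * norm (1 - ?z)"
    by (intro mult_left_mono norm_one_minus_rcis_ge_arc a) auto
  also have "\<dots> \<le> \<Phi> j"
    using dom a by (auto simp: dominated_def)
  finally have "norm (deriv g ?z) * (1 / 2) ^ (min i j + 2) * 2 ^ (min i j + 2) \<le> \<Phi> j * 2 ^ (min i j + 2)"
    by (intro mult_right_mono) auto
  then show ?thesis by (simp add: power_one_over mult.assoc) (simp add: mult_ac)
qed

lemma rcis_add_2pi: "rcis r (x + 2 * pi) = rcis r x"
  by (simp add: rcis_def cis.code)

text \<open>On radius \<open>j\<close> and arc \<open>i\<close> the integrand is at most
  \<open>\<Phi> j powr p\<close> times \<open>2 powr (p * min i j)\<close> from the distance to 1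
  and \<open>2 powr (- j * (p - 1))\<close> from the weight, and the arc has length of order
  \<open>(1 / 2) ^ i\<close>. The product decays in the distance of \<open>i\<close> and
  \<open>j\<close>, so the integral over each circle is of order
  \<open>\<Phi> j powr p\<close>.\<close>

lemma Dirichlet_norm_le_dominated:
  assumes p: "1 < p"
  shows "\<exists>C>0. \<forall>g \<Phi>. dominated g \<Phi> \<longrightarrow> epowr (Dirichlet_norm p g) p \<le> ennreal C * dom_sum p g \<Phi>"
proof (intro exI conjI allI impI)
  \<comment> \<open>The first rate belongs to arcs narrower than the distance
    \<open>(1 / 2) ^ j\<close> to the unit circle, the second to wider ones.\<close>
  define q where "q = max (1 / 2) (2 powr (1 - p))"
  have q: "0 < q" "q < 1" using p by (auto simp: q_def powr_less_one)
  define A where "A = 2 * 4 powr p * (2 / (1 - q))"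
  have A0: "0 < A" using q by (simp add: A_def)
  let ?C = "max 1 A"
  show "0 < ?C" by simp
  fix g \<Phi> assume dom: "dominated g \<Phi>"
  have g: "g holomorphic_on ball 0 1" and \<Phi>0: "0 \<le> \<Phi> j" for j using dom by (auto simp: dominated_def)
  define h where "h r \<theta> = ennreal (1 / pi * (norm (deriv g (rcis r \<theta>)) powr p * (1 - norm (rcis r \<theta>)) powr (p - 1)))" for r \<theta>
  have inner: "ennreal r * (\<integral>\<^sup>+\<theta>\<in>{0..<2 * pi}. h r \<theta> \<partial>lborel) \<le> ennreal (A * \<Phi> j powr p)"
    if r: "r \<in> {dyad j..<dyad (Suc j)}" for r j
  proof -
    have r01: "0 \<le> r" "r < 1" using r dyad_nonneg[of j] dyad_less_1[of "Suc j"] by (auto simp del: dyad_nonneg dyad_less_1)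
    have [measurable]: "(\<lambda>\<theta>. deriv g (rcis r \<theta>)) \<in> borel_measurable borel"
      by (rule measurable_circle[OF holomorphic_on_deriv_disc[OF g] r01])
    have [measurable]: "h r \<in> borel_measurable borel"
      unfolding h_def by measurable
    define H where "H i = ennreal (1 / pi * ((4 * 2 ^ min i j * \<Phi> j) powr p * ((1 / 2) ^ j) powr (p - 1)))" for i
    have "(\<integral>\<^sup>+\<theta>\<in>{0..<2 * pi}. h r \<theta> \<partial>lborel) \<le> (\<Sum>i. H i * ennreal (2 * pi * (1 / 2) ^ i))"
    proof (rule nn_integral_circle_arcs)
      show "h r \<theta> \<le> H i" if "\<theta> \<in> arc i" for i \<theta>
        unfolding h_def H_def
        using that r r01 p dominated_deriv_le[OF dom that r01(1), of j]
        by (intro ennreal_leI mult_left_mono mult_mono powr_mono2) (auto simp: dyad_def)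
    qed (auto simp: h_def rcis_add_2pi)
    also have "\<dots> \<le> (\<Sum>i. ennreal (2 * 4 powr p * \<Phi> j powr p) * ennreal (q ^ ndist j i))"
    proof (intro suminf_le)
      fix i
      have k: "(2 ^ min i j) powr p * ((1 / 2) ^ j) powr (p - 1) * (1 / 2) ^ i \<le> q ^ ndist j i"
      proof -
        have "(2 ^ min i j) powr p = 2 powr (real (min i j) * p)"
          by (simp add: powr_powr flip: powr_realpow)
        moreover have "((1 / 2) ^ j) powr (p - 1) = 2 powr (- real j * (p - 1))"
          by (simp only: half_power powr_powr)
        ultimately have e: "(2 ^ min i j) powr p * ((1 / 2) ^ j) powr (p - 1) * (1 / 2) ^ i = 2 powr (real (min i j) * p + - real j * (p - 1) + - real i)"
          by (simp only: half_power powr_add)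
        show ?thesis
        proof (cases "i \<le> j")
          case True
          have "(2 ^ min i j) powr p * ((1 / 2) ^ j) powr (p - 1) * (1 / 2) ^ i = (2 powr (1 - p)) ^ (j - i)"
          proof -
            have "real (min i j) * p + - real j * (p - 1) + - real i = (1 - p) * real (j - i)"
              using True by (simp add: of_nat_diff algebra_simps)
            then show ?thesis unfolding e by (simp add: powr_powr flip: powr_realpow)
          qed
          also have "\<dots> \<le> q ^ (j - i)" by (intro power_mono) (auto simp: q_def)
          finally show ?thesis using True by (simp add: ndist_def)
        next
          case False
          have "(2 ^ min i j) powr p * ((1 / 2) ^ j) powr (p - 1) * (1 / 2) ^ i = (1 / 2) ^ (i - j)"
          proof -
            have "real (min i j) * p + - real j * (p - 1) + - real i = - real (i - j)"
              using False by (simp add: of_nat_diff algebra_simps)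
            then show ?thesis by (subst e, subst half_power) (simp only:)
          qed
          also have "\<dots> \<le> q ^ (i - j)" by (intro power_mono) (auto simp: q_def)
          finally show ?thesis using False by (simp add: ndist_def)
        qed
      qed
      have "H i * ennreal (2 * pi * (1 / 2) ^ i) = ennreal (2 * 4 powr p * \<Phi> j powr p * ((2 ^ min i j) powr p * ((1 / 2) ^ j) powr (p - 1) * (1 / 2) ^ i))"
        unfolding H_def using \<Phi>0 by (subst ennreal_mult[symmetric]) (auto simp: powr_mult mult_ac)
      also have "\<dots> \<le> ennreal (2 * 4 powr p * \<Phi> j powr p * q ^ ndist j i)"
        by (intro ennreal_leI mult_left_mono k) auto
      also have "\<dots> = ennreal (2 * 4 powr p * \<Phi> j powr p) * ennreal (q ^ ndist j i)"
        using q by (intro ennreal_mult) auto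
      finally show "H i * ennreal (2 * pi * (1 / 2) ^ i) \<le> ennreal (2 * 4 powr p * \<Phi> j powr p) * ennreal (q ^ ndist j i)" .
    qed auto
    also have "\<dots> = ennreal (2 * 4 powr p * \<Phi> j powr p) * (\<Sum>i. ennreal (q ^ ndist j i))"
      by (rule ennreal_suminf_cmult)
    also have "\<dots> \<le> ennreal (2 * 4 powr p * \<Phi> j powr p) * ennreal (2 / (1 - q))"
      by (intro mult_left_mono geometric_row_sum q) auto
    also have "\<dots> = ennreal (A * \<Phi> j powr p)"
      unfolding A_def using q by (subst ennreal_mult[symmetric]) (auto simp: mult_ac)
    finally have le: "(\<integral>\<^sup>+\<theta>\<in>{0..<2 * pi}. h r \<theta> \<partial>lborel) \<le> ennreal (A * \<Phi> j powr p)" .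
    have "ennreal r * (\<integral>\<^sup>+\<theta>\<in>{0..<2 * pi}. h r \<theta> \<partial>lborel) \<le> ennreal 1 * ennreal (A * \<Phi> j powr p)"
      using r01 by (intro mult_mono le ennreal_leI) auto
    then show ?thesis by simp
  qed
  have "(\<integral>\<^sup>+z\<in>ball 0 1. ennreal (1 / pi * (norm (deriv g z) powr p * (1 - norm z) powr (p - 1))) \<partial>lborel)
     = (\<integral>\<^sup>+r\<in>{0<..<1}. ennreal r * (\<integral>\<^sup>+\<theta>\<in>{0..<2 * pi}. h r \<theta> \<partial>lborel) \<partial>lborel)"
    unfolding h_def by (rule nn_integral_disc_polar) (rule continuous_on_Dirichlet_integrand[OF g p])
  also have "\<dots> \<le> (\<Sum>j. ennreal (A * \<Phi> j powr p) * emeasure lborel {dyad j..<dyad (Suc j)})"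
  proof (rule nn_integral_le_UN)
    show "{0<..<1} \<subseteq> (\<Union>j. {dyad j..<dyad (Suc j)})"
    proof
      fix r :: real assume "r \<in> {0<..<1}"
      then obtain k where "dyad k \<le> r" "r < dyad (Suc k)" using dyad_cover[of r] by auto
      then show "r \<in> (\<Union>j. {dyad j..<dyad (Suc j)})" by auto
    qed
  qed (use inner in auto)
  also have "\<dots> \<le> (\<Sum>j. ennreal A * ennreal (\<Phi> j powr p * (1 / 2) ^ j))"
  proof (intro suminf_le)
    fix j
    have "ennreal (A * \<Phi> j powr p) * emeasure lborel {dyad j..<dyad (Suc j)} \<le> ennreal (A * \<Phi> j powr p) * ennreal ((1 / 2) ^ j)"
      by (intro mult_left_mono) (auto simp: dyad_mono dyad_Suc_diff)
    also have "\<dots> = ennreal A * ennreal (\<Phi> j powr p * (1 / 2) ^ j)"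
      using A0 by (simp add: ennreal_mult mult.assoc)
    finally show "ennreal (A * \<Phi> j powr p) * emeasure lborel {dyad j..<dyad (Suc j)} \<le> ennreal A * ennreal (\<Phi> j powr p * (1 / 2) ^ j)" .
  qed auto
  also have "\<dots> = ennreal A * (\<Sum>j. ennreal (\<Phi> j powr p * (1 / 2) ^ j))" by (rule ennreal_suminf_cmult)
  finally have S: "(\<integral>\<^sup>+z\<in>ball 0 1. ennreal (1 / pi * (norm (deriv g z) powr p * (1 - norm z) powr (p - 1))) \<partial>lborel)
     \<le> ennreal A * (\<Sum>j. ennreal (\<Phi> j powr p * (1 / 2) ^ j))" .
  have "epowr (Dirichlet_norm p g) p \<le> ennreal 1 * ennreal (norm (g 0) powr p) + ennreal A * (\<Sum>j. ennreal (\<Phi> j powr p * (1 / 2) ^ j))"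
    using p S by (simp add: Dirichlet_norm_def epowr_root add_left_mono)
  also have "\<dots> \<le> ennreal ?C * ennreal (norm (g 0) powr p) + ennreal ?C * (\<Sum>j. ennreal (\<Phi> j powr p * (1 / 2) ^ j))"
    by (intro add_mono mult_right_mono ennreal_leI) auto
  also have "\<dots> = ennreal ?C * dom_sum p g \<Phi>"
    by (simp add: dom_sum_def distrib_left)
  finally show "epowr (Dirichlet_norm p g) p \<le> ennreal ?C * dom_sum p g \<Phi>" .
qed

text \<open>Integration of the derivative along the ray of angle \<open>\<theta>\<close>; the bound
  depends on the arc but not on the radius \<open>\<rho>\<close>.\<close>

lemma dominated_circle_le:
  assumes dom: "dominated g \<Phi>" and a: "\<theta> \<in> arc i" and \<rho>: "0 \<le> \<rho>" "\<rho> < 1"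
  shows "ennreal (norm (g (rcis \<rho> \<theta>))) \<le> ennreal (norm (g 0)) + (\<Sum>j. ennreal (2 * 2 ^ min i j * (1 / 2) ^ j * \<Phi> j))"
proof -
  have g: "g holomorphic_on ball 0 1" and \<Phi>0: "0 \<le> \<Phi> j" for j using dom by (auto simp: dominated_def)
  \<comment> \<open>Cutting the dyadic radii off at \<open>\<rho>\<close> keeps the path inside the
    circle; from some index on \<open>s\<close> equals \<open>\<rho>\<close>.\<close>
  define s where "s j = min (dyad j) \<rho>" for j
  have s: "0 \<le> s j" "s j \<le> s (Suc j)" "s (Suc j) - s j \<le> (1 / 2) ^ Suc j" "s j < 1" "s j \<le> dyad j" for j
    using \<rho> dyad_mono[of j "Suc j"] dyad_Suc_diff[of j] by (auto simp: s_def min_def)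
  have step: "norm (g (rcis (s k) \<theta>)) \<le> norm (g 0) + (\<Sum>j<k. 2 * 2 ^ min i j * (1 / 2) ^ j * \<Phi> j)" for k
  proof (induction k)
    case 0
    then show ?case using \<rho> by (simp add: s_def)
  next
    case (Suc k)
    let ?S = "closed_segment (rcis (s k) \<theta>) (rcis (s (Suc k)) \<theta>)"
    have S: "\<exists>r. z = rcis r \<theta> \<and> 0 \<le> r \<and> r \<le> s (Suc k)" if z: "z \<in> ?S" for z
    proof -
      obtain u where u: "0 \<le> u" "u \<le> 1" "z = (1 - u) *\<^sub>R rcis (s k) \<theta> + u *\<^sub>R rcis (s (Suc k)) \<theta>"
        using z unfolding closed_segment_def by auto
      have "z = rcis ((1 - u) * s k + u * s (Suc k)) \<theta>"
        unfolding u(3) by (simp add: rcis_def scaleR_conv_of_real algebra_simps)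
      moreover have "(1 - u) * s k + u * s (Suc k) \<le> (1 - u) * s (Suc k) + u * s (Suc k)"
        using u s[of k] by (intro add_mono mult_left_mono) auto
      moreover have "0 \<le> (1 - u) * s k + u * s (Suc k)" using u s(1)[of k] s(1)[of "Suc k"] by auto
      ultimately show ?thesis by (intro exI[of _ "(1 - u) * s k + u * s (Suc k)"]) (auto simp: algebra_simps)
    qed
    have "norm (g (rcis (s (Suc k)) \<theta>) - g (rcis (s k) \<theta>))
      \<le> (4 * 2 ^ min i k * \<Phi> k) * norm (rcis (s (Suc k)) \<theta> - rcis (s k) \<theta>)"
    proof (rule field_differentiable_bound[where S = ?S])
      fix z assume "z \<in> ?S"
      then obtain r where r: "z = rcis r \<theta>" "0 \<le> r" "r \<le> s (Suc k)" using S by blast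
      have "z \<in> ball 0 1" using r s(4)[of "Suc k"] by auto
      then have "(g has_field_derivative deriv g z) (at z)"
        using g by (intro holomorphic_derivI[where S = "ball 0 1"]) auto
      then show "(g has_field_derivative deriv g z) (at z within ?S)" by (rule has_field_derivative_at_within)
      show "norm (deriv g z) \<le> 4 * 2 ^ min i k * \<Phi> k"
        unfolding r(1) using r s(5)[of "Suc k"] by (intro dominated_deriv_le[OF dom a]) auto
    qed auto
    also have "norm (rcis (s (Suc k)) \<theta> - rcis (s k) \<theta>) = s (Suc k) - s k"
    proof -
      have "rcis (s (Suc k)) \<theta> - rcis (s k) \<theta> = rcis (s (Suc k) - s k) \<theta>"
        by (simp add: rcis_def algebra_simps)
      then show ?thesis using s(2)[of k] by simp
    qed
    also have "(4 * 2 ^ min i k * \<Phi> k) * (s (Suc k) - s k) \<le> (4 * 2 ^ min i k * \<Phi> k) * (1 / 2) ^ Suc k"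
      using s(3)[of k] \<Phi>0 by (intro mult_left_mono) auto
    also have "\<dots> = 2 * 2 ^ min i k * (1 / 2) ^ k * \<Phi> k" by simp
    finally have "norm (g (rcis (s (Suc k)) \<theta>) - g (rcis (s k) \<theta>)) \<le> 2 * 2 ^ min i k * (1 / 2) ^ k * \<Phi> k" .
    moreover have "norm (g (rcis (s (Suc k)) \<theta>)) \<le> norm (g (rcis (s k) \<theta>)) + norm (g (rcis (s (Suc k)) \<theta>) - g (rcis (s k) \<theta>))"
      by (rule norm_triangle_sub)
    ultimately show ?case using Suc by simp
  qed
  obtain k where k: "\<rho> < dyad (Suc k)" using dyad_cover[OF \<rho>] by auto
  then have "s (Suc k) = \<rho>" by (simp add: s_def)
  then have "norm (g (rcis \<rho> \<theta>)) \<le> norm (g 0) + (\<Sum>j<Suc k. 2 * 2 ^ min i j * (1 / 2) ^ j * \<Phi> j)"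
    using step[of "Suc k"] by simp
  then have "ennreal (norm (g (rcis \<rho> \<theta>))) \<le> ennreal (norm (g 0) + (\<Sum>j<Suc k. 2 * 2 ^ min i j * (1 / 2) ^ j * \<Phi> j))"
    by (rule ennreal_leI)
  also have "\<dots> = ennreal (norm (g 0)) + (\<Sum>j<Suc k. ennreal (2 * 2 ^ min i j * (1 / 2) ^ j * \<Phi> j))"
    using \<Phi>0 by (subst ennreal_plus) (auto intro!: sum_nonneg simp del: sum.lessThan_Suc simp: sum_ennreal)
  also have "\<dots> \<le> ennreal (norm (g 0)) + (\<Sum>j. ennreal (2 * 2 ^ min i j * (1 / 2) ^ j * \<Phi> j))"
    by (intro add_left_mono sum_le_suminf) auto
  finally show ?thesis .
qed

text \<open>On arc \<open>i\<close> the function is bounded by \<open>norm (g 0) + z i\<close>, and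
  the length of the arc is of the order of the \<open>p\<close>-th power of
  \<open>gam p ^ i\<close>, so the circle mean becomes an \<open>l^p\<close> sum of
  \<open>y i\<close>. The matrix from \<open>\<Phi>\<close> to \<open>y\<close> decays off the
  diagonal with rate \<open>gam p\<close> on one side and \<open>1 / (2 * gam p)\<close> on the
  other; the latter is below 1 because \<open>p > 1\<close>.\<close>

lemma Hardy_norm_le_dominated:
  assumes p: "1 < p"
  shows "\<exists>C>0. \<forall>g \<Phi>. dominated g \<Phi> \<longrightarrow> epowr (Hardy_norm p g) p \<le> ennreal C * dom_sum p g \<Phi>"
proof (intro exI conjI allI impI)
  define q where "q = max (gam p) (1 / (2 * gam p))"
  have "1 / 2 < gam p"
  proof -
    have "2 powr (-1) < (2::real) powr (- (1 / p))" using p by (intro powr_less_mono) auto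
    then show ?thesis by (simp add: gam_def powr_minus)
  qed
  then have q: "0 < q" "q < 1" using p gam_pos[of p] gam_less_1[of p] by (auto simp: q_def field_simps)
  define A where "A = (2 * 2 / (1 - q)) powr p"
  let ?C = "2 powr p * max 2 A"
  show "0 < ?C" by simp
  fix g \<Phi> assume dom: "dominated g \<Phi>"
  have g: "g holomorphic_on ball 0 1" and \<Phi>0: "0 \<le> \<Phi> j" for j using dom by (auto simp: dominated_def)
  define z where "z i = (\<Sum>j. ennreal (2 * 2 ^ min i j * (1 / 2) ^ j * \<Phi> j))" for i
  define y where "y i = ennreal (gam p ^ i) * z i" for i
  have zq: "y i \<le> ennreal 2 * (\<Sum>j. ennreal (q ^ ndist i j) * ennreal (\<Phi> j * gam p ^ j))" for i
  proof -
    have "y i = (\<Sum>j. ennreal (gam p ^ i) * ennreal (2 * 2 ^ min i j * (1 / 2) ^ j * \<Phi> j))"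
      unfolding z_def y_def by (rule ennreal_suminf_cmult[symmetric])
    also have "\<dots> \<le> (\<Sum>j. ennreal 2 * (ennreal (q ^ ndist i j) * ennreal (\<Phi> j * gam p ^ j)))"
    proof (intro suminf_le)
      fix j
      have k: "gam p ^ i * (2 ^ min i j * (1 / 2) ^ j) \<le> q ^ ndist i j * gam p ^ j"
      proof (cases "j \<le> i")
        case True
        then have "gam p ^ i * (2 ^ min i j * (1 / 2) ^ j) = gam p ^ (i - j) * gam p ^ j"
          by (simp add: power_one_over power_add[symmetric])
        also have "\<dots> \<le> q ^ (i - j) * gam p ^ j"
          using gam_pos[of p] by (intro mult_right_mono power_mono) (auto simp: q_def)
        finally show ?thesis using True by (simp add: ndist_def)
      next
        case False
        define d where "d = j - i"
        have j: "j = i + d" using False by (simp add: d_def)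
        have "gam p ^ i * (2 ^ min i j * (1 / 2) ^ j) = (1 / (2 * gam p)) ^ d * gam p ^ j"
          using gam_pos[of p] by (simp add: j power_one_over power_add power_mult_distrib power_divide)
        also have "\<dots> \<le> q ^ d * gam p ^ j"
          using gam_pos[of p] by (intro mult_right_mono power_mono) (auto simp: q_def)
        finally show ?thesis using False by (simp add: ndist_def d_def)
      qed
      have "ennreal (gam p ^ i) * ennreal (2 * 2 ^ min i j * (1 / 2) ^ j * \<Phi> j) = ennreal (2 * (gam p ^ i * (2 ^ min i j * (1 / 2) ^ j)) * \<Phi> j)"
        using \<Phi>0 gam_pos[of p] by (subst ennreal_mult[symmetric]) (auto simp: mult_ac)
      also have "\<dots> \<le> ennreal (2 * (q ^ ndist i j * gam p ^ j) * \<Phi> j)"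
        using \<Phi>0 by (intro ennreal_leI mult_right_mono mult_left_mono k) auto
      also have "\<dots> = ennreal (2 * (q ^ ndist i j * (\<Phi> j * gam p ^ j)))" by (simp only: mult_ac)
      also have "\<dots> = ennreal 2 * (ennreal (q ^ ndist i j) * ennreal (\<Phi> j * gam p ^ j))"
        using q \<Phi>0 gam_pos[of p] by (simp add: ennreal_mult)
      finally show "ennreal (gam p ^ i) * ennreal (2 * 2 ^ min i j * (1 / 2) ^ j * \<Phi> j) \<le> ennreal 2 * (ennreal (q ^ ndist i j) * ennreal (\<Phi> j * gam p ^ j))" .
    qed auto
    also have "\<dots> = ennreal 2 * (\<Sum>j. ennreal (q ^ ndist i j) * ennreal (\<Phi> j * gam p ^ j))"
      by (rule ennreal_suminf_cmult)
    finally show ?thesis .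
  qed
  have ysum: "(\<Sum>i. epowr (y i) p) \<le> ennreal A * (\<Sum>j. ennreal (\<Phi> j powr p * (1 / 2) ^ j))"
  proof -
    have "(\<Sum>i. epowr (y i) p) \<le> ennreal A * (\<Sum>j. epowr (ennreal (\<Phi> j * gam p ^ j)) p)"
      unfolding A_def using zq p by (intro geometric_convolution q) auto
    also have "(\<Sum>j. epowr (ennreal (\<Phi> j * gam p ^ j)) p) = (\<Sum>j. ennreal (\<Phi> j powr p * (1 / 2) ^ j))"
      using p \<Phi>0 gam_pos[of p] by (intro suminf_cong) (simp add: powr_mult gam_power_powr)
    finally show ?thesis .
  qed
  have mean: "ennreal (integral_mean p \<rho> g powr p) \<le> ennreal ?C * dom_sum p g \<Phi>" if \<rho>: "0 < \<rho>" "\<rho> < 1" for \<rho>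
  proof -
    have [measurable]: "(\<lambda>\<theta>. g (rcis \<rho> \<theta>)) \<in> borel_measurable borel"
      using \<rho> by (intro measurable_circle[OF g]) auto
    have "ennreal (2 * pi * integral_mean p \<rho> g powr p) = (\<integral>\<^sup>+\<theta>\<in>{0..<2 * pi}. ennreal (norm (g (rcis \<rho> \<theta>)) powr p) \<partial>lborel)"
      using p \<rho> by (intro nn_integral_circle_powr[symmetric] g) auto
    also have "\<dots> \<le> (\<Sum>i. epowr (ennreal (norm (g 0)) + z i) p * ennreal (2 * pi * (1 / 2) ^ i))"
    proof (rule nn_integral_circle_arcs)
      fix i \<theta> assume "\<theta> \<in> arc i"
      then have "epowr (ennreal (norm (g (rcis \<rho> \<theta>)))) p \<le> epowr (ennreal (norm (g 0)) + z i) p"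
        unfolding z_def using p \<rho> by (intro epowr_mono dominated_circle_le dom) auto
      then show "ennreal (norm (g (rcis \<rho> \<theta>)) powr p) \<le> epowr (ennreal (norm (g 0)) + z i) p" by simp
    qed (auto simp: rcis_add_2pi)
    also have "\<dots> \<le> (\<Sum>i. ennreal (2 * pi * 2 powr p) * (ennreal (norm (g 0) powr p * (1 / 2) ^ i) + epowr (y i) p))"
    proof (intro suminf_le)
      fix i
      have yi: "epowr (y i) p = ennreal ((1 / 2) ^ i) * epowr (z i) p"
        unfolding y_def using p gam_pos[of p] by (simp add: epowr_mult gam_power_powr)
      have "epowr (ennreal (norm (g 0)) + z i) p * ennreal (2 * pi * (1 / 2) ^ i)
        \<le> (ennreal (2 powr p) * (epowr (ennreal (norm (g 0))) p + epowr (z i) p)) * ennreal (2 * pi * (1 / 2) ^ i)"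
        using p by (intro mult_right_mono epowr_add_le) auto
      also have "\<dots> = (ennreal (2 * pi) * ennreal (2 powr p)) * (ennreal (norm (g 0) powr p) * ennreal ((1 / 2) ^ i) + ennreal ((1 / 2) ^ i) * epowr (z i) p)"
      proof -
        have "ennreal (2 * pi * (1 / 2) ^ i) = ennreal (2 * pi) * ennreal ((1 / 2) ^ i)"
          by (intro ennreal_mult) auto
        then show ?thesis by (simp only: epowr_ennreal norm_ge_zero distrib_left distrib_right mult_ac)
      qed
      also have "ennreal (2 * pi) * ennreal (2 powr p) = ennreal (2 * pi * 2 powr p)"
        by (intro ennreal_mult[symmetric]) auto
      also have "ennreal (norm (g 0) powr p) * ennreal ((1 / 2) ^ i) = ennreal (norm (g 0) powr p * (1 / 2) ^ i)"
        by (intro ennreal_mult[symmetric]) auto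
      finally show "epowr (ennreal (norm (g 0)) + z i) p * ennreal (2 * pi * (1 / 2) ^ i)
        \<le> ennreal (2 * pi * 2 powr p) * (ennreal (norm (g 0) powr p * (1 / 2) ^ i) + epowr (y i) p)"
        unfolding yi .
    qed auto
    also have "\<dots> = ennreal (2 * pi * 2 powr p) * ((\<Sum>i. ennreal (norm (g 0) powr p * (1 / 2) ^ i)) + (\<Sum>i. epowr (y i) p))"
      by (simp add: ennreal_suminf_cmult suminf_add[symmetric])
    also have "(\<Sum>i. ennreal (norm (g 0) powr p * (1 / 2) ^ i)) = ennreal (2 * norm (g 0) powr p)"
      by (rule suminf_half_power_mult) simp
    also have "ennreal (2 * pi * 2 powr p) * (ennreal (2 * norm (g 0) powr p) + (\<Sum>i. epowr (y i) p))
      \<le> ennreal (2 * pi * 2 powr p) * (ennreal (max 2 A) * dom_sum p g \<Phi>)"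
    proof (rule mult_left_mono)
      have "ennreal (2 * norm (g 0) powr p) + (\<Sum>i. epowr (y i) p)
        \<le> ennreal (max 2 A * norm (g 0) powr p) + ennreal A * (\<Sum>j. ennreal (\<Phi> j powr p * (1 / 2) ^ j))"
        by (intro add_mono ysum ennreal_leI mult_right_mono) auto
      also have "\<dots> \<le> ennreal (max 2 A) * ennreal (norm (g 0) powr p) + ennreal (max 2 A) * (\<Sum>j. ennreal (\<Phi> j powr p * (1 / 2) ^ j))"
        by (intro add_mono mult_right_mono ennreal_leI) (auto simp: ennreal_mult)
      finally show "ennreal (2 * norm (g 0) powr p) + (\<Sum>i. epowr (y i) p) \<le> ennreal (max 2 A) * dom_sum p g \<Phi>"
        by (simp add: dom_sum_def distrib_left)
    qed simp
    also have "\<dots> = ennreal (2 * pi) * (ennreal ?C * dom_sum p g \<Phi>)"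
      by (simp add: ennreal_mult mult.assoc)
    finally have "ennreal (1 / (2 * pi)) * ennreal (2 * pi * integral_mean p \<rho> g powr p) \<le> ennreal (1 / (2 * pi)) * (ennreal (2 * pi) * (ennreal ?C * dom_sum p g \<Phi>))"
      by (rule mult_left_mono) simp
    moreover have "ennreal (1 / (2 * pi)) * (ennreal (2 * pi) * x) = x" for x
      by (subst mult.assoc[symmetric], subst ennreal_mult[symmetric]) auto
    moreover have "ennreal (2 * pi * integral_mean p \<rho> g powr p) = ennreal (2 * pi) * ennreal (integral_mean p \<rho> g powr p)"
      by (intro ennreal_mult) auto
    ultimately show ?thesis by simp
  qed
  show "epowr (Hardy_norm p g) p \<le> ennreal ?C * dom_sum p g \<Phi>"
  proof (rule epowr_inverse_le)
    show "Hardy_norm p g \<le> epowr (ennreal ?C * dom_sum p g \<Phi>) (1 / p)"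
      unfolding Hardy_norm_def
    proof (rule SUP_least)
      fix \<rho> :: real assume "\<rho> \<in> {0<..<1}"
      then have "epowr (ennreal (integral_mean p \<rho> g)) p \<le> ennreal ?C * dom_sum p g \<Phi>"
        using mean[of \<rho>] by (simp add: integral_mean_def)
      then show "ennreal (integral_mean p \<rho> g) \<le> epowr (ennreal ?C * dom_sum p g \<Phi>) (1 / p)"
        using p by (intro epowr_le_imp_le) auto
    qed
  qed (use p in auto)
qed

section \<open>Lower and upper bounds for all four norms\<close>

definition admissible_norms :: "real \<Rightarrow> ((complex \<Rightarrow> complex) \<Rightarrow> ennreal) set" where
  "admissible_norms p = {Hinf_norm p, Hardy_norm p, Dirichlet_norm p, HL_norm p}"

theorem norm_dominates_dyad_norm:
  assumes p: "1 < p" and N: "N \<in> admissible_norms p"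
  shows "\<exists>C>0. \<forall>f. f holomorphic_on ball 0 1 \<longrightarrow> dyad_norm p f \<le> ennreal C * epowr (N f) p"
proof -
  have "\<exists>C>0. \<forall>f. f holomorphic_on ball 0 1 \<longrightarrow> dyad_norm p f \<le> ennreal C * epowr (Hinf_norm p f) p"
    using dyad_norm_le_Hinf_norm[OF _ p] by (intro exI[of _ 2]) auto
  then show ?thesis
    using N Hardy_embedding[OF p] Dirichlet_embedding[OF p] HL_embedding[OF p]
    by (auto simp: admissible_norms_def)
qed

theorem norm_le_dominated:
  assumes p: "1 < p" and N: "N \<in> admissible_norms p"
  shows "\<exists>C>0. \<forall>g \<Phi>. dominated g \<Phi> \<longrightarrow> epowr (N g) p \<le> ennreal C * dom_sum p g \<Phi>"
proof -
  have HL: "\<exists>C>0. \<forall>g \<Phi>. dominated g \<Phi> \<longrightarrow> epowr (HL_norm p g) p \<le> ennreal C * dom_sum p g \<Phi>"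
    using HL_norm_le_dominated[OF p] by (intro exI[of _ "8 powr p"]) auto
  \<comment> \<open>This norm is reached by a detour: it is at most \<open>dyad_norm\<close>, hence
    bounded by the coefficient norm, which is already controlled by \<open>dom_sum\<close>.\<close>
  have "\<exists>C>0. \<forall>g \<Phi>. dominated g \<Phi> \<longrightarrow> epowr (Hinf_norm p g) p \<le> ennreal C * dom_sum p g \<Phi>"
  proof -
    obtain C where C: "0 < C" "\<And>f. f holomorphic_on ball 0 1 \<Longrightarrow> dyad_norm p f \<le> ennreal C * epowr (HL_norm p f) p"
      using HL_embedding[OF p] by auto
    show ?thesis
    proof (intro exI[of _ "C * 8 powr p"] conjI allI impI)
      fix g \<Phi> assume dom: "dominated g \<Phi>"
      have g: "g holomorphic_on ball 0 1" using dom by (simp add: dominated_def)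
      have "epowr (Hinf_norm p g) p \<le> dyad_norm p g" by (rule Hinf_norm_le_dyad_norm[OF g p])
      also have "\<dots> \<le> ennreal C * epowr (HL_norm p g) p" by (rule C(2)[OF g])
      also have "\<dots> \<le> ennreal C * (ennreal (8 powr p) * dom_sum p g \<Phi>)"
        by (intro mult_left_mono HL_norm_le_dominated p dom) auto
      finally show "epowr (Hinf_norm p g) p \<le> ennreal (C * 8 powr p) * dom_sum p g \<Phi>"
        using C(1) by (simp add: ennreal_mult mult.assoc)
    qed (use C in auto)
  qed
  then show ?thesis
    using N HL Hardy_norm_le_dominated[OF p] Dirichlet_norm_le_dominated[OF p]
    by (auto simp: admissible_norms_def)
qed

subsection \<open>Coefficients that are products of monotone sequences\<close>

text \<open>Summation by parts. The boundary term stays on the left, since it is what bounds a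
  single coefficient later on.\<close>

lemma abel_sum_le:
  fixes c A :: "nat \<Rightarrow> real"
  assumes c0: "c 0 = 0" and c: "\<And>n. c n \<le> c (Suc n)" and A: "\<And>n. 0 \<le> A n"
    and R: "0 \<le> R" "R \<le> 1"
  shows "(\<Sum>n<N. c n * (A n - A (Suc n)) * R ^ n) + c N * A N * R ^ N
    \<le> (\<Sum>n<N. (c (Suc n) - c n) * A (Suc n) * R ^ n)"
proof (induction N)
  case 0
  then show ?case using c0 by simp
next
  case (Suc N)
  have cN: "0 \<le> c n" for n using lift_Suc_mono_le[of c 0 n, OF c] c0 by simp
  have "c (Suc N) * A (Suc N) * R ^ Suc N \<le> c (Suc N) * A (Suc N) * R ^ N"
    using cN A R by (intro mult_left_mono power_decreasing) auto
  then show ?case using Suc by (simp add: algebra_simps)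
qed

text \<open>Summation by parts turns \<open>(1 - z) g'(z)\<close> into a series whose coefficients are controlled by the
  increments of the monotone sequences \<open>c\<close> and \<open>A\<close>; no regularity of the increments is needed.\<close>

lemma dominated_of_coeffs:
  fixes c A :: "nat \<Rightarrow> real" and Ah :: "nat \<Rightarrow> complex"
  assumes g: "g holomorphic_on ball 0 1"
    and c0: "c 0 = 0" and c: "\<And>n. c n \<le> c (Suc n)" and A: "\<And>n. 0 \<le> A n" "\<And>n. A (Suc n) \<le> A n"
    and Ah: "\<And>n. norm (Ah n) \<le> A n" "\<And>n. norm (Ah n - Ah (Suc n)) \<le> A n - A (Suc n)"
    and coef: "\<And>n. of_nat n * taylor_coeff g n = of_real (c n) * Ah n"
    and summ: "\<And>r. 0 \<le> r \<Longrightarrow> r < 1 \<Longrightarrow> summable (\<lambda>m. (c (Suc m) - c m) * A (Suc m) * r ^ m)"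
  shows "dominated g (\<lambda>j. 2 * (\<Sum>m. (c (Suc m) - c m) * A (Suc m) * dyad (Suc j) ^ m))"
proof -
  define e where "e m = (c (Suc m) - c m) * A (Suc m)" for m
  have e0: "0 \<le> e m" for m unfolding e_def using c A by simp
  have cN: "0 \<le> c n" for n using lift_Suc_mono_le[of c 0 n, OF c] c0 by simp
  have sE: "summable (\<lambda>m. e m * dyad (Suc j) ^ m)" for j
    unfolding e_def by (rule summ) auto
  define E where "E j = (\<Sum>m. e m * dyad (Suc j) ^ m)" for j
  have abel: "(\<Sum>n<N. c n * (A n - A (Suc n)) * dyad (Suc j) ^ n) + c N * A N * dyad (Suc j) ^ N \<le> E j" for j N
  proof -
    have "(\<Sum>n<N. c n * (A n - A (Suc n)) * dyad (Suc j) ^ n) + c N * A N * dyad (Suc j) ^ N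
      \<le> (\<Sum>n<N. e n * dyad (Suc j) ^ n)"
      unfolding e_def by (rule abel_sum_le[OF c0 c A(1)]) (auto intro: less_imp_le)
    also have "\<dots> \<le> E j"
      unfolding E_def by (intro sum_le_suminf sE) (auto simp: e0)
    finally show ?thesis .
  qed
  have part_nonneg: "0 \<le> (\<Sum>n<N. c n * (A n - A (Suc n)) * dyad (Suc j) ^ n)" for N j
    using cN A by (intro sum_nonneg mult_nonneg_nonneg) auto
  have E0: "0 \<le> E j" for j unfolding E_def by (intro suminf_nonneg sE) (auto simp: e0)
  have coefb: "real n * norm (taylor_coeff g n) * dyad (Suc j) ^ n \<le> 2 * E j" for n j
  proof -
    have "real n * norm (taylor_coeff g n) = norm (of_nat n * taylor_coeff g n)" by (simp add: norm_mult)
    also have "\<dots> = c n * norm (Ah n)" unfolding coef using cN by (simp add: norm_mult)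
    also have "\<dots> \<le> c n * A n" by (intro mult_left_mono Ah cN)
    finally have "real n * norm (taylor_coeff g n) * dyad (Suc j) ^ n \<le> c n * A n * dyad (Suc j) ^ n"
      by (intro mult_right_mono) auto
    also have "\<dots> \<le> E j" using abel[where N = n and j = j] part_nonneg[where N = n and j = j] by linarith
    finally show ?thesis using E0[of j] by linarith
  qed
  have derivb: "norm (deriv g z) * norm (1 - z) \<le> 2 * E j" if z: "norm z \<le> dyad (Suc j)" for z j
  proof -
    define d where "d n = of_real (c n) * Ah n" for n
    have z1: "norm z < 1" using z dyad_less_1[of "Suc j"] by linarith
    have tc: "taylor_coeff (deriv g) n = d (Suc n)" for n
    proof -
      have "taylor_coeff (deriv g) n = (deriv ^^ Suc n) g 0 / fact n"
        unfolding taylor_coeff_def by (simp add: funpow_Suc_right del: funpow.simps)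
      also have "\<dots> = of_nat (Suc n) * taylor_coeff g (Suc n)"
        by (simp add: taylor_coeff_def del: of_nat_Suc funpow.simps)
      also have "\<dots> = d (Suc n)" unfolding d_def by (rule coef)
      finally show ?thesis .
    qed
    have s1: "(\<lambda>n. d (Suc n) * z ^ n) sums deriv g z"
      using taylor_sums[OF holomorphic_on_deriv_disc[OF g] z1] by (simp add: tc)
    then have "(\<lambda>n. z * (d (Suc n) * z ^ n)) sums (z * deriv g z)" by (rule sums_mult)
    then have "(\<lambda>n. d (Suc n) * z ^ Suc n) sums (z * deriv g z)" by (simp add: mult_ac)
    then have s2: "(\<lambda>n. d n * z ^ n) sums (z * deriv g z)"
      using sums_Suc_iff[of "\<lambda>n. d n * z ^ n" "z * deriv g z"] by (simp add: d_def c0)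
    have s3: "(\<lambda>n. (d (Suc n) - d n) * z ^ n) sums ((1 - z) * deriv g z)"
      using sums_diff[OF s1 s2] by (simp add: algebra_simps)
    have "norm (\<Sum>n<N. (d (Suc n) - d n) * z ^ n) \<le> 2 * E j" for N
    proof -
      \<comment> \<open>The product rule for differences. The first part sums to at most
        \<open>E j\<close>; the second contains the increments of \<open>A\<close> and is again at
        most \<open>E j\<close> after summation by parts, whence the factor 2.\<close>
      have dd: "norm (d (Suc n) - d n) \<le> e n + c n * (A n - A (Suc n))" for n
      proof -
        have "d (Suc n) - d n = of_real (c (Suc n) - c n) * Ah (Suc n) - of_real (c n) * (Ah n - Ah (Suc n))"
          by (simp add: d_def algebra_simps)
        then have "norm (d (Suc n) - d n) \<le> norm (of_real (c (Suc n) - c n) * Ah (Suc n)) + norm (of_real (c n) * (Ah n - Ah (Suc n)))"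
          by (simp only: norm_triangle_ineq4)
        also have "\<dots> = (c (Suc n) - c n) * norm (Ah (Suc n)) + c n * norm (Ah n - Ah (Suc n))"
          using c[of n] cN[of n] by (simp add: norm_mult del: of_real_diff)
        also have "\<dots> \<le> e n + c n * (A n - A (Suc n))"
          unfolding e_def using c[of n] cN[of n] by (intro add_mono mult_left_mono Ah) auto
        finally show ?thesis .
      qed
      have "norm (\<Sum>n<N. (d (Suc n) - d n) * z ^ n) \<le> (\<Sum>n<N. norm (d (Suc n) - d n) * norm z ^ n)"
        by (rule order.trans[OF norm_sum]) (simp add: norm_mult norm_power)
      also have "\<dots> \<le> (\<Sum>n<N. (e n + c n * (A n - A (Suc n))) * dyad (Suc j) ^ n)"
        using z e0 cN A by (intro sum_mono mult_mono dd power_mono) (auto intro!: add_nonneg_nonneg mult_nonneg_nonneg)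
      also have "\<dots> = (\<Sum>n<N. e n * dyad (Suc j) ^ n) + (\<Sum>n<N. c n * (A n - A (Suc n)) * dyad (Suc j) ^ n)"
        by (simp add: distrib_right sum.distrib)
      also have "\<dots> \<le> E j + E j"
      proof (rule add_mono)
        show "(\<Sum>n<N. e n * dyad (Suc j) ^ n) \<le> E j"
          unfolding E_def by (intro sum_le_suminf sE) (auto simp: e0)
        have "0 \<le> c N * A N * dyad (Suc j) ^ N" using cN A by simp
        then show "(\<Sum>n<N. c n * (A n - A (Suc n)) * dyad (Suc j) ^ n) \<le> E j"
          using abel[where N = N and j = j] by linarith
      qed
      finally show ?thesis by simp
    qed
    moreover have "(\<lambda>N. norm (\<Sum>n<N. (d (Suc n) - d n) * z ^ n)) \<longlonglongrightarrow> norm ((1 - z) * deriv g z)"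
      using s3 unfolding sums_def by (rule tendsto_norm)
    ultimately have "norm ((1 - z) * deriv g z) \<le> 2 * E j"
      by (intro LIMSEQ_le_const2[of _ "norm ((1 - z) * deriv g z)"]) auto
    then show ?thesis by (simp add: norm_mult mult.commute)
  qed
  show ?thesis
    unfolding dominated_def e_def[symmetric] E_def[symmetric]
    using g coefb derivb E0 by auto
qed

lemma taylor_coeff_unique:
  fixes a :: "nat \<Rightarrow> complex"
  assumes "\<And>z. norm z < 1 \<Longrightarrow> (\<lambda>n. a n * z ^ n) sums g z"
  shows "taylor_coeff g n = a n"
proof -
  have "summable (\<lambda>n. a n * (1 / 2) ^ n)" using assms[of "1 / 2"] by (simp add: sums_iff)
  then have "conv_radius a \<ge> ereal (norm (1 / 2 :: complex))" by (rule conv_radius_geI)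
  moreover have "(0 :: ereal) < ereal (norm (1 / 2 :: complex))" by simp
  ultimately have "0 < conv_radius a" by (rule less_le_trans[rotated])
  then have r: "0 < fps_conv_radius (Abs_fps a)"
    unfolding fps_conv_radius_def by simp
  have "a n = (deriv ^^ n) (eval_fps (Abs_fps a)) 0 / fact n"
    using fps_nth_conv_deriv[OF r, of n] by simp
  also have "(deriv ^^ n) (eval_fps (Abs_fps a)) 0 = (deriv ^^ n) g 0"
  proof (rule higher_deriv_cong_ev)
    have "eventually (\<lambda>z. z \<in> ball (0::complex) 1) (nhds 0)" by (intro eventually_nhds_in_open) auto
    then show "eventually (\<lambda>z. eval_fps (Abs_fps a) z = g z) (nhds 0)"
      by eventually_elim (use assms in \<open>auto simp: eval_fps_def sums_iff\<close>)
  qed simp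
  finally show ?thesis by (simp add: taylor_coeff_def)
qed

subsection \<open>The operators as power series\<close>

locale radial =
  fixes \<omega> :: "real \<Rightarrow> real"
  assumes radial: "radial_weight \<omega>"
begin

section \<open>The weight as a finite measure, its moments and tails\<close>

text \<open>The assumptions leave the weight arbitrary outside the interval; cutting it off allows
  integrals over the whole line.\<close>

definition \<omega>0 :: "real \<Rightarrow> real" where
  "\<omega>0 t = indicator {0..<1} t * \<omega> t"

text \<open>The weight is only Lebesgue measurable, whereas all integrands are Borel functions.
  Pushing forward along the identity restricts the weighted measure to Borel sets.\<close>

definition \<mu> :: "real measure" where
  "\<mu> = distr (density lebesgue (\<lambda>t. ennreal (\<omega>0 t))) borel (\<lambda>t. t)"

definition mom :: "nat \<Rightarrow> real" where
  "mom n = (\<integral>t. t ^ n \<partial>\<mu>)"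

definition tl :: "real \<Rightarrow> real" where
  "tl = weight_tail \<omega>"

definition w :: "nat \<Rightarrow> real" where
  "w k = tl (dyad k)"

lemma \<omega>0_nonneg: "0 \<le> \<omega>0 t"
  using radial by (auto simp: \<omega>0_def radial_weight_def split: split_indicator)

lemma \<omega>0_integrable: "integrable lebesgue \<omega>0"
  using radial by (simp add: radial_weight_def set_integrable_def \<omega>0_def[abs_def])

lemma \<omega>0_measurable [measurable]: "\<omega>0 \<in> borel_measurable lebesgue"
  using \<omega>0_integrable by auto

lemma sets_\<mu> [simp, measurable_cong]: "sets \<mu> = sets borel"
  by (simp add: \<mu>_def)

lemma space_\<mu> [simp]: "space \<mu> = UNIV"
  by (simp add: \<mu>_def)

lemma borel_imp_lebesgue: "f \<in> borel_measurable borel \<Longrightarrow> f \<in> borel_measurable lebesgue"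
  by (rule measurable_completion) simp

lemma id_measurable_density: "(\<lambda>t. t) \<in> measurable (density lebesgue (\<lambda>t. ennreal (\<omega>0 t))) borel"
  by (simp add: borel_imp_lebesgue)

lemma integral_\<mu>:
  fixes f :: "real \<Rightarrow> 'b::{banach, second_countable_topology}"
  assumes f: "f \<in> borel_measurable borel"
  shows "integrable \<mu> f \<longleftrightarrow> integrable lebesgue (\<lambda>t. \<omega>0 t *\<^sub>R f t)"
    and "integral\<^sup>L \<mu> f = (\<integral>t. \<omega>0 t *\<^sub>R f t \<partial>lebesgue)"
proof -
  have [measurable]: "f \<in> borel_measurable lebesgue" by (rule borel_imp_lebesgue[OF f])
  show "integrable \<mu> f \<longleftrightarrow> integrable lebesgue (\<lambda>t. \<omega>0 t *\<^sub>R f t)"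
    unfolding \<mu>_def
    by (subst integrable_distr_eq[OF id_measurable_density f], subst integrable_density) (auto simp: \<omega>0_nonneg)
  show "integral\<^sup>L \<mu> f = (\<integral>t. \<omega>0 t *\<^sub>R f t \<partial>lebesgue)"
    unfolding \<mu>_def
    by (subst integral_distr[OF id_measurable_density f], subst integral_density) (auto simp: \<omega>0_nonneg)
qed

lemma finite_measure_\<mu>: "finite_measure \<mu>"
proof
  have "integrable \<mu> (\<lambda>_. 1 :: real)"
    using \<omega>0_integrable by (subst integral_\<mu>) auto
  then have "(\<integral>\<^sup>+t. ennreal (norm (1::real)) \<partial>\<mu>) < \<infinity>" unfolding integrable_iff_bounded by auto
  then show "emeasure \<mu> (space \<mu>) \<noteq> \<infinity>" by (simp only: norm_one ennreal_1 nn_integral_const) auto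
qed

sublocale \<mu>: finite_measure \<mu>
  by (rule finite_measure_\<mu>)

lemma AE_\<mu>: "AE t in \<mu>. 0 \<le> t \<and> t < 1"
proof -
  have "AE t in density lebesgue (\<lambda>t. ennreal (\<omega>0 t)). 0 \<le> t \<and> t < 1"
  proof (subst AE_density)
    show "(\<lambda>t. ennreal (\<omega>0 t)) \<in> borel_measurable lebesgue" by measurable
  qed (auto simp: \<omega>0_def split: split_indicator)
  then show ?thesis
    unfolding \<mu>_def by (subst AE_distr_iff[OF id_measurable_density]) auto
qed

lemma set_integrable_\<mu>:
  fixes f :: "real \<Rightarrow> complex"
  assumes f: "f \<in> borel_measurable borel" and g: "\<And>t. 0 \<le> t \<Longrightarrow> t < 1 \<Longrightarrow> g t = f t * of_real (\<omega> t)"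
  shows "set_integrable lebesgue {0..<1} g \<longleftrightarrow> integrable \<mu> f"
    and "(LINT t:{0..<1}|lebesgue. g t) = (\<integral>t. f t \<partial>\<mu>)"
proof -
  have eq: "indicator {0..<1} t *\<^sub>R g t = \<omega>0 t *\<^sub>R f t" for t
    using g[of t] by (auto simp: \<omega>0_def scaleR_conv_of_real split: split_indicator)
  show "set_integrable lebesgue {0..<1} g \<longleftrightarrow> integrable \<mu> f"
    unfolding set_integrable_def eq by (simp add: integral_\<mu>(1)[OF f])
  show "(LINT t:{0..<1}|lebesgue. g t) = (\<integral>t. f t \<partial>\<mu>)"
    unfolding set_lebesgue_integral_def eq by (simp add: integral_\<mu>(2)[OF f])
qed

lemma moment_eq: "moment \<omega> (2 * real n + 1) = mom (2 * n + 1)"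
proof -
  have "moment \<omega> (2 * real n + 1) = (\<integral>t. \<omega>0 t *\<^sub>R (t ^ (2 * n + 1)) \<partial>lebesgue)"
    unfolding moment_def set_lebesgue_integral_def
  proof (intro Bochner_Integration.integral_cong refl)
    fix t :: real
    have "t powr (2 * real n + 1) = t ^ (2 * n + 1)" if "0 \<le> t"
      using that powr_realpow'[of t "2 * n + 1"] by (simp add: add.commute)
    then show "indicator {0..<1} t *\<^sub>R (t powr (2 * real n + 1) * \<omega> t) = \<omega>0 t *\<^sub>R (t ^ (2 * n + 1))"
      by (auto simp: \<omega>0_def split: split_indicator)
  qed
  also have "\<dots> = mom (2 * n + 1)"
    unfolding mom_def by (rule integral_\<mu>(2)[symmetric]) simp
  finally show ?thesis .
qed

lemma tl_eq: "0 \<le> r \<Longrightarrow> tl r = measure \<mu> {r..<1}"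
proof -
  assume r: "0 \<le> r"
  have "measure \<mu> {r..<1} = (\<integral>t. indicator {r..<1} t \<partial>\<mu>)" by simp
  also have "\<dots> = (\<integral>t. \<omega>0 t *\<^sub>R indicator {r..<1} t \<partial>lebesgue)"
    by (rule integral_\<mu>(2)) simp
  also have "\<dots> = tl r"
    unfolding tl_def weight_tail_def set_lebesgue_integral_def
    using r by (intro Bochner_Integration.integral_cong refl) (auto simp: \<omega>0_def split: split_indicator)
  finally show ?thesis ..
qed

lemma tl_pos: "0 \<le> r \<Longrightarrow> r < 1 \<Longrightarrow> 0 < tl r"
  using radial by (simp add: radial_weight_def tl_def)

lemma tl_antimono: "0 \<le> r \<Longrightarrow> r \<le> s \<Longrightarrow> tl s \<le> tl r"
  by (subst (1 2) tl_eq) (auto intro!: \<mu>.finite_measure_mono)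

lemma w_pos: "0 < w k"
  by (simp add: w_def tl_pos)

lemma w_antimono: "j \<le> k \<Longrightarrow> w k \<le> w j"
  by (simp add: w_def tl_antimono dyad_mono)

lemma integrable_bounded:
  fixes f :: "real \<Rightarrow> 'b::{banach, second_countable_topology}"
  assumes "f \<in> borel_measurable borel" "\<And>t. 0 \<le> t \<Longrightarrow> t < 1 \<Longrightarrow> norm (f t) \<le> B"
  shows "integrable \<mu> f"
proof (rule \<mu>.integrable_const_bound)
  show "AE t in \<mu>. norm (f t) \<le> B" using AE_\<mu> assms(2) by (auto elim: eventually_mono)
qed (use assms in simp)

lemma integrable_power: "integrable \<mu> (\<lambda>t. t ^ n)"
  by (rule integrable_bounded[where B = 1]) (auto simp: power_le_one abs_le_iff)

lemma mom_antimono: "m \<le> n \<Longrightarrow> mom n \<le> mom m"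
  unfolding mom_def
  by (rule integral_mono_AE[OF integrable_power integrable_power])
     (rule eventually_mono[OF AE_\<mu>], auto intro: power_decreasing)

lemma mom_ge:
  assumes "0 \<le> r" "r < 1"
  shows "r ^ n * tl r \<le> mom n"
proof -
  have "r ^ n * tl r = (\<integral>t. r ^ n * indicator {r..<1} t \<partial>\<mu>)"
    using assms by (simp add: tl_eq)
  also have "\<dots> \<le> mom n"
    unfolding mom_def
  proof (rule integral_mono_AE)
    show "integrable \<mu> (\<lambda>t. r ^ n * indicator {r..<1} t)"
      by (rule integrable_bounded[where B = "r ^ n"]) (use assms in \<open>auto split: split_indicator\<close>)
    show "AE t in \<mu>. r ^ n * indicator {r..<1} t \<le> t ^ n"
      using AE_\<mu> by eventually_elim (use assms in \<open>auto split: split_indicator intro: power_mono\<close>)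
  qed (rule integrable_power)
  finally show ?thesis .
qed

lemma mom_pos: "0 < mom n"
proof -
  have "0 < (1 / 2) ^ n * tl (1 / 2)" by (simp add: tl_pos)
  also have "\<dots> \<le> mom n" by (rule mom_ge) auto
  finally show ?thesis .
qed

text \<open>A dyadic interval may carry no mass, so it is given the mass of the whole tail behind
  its left end.\<close>

lemma nn_integral_\<mu>_le:
  assumes "\<And>k t. dyad k \<le> t \<Longrightarrow> t < dyad (Suc k) \<Longrightarrow> h t \<le> H k"
  shows "(\<integral>\<^sup>+t. h t \<partial>\<mu>) \<le> (\<Sum>k. H k * ennreal (w k))"
proof -
  have "(\<integral>\<^sup>+t. h t \<partial>\<mu>) = (\<integral>\<^sup>+t\<in>{0..<1}. h t \<partial>\<mu>)"
    by (rule nn_integral_cong_AE) (rule eventually_mono[OF AE_\<mu>], auto)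
  also have "\<dots> \<le> (\<Sum>k. H k * emeasure \<mu> {dyad k..<dyad (Suc k)})"
  proof (rule nn_integral_le_UN)
    show "{0..<1} \<subseteq> (\<Union>k. {dyad k..<dyad (Suc k)})"
    proof
      fix r :: real assume "r \<in> {0..<1}"
      then obtain k where "dyad k \<le> r" "r < dyad (Suc k)" using dyad_cover[of r] by auto
      then show "r \<in> (\<Union>k. {dyad k..<dyad (Suc k)})" by auto
    qed
  qed (use assms in auto)
  also have "\<dots> \<le> (\<Sum>k. H k * ennreal (w k))"
  proof (intro suminf_le mult_left_mono)
    fix k
    have "emeasure \<mu> {dyad k..<dyad (Suc k)} \<le> emeasure \<mu> {dyad k..<1}"
      using dyad_less_1[of "Suc k"] by (intro emeasure_mono) (auto simp del: dyad_less_1)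
    also have "\<dots> = ennreal (w k)" by (simp add: w_def tl_eq \<mu>.emeasure_eq_measure)
    finally show "emeasure \<mu> {dyad k..<dyad (Suc k)} \<le> ennreal (w k)" .
  qed auto
  finally show ?thesis .
qed

section \<open>Taylor coefficients of the kernel and of the images\<close>

text \<open>The coefficient of \<open>(t * z) ^ n\<close> in the averaged kernel; averaging over the
  segment brings in the factor \<open>n + 1\<close>.\<close>

definition multiplier :: "nat \<Rightarrow> real" where
  "multiplier n = 1 / (2 * (real n + 1) * mom (2 * n + 1))"

lemma multiplier_pos: "0 < multiplier n"
  using mom_pos[of "2 * n + 1"] by (simp add: multiplier_def)

text \<open>Since the tail never vanishes, moments decay more slowly than any geometric sequence:
  they are at least \<open>s ^ (2 * n + 1) * tl s\<close>, and \<open>s\<close> is chosen with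
  \<open>s\<^sup>2\<close> above \<open>norm x\<close>.\<close>

lemma summable_mom:
  assumes x: "norm (x :: complex) < 1"
  shows "summable (\<lambda>n. norm (x ^ n / of_real (2 * mom (2 * n + 1))))"
proof -
  obtain s where s: "norm x < s\<^sup>2" "0 < s" "s < 1"
  proof -
    obtain y where y: "norm x < y" "y < 1" using dense[OF x] by auto
    have "0 < y" using y norm_ge_zero[of x] by linarith
    then show thesis using y by (intro that[of "sqrt y"]) auto
  qed
  have tp: "0 < tl s" using s by (intro tl_pos) auto
  show ?thesis
  proof (rule summable_comparison_test')
    show "summable (\<lambda>n. (1 / (2 * s * tl s)) * (norm x / s\<^sup>2) ^ n)"
      using s by (intro summable_mult summable_geometric) auto
    show "norm (norm (x ^ n / of_real (2 * mom (2 * n + 1)))) \<le> (1 / (2 * s * tl s)) * (norm x / s\<^sup>2) ^ n" for n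
    proof -
      have "norm (x ^ n / of_real (2 * mom (2 * n + 1))) = norm x ^ n / (2 * mom (2 * n + 1))"
        using mom_pos[of "2 * n + 1"] by (simp add: norm_divide norm_power norm_mult)
      also have "\<dots> \<le> norm x ^ n / (2 * (s ^ (2 * n + 1) * tl s))"
        using s tp mom_ge[of s "2 * n + 1"] by (intro divide_left_mono mult_left_mono) (auto intro!: mult_pos_pos mom_pos)
      also have "\<dots> = (1 / (2 * s * tl s)) * (norm x / s\<^sup>2) ^ n"
      proof -
        have "s ^ (2 * n + 1) = s * (s\<^sup>2) ^ n" by (simp add: power_mult)
        then show ?thesis by (simp only: power_divide times_divide_times_eq mult_1 mult.assoc mult.commute mult.left_commute)
      qed
      finally show ?thesis by simp
    qed
  qed
qed

lemma bergman_sums: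
  assumes "0 \<le> t" "t < 1" "norm \<zeta> < 1"
  shows "(\<lambda>n. of_real (t ^ n / (2 * mom (2 * n + 1))) * \<zeta> ^ n) sums bergman_kernel \<omega> (of_real t) \<zeta>"
proof -
  have "norm (of_real t * \<zeta>) < 1"
  proof -
    have "norm (of_real t * \<zeta>) \<le> 1 * norm \<zeta>"
      unfolding norm_mult using assms by (intro mult_right_mono) auto
    then show ?thesis using assms by simp
  qed
  then have "summable (\<lambda>n. (of_real t * \<zeta>) ^ n / of_real (2 * mom (2 * n + 1)))"
    by (intro summable_norm_cancel[OF summable_mom])
  then have "(\<lambda>n. (of_real t * \<zeta>) ^ n / of_real (2 * mom (2 * n + 1))) sums bergman_kernel \<omega> (of_real t) \<zeta>"
    unfolding bergman_kernel_def moment_eq by (simp add: summable_sums)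
  then show ?thesis by (simp add: power_mult_distrib)
qed

text \<open>The kernel series is integrated termwise to a primitive \<open>P\<close> with
  \<open>P 0 = 0\<close>, so the contour integral is \<open>P z\<close>. The value prescribed at
  \<open>z = 0\<close> is the constant term of the resulting series.\<close>

lemma averaged_kernel_sums:
  assumes t: "0 \<le> t" "t < 1" and z: "norm z < 1"
  shows "(\<lambda>n. of_real (multiplier n * t ^ n) * z ^ n) sums averaged_kernel \<omega> t z"
proof -
  define b :: "nat \<Rightarrow> complex" where "b n = of_real (t ^ n / (2 * mom (2 * n + 1)))" for n
  have lamb: "of_real (multiplier n * t ^ n) = b n / of_nat (Suc n)" for n
    by (simp add: b_def multiplier_def add.commute mult_ac)
  \<comment> \<open>The coefficients of the primitive \<open>P\<close>: those of the kernel, shifted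
    by one and divided by the new index.\<close>
  define diff_coeff where "diff_coeff n = (case n of 0 \<Rightarrow> 0 | Suc m \<Rightarrow> b m / of_nat (Suc m))" for n
  have sb: "summable (\<lambda>n. norm (b n * \<zeta> ^ n))" if "norm \<zeta> < 1" for \<zeta>
  proof (rule summable_comparison_test'[OF summable_mom[OF that]])
    fix n
    have "norm (b n * \<zeta> ^ n) = t ^ n * norm (\<zeta> ^ n / of_real (2 * mom (2 * n + 1)))"
      using t by (simp add: b_def norm_mult norm_divide norm_power)
    also have "\<dots> \<le> 1 * norm (\<zeta> ^ n / of_real (2 * mom (2 * n + 1)))"
      using t by (intro mult_right_mono power_le_one) auto
    finally show "norm (norm (b n * \<zeta> ^ n)) \<le> norm (\<zeta> ^ n / of_real (2 * mom (2 * n + 1)))" by simp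
  qed
  have scc: "summable (\<lambda>n. diff_coeff n * \<zeta> ^ n)" if "norm \<zeta> < 1" for \<zeta>
  proof -
    have "summable (\<lambda>n. diff_coeff (Suc n) * \<zeta> ^ Suc n)"
    proof (rule summable_comparison_test'[OF sb[OF that]])
      fix n
      have "norm (diff_coeff (Suc n) * \<zeta> ^ Suc n) = norm (b n * \<zeta> ^ n) * (norm \<zeta> / real (Suc n))"
        by (simp add: diff_coeff_def norm_mult norm_divide norm_power del: of_nat_Suc)
      also have "\<dots> \<le> norm (b n * \<zeta> ^ n) * 1"
      proof (intro mult_left_mono)
        have "norm \<zeta> \<le> real (Suc n)" using that by simp
        then show "norm \<zeta> / real (Suc n) \<le> 1" by (simp del: of_nat_Suc)
      qed auto
      finally show "norm (diff_coeff (Suc n) * \<zeta> ^ Suc n) \<le> norm (b n * \<zeta> ^ n)" by simp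
    qed
    then show ?thesis using summable_Suc_iff[of "\<lambda>n. diff_coeff n * \<zeta> ^ n"] by blast
  qed
  define P where "P \<zeta> = (\<Sum>n. diff_coeff n * \<zeta> ^ n)" for \<zeta>
  have dP: "(P has_field_derivative bergman_kernel \<omega> (of_real t) \<zeta>) (at \<zeta>)" if \<zeta>: "norm \<zeta> < 1" for \<zeta>
  proof -
    obtain y where y: "norm \<zeta> < y" "y < 1" using dense[OF \<zeta>] by auto
    have y0: "0 \<le> y" using y norm_ge_zero[of \<zeta>] by linarith
    have "((\<lambda>x. \<Sum>n. diff_coeff n * x ^ n) has_field_derivative (\<Sum>n. diffs diff_coeff n * \<zeta> ^ n)) (at \<zeta>)"
      using y y0 by (intro termdiffs_strong[where K = "of_real y"] scc) auto
    moreover have "diffs diff_coeff = b" by (auto simp: diffs_def diff_coeff_def fun_eq_iff simp del: of_nat_Suc)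
    moreover have "(\<Sum>n. b n * \<zeta> ^ n) = bergman_kernel \<omega> (of_real t) \<zeta>"
      using bergman_sums[OF t \<zeta>] unfolding b_def by (simp add: sums_iff)
    ultimately show ?thesis unfolding P_def by simp
  qed
  have s: "(\<lambda>n. of_real (multiplier n * t ^ n) * z ^ n) sums (if z = 0 then bergman_kernel \<omega> (of_real t) 0 else 1 / z * P z)"
  proof (cases "z = 0")
    case True
    have "(\<lambda>n. b n * 0 ^ n) sums bergman_kernel \<omega> (of_real t) 0"
      using bergman_sums[OF t, of 0] by (simp add: b_def)
    moreover have "(\<lambda>n. b n * 0 ^ n) sums b 0" using powser_sums_zero[of b] by simp
    ultimately have "bergman_kernel \<omega> (of_real t) 0 = b 0" by (rule sums_unique2)
    moreover have "of_real (multiplier 0 * t ^ 0) = b 0" unfolding lamb by simp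
    ultimately show ?thesis
      using powser_sums_zero[of "\<lambda>n. of_real (multiplier n * t ^ n) :: complex"] True by simp
  next
    case False
    have "(\<lambda>n. diff_coeff n * z ^ n) sums P z" unfolding P_def using scc[OF z] by (rule summable_sums)
    then have "(\<lambda>n. diff_coeff (Suc n) * z ^ Suc n) sums P z"
      using sums_Suc_iff[of "\<lambda>n. diff_coeff n * z ^ n" "P z"] by (simp add: diff_coeff_def)
    then have "(\<lambda>n. 1 / z * (diff_coeff (Suc n) * z ^ Suc n)) sums (1 / z * P z)" by (rule sums_mult)
    moreover have "1 / z * (diff_coeff (Suc n) * z ^ Suc n) = of_real (multiplier n * t ^ n) * z ^ n" for n
      unfolding lamb diff_coeff_def using False by simp
    ultimately show ?thesis using False by simp
  qed
  have "contour_integral (linepath 0 z) (bergman_kernel \<omega> (of_real t)) = P z - P 0"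
  proof -
    have "(bergman_kernel \<omega> (of_real t) has_contour_integral (P (pathfinish (linepath 0 z)) - P (pathstart (linepath 0 z)))) (linepath 0 z)"
    proof (rule contour_integral_primitive[where S = "ball 0 1" and f = P and f' = "bergman_kernel \<omega> (of_real t)" and g = "linepath 0 z"])
      show "(P has_field_derivative bergman_kernel \<omega> (of_real t) x) (at x within ball 0 1)" if "x \<in> ball 0 1" for x
        using that by (intro has_field_derivative_at_within[OF dP]) auto
      have "closed_segment 0 z \<subseteq> ball 0 1"
        using z by (intro closed_segment_subset) auto
      then show "path_image (linepath 0 z) \<subseteq> ball 0 1" by simp
    qed auto
    then show ?thesis by (simp add: contour_integral_unique)
  qed
  moreover have "P 0 = 0" unfolding P_def by (subst powser_zero) (simp add: diff_coeff_def)
  ultimately have "averaged_kernel \<omega> t z = (if z = 0 then bergman_kernel \<omega> (of_real t) 0 else 1 / z * P z)"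
    unfolding averaged_kernel_def by simp
  then show ?thesis using s by (simp only:)
qed

text \<open>Integrability of \<open>G\<close> against the weight suffices: at each point of the disc
  the kernel series has a convergent majorant that does not depend on \<open>t\<close>, so series
  and integral may be exchanged. The operator thus acts on the moments of \<open>G\<close> as a
  multiplier.\<close>

lemma kernel_op_series:
  fixes G :: "real \<Rightarrow> complex"
  assumes G: "continuous_on {0..<1} G" and fin: "(\<integral>\<^sup>+t. ennreal (norm (G t) * indicator {0..<1} t) \<partial>\<mu>) < \<infinity>"
  defines "G0 \<equiv> \<lambda>t. indicator {0..<1} t *\<^sub>R G t"
  shows "\<exists>g. kernel_op (averaged_kernel \<omega>) \<omega> G = Some g \<and> g holomorphic_on ball 0 1 \<and>
    (\<forall>n. taylor_coeff g n = of_real (multiplier n) * (\<integral>t. G0 t * of_real (t ^ n) \<partial>\<mu>)) \<and>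
    (\<forall>n. integrable \<mu> (\<lambda>t. G0 t * of_real (t ^ n)))"
proof -
  have [measurable]: "G0 \<in> borel_measurable borel"
    unfolding G0_def by (rule borel_measurable_continuous_on_indicator[OF _ G]) simp
  have G0int: "integrable \<mu> G0"
  proof (rule integrableI_bounded)
    have "norm (G0 t) = norm (G t) * indicator {0..<1} t" for t
      by (auto simp: G0_def split: split_indicator)
    then show "(\<integral>\<^sup>+t. ennreal (norm (G0 t)) \<partial>\<mu>) < \<infinity>" using fin by simp
  qed simp
  have int: "integrable \<mu> (\<lambda>t. G0 t * of_real (t ^ n))" for n
  proof (rule Bochner_Integration.integrable_bound[OF G0int])
    show "AE t in \<mu>. norm (G0 t * of_real (t ^ n)) \<le> norm (G0 t)"
      using AE_\<mu>
    proof eventually_elim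
      case (elim t)
      then have "norm (G0 t) * t ^ n \<le> norm (G0 t) * 1" by (intro mult_left_mono power_le_one) auto
      then show ?case using elim by (simp add: norm_mult norm_power)
    qed
  qed simp
  define a where "a n = of_real (multiplier n) * (\<integral>t. G0 t * of_real (t ^ n) \<partial>\<mu>)" for n
  define h where "h z t = (\<Sum>n. G0 t * of_real (t ^ n) * (of_real (multiplier n) * z ^ n))" for z t
  have slam: "summable (\<lambda>n. multiplier n * norm z ^ n)" if "norm z < 1" for z :: complex
  proof (rule summable_comparison_test'[OF summable_mom[OF that]])
    fix n
    have "multiplier n \<le> 1 / (1 * (2 * mom (2 * n + 1)))"
      unfolding multiplier_def mult.assoc mult.left_commute[of 2]
      using mom_pos[of "2 * n + 1"] by (intro divide_left_mono mult_right_mono) (auto intro!: mult_pos_pos)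
    then have "multiplier n * norm z ^ n \<le> 1 / (1 * (2 * mom (2 * n + 1))) * norm z ^ n"
      by (intro mult_right_mono) auto
    then have "multiplier n * norm z ^ n \<le> norm z ^ n / (2 * mom (2 * n + 1))" by simp
    then show "norm (multiplier n * norm z ^ n) \<le> norm (z ^ n / of_real (2 * mom (2 * n + 1)))"
      using mom_pos[of "2 * n + 1"] multiplier_pos[of n] by (simp add: norm_divide norm_power norm_mult abs_mult)
  qed
  have key: "integrable \<mu> (h z) \<and> (\<lambda>n. a n * z ^ n) sums (\<integral>t. h z t \<partial>\<mu>)" if z: "norm z < 1" for z
  proof -
    let ?f = "\<lambda>n t. G0 t * of_real (t ^ n) * (of_real (multiplier n) * z ^ n)"
    have i: "integrable \<mu> (?f n)" for n by (intro integrable_mult_left int)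
    have nb: "norm (?f n t) \<le> norm (G0 t) * (multiplier n * norm z ^ n)" if "0 \<le> t \<and> t < 1" for n t
    proof -
      have "norm (?f n t) = norm (G0 t) * t ^ n * (multiplier n * norm z ^ n)"
        using that multiplier_pos[of n] by (simp add: norm_mult norm_power)
      also have "\<dots> \<le> norm (G0 t) * 1 * (multiplier n * norm z ^ n)"
        using that multiplier_pos[of n] by (intro mult_right_mono mult_left_mono power_le_one) auto
      finally show ?thesis by simp
    qed
    have ae: "AE t in \<mu>. summable (\<lambda>n. norm (?f n t))"
      using AE_\<mu>
    proof eventually_elim
      case (elim t)
      show ?case
      proof (rule summable_comparison_test'[of "\<lambda>n. norm (G0 t) * (multiplier n * norm z ^ n)"])
        show "summable (\<lambda>n. norm (G0 t) * (multiplier n * norm z ^ n))" by (intro summable_mult slam z)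
        show "norm (norm (?f n t)) \<le> norm (G0 t) * (multiplier n * norm z ^ n)" for n
          using nb[OF elim, of n] by simp
      qed
    qed
    have sn: "summable (\<lambda>n. \<integral>t. norm (?f n t) \<partial>\<mu>)"
    proof (rule summable_comparison_test'[of "\<lambda>n. (\<integral>t. norm (G0 t) \<partial>\<mu>) * (multiplier n * norm z ^ n)"])
      show "summable (\<lambda>n. (\<integral>t. norm (G0 t) \<partial>\<mu>) * (multiplier n * norm z ^ n))" by (intro summable_mult slam z)
      fix n
      have "(\<integral>t. norm (?f n t) \<partial>\<mu>) \<le> (\<integral>t. norm (G0 t) * (multiplier n * norm z ^ n) \<partial>\<mu>)"
      proof (rule integral_mono_AE)
        show "integrable \<mu> (\<lambda>t. norm (?f n t))" by (intro integrable_norm i)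
        show "integrable \<mu> (\<lambda>t. norm (G0 t) * (multiplier n * norm z ^ n))" by (intro integrable_mult_left integrable_norm G0int)
        show "AE t in \<mu>. norm (?f n t) \<le> norm (G0 t) * (multiplier n * norm z ^ n)"
          using AE_\<mu> by eventually_elim (rule nb)
      qed
      then show "norm (\<integral>t. norm (?f n t) \<partial>\<mu>) \<le> (\<integral>t. norm (G0 t) \<partial>\<mu>) * (multiplier n * norm z ^ n)"
        by simp
    qed
    have 1: "integrable \<mu> (\<lambda>t. \<Sum>n. ?f n t)" by (rule integrable_suminf[OF i ae sn])
    have 2: "(\<lambda>n. \<integral>t. ?f n t \<partial>\<mu>) sums (\<integral>t. (\<Sum>n. ?f n t) \<partial>\<mu>)" by (rule sums_integral[OF i ae sn])
    have 3: "(\<integral>t. ?f n t \<partial>\<mu>) = a n * z ^ n" for n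
      by (subst integral_mult_left_zero) (simp add: a_def mult_ac)
    show ?thesis using 1 2 unfolding 3 h_def[abs_def] by (rule conjI)
  qed
  have hm: "h z \<in> borel_measurable borel" if "norm z < 1" for z
    using borel_measurable_integrable[OF conjunct1[OF key[OF that]]] by simp
  have hK: "G t * averaged_kernel \<omega> t z * of_real (\<omega> t) = h z t * of_real (\<omega> t)" if "norm z < 1" "0 \<le> t" "t < 1" for z t
  proof -
    have "(\<lambda>n. G0 t * (of_real (multiplier n * t ^ n) * z ^ n)) sums (G0 t * averaged_kernel \<omega> t z)"
      by (intro sums_mult averaged_kernel_sums that)
    then have "(\<lambda>n. G0 t * of_real (t ^ n) * (of_real (multiplier n) * z ^ n)) sums (G0 t * averaged_kernel \<omega> t z)"
      by (simp add: mult_ac)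
    then have "h z t = G0 t * averaged_kernel \<omega> t z" unfolding h_def by (rule sums_unique[symmetric])
    then show ?thesis using that by (simp add: G0_def)
  qed
  define g where "g z = (LINT t:{0..<1}|lebesgue. G t * averaged_kernel \<omega> t z * of_real (\<omega> t))" for z
  have "set_integrable lebesgue {0..<1} (\<lambda>t. G t * averaged_kernel \<omega> t z * of_real (\<omega> t))" if "z \<in> ball 0 1" for z
    using that key[of z] set_integrable_\<mu>(1)[OF hm, of z "\<lambda>t. G t * averaged_kernel \<omega> t z * of_real (\<omega> t)"] hK[of z] by auto
  then have op: "kernel_op (averaged_kernel \<omega>) \<omega> G = Some g"
    unfolding kernel_op_def g_def by auto
  have gs: "(\<lambda>n. a n * (z - 0) ^ n) sums g z" if z: "z \<in> ball 0 1" for z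
  proof -
    have "g z = (\<integral>t. h z t \<partial>\<mu>)"
      unfolding g_def using z hK[of z] by (intro set_integrable_\<mu>(2) hm) auto
    then show ?thesis using key[of z] z by simp
  qed
  have gh: "g holomorphic_on ball 0 1"
    by (rule power_series_holomorphic[of 0 1 a]) (use gs in auto)
  have "taylor_coeff g n = a n" for n
    by (rule taylor_coeff_unique) (use gs in auto)
  with op gh int show ?thesis unfolding a_def by blast
qed

end

subsection \<open>Dyadic conditions on the weight\<close>

lemma power_le_fact_exp:
  fixes x :: real
  assumes "0 \<le> x"
  shows "x ^ m \<le> fact m * exp x"
proof -
  have "(\<Sum>n\<in>{m}. x ^ n /\<^sub>R fact n) \<le> exp x"
    unfolding exp_def using assms by (intro sum_le_suminf summable_exp_generic) auto
  then show ?thesis by (simp add: field_simps)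
qed

text \<open>\<open>C ^ d\<close> is at most a fixed power of \<open>2 ^ d\<close>, which the
  exponential of \<open>2 ^ d\<close> beats. In this way the decay of powers of the radius absorbs
  any doubling constant.\<close>

lemma power_exp_bounded:
  "\<exists>B>0. \<forall>d. C ^ d * exp (- (2 ^ d)) \<le> (B::real)"
proof -
  obtain m where m: "\<bar>C\<bar> < 2 ^ m" using real_arch_pow[of 2 "\<bar>C\<bar>"] by auto
  show ?thesis
  proof (intro exI[of _ "fact m"] conjI allI)
    fix d
    have "C ^ d \<le> \<bar>C\<bar> ^ d" by (metis abs_ge_self power_abs)
    also have "\<dots> \<le> (2 ^ m) ^ d" using m by (intro power_mono) auto
    also have "\<dots> = (2 ^ d) ^ m" by (simp add: power_mult[symmetric] mult.commute)
    also have "\<dots> \<le> fact m * exp (2 ^ d)" by (intro power_le_fact_exp) auto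
    finally show "C ^ d * exp (- (2 ^ d)) \<le> fact m" by (simp add: exp_minus field_simps)
  qed auto
qed

context radial
begin

definition tail_doubling :: bool where
  "tail_doubling \<longleftrightarrow> (\<exists>C. \<forall>k. w k \<le> C * w (Suc k))"

lemma tail_doublingD:
  assumes tail_doubling
  shows "\<exists>C\<ge>1. \<forall>j k. j \<le> k \<longrightarrow> w j \<le> C ^ (k - j) * w k"
proof -
  obtain C0 where C0: "\<And>k. w k \<le> C0 * w (Suc k)" using assms by (auto simp: tail_doubling_def)
  define C where "C = max 1 C0"
  have C: "w k \<le> C * w (Suc k)" for k
  proof -
    have "C0 * w (Suc k) \<le> C * w (Suc k)" using w_pos[of "Suc k"] by (intro mult_right_mono) (auto simp: C_def)
    then show ?thesis using C0[of k] by linarith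
  qed
  have "w j \<le> C ^ (k - j) * w k" if "j \<le> k" for j k
    using that
  proof (induction k rule: dec_induct)
    case base
    then show ?case by simp
  next
    case (step n)
    have "C ^ (n - j) * w n \<le> C ^ (n - j) * (C * w (Suc n))"
      using C[of n] by (intro mult_left_mono) (auto simp: C_def)
    then show ?case using step by (simp add: Suc_diff_le mult_ac)
  qed
  then show ?thesis by (intro exI[of _ C]) (auto simp: C_def)
qed

text \<open>From \<open>r\<close> to \<open>(1 + r) / 2\<close> is covered by two dyadic steps.
  Adding 1 to the constant makes it exceed 1, as \<open>D_hat\<close> demands.\<close>

lemma D_hat_iff: "\<omega> \<in> D_hat \<longleftrightarrow> tail_doubling"
proof
  assume "\<omega> \<in> D_hat"
  then obtain C where C: "\<forall>r\<in>{0..<1}. tl r \<le> C * tl ((1 + r) / 2)"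
    by (auto simp: D_hat_def tl_def)
  have "(1 + dyad k) / 2 = dyad (Suc k)" for k by (simp add: dyad_def field_simps)
  then have "w k \<le> C * w (Suc k)" for k using bspec[OF C, of "dyad k"] by (simp add: w_def)
  then show tail_doubling by (auto simp: tail_doubling_def)
next
  assume tail_doubling
  from tail_doublingD[OF this] obtain C where C: "1 \<le> C" "\<And>j k. j \<le> k \<Longrightarrow> w j \<le> C ^ (k - j) * w k"
    by auto
  have "tl r \<le> (C + 1) ^ 2 * tl ((1 + r) / 2)" if r: "0 \<le> r" "r < 1" for r
  proof -
    obtain k where k: "dyad k \<le> r" "r < dyad (Suc k)" using dyad_cover[OF r] .
    have "tl r \<le> w k" unfolding w_def using k by (intro tl_antimono) auto
    also have "\<dots> \<le> C ^ 2 * w (k + 2)" using C(2)[of k "k + 2"] by simp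
    also have "\<dots> \<le> C ^ 2 * tl ((1 + r) / 2)"
      unfolding w_def using k r C(1) by (intro mult_left_mono tl_antimono) (auto simp: dyad_def)
    also have "\<dots> \<le> (C + 1) ^ 2 * tl ((1 + r) / 2)"
      using C(1) r tl_pos[of "(1 + r) / 2"] by (intro mult_right_mono power_mono) auto
    finally show ?thesis .
  qed
  moreover have "1 < (C + 1) ^ 2" using C(1) by (simp add: power2_eq_square) (smt (verit) mult_less_cancel_left2 mult_less_cancel_right2)
  ultimately show "\<omega> \<in> D_hat" by (auto simp: D_hat_def tl_def)
qed

text \<open>With \<open>u k = w k * 2 powr (k / p)\<close> and \<open>q = p / (p - 1)\<close> the sums below are
  the sums of \<open>u k powr q\<close>.\<close>

definition tail_sum_bound :: "real \<Rightarrow> bool" where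
  "tail_sum_bound q \<longleftrightarrow> (\<exists>C. \<forall>j M. (\<Sum>k=j..M. w k powr q * 2 powr (real k * (q - 1))) \<le> C * (w j powr q * 2 powr (real j * (q - 1))))"

text \<open>The tail sums satisfy \<open>s (Suc j) = s j - v j\<close> with \<open>v j\<close> at
  least \<open>s j / C\<close>, so each step shrinks them by the factor \<open>1 - 1 / C\<close>.
  They decay geometrically and with them their first terms. The \<open>q\<close>-th root of
  \<open>v k\<close> is \<open>w k * 2 powr (k / p)\<close>, which accounts for the powers of
  \<open>gam p\<close>.\<close>

lemma tail_sum_bound_decay:
  assumes pq: "1 < p" "1 < q" "1 / p + 1 / q = 1" and G: "tail_sum_bound q"
  obtains C g where "0 < C" "0 < g" "g < 1" "\<And>j k. j \<le> k \<Longrightarrow> w k \<le> C * (g ^ (k - j) * gam p ^ (k - j)) * w j"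
proof -
  define v where "v k = w k powr q * 2 powr (real k * (q - 1))" for k
  have v0: "0 < v k" for k using w_pos[of k] by (simp add: v_def)
  obtain C0 where C0: "\<And>j M. (\<Sum>k=j..M. v k) \<le> C0 * v j" using G by (auto simp: tail_sum_bound_def v_def)
  define C where "C = max 2 C0"
  have C: "(\<Sum>k=j..M. v k) \<le> C * v j" for j M
  proof -
    have "C0 * v j \<le> C * v j" using v0[of j] by (intro mult_right_mono) (auto simp: C_def)
    then show ?thesis using C0[of j M] by linarith
  qed
  have C2: "2 \<le> C" by (simp add: C_def)
  define s where "s j M = (\<Sum>k=j..M. v k)" for j M
  have s0: "0 \<le> s j M" for j M unfolding s_def by (intro sum_nonneg less_imp_le v0)
  define \<theta> where "\<theta> = 1 - 1 / C"
  have \<theta>: "0 < \<theta>" "\<theta> < 1" using C2 by (auto simp: \<theta>_def)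
  have step: "s (Suc j) M \<le> \<theta> * s j M" if "j \<le> M" for j M
  proof -
    have "s j M = v j + s (Suc j) M" unfolding s_def using that by (rule sum.atLeast_Suc_atMost)
    moreover have "s j M / C \<le> v j" using C[of j M] C2 by (simp add: s_def divide_le_eq mult.commute)
    moreover have "\<theta> * s j M = s j M - s j M / C" by (simp add: \<theta>_def algebra_simps)
    ultimately show ?thesis by linarith
  qed
  have iter: "s k M \<le> \<theta> ^ (k - j) * s j M" if "j \<le> k" "k \<le> M" for j k M
    using that
  proof (induction k rule: dec_induct)
    case base
    then show ?case by simp
  next
    case (step n)
    have "s (Suc n) M \<le> \<theta> * s n M" using step by (intro \<open>\<And>j M. j \<le> M \<Longrightarrow> s (Suc j) M \<le> \<theta> * s j M\<close>) auto
    also have "\<dots> \<le> \<theta> * (\<theta> ^ (n - j) * s j M)" using step \<theta> by (intro mult_left_mono) auto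
    finally show ?case using step by (simp add: Suc_diff_le)
  qed
  have vk: "v k \<le> \<theta> ^ (k - j) * (C * v j)" if "j \<le> k" for j k
  proof -
    have "v k = s k k" by (simp add: s_def)
    also have "\<dots> \<le> \<theta> ^ (k - j) * s j k" using that by (intro iter) auto
    also have "\<dots> \<le> \<theta> ^ (k - j) * (C * v j)" unfolding s_def using \<theta> by (intro mult_left_mono C) auto
    finally show ?thesis .
  qed
  define g where "g = \<theta> powr (1 / q)"
  have "(q - 1) * p = q" using pq by (simp add: field_simps)
  then have qp: "(q - 1) / q = 1 / p" using pq by (simp add: field_simps)
  have vq: "v k powr (1 / q) = w k * 2 powr (real k / p)" for k
  proof -
    have "v k powr (1 / q) = w k powr (q * (1 / q)) * 2 powr (real k * ((q - 1) / q))"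
      unfolding v_def using w_pos[of k] by (simp add: powr_mult powr_powr)
    then show ?thesis using w_pos[of k] pq unfolding qp by simp
  qed
  have "w k \<le> C powr (1 / q) * (g ^ (k - j) * gam p ^ (k - j)) * w j" if jk: "j \<le> k" for j k
  proof -
    have "v k powr (1 / q) \<le> (\<theta> ^ (k - j) * (C * v j)) powr (1 / q)"
      using vk[OF jk] v0[of k] pq by (intro powr_mono2) auto
    also have "\<dots> = g ^ (k - j) * (C powr (1 / q) * v j powr (1 / q))"
      using \<theta> C2 v0[of j] by (simp add: powr_mult g_def powr_powr mult.commute flip: powr_realpow)
    finally have "w k * 2 powr (real k / p) * 2 powr (- (real k / p)) \<le> g ^ (k - j) * (C powr (1 / q) * (w j * 2 powr (real j / p))) * 2 powr (- (real k / p))"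
      unfolding vq by (intro mult_right_mono) auto
    moreover have "2 powr (real k / p) * 2 powr (- (real k / p)) = (1::real)" by (simp flip: powr_add)
    moreover have "2 powr (real j / p) * 2 powr (- (real k / p)) = gam p ^ (k - j)"
      unfolding gam_power using jk pq by (simp add: powr_add[symmetric] of_nat_diff diff_divide_distrib)
    ultimately show ?thesis by (simp only: mult_ac)
  qed
  moreover have "0 < g" "g < 1"
    using \<theta> pq powr_less_mono2[of "1 / q" \<theta> 1] by (auto simp: g_def)
  ultimately show thesis using C2 by (intro that[of "C powr (1 / q)" g]) auto
qed

section \<open>Moments of a doubling weight\<close>

lemma ennreal_mom: "ennreal (mom n) = (\<integral>\<^sup>+t. ennreal (t ^ n * indicator {0..<1} t) \<partial>\<mu>)"
proof -
  have "ennreal (mom n) = ennreal (\<integral>t. t ^ n * indicator {0..<1} t \<partial>\<mu>)"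
    unfolding mom_def by (intro arg_cong[of _ _ ennreal] integral_cong_AE)
      (auto intro!: eventually_mono[OF AE_\<mu>])
  also have "\<dots> = (\<integral>\<^sup>+t. ennreal (t ^ n * indicator {0..<1} t) \<partial>\<mu>)"
    by (intro nn_integral_eq_integral[symmetric] integrable_bounded[where B = 1])
       (auto simp: power_le_one split: split_indicator)
  finally show ?thesis .
qed

lemma dyad_power_le_exp: "dyad k ^ n \<le> exp (- (real n * (1 / 2) ^ k))"
proof -
  have "dyad k ^ n \<le> exp (- ((1 / 2) ^ k)) ^ n"
    using exp_ge_add_one_self[of "- ((1 / 2 :: real) ^ k)"] by (intro power_mono) (auto simp: dyad_def power_le_one)
  then show ?thesis by (simp flip: exp_of_nat_mult)
qed

text \<open>Radii beyond \<open>dyad k\<close> contribute at most \<open>w k\<close>. On an earlier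
  dyadic interval \<open>i\<close> the integrand is at most
  \<open>exp (- (2 ^ (k - Suc i)))\<close>, whereas doubling lets the tail grow only geometrically
  in \<open>k - i\<close>.\<close>

lemma mom_le:
  assumes tail_doubling
  obtains C where "0 < C" "\<And>k. mom (2 ^ k) \<le> C * w k"
proof -
  obtain C where C: "1 \<le> C" "\<And>j k. j \<le> k \<Longrightarrow> w j \<le> C ^ (k - j) * w k"
    using tail_doublingD[OF assms] by auto
  \<comment> \<open>The base \<open>2 * C\<close> rather than \<open>C\<close> leaves a factor
    \<open>(1 / 2) ^ d\<close> to sum over.\<close>
  obtain B where B: "0 < B" "\<And>d. (2 * C) ^ d * exp (- (2 ^ d)) \<le> B" using power_exp_bounded[of "2 * C"] by auto
  have "mom (2 ^ k) \<le> (1 + 2 * C * B) * w k" for k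
  proof -
    define H where "H i = (if i < k then dyad (Suc i) ^ (2 ^ k) else 0)" for i
    have H0: "0 \<le> H i" for i by (simp add: H_def)
    have "ennreal (mom (2 ^ k)) \<le> (\<integral>\<^sup>+t. indicator {dyad k..<1} t + ennreal (t ^ (2 ^ k) * indicator {0..<dyad k} t) \<partial>\<mu>)"
      unfolding ennreal_mom
    proof (rule nn_integral_mono)
      fix t :: real
      have "t ^ (2 ^ k) \<le> 1" if "0 \<le> t" "t < 1" using that by (intro power_le_one) auto
      then show "ennreal (t ^ (2 ^ k) * indicator {0..<1} t) \<le> indicator {dyad k..<1} t + ennreal (t ^ (2 ^ k) * indicator {0..<dyad k} t)"
        by (auto split: split_indicator simp: not_less)
    qed
    also have "\<dots> = ennreal (w k) + (\<integral>\<^sup>+t. ennreal (t ^ (2 ^ k) * indicator {0..<dyad k} t) \<partial>\<mu>)"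
      by (subst nn_integral_add) (auto simp: w_def tl_eq \<mu>.emeasure_eq_measure)
    also have "(\<integral>\<^sup>+t. ennreal (t ^ (2 ^ k) * indicator {0..<dyad k} t) \<partial>\<mu>) \<le> (\<Sum>i. ennreal (H i) * ennreal (w i))"
    proof (rule nn_integral_\<mu>_le)
      fix i t assume t: "dyad i \<le> t" "t < dyad (Suc i)"
      show "ennreal (t ^ (2 ^ k) * indicator {0..<dyad k} t) \<le> ennreal (H i)"
      proof (cases "i < k")
        case True
        have "0 \<le> t" using t dyad_nonneg[of i] by linarith
        then show ?thesis using True t by (auto simp: H_def intro!: ennreal_leI power_mono split: split_indicator)
      next
        case False
        then show ?thesis using t dyad_mono[of k i] by (auto simp: H_def split: split_indicator)
      qed
    qed
    also have "(\<Sum>i. ennreal (H i) * ennreal (w i)) = (\<Sum>i<k. ennreal (H i) * ennreal (w i))"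
      by (intro suminf_finite) (auto simp: H_def)
    also have "\<dots> = ennreal (\<Sum>i<k. H i * w i)"
      using H0 w_pos by (intro ennreal_sum_mult[symmetric]) (auto intro: less_imp_le)
    also have "(\<Sum>i<k. H i * w i) \<le> (\<Sum>i<k. (C * B * (1 / 2) ^ (k - Suc i)) * w k)"
    proof (rule sum_mono)
      fix i assume i: "i \<in> {..<k}"
      define d where "d = k - Suc i"
      have kd: "k = Suc i + d" "k - i = Suc d" using i by (auto simp: d_def)
      have "H i \<le> exp (- (real (2 ^ k) * (1 / 2) ^ Suc i))"
        using i dyad_power_le_exp[of "Suc i" "2 ^ k"] by (simp add: H_def)
      also have "real (2 ^ k) * (1 / 2) ^ Suc i = 2 ^ d" by (simp add: kd(1) power_add power_one_over)
      finally have "H i * w i \<le> exp (- (2 ^ d)) * (C ^ Suc d * w k)"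
        using C(2)[of i k] i H0 w_pos[of i] kd by (intro mult_mono) auto
      also have "\<dots> = C * ((2 * C) ^ d * exp (- (2 ^ d))) * (1 / 2) ^ d * w k"
        by (simp add: power_mult_distrib power_one_over)
      also have "\<dots> \<le> C * B * (1 / 2) ^ d * w k"
        using C(1) B(2)[of d] w_pos[of k] by (intro mult_right_mono mult_left_mono) auto
      finally show "H i * w i \<le> C * B * (1 / 2) ^ (k - Suc i) * w k" by (simp add: d_def)
    qed
    also have "\<dots> = (C * B * w k) * (\<Sum>i<k. (1 / 2) ^ (k - Suc i))" by (simp add: sum_distrib_left mult_ac)
    also have "(\<Sum>i<k. (1 / 2 :: real) ^ (k - Suc i)) = (\<Sum>i<k. (1 / 2) ^ i)"
      by (rule sum.nat_diff_reindex)
    also have "(C * B * w k) * \<dots> \<le> (C * B * w k) * 2"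
      using C(1) B(1) w_pos[of k] by (intro mult_left_mono) (auto simp: sum_gp_strict)
    finally have "ennreal (mom (2 ^ k)) \<le> ennreal (w k) + ennreal (C * B * w k * 2)"
      by (simp add: add_left_mono ennreal_leI)
    also have "\<dots> = ennreal ((1 + 2 * C * B) * w k)"
      using C(1) B(1) w_pos[of k] by (subst ennreal_plus[symmetric]) (auto simp: algebra_simps)
    finally show ?thesis using C(1) B(1) w_pos[of k] by (subst (asm) ennreal_le_iff) auto
  qed
  then show thesis using C(1) B(1) by (intro that[of "1 + 2 * C * B"]) (auto intro: add_pos_pos)
qed

lemma mom_ge_w: "n \<le> 2 ^ Suc k \<Longrightarrow> w (Suc k) / 4 \<le> mom n"
proof -
  assume n: "n \<le> 2 ^ Suc k"
  have "1 / 4 * w (Suc k) \<le> dyad (Suc k) ^ n * w (Suc k)"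
    using w_pos[of "Suc k"] by (intro mult_right_mono dyad_power_ge n) auto
  also have "\<dots> \<le> mom n" unfolding w_def by (rule mom_ge) auto
  finally show ?thesis by simp
qed

section \<open>Coefficients of the derivative of the kernel\<close>

text \<open>The coefficients of \<open>z\<close> times the \<open>z\<close>-derivative of the
  averaged kernel. They start at \<open>0\<close> and increase, as summation by parts
  requires.\<close>

definition diff_coeff :: "nat \<Rightarrow> real" where
  "diff_coeff n = real n * multiplier n"

lemma diff_coeff_0 [simp]: "diff_coeff 0 = 0"
  by (simp add: diff_coeff_def)

lemma diff_coeff_nonneg: "0 \<le> diff_coeff n"
  using multiplier_pos[of n] by (simp add: diff_coeff_def)

lemma diff_coeff_eq: "diff_coeff n = (real n / (real n + 1)) * (1 / (2 * mom (2 * n + 1)))"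
  by (simp add: diff_coeff_def multiplier_def)

lemma diff_coeff_mono: "diff_coeff n \<le> diff_coeff (Suc n)"
  unfolding diff_coeff_eq
proof (rule mult_mono)
  show "real n / (real n + 1) \<le> real (Suc n) / (real (Suc n) + 1)" by (simp add: field_simps)
  show "1 / (2 * mom (2 * n + 1)) \<le> 1 / (2 * mom (2 * Suc n + 1))"
    using mom_antimono[of "2 * n + 1" "2 * Suc n + 1"] mom_pos by (intro divide_left_mono) auto
qed (use mom_pos[of "2 * n + 1"] in auto)

lemma diff_coeff_le: "diff_coeff n \<le> 1 / (2 * mom (2 * n + 1))"
proof -
  have "diff_coeff n \<le> 1 * (1 / (2 * mom (2 * n + 1)))"
    unfolding diff_coeff_eq using mom_pos[of "2 * n + 1"] by (intro mult_right_mono) auto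
  then show ?thesis by simp
qed

lemma summable_diff_coeff:
  assumes "0 \<le> r" "r < 1"
  shows "summable (\<lambda>n. diff_coeff n * r ^ n)" "summable (\<lambda>n. diff_coeff (Suc n) * r ^ n)"
proof -
  have s: "summable (\<lambda>n. diff_coeff n * x ^ n)" if x: "0 \<le> x" "x < 1" for x
  proof (rule summable_comparison_test'[OF summable_mom[of "of_real x"]])
    show "norm (of_real x :: complex) < 1" using x by simp
    fix n
    have "diff_coeff n * x ^ n \<le> 1 / (2 * mom (2 * n + 1)) * x ^ n"
      using x by (intro mult_right_mono diff_coeff_le) auto
    then show "norm (diff_coeff n * x ^ n) \<le> norm (of_real x ^ n / of_real (2 * mom (2 * n + 1)) :: complex)"
      using x mom_pos[of "2 * n + 1"] diff_coeff_nonneg[of n] by (simp add: norm_divide norm_power norm_mult abs_mult)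
  qed
  show "summable (\<lambda>n. diff_coeff n * r ^ n)" by (rule s[OF assms])
  define x where "x = max r (1 / 2)"
  have x: "0 < x" "x < 1" "r \<le> x" using assms by (auto simp: x_def)
  have "summable (\<lambda>n. diff_coeff (Suc n) * x ^ Suc n)"
    using s[of x] x summable_Suc_iff[of "\<lambda>n. diff_coeff n * x ^ n"] by simp
  then have "summable (\<lambda>n. (1 / x) * (diff_coeff (Suc n) * x ^ Suc n))" by (rule summable_mult)
  then have s': "summable (\<lambda>n. diff_coeff (Suc n) * x ^ n)" using x by simp
  show "summable (\<lambda>n. diff_coeff (Suc n) * r ^ n)"
  proof (rule summable_comparison_test'[OF s'])
    fix n
    have "diff_coeff (Suc n) * r ^ n \<le> diff_coeff (Suc n) * x ^ n"
      using assms x by (intro mult_left_mono power_mono diff_coeff_nonneg) auto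
    then show "norm (diff_coeff (Suc n) * r ^ n) \<le> diff_coeff (Suc n) * x ^ n"
      using assms diff_coeff_nonneg by simp
  qed
qed

text \<open>What summation by parts leaves of the kernel. It equals \<open>1 - s\<close> times the
  power series with coefficients \<open>diff_coeff (Suc m)\<close>, and is estimated in that
  form.\<close>

definition diff_kernel :: "real \<Rightarrow> real" where
  "diff_kernel s = (\<Sum>m. (diff_coeff (Suc m) - diff_coeff m) * s ^ m)"

lemma diff_kernel_sums:
  assumes "0 \<le> s" "s < 1"
  shows "summable (\<lambda>m. (diff_coeff (Suc m) - diff_coeff m) * s ^ m)" "diff_kernel s = (1 - s) * (\<Sum>m. diff_coeff (Suc m) * s ^ m)"
proof -
  note s = summable_diff_coeff[OF assms]
  show "summable (\<lambda>m. (diff_coeff (Suc m) - diff_coeff m) * s ^ m)"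
    using summable_diff[OF s(2) s(1)] by (simp add: left_diff_distrib)
  have "diff_kernel s = (\<Sum>m. diff_coeff (Suc m) * s ^ m) - (\<Sum>m. diff_coeff m * s ^ m)"
    unfolding diff_kernel_def using suminf_diff[OF s(2) s(1)] by (simp add: left_diff_distrib)
  also have "(\<Sum>m. diff_coeff m * s ^ m) = (\<Sum>m. diff_coeff (Suc m) * s ^ Suc m)"
    using suminf_split_head[OF s(1)] by simp
  also have "\<dots> = s * (\<Sum>m. diff_coeff (Suc m) * s ^ m)"
    using suminf_mult[OF s(2), of s] by (simp add: mult_ac)
  finally show "diff_kernel s = (1 - s) * (\<Sum>m. diff_coeff (Suc m) * s ^ m)" by (simp add: algebra_simps)
qed

text \<open>With \<open>d = i - k\<close>, block \<open>i\<close> contributes about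
  \<open>2 ^ d * exp (- (2 ^ d)) / w i\<close> at radius \<open>dyad k\<close>. For
  \<open>i \<le> k\<close> the first factor decays and \<open>w i\<close> is at least
  \<open>w k\<close>. For \<open>i > k\<close> the exponential outweighs both \<open>2 ^ d\<close>
  and the growth of \<open>1 / w i\<close>, which doubling keeps geometric.\<close>

lemma diff_kernel_le:
  assumes tail_doubling
  obtains B where "0 < B" "\<And>k. diff_kernel (dyad k) \<le> B / w k"
proof -
  obtain C where C: "1 \<le> C" "\<And>j k. j \<le> k \<Longrightarrow> w j \<le> C ^ (k - j) * w k"
    using tail_doublingD[OF assms] by auto
  \<comment> \<open>In the base \<open>4 * C\<close> one 2 is for the number of indices in a block,
    \<open>C\<close> for doubling, and the other 2 leaves the summable factor
    \<open>(1 / 2) ^ d\<close>.\<close>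
  obtain B where B: "0 < B" "\<And>d. (4 * C) ^ d * exp (- (2 ^ d)) \<le> B" using power_exp_bounded[of "4 * C"] by auto
  define B1 where "B1 = max 1 B"
  define K where "K = 2 * C\<^sup>2 * exp 1 * B1"
  have K0: "0 < K" using C(1) by (auto simp: K_def B1_def intro!: mult_pos_pos)
  have "diff_kernel (dyad k) \<le> K * 4 / w k" for k
  proof -
    have s: "summable (\<lambda>m. diff_coeff (Suc m) * dyad k ^ m)" by (intro summable_diff_coeff) auto
    have "ennreal (diff_kernel (dyad k)) = ennreal ((1 / 2) ^ k * (\<Sum>m. diff_coeff (Suc m) * dyad k ^ m))"
      by (subst diff_kernel_sums(2)) (auto simp: dyad_def power_le_one)
    also have "\<dots> = ennreal ((1 / 2) ^ k) * (\<Sum>m. ennreal (diff_coeff (Suc m) * dyad k ^ m))"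
      using diff_coeff_nonneg s by (subst suminf_ennreal2) (auto simp: ennreal_mult suminf_nonneg)
    also have "\<dots> = (\<Sum>m. ennreal ((1 / 2) ^ k) * ennreal (diff_coeff (Suc m) * dyad k ^ m))"
      by (rule ennreal_suminf_cmult[symmetric])
    also have "\<dots> = (\<Sum>m. ennreal ((1 / 2) ^ k * (diff_coeff (Suc m) * dyad k ^ m)))"
      using diff_coeff_nonneg by (intro suminf_cong ennreal_mult[symmetric]) auto
    also have "\<dots> = (\<Sum>i. \<Sum>m\<in>dblock i. ennreal ((1 / 2) ^ k * (diff_coeff (Suc m) * dyad k ^ m)))"
      by (rule suminf_dblock)
    also have "\<dots> \<le> (\<Sum>i. ennreal (K / w k) * ennreal ((1 / 2) ^ ndist k i))"
    proof (intro suminf_le)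
      fix i
      have "(1 / 2) ^ k * (diff_coeff (Suc m) * dyad k ^ m) \<le> (1 / 2) ^ k * (2 * C\<^sup>2 / w i * (exp 1 * exp (- (2 ^ i * (1 / 2) ^ k))))"
        if m: "m \<in> dblock i" for m
      proof (intro mult_left_mono mult_mono)
        have m2: "2 * Suc m + 1 \<le> 2 ^ Suc (Suc i)" "2 ^ i \<le> m + 1" using m by (auto simp: mem_dblock)
        have "w i \<le> C\<^sup>2 * w (Suc (Suc i))" using C(2)[of i "Suc (Suc i)"] by (simp add: numeral_2_eq_2)
        moreover have "w (Suc (Suc i)) / 4 \<le> mom (2 * Suc m + 1)" by (intro mom_ge_w m2)
        then have "C\<^sup>2 * w (Suc (Suc i)) \<le> C\<^sup>2 * (4 * mom (2 * Suc m + 1))" by (intro mult_left_mono) auto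
        ultimately have "w i \<le> C\<^sup>2 * 4 * mom (2 * Suc m + 1)" by simp
        then have "1 / (2 * mom (2 * Suc m + 1)) \<le> 2 * C\<^sup>2 / w i"
          using w_pos[of i] mom_pos[of "2 * Suc m + 1"] by (simp add: field_simps)
        then show "diff_coeff (Suc m) \<le> 2 * C\<^sup>2 / w i" using diff_coeff_le[of "Suc m"] by linarith
        have "dyad k ^ m \<le> exp (- (real m * (1 / 2) ^ k))" by (rule dyad_power_le_exp)
        also have "\<dots> \<le> exp (1 + - (2 ^ i * (1 / 2) ^ k))"
        proof -
          have "2 ^ i * (1 / 2) ^ k \<le> (real m + 1) * (1 / 2 :: real) ^ k"
            using real_mem_dblock[OF m] by (intro mult_right_mono) auto
          moreover have "(1 / 2 :: real) ^ k \<le> 1" by (intro power_le_one) auto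
          ultimately show ?thesis by (simp add: distrib_right)
        qed
        finally show "dyad k ^ m \<le> exp 1 * exp (- (2 ^ i * (1 / 2) ^ k))" by (simp only: exp_add)
      qed (use w_pos[of i] diff_coeff_nonneg in auto)
      then have "(\<Sum>m\<in>dblock i. (1 / 2) ^ k * (diff_coeff (Suc m) * dyad k ^ m)) \<le> (\<Sum>m\<in>dblock i. (1 / 2) ^ k * (2 * C\<^sup>2 / w i * (exp 1 * exp (- (2 ^ i * (1 / 2) ^ k)))))"
        by (rule sum_mono)
      also have "\<dots> = 2 * C\<^sup>2 * exp 1 * (2 ^ i * (1 / 2) ^ k * exp (- (2 ^ i * (1 / 2) ^ k)) * (1 / w i))"
        by (simp add: card_dblock)
      also have "\<dots> \<le> 2 * C\<^sup>2 * exp 1 * (B1 * (1 / 2) ^ ndist k i * (1 / w k))"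
      proof (rule mult_left_mono)
        show "2 ^ i * (1 / 2) ^ k * exp (- (2 ^ i * (1 / 2) ^ k)) * (1 / w i) \<le> B1 * (1 / 2) ^ ndist k i * (1 / w k)"
        proof (cases "i \<le> k")
          case True
          have "2 ^ i * (1 / 2) ^ k = (1 / 2 :: real) ^ (k - i)" using True by (simp add: power_one_over power_diff)
          then have "2 ^ i * (1 / 2) ^ k * exp (- (2 ^ i * (1 / 2) ^ k)) \<le> (1 / 2 :: real) ^ (k - i) * 1"
            by (simp only:) (intro mult_left_mono, auto)
          also have "\<dots> \<le> B1 * (1 / 2) ^ (k - i)" by (simp add: B1_def)
          finally have X: "2 ^ i * (1 / 2) ^ k * exp (- (2 ^ i * (1 / 2) ^ k)) \<le> B1 * (1 / 2 :: real) ^ (k - i)" .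
          have Y: "1 / w i \<le> 1 / w k"
            by (intro divide_left_mono mult_pos_pos w_pos w_antimono True) simp
          have "2 ^ i * (1 / 2) ^ k * exp (- (2 ^ i * (1 / 2) ^ k)) * (1 / w i) \<le> (B1 * (1 / 2 :: real) ^ (k - i)) * (1 / w k)"
            using w_pos[of i] by (intro mult_mono[OF X Y]) (auto simp: B1_def)
          then show ?thesis using True by (simp add: ndist_def)
        next
          case False
          define d where "d = i - k"
          have i: "i = k + d" using False by (simp add: d_def)
          have e: "2 ^ i * (1 / 2) ^ k = (2 :: real) ^ d" by (simp add: i power_add power_one_over)
          have "w k \<le> C ^ d * w i" using C(2)[of k i] by (simp add: i)
          then have "1 / w i \<le> C ^ d * (1 / w k)" using w_pos[of i] w_pos[of k] by (simp add: field_simps)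
          then have "2 ^ d * exp (- (2 ^ d)) * (1 / w i) \<le> 2 ^ d * exp (- (2 ^ d)) * (C ^ d * (1 / w k))"
            by (intro mult_left_mono) auto
          also have "\<dots> = ((4 * C) ^ d * exp (- (2 ^ d))) * (1 / 2) ^ d * (1 / w k)"
          proof -
            have "(4 * C) ^ d = (2 * 2 * C) ^ d" by simp
            also have "\<dots> = 2 ^ d * 2 ^ d * C ^ d" by (simp only: power_mult_distrib)
            finally have E: "(4 * C) ^ d = 2 ^ d * 2 ^ d * C ^ d" .
            show ?thesis by (subst E) (simp add: power_one_over)
          qed
          also have "\<dots> \<le> B1 * (1 / 2) ^ d * (1 / w k)"
            using B(2)[of d] w_pos[of k] by (intro mult_right_mono) (auto simp: B1_def)
          finally show ?thesis unfolding e using False by (simp add: ndist_def d_def)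
        qed
      qed (use C(1) in auto)
      also have "\<dots> = (K / w k) * (1 / 2) ^ ndist k i" by (simp add: K_def)
      finally have "ennreal (\<Sum>m\<in>dblock i. (1 / 2) ^ k * (diff_coeff (Suc m) * dyad k ^ m)) \<le> ennreal ((K / w k) * (1 / 2) ^ ndist k i)"
        by (rule ennreal_leI)
      moreover have "(\<Sum>m\<in>dblock i. ennreal ((1 / 2) ^ k * (diff_coeff (Suc m) * dyad k ^ m))) = ennreal (\<Sum>m\<in>dblock i. (1 / 2) ^ k * (diff_coeff (Suc m) * dyad k ^ m))"
        using diff_coeff_nonneg by (intro sum_ennreal) auto
      moreover have "ennreal ((K / w k) * (1 / 2) ^ ndist k i) = ennreal (K / w k) * ennreal ((1 / 2) ^ ndist k i)"
        using K0 w_pos[of k] by (intro ennreal_mult) auto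
      ultimately show "(\<Sum>m\<in>dblock i. ennreal ((1 / 2) ^ k * (diff_coeff (Suc m) * dyad k ^ m))) \<le> ennreal (K / w k) * ennreal ((1 / 2) ^ ndist k i)"
        by simp
    qed auto
    also have "\<dots> = ennreal (K / w k) * (\<Sum>i. ennreal ((1 / 2) ^ ndist k i))" by (rule ennreal_suminf_cmult)
    also have "\<dots> \<le> ennreal (K / w k) * ennreal (2 / (1 - 1 / 2))"
      by (intro mult_left_mono geometric_row_sum) auto
    also have "\<dots> = ennreal (K / w k * (2 / (1 - 1 / 2)))"
      using K0 w_pos[of k] by (intro ennreal_mult[symmetric]) auto
    finally have "ennreal (diff_kernel (dyad k)) \<le> ennreal (K * 4 / w k)" by (simp add: mult.commute)
    then show ?thesis using K0 w_pos[of k] by (subst (asm) ennreal_le_iff) auto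
  qed
  then show thesis using K0 by (intro that[of "K * 4"]) auto
qed

end

subsection \<open>Boundedness of the operators\<close>

lemma ennreal_mult3:
  "0 \<le> a \<Longrightarrow> 0 \<le> b \<Longrightarrow> 0 \<le> c \<Longrightarrow> ennreal (a * (b * c)) = ennreal a * (ennreal b * ennreal c)"
  by (simp add: ennreal_mult)

context radial
begin

text \<open>Everything is expressed by the moments \<open>A n\<close> of \<open>norm f\<close>.
  Bounding \<open>norm f\<close> by \<open>F k\<close> on each dyadic interval and summing the
  increments of \<open>diff_coeff\<close> first shows that \<open>\<Phi> j\<close> is at most a
  constant times the sum over \<open>k\<close> of \<open>F k * w k / w (min j k)\<close>. With the
  weights \<open>gam p ^ j\<close> this matrix decays geometrically off the diagonal.\<close>

lemma sufficiency:
  assumes dbl: tail_doubling and pq: "1 < p" "1 < q" "1 / p + 1 / q = 1" and G: "tail_sum_bound q"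
  shows "\<exists>K>0. \<forall>f F. continuous_on {0..<1} f \<longrightarrow> (\<forall>k. 0 \<le> F k) \<longrightarrow>
    (\<forall>k t. dyad k \<le> t \<longrightarrow> t < dyad (Suc k) \<longrightarrow> norm (f t) \<le> F k) \<longrightarrow>
    (\<Sum>k. epowr (ennreal (F k * gam p ^ k)) p) < \<infinity> \<longrightarrow>
    (\<exists>g \<Phi>. kernel_op (averaged_kernel \<omega>) \<omega> f = Some g \<and> dominated g \<Phi> \<and>
      dom_sum p g \<Phi> \<le> ennreal K * (\<Sum>k. epowr (ennreal (F k * gam p ^ k)) p))"
proof -
  obtain C2 where C2: "1 \<le> C2" "\<And>j k. j \<le> k \<Longrightarrow> w j \<le> C2 ^ (k - j) * w k"
    using tail_doublingD[OF dbl] by auto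
  obtain C1 \<theta> where C1: "0 < C1" and \<theta>: "0 < \<theta>" "\<theta> < 1"
    and decay: "\<And>j k. j \<le> k \<Longrightarrow> w k \<le> C1 * (\<theta> ^ (k - j) * gam p ^ (k - j)) * w j"
    using tail_sum_bound_decay[OF pq G] by metis
  obtain B where B: "0 < B" "\<And>k. diff_kernel (dyad k) \<le> B / w k" using diff_kernel_le[OF dbl] by metis
  define D where "D = 2 * B * C2 * max 1 C1"
  have D0: "0 < D" using B(1) C2(1) by (auto simp: D_def intro!: mult_pos_pos)
  \<comment> \<open>A common rate for both sides of the diagonal: \<open>gam p\<close> for
    \<open>k \<le> j\<close> and \<open>\<theta>\<close> for \<open>k > j\<close>.\<close>
  define r where "r = max \<theta> (gam p)"
  have r: "0 < r" "r < 1" using \<theta> gam_less_1[of p] pq by (auto simp: r_def)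
  define E where "E = multiplier 0 * C1 * w 0"
  have E0: "0 < E" using multiplier_pos[of 0] C1 w_pos[of 0] by (simp add: E_def)
  define K1 where "K1 = (1 * 2 / (1 - r)) powr p"
  have K1: "0 < K1" using r by (simp add: K1_def)
  define K where "K = E powr p * K1 + (D * 2 / (1 - r)) powr p"
  have gp: "0 \<le> gam p" using gam_pos[of p] by simp
  have "\<exists>g \<Phi>. kernel_op (averaged_kernel \<omega>) \<omega> f = Some g \<and> dominated g \<Phi> \<and>
      dom_sum p g \<Phi> \<le> ennreal K * (\<Sum>k. epowr (ennreal (F k * gam p ^ k)) p)"
    if f: "continuous_on {0..<1} f" and F0: "\<And>k. 0 \<le> F k"
      and fF: "\<And>k t. dyad k \<le> t \<Longrightarrow> t < dyad (Suc k) \<Longrightarrow> norm (f t) \<le> F k"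
      and fin: "(\<Sum>k. epowr (ennreal (F k * gam p ^ k)) p) < \<infinity>" for f F
  proof -
    define x where "x k = ennreal (F k * gam p ^ k)" for k
    define S where "S = (\<Sum>k. epowr (x k) p)"
    define z where "z j = (\<Sum>k. ennreal (r ^ ndist j k) * x k)" for j
    have zS: "(\<Sum>j. epowr (z j) p) \<le> ennreal K1 * S"
      unfolding S_def K1_def using r pq by (intro geometric_convolution) (auto simp: z_def)
    have z0: "epowr (z 0) p \<le> ennreal K1 * S"
      using zS ennreal_le_suminf[of "\<lambda>j. epowr (z j) p" 0] by (rule order.trans[rotated])
    have z0fin: "z 0 < \<infinity>"
    proof -
      have "ennreal K1 * S < \<infinity>" using fin by (simp add: S_def x_def ennreal_mult_less_top)
      then have "epowr (z 0) p < \<infinity>" using z0 by (rule le_less_trans[rotated])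
      then show ?thesis by simp
    qed
    \<comment> \<open>Integrability of \<open>f\<close> against the weight is the row
      \<open>j = 0\<close> of the same convolution.\<close>
    have Fw: "(\<Sum>k. ennreal (F k) * ennreal (w k)) \<le> ennreal (C1 * w 0) * z 0"
    proof -
      have "(\<Sum>k. ennreal (F k) * ennreal (w k)) \<le> (\<Sum>k. ennreal (C1 * w 0) * (ennreal (r ^ ndist 0 k) * x k))"
      proof (intro suminf_le)
        fix k
        have "F k * w k \<le> F k * (C1 * (\<theta> ^ (k - 0) * gam p ^ (k - 0)) * w 0)"
          using F0 decay[of 0 k] by (intro mult_left_mono) auto
        also have "\<dots> = (C1 * w 0) * (\<theta> ^ k * (F k * gam p ^ k))" by (simp add: mult_ac)
        also have "\<dots> \<le> (C1 * w 0) * (r ^ ndist 0 k * (F k * gam p ^ k))"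
          using C1 w_pos[of 0] \<theta> F0 gp
          by (intro mult_left_mono mult_right_mono) (auto simp: ndist_def r_def intro!: power_mono)
        finally have "ennreal (F k * w k) \<le> ennreal ((C1 * w 0) * (r ^ ndist 0 k * (F k * gam p ^ k)))" by (rule ennreal_leI)
        moreover have "ennreal (F k * w k) = ennreal (F k) * ennreal (w k)"
          using F0 w_pos[of k] by (intro ennreal_mult) auto
        moreover have "ennreal ((C1 * w 0) * (r ^ ndist 0 k * (F k * gam p ^ k))) = ennreal (C1 * w 0) * (ennreal (r ^ ndist 0 k) * x k)"
          unfolding x_def using C1 w_pos[of 0] r F0 gp by (intro ennreal_mult3) auto
        ultimately show "ennreal (F k) * ennreal (w k) \<le> ennreal (C1 * w 0) * (ennreal (r ^ ndist 0 k) * x k)" by simp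
      qed auto
      then show ?thesis by (simp only: ennreal_suminf_cmult z_def)
    qed
    define f0 where "f0 t = indicator {0..<1} t *\<^sub>R f t" for t
    have f0n: "norm (f0 t) = norm (f t) * indicator {0..<1} t" for t
      by (auto simp: f0_def split: split_indicator)
    have [measurable]: "f0 \<in> borel_measurable borel"
      unfolding f0_def by (rule borel_measurable_continuous_on_indicator[OF _ f]) simp
    have Afin: "(\<integral>\<^sup>+t. ennreal (norm (f0 t)) \<partial>\<mu>) \<le> (\<Sum>k. ennreal (F k) * ennreal (w k))"
    proof (rule nn_integral_\<mu>_le)
      fix k t assume t: "dyad k \<le> t" "t < dyad (Suc k)"
      have "norm (f0 t) \<le> F k" using fF[OF t] F0[of k] by (auto simp: f0n split: split_indicator)
      then show "ennreal (norm (f0 t)) \<le> ennreal (F k)" by (rule ennreal_leI)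
    qed
    have "(\<integral>\<^sup>+t. ennreal (norm (f t) * indicator {0..<1} t) \<partial>\<mu>) < \<infinity>"
    proof -
      have "ennreal (C1 * w 0) * z 0 < \<infinity>" using z0fin by (simp add: ennreal_mult_less_top)
      then show ?thesis using Afin Fw unfolding f0n by (meson le_less_trans)
    qed
    from kernel_op_series[OF f this, folded f0_def]
    obtain g where g: "kernel_op (averaged_kernel \<omega>) \<omega> f = Some g" "g holomorphic_on ball 0 1"
      and tay: "\<And>n. taylor_coeff g n = of_real (multiplier n) * (\<integral>t. f0 t * of_real (t ^ n) \<partial>\<mu>)"
      and int: "\<And>n. integrable \<mu> (\<lambda>t. f0 t * of_real (t ^ n))"
      by auto
    define Ah where "Ah n = (\<integral>t. f0 t * of_real (t ^ n) \<partial>\<mu>)" for n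
    define A where "A n = (\<integral>t. norm (f0 t) * t ^ n \<partial>\<mu>)" for n
    have int0: "integrable \<mu> (\<lambda>t. norm (f0 t) * t ^ n)" for n
    proof (rule Bochner_Integration.integrable_bound[OF integrable_norm[OF int[of n]]])
      show "AE t in \<mu>. norm (norm (f0 t) * t ^ n) \<le> norm (norm (f0 t * of_real (t ^ n)))"
        by (auto simp: norm_mult norm_power abs_mult power_abs)
    qed simp
    have A0: "0 \<le> A n" for n
      unfolding A_def by (intro integral_nonneg_AE eventually_mono[OF AE_\<mu>]) auto
    have Adiff: "A n - A (Suc n) = (\<integral>t. norm (f0 t) * t ^ n * (1 - t) \<partial>\<mu>)" for n
      unfolding A_def Bochner_Integration.integral_diff[OF int0 int0, symmetric]
      by (intro Bochner_Integration.integral_cong refl) (simp add: algebra_simps)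
    have intd: "integrable \<mu> (\<lambda>t. norm (f0 t) * t ^ n * (1 - t))" for n
    proof -
      have "integrable \<mu> (\<lambda>t. norm (f0 t) * t ^ n - norm (f0 t) * t ^ Suc n)"
        by (intro Bochner_Integration.integrable_diff int0)
      then show ?thesis by (simp add: algebra_simps)
    qed
    have Adec: "A (Suc n) \<le> A n" for n
    proof -
      have "0 \<le> A n - A (Suc n)"
        unfolding Adiff by (intro integral_nonneg_AE eventually_mono[OF AE_\<mu>]) auto
      then show ?thesis by simp
    qed
    have Ah: "norm (Ah n) \<le> A n" for n
    proof -
      have "norm (Ah n) \<le> (\<integral>t. norm (f0 t * of_real (t ^ n)) \<partial>\<mu>)"
        unfolding Ah_def by (rule integral_norm_bound)
      also have "\<dots> = A n"
        unfolding A_def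
        by (intro integral_cong_AE eventually_mono[OF AE_\<mu>]) (auto simp: norm_mult norm_power)
      finally show ?thesis .
    qed
    have Ahd: "norm (Ah n - Ah (Suc n)) \<le> A n - A (Suc n)" for n
    proof -
      have "Ah n - Ah (Suc n) = (\<integral>t. f0 t * of_real (t ^ n) - f0 t * of_real (t ^ Suc n) \<partial>\<mu>)"
        unfolding Ah_def by (rule Bochner_Integration.integral_diff[OF int int, symmetric])
      also have "norm \<dots> \<le> (\<integral>t. norm (f0 t * of_real (t ^ n) - f0 t * of_real (t ^ Suc n)) \<partial>\<mu>)"
        by (rule integral_norm_bound)
      also have "\<dots> = (\<integral>t. norm (f0 t) * t ^ n * (1 - t) \<partial>\<mu>)"
      proof (intro integral_cong_AE eventually_mono[OF AE_\<mu>])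
        fix t :: real assume t: "0 \<le> t \<and> t < 1"
        have "f0 t * of_real (t ^ n) - f0 t * of_real (t ^ Suc n) = f0 t * of_real (t ^ n * (1 - t))"
          by (simp add: algebra_simps)
        then show "norm (f0 t * of_real (t ^ n) - f0 t * of_real (t ^ Suc n)) = norm (f0 t) * t ^ n * (1 - t)"
          using t by (simp only: norm_mult norm_of_real) (simp add: abs_mult)
      qed auto
      finally show ?thesis by (simp add: Adiff)
    qed
    have coef: "of_nat n * taylor_coeff g n = of_real (diff_coeff n) * Ah n" for n
      by (simp add: tay Ah_def diff_coeff_def)
    have Ale: "ennreal (A n) \<le> (\<Sum>k. ennreal (F k) * ennreal (dyad (Suc k) ^ n) * ennreal (w k))" for n
    proof -
      have "ennreal (A n) = (\<integral>\<^sup>+t. ennreal (norm (f0 t) * t ^ n) \<partial>\<mu>)"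
        unfolding A_def by (intro nn_integral_eq_integral[symmetric] int0 eventually_mono[OF AE_\<mu>]) auto
      also have "\<dots> \<le> (\<Sum>k. ennreal (F k) * ennreal (dyad (Suc k) ^ n) * ennreal (w k))"
      proof (rule nn_integral_\<mu>_le)
        fix k t assume t: "dyad k \<le> t" "t < dyad (Suc k)"
        have t0: "0 \<le> t" using t dyad_nonneg[of k] by linarith
        have "norm (f0 t) \<le> F k" using fF[OF t] F0[of k] by (auto simp: f0n split: split_indicator)
        then have "norm (f0 t) * t ^ n \<le> F k * dyad (Suc k) ^ n"
          using t t0 F0 by (intro mult_mono power_mono) auto
        then show "ennreal (norm (f0 t) * t ^ n) \<le> ennreal (F k) * ennreal (dyad (Suc k) ^ n)"
          using F0 by (simp add: ennreal_mult[symmetric] ennreal_leI)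
      qed
      finally show ?thesis .
    qed
    have A_le0: "A n \<le> A 0" for n
      by (induction n) (use Adec order.trans in auto)
    define e where "e m = (diff_coeff (Suc m) - diff_coeff m) * A (Suc m)" for m
    have dcc: "0 \<le> diff_coeff (Suc m) - diff_coeff m" for m using diff_coeff_mono[of m] by simp
    have summ: "summable (\<lambda>m. (diff_coeff (Suc m) - diff_coeff m) * A (Suc m) * s ^ m)" if s: "0 \<le> s" "s < 1" for s
    proof (rule summable_comparison_test'[OF summable_mult[OF diff_kernel_sums(1)[OF s], of "A 0"]])
      fix m
      have "(diff_coeff (Suc m) - diff_coeff m) * A (Suc m) * s ^ m \<le> (diff_coeff (Suc m) - diff_coeff m) * A 0 * s ^ m"
        using dcc A_le0 s by (intro mult_right_mono mult_left_mono) auto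
      then show "norm ((diff_coeff (Suc m) - diff_coeff m) * A (Suc m) * s ^ m) \<le> A 0 * ((diff_coeff (Suc m) - diff_coeff m) * s ^ m)"
        using dcc A0 s by (simp add: abs_mult mult_ac)
    qed
    define \<Phi> where "\<Phi> j = 2 * (\<Sum>m. (diff_coeff (Suc m) - diff_coeff m) * A (Suc m) * dyad (Suc j) ^ m)" for j
    have dom: "dominated g \<Phi>"
      unfolding \<Phi>_def
      by (rule dominated_of_coeffs[where Ah = Ah, OF g(2) diff_coeff_0 diff_coeff_mono A0 Adec Ah Ahd coef summ])
    have HHe: "(\<Sum>m. ennreal ((diff_coeff (Suc m) - diff_coeff m) * s ^ m)) = ennreal (diff_kernel s)" if "0 \<le> s" "s < 1" for s
      unfolding diff_kernel_def using diff_kernel_sums(1)[OF that] dcc that by (intro suminf_ennreal2) auto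
    have \<Phi>le: "ennreal (\<Phi> j * gam p ^ j) \<le> ennreal D * z j" for j
    proof -
      let ?R = "dyad (Suc j)"
      have "(\<Sum>m. ennreal ((diff_coeff (Suc m) - diff_coeff m) * A (Suc m) * ?R ^ m))
        \<le> (\<Sum>m. \<Sum>k. ennreal (F k) * ennreal (w k) * ennreal ((diff_coeff (Suc m) - diff_coeff m) * dyad (Suc (min j k)) ^ m))"
      proof (intro suminf_le)
        fix m
        have "ennreal ((diff_coeff (Suc m) - diff_coeff m) * A (Suc m) * ?R ^ m) = ennreal ((diff_coeff (Suc m) - diff_coeff m) * ?R ^ m) * ennreal (A (Suc m))"
          using dcc[of m] A0 by (subst ennreal_mult[symmetric]) (auto simp: mult_ac)
        also have "\<dots> \<le> ennreal ((diff_coeff (Suc m) - diff_coeff m) * ?R ^ m) * (\<Sum>k. ennreal (F k) * ennreal (dyad (Suc k) ^ Suc m) * ennreal (w k))"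
          by (intro mult_left_mono Ale) auto
        also have "\<dots> = (\<Sum>k. ennreal ((diff_coeff (Suc m) - diff_coeff m) * ?R ^ m) * (ennreal (F k) * ennreal (dyad (Suc k) ^ Suc m) * ennreal (w k)))"
          by (rule ennreal_suminf_cmult[symmetric])
        also have "\<dots> \<le> (\<Sum>k. ennreal (F k) * ennreal (w k) * ennreal ((diff_coeff (Suc m) - diff_coeff m) * dyad (Suc (min j k)) ^ m))"
        proof (intro suminf_le)
          fix k
          \<comment> \<open>Of the two radii the larger one is estimated by 1; summing over
            \<open>m\<close> then gives \<open>diff_kernel\<close> at scale
            \<open>min j k\<close>.\<close>
          have "?R ^ m * dyad (Suc k) ^ Suc m \<le> dyad (Suc (min j k)) ^ m"
          proof (cases "j \<le> k")
            case True
            have "?R ^ m * dyad (Suc k) ^ Suc m \<le> ?R ^ m * 1"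
              by (intro mult_left_mono power_le_one) (auto intro: less_imp_le)
            then show ?thesis using True by simp
          next
            case False
            have "?R ^ m * dyad (Suc k) ^ Suc m \<le> 1 * dyad (Suc k) ^ m"
              by (intro mult_mono power_le_one power_decreasing) (auto intro: less_imp_le)
            then show ?thesis using False by simp
          qed
          then have "(diff_coeff (Suc m) - diff_coeff m) * (?R ^ m * dyad (Suc k) ^ Suc m) \<le> (diff_coeff (Suc m) - diff_coeff m) * dyad (Suc (min j k)) ^ m"
            using dcc by (intro mult_left_mono) auto
          then have "ennreal ((diff_coeff (Suc m) - diff_coeff m) * ?R ^ m) * ennreal (dyad (Suc k) ^ Suc m) \<le> ennreal ((diff_coeff (Suc m) - diff_coeff m) * dyad (Suc (min j k)) ^ m)"
            using dcc[of m] by (subst ennreal_mult[symmetric]) (auto simp: mult_ac intro!: ennreal_leI)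
          then have "ennreal (F k) * ennreal (w k) * (ennreal ((diff_coeff (Suc m) - diff_coeff m) * ?R ^ m) * ennreal (dyad (Suc k) ^ Suc m))
            \<le> ennreal (F k) * ennreal (w k) * ennreal ((diff_coeff (Suc m) - diff_coeff m) * dyad (Suc (min j k)) ^ m)"
            by (intro mult_left_mono) auto
          then show "ennreal ((diff_coeff (Suc m) - diff_coeff m) * ?R ^ m) * (ennreal (F k) * ennreal (dyad (Suc k) ^ Suc m) * ennreal (w k))
            \<le> ennreal (F k) * ennreal (w k) * ennreal ((diff_coeff (Suc m) - diff_coeff m) * dyad (Suc (min j k)) ^ m)"
            by (simp only: mult_ac)
        qed auto
        finally show "ennreal ((diff_coeff (Suc m) - diff_coeff m) * A (Suc m) * ?R ^ m) \<le> (\<Sum>k. ennreal (F k) * ennreal (w k) * ennreal ((diff_coeff (Suc m) - diff_coeff m) * dyad (Suc (min j k)) ^ m))" .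
      qed auto
      also have "\<dots> = (\<Sum>k. \<Sum>m. ennreal (F k) * ennreal (w k) * ennreal ((diff_coeff (Suc m) - diff_coeff m) * dyad (Suc (min j k)) ^ m))"
        by (rule suminf_swap_ennreal)
      also have "\<dots> = (\<Sum>k. ennreal (F k) * ennreal (w k) * ennreal (diff_kernel (dyad (Suc (min j k)))))"
        unfolding ennreal_suminf_cmult by (subst HHe) auto
      finally have 1: "(\<Sum>m. ennreal ((diff_coeff (Suc m) - diff_coeff m) * A (Suc m) * ?R ^ m)) \<le> \<dots>" .
      have "ennreal (\<Phi> j * gam p ^ j) = ennreal (2 * gam p ^ j) * ennreal (\<Sum>m. (diff_coeff (Suc m) - diff_coeff m) * A (Suc m) * ?R ^ m)"
      proof -
        have "0 \<le> (\<Sum>m. (diff_coeff (Suc m) - diff_coeff m) * A (Suc m) * ?R ^ m)"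
          by (intro suminf_nonneg summ) (use dcc A0 in auto)
        moreover have "\<Phi> j * gam p ^ j = 2 * gam p ^ j * (\<Sum>m. (diff_coeff (Suc m) - diff_coeff m) * A (Suc m) * ?R ^ m)"
          unfolding \<Phi>_def by (simp only: mult_ac)
        ultimately show ?thesis using gp by (simp only:) (rule ennreal_mult, auto)
      qed
      also have "ennreal (\<Sum>m. (diff_coeff (Suc m) - diff_coeff m) * A (Suc m) * ?R ^ m) = (\<Sum>m. ennreal ((diff_coeff (Suc m) - diff_coeff m) * A (Suc m) * ?R ^ m))"
        using dcc A0 by (intro suminf_ennreal2[symmetric] summ) auto
      also have "ennreal (2 * gam p ^ j) * \<dots> \<le> ennreal (2 * gam p ^ j) * (\<Sum>k. ennreal (F k) * ennreal (w k) * ennreal (diff_kernel (dyad (Suc (min j k)))))"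
        by (intro mult_left_mono 1) auto
      also have "\<dots> = (\<Sum>k. ennreal (2 * gam p ^ j) * (ennreal (F k) * ennreal (w k) * ennreal (diff_kernel (dyad (Suc (min j k))))))"
        by (rule ennreal_suminf_cmult[symmetric])
      also have "\<dots> \<le> (\<Sum>k. ennreal D * (ennreal (r ^ ndist j k) * x k))"
      proof (intro suminf_le)
        fix k
        let ?i = "min j k"
        have "diff_kernel (dyad (Suc ?i)) \<le> B / w (Suc ?i)" by (rule B(2))
        also have "\<dots> \<le> B * C2 / w ?i"
          using C2(2)[of ?i "Suc ?i"] w_pos[of ?i] w_pos[of "Suc ?i"] B(1) by (simp add: field_simps)
        finally have h: "diff_kernel (dyad (Suc ?i)) \<le> B * C2 / w ?i" .
        \<comment> \<open>For \<open>k \<le> j\<close> the ratio of the tails is 1 and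
          \<open>gam p\<close> supplies the decay; for \<open>k > j\<close> the decay comes from the
          improved tail condition.\<close>
        have rat: "gam p ^ j * (w k / w ?i) \<le> max 1 C1 * (r ^ ndist j k * gam p ^ k)"
        proof (cases "k \<le> j")
          case True
          have "gam p ^ j * (w k / w ?i) = 1 * (gam p ^ (j - k) * gam p ^ k)"
            using True w_pos[of k] by (simp add: power_add[symmetric] min_def)
          also have "\<dots> \<le> max 1 C1 * (r ^ ndist j k * gam p ^ k)"
            using True gp r C1 by (intro mult_mono) (auto simp: ndist_def r_def intro!: power_mono)
          finally show ?thesis .
        next
          case False
          have "w k / w j \<le> C1 * (\<theta> ^ (k - j) * gam p ^ (k - j))"
            using decay[of j k] False w_pos[of j] by (simp add: divide_le_eq)
          then have "gam p ^ j * (w k / w ?i) \<le> gam p ^ j * (C1 * (\<theta> ^ (k - j) * gam p ^ (k - j)))"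
            using False gp by (intro mult_left_mono) auto
          also have "\<dots> = C1 * (\<theta> ^ (k - j) * (gam p ^ j * gam p ^ (k - j)))" by (simp only: mult_ac)
          also have "gam p ^ j * gam p ^ (k - j) = gam p ^ k" using False by (simp add: power_add[symmetric])
          also have "C1 * (\<theta> ^ (k - j) * gam p ^ k) \<le> max 1 C1 * (r ^ ndist j k * gam p ^ k)"
            using False gp r C1 \<theta> by (intro mult_mono) (auto simp: ndist_def r_def intro!: power_mono)
          finally show ?thesis .
        qed
        have "2 * gam p ^ j * (F k * w k * diff_kernel (dyad (Suc ?i))) \<le> 2 * gam p ^ j * (F k * w k * (B * C2 / w ?i))"
          using gp F0 w_pos[of k] h by (intro mult_left_mono) auto
        also have "\<dots> = 2 * B * C2 * F k * (gam p ^ j * (w k / w ?i))" by simp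
        also have "\<dots> \<le> 2 * B * C2 * F k * (max 1 C1 * (r ^ ndist j k * gam p ^ k))"
          using B(1) C2(1) F0 by (intro mult_left_mono rat) auto
        also have "\<dots> = D * (r ^ ndist j k * (F k * gam p ^ k))" by (simp add: D_def)
        finally have "ennreal (2 * gam p ^ j * (F k * w k * diff_kernel (dyad (Suc ?i)))) \<le> ennreal (D * (r ^ ndist j k * (F k * gam p ^ k)))"
          by (rule ennreal_leI)
        moreover have "ennreal (D * (r ^ ndist j k * (F k * gam p ^ k))) = ennreal D * (ennreal (r ^ ndist j k) * x k)"
          unfolding x_def using D0 r F0 gp by (intro ennreal_mult3) auto
        moreover have "ennreal (2 * gam p ^ j * (F k * w k * diff_kernel (dyad (Suc ?i)))) = ennreal (2 * gam p ^ j) * (ennreal (F k) * ennreal (w k) * ennreal (diff_kernel (dyad (Suc ?i))))"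
        proof -
          have "0 \<le> diff_kernel (dyad (Suc ?i))" unfolding diff_kernel_def using dcc by (intro suminf_nonneg diff_kernel_sums(1)) auto
          then show ?thesis using gp F0 w_pos[of k] by (simp add: ennreal_mult less_imp_le)
        qed
        ultimately show "ennreal (2 * gam p ^ j) * (ennreal (F k) * ennreal (w k) * ennreal (diff_kernel (dyad (Suc ?i)))) \<le> ennreal D * (ennreal (r ^ ndist j k) * x k)"
          by simp
      qed auto
      finally show ?thesis by (simp only: ennreal_suminf_cmult z_def)
    qed
    have \<Phi>0: "0 \<le> \<Phi> j" for j using dom by (simp add: dominated_def)
    have Phi_sum: "(\<Sum>j. ennreal (\<Phi> j powr p * (1 / 2) ^ j)) \<le> ennreal ((D * 2 / (1 - r)) powr p) * S"
    proof -
      have "(\<Sum>j. ennreal (\<Phi> j powr p * (1 / 2) ^ j)) = (\<Sum>j. epowr (ennreal (\<Phi> j * gam p ^ j)) p)"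
        using \<Phi>0 gp pq by (intro suminf_cong) (simp add: powr_mult gam_power_powr)
      also have "\<dots> \<le> ennreal ((D * 2 / (1 - r)) powr p) * S"
        unfolding S_def using r pq D0 \<Phi>le by (intro geometric_convolution) (auto simp: z_def)
      finally show ?thesis .
    qed
    have g0: "ennreal (norm (g 0) powr p) \<le> ennreal (E powr p * K1) * S"
    proof -
      have "norm (g 0) = norm (taylor_coeff g 0)" by (simp add: taylor_coeff_def)
      also have "\<dots> = multiplier 0 * norm (Ah 0)" unfolding tay Ah_def[symmetric] using multiplier_pos[of 0] by (simp add: norm_mult)
      also have "\<dots> \<le> multiplier 0 * A 0" using multiplier_pos[of 0] Ah[of 0] by (intro mult_left_mono) auto
      finally have "ennreal (norm (g 0)) \<le> ennreal (multiplier 0) * ennreal (A 0)"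
        using multiplier_pos[of 0] A0 by (simp add: ennreal_mult[symmetric] ennreal_leI less_imp_le)
      also have "\<dots> \<le> ennreal (multiplier 0) * (ennreal (C1 * w 0) * z 0)"
      proof (rule mult_left_mono)
        have "ennreal (A 0) \<le> (\<Sum>k. ennreal (F k) * ennreal (w k))" using Ale[of 0] by simp
        then show "ennreal (A 0) \<le> ennreal (C1 * w 0) * z 0" using Fw by (rule order.trans)
      qed simp
      also have "\<dots> = ennreal E * z 0"
        unfolding E_def using multiplier_pos[of 0] C1 w_pos[of 0] by (simp add: ennreal_mult less_imp_le mult.assoc)
      finally have "epowr (ennreal (norm (g 0))) p \<le> epowr (ennreal E * z 0) p"
        using pq by (intro epowr_mono) auto
      also have "\<dots> = ennreal (E powr p) * epowr (z 0) p"
        using pq E0 by (simp add: epowr_mult)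
      also have "\<dots> \<le> ennreal (E powr p) * (ennreal K1 * S)" by (intro mult_left_mono z0) auto
      also have "\<dots> = ennreal (E powr p * K1) * S" using K1 by (simp add: ennreal_mult mult.assoc)
      finally show ?thesis by simp
    qed
    have "dom_sum p g \<Phi> \<le> ennreal (E powr p * K1) * S + ennreal ((D * 2 / (1 - r)) powr p) * S"
      unfolding dom_sum_def by (intro add_mono g0 Phi_sum)
    also have "\<dots> = ennreal K * S"
      unfolding K_def using K1 by (simp add: distrib_right[symmetric] ennreal_plus[symmetric] del: ennreal_plus)
    finally show ?thesis using g(1) dom by (auto simp: S_def x_def)
  qed
  moreover have "0 < K" unfolding K_def using E0 K1 by (intro add_pos_nonneg mult_pos_pos) auto
  ultimately show ?thesis by blast
qed

end

subsection \<open>Test functions\<close>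

text \<open>The polynomial \<open>1 + z + ... + z ^ (2 ^ k - 1)\<close> has dyadic norm, after the
  \<open>p\<close>-th root, of order \<open>(2 * gam p) ^ k\<close>: its size is
  \<open>2 ^ k\<close> and the weight at scale \<open>k\<close> is \<open>gam p ^ k\<close>.
  Dividing by this normalizes the summands, so the \<open>l^p\<close> norm of \<open>v\<close>
  controls the whole sum.\<close>

definition test_coeff :: "real \<Rightarrow> (nat \<Rightarrow> real) \<Rightarrow> nat \<Rightarrow> nat \<Rightarrow> real" where
  "test_coeff p v M n = (\<Sum>k\<le>M. v k / (2 * gam p) ^ k * (if n < 2 ^ k then 1 else 0))"

definition test_fun :: "real \<Rightarrow> (nat \<Rightarrow> real) \<Rightarrow> nat \<Rightarrow> complex \<Rightarrow> complex" where
  "test_fun p v M z = (\<Sum>n<2 ^ M. of_real (test_coeff p v M n) * z ^ n)"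

lemma test_coeff_nonneg: "(\<And>k. 0 \<le> v k) \<Longrightarrow> 0 \<le> test_coeff p v M n"
  unfolding test_coeff_def using gam_pos[of p] by (intro sum_nonneg) auto

lemma test_coeff_eq_0: "2 ^ M \<le> n \<Longrightarrow> test_coeff p v M n = 0"
  unfolding test_coeff_def
proof (intro sum.neutral ballI)
  fix k assume n: "2 ^ M \<le> n" and k: "k \<in> {..M}"
  have "(2::nat) ^ k \<le> 2 ^ M" using k by (intro power_increasing) auto
  then have "\<not> n < 2 ^ k" using n by linarith
  then show "v k / (2 * gam p) ^ k * (if n < 2 ^ k then 1 else 0) = 0" by simp
qed

lemma test_fun_holomorphic: "test_fun p v M holomorphic_on S"
  unfolding test_fun_def[abs_def] by (intro holomorphic_intros)

lemma taylor_coeff_test_fun: "taylor_coeff (test_fun p v M) n = of_real (test_coeff p v M n)"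
proof (rule taylor_coeff_unique)
  fix z :: complex
  show "(\<lambda>n. of_real (test_coeff p v M n) * z ^ n) sums test_fun p v M z"
    unfolding test_fun_def by (rule sums_finite) (auto simp: test_coeff_eq_0 not_less)
qed

lemma test_fun_real: "test_fun p v M (of_real t) = of_real (\<Sum>n<2 ^ M. test_coeff p v M n * t ^ n)"
  by (simp add: test_fun_def)

lemma half_less_gam: "1 < p \<Longrightarrow> 1 / 2 < gam p"
proof -
  assume "1 < p"
  then have "2 powr (-1) < (2::real) powr (- (1 / p))" by (intro powr_less_mono) auto
  then show ?thesis by (simp add: gam_def powr_minus)
qed

lemma sum_power_le_min:
  assumes "0 \<le> R" "R < 1"
  shows "(\<Sum>m<N. R ^ m) \<le> min (real N) (1 / (1 - R))"
proof (rule min.boundedI)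
  have "(\<Sum>m<N. R ^ m) \<le> (\<Sum>m<N. 1)" using assms by (intro sum_mono power_le_one) auto
  then show "(\<Sum>m<N. R ^ m) \<le> real N" by simp
  have "(\<Sum>m<N. R ^ m) \<le> (\<Sum>m. R ^ m)" using assms by (intro sum_le_suminf summable_geometric) auto
  then show "(\<Sum>m<N. R ^ m) \<le> 1 / (1 - R)" using assms by (simp add: suminf_geometric)
qed

text \<open>The coefficients decrease, so the bound from summation by parts applies with
  \<open>c n = n\<close>. At scale \<open>j\<close> a geometric sum of length \<open>2 ^ k\<close>
  is of order at most \<open>2 ^ min j k\<close>; combined with the normalization this is a kernel
  decaying on both sides of the diagonal.\<close>

lemma test_fun_dominated:
  assumes p: "1 < p"
  shows "\<exists>C>0. \<forall>v M. (\<forall>k. 0 \<le> v k) \<longrightarrow> (\<exists>\<Phi>. dominated (test_fun p v M) \<Phi> \<and>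
    dom_sum p (test_fun p v M) \<Phi> \<le> ennreal (C * (\<Sum>k\<le>M. v k powr p)))"
proof -
  \<comment> \<open>The rate is \<open>gam p\<close> for \<open>k \<le> j\<close> and
    \<open>1 / (2 * gam p)\<close> for \<open>k > j\<close>.\<close>
  define q where "q = max (gam p) (1 / (2 * gam p))"
  have q: "0 < q" "q < 1" using p gam_pos[of p] gam_less_1[of p] half_less_gam[of p] by (auto simp: q_def field_simps)
  define C where "C = (1 * 2 / (1 - q)) powr p + (4 * 2 / (1 - q)) powr p"
  have C0: "0 < C" unfolding C_def using q by (intro add_pos_pos) auto
  have gp: "0 < gam p" by (rule gam_pos)
  have "\<exists>\<Phi>. dominated (test_fun p v M) \<Phi> \<and>
    dom_sum p (test_fun p v M) \<Phi> \<le> ennreal (C * (\<Sum>k\<le>M. v k powr p))" if v: "\<And>k. 0 \<le> v k" for v M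
  proof -
    define b where "b = test_coeff p v M"
    define \<beta> where "\<beta> k = v k / (2 * gam p) ^ k" for k
    have \<beta>0: "0 \<le> \<beta> k" for k using v gp by (simp add: \<beta>_def)
    have b: "b n = (\<Sum>k\<le>M. \<beta> k * (if n < 2 ^ k then 1 else 0))" for n by (simp add: b_def test_coeff_def \<beta>_def)
    have b0: "0 \<le> b n" for n unfolding b_def by (rule test_coeff_nonneg[OF v])
    have bdec: "b (Suc n) \<le> b n" for n
      unfolding b using \<beta>0 by (intro sum_mono mult_left_mono) auto
    define \<Phi> where "\<Phi> j = 2 * (\<Sum>m. (real (Suc m) - real m) * b (Suc m) * dyad (Suc j) ^ m)" for j
    have fs: "b (Suc m) = 0" if "m \<notin> {..<2 ^ M}" for m
      using that by (auto simp: b_def test_coeff_eq_0 not_less)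
    have dom: "dominated (test_fun p v M) \<Phi>"
      unfolding \<Phi>_def
    proof (rule dominated_of_coeffs[where Ah = "\<lambda>n. of_real (b n)"])
      show "norm (complex_of_real (b n) - complex_of_real (b (Suc n))) \<le> b n - b (Suc n)" for n
        using bdec[of n] by (simp flip: of_real_diff)
      show "of_nat n * taylor_coeff (test_fun p v M) n = of_real (real n) * of_real (b n)" for n
        by (simp add: taylor_coeff_test_fun b_def)
      show "summable (\<lambda>m. (real (Suc m) - real m) * b (Suc m) * r ^ m)" for r
        by (rule summable_finite[of "{..<2 ^ M}"]) (auto simp: fs)
    qed (use b0 bdec in \<open>auto simp: test_fun_holomorphic\<close>)
    define x where "x k = ennreal (if k \<le> M then v k else 0)" for k
    define z where "z j = (\<Sum>k. ennreal (q ^ ndist j k) * x k)" for j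
    have xs: "(\<Sum>k. epowr (x k) p) = ennreal (\<Sum>k\<le>M. v k powr p)"
    proof -
      have "(\<Sum>k. epowr (x k) p) = (\<Sum>k\<le>M. epowr (x k) p)"
        by (rule suminf_finite) (auto simp: x_def)
      also have "\<dots> = (\<Sum>k\<le>M. ennreal (v k powr p))" using v by (intro sum.cong refl) (simp add: x_def)
      also have "\<dots> = ennreal (\<Sum>k\<le>M. v k powr p)" by (rule sum_ennreal) simp
      finally show ?thesis .
    qed
    have zfin: "z j = ennreal (\<Sum>k\<le>M. q ^ ndist j k * v k)" for j
    proof -
      have "z j = (\<Sum>k\<le>M. ennreal (q ^ ndist j k) * x k)"
        unfolding z_def by (rule suminf_finite) (auto simp: x_def)
      also have "\<dots> = (\<Sum>k\<le>M. ennreal (q ^ ndist j k) * ennreal (v k))"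
        by (intro sum.cong refl) (simp add: x_def)
      also have "\<dots> = ennreal (\<Sum>k\<le>M. q ^ ndist j k * v k)"
        using q v by (intro ennreal_sum_mult[symmetric]) auto
      finally show ?thesis .
    qed
    have kern: "\<beta> k * 2 ^ min j k * gam p ^ j \<le> q ^ ndist j k * v k" for j k
    proof (cases "k \<le> j")
      case True
      have "\<beta> k * 2 ^ min j k * gam p ^ j = v k * gam p ^ (j - k)"
        using True gp by (simp add: \<beta>_def power_mult_distrib power_diff min_def)
      also have "\<dots> \<le> v k * q ^ (j - k)" using v gp by (intro mult_left_mono power_mono) (auto simp: q_def)
      finally show ?thesis using True by (simp add: ndist_def mult.commute)
    next
      case False
      define d where "d = k - j"
      have k: "k = j + d" using False by (simp add: d_def)
      have "\<beta> k * 2 ^ min j k * gam p ^ j = v k * (1 / (2 * gam p)) ^ d"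
        using gp by (simp add: \<beta>_def k power_mult_distrib power_add power_divide)
      also have "\<dots> \<le> v k * q ^ d" using v gp by (intro mult_left_mono power_mono) (auto simp: q_def)
      finally show ?thesis using False by (simp add: ndist_def mult.commute d_def)
    qed
    have \<Phi>0: "0 \<le> \<Phi> j" for j using dom by (simp add: dominated_def)
    have \<Phi>z: "ennreal (\<Phi> j * gam p ^ j) \<le> ennreal 4 * z j" for j
    proof -
      let ?R = "dyad (Suc j)"
      have "(\<Sum>m. (real (Suc m) - real m) * b (Suc m) * ?R ^ m) = (\<Sum>m<2 ^ M. b (Suc m) * ?R ^ m)"
        by (subst suminf_finite[of "{..<2 ^ M}"]) (auto simp: fs)
      also have "\<dots> \<le> (\<Sum>m<2 ^ M. b m * ?R ^ m)"
        by (intro sum_mono mult_right_mono bdec) auto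
      also have "\<dots> = (\<Sum>k\<le>M. \<beta> k * (\<Sum>m<2 ^ M. (if m < 2 ^ k then 1 else 0) * ?R ^ m))"
        unfolding b sum_distrib_right sum_distrib_left by (subst sum.swap) (simp add: mult.assoc)
      also have "\<dots> \<le> (\<Sum>k\<le>M. \<beta> k * (2 * 2 ^ min j k))"
      proof (intro sum_mono mult_left_mono \<beta>0)
        fix k assume "k \<in> {..M}"
        then have "(2::nat) ^ k \<le> 2 ^ M" by (intro power_increasing) auto
        then have "(\<Sum>m<2 ^ M. (if m < 2 ^ k then 1 else 0) * ?R ^ m) = (\<Sum>m<2 ^ k. ?R ^ m)"
          by (intro sum.mono_neutral_cong_right) auto
        also have "\<dots> \<le> min (real (2 ^ k)) (1 / (1 - ?R))" by (rule sum_power_le_min) auto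
        also have "1 / (1 - ?R) = 2 * 2 ^ j" by (simp add: dyad_def power_one_over)
        also have "min (real (2 ^ k)) (2 * 2 ^ j) \<le> 2 * 2 ^ min j k" 
          by (cases "j \<le> k") (auto simp: min_absorb1 min_absorb2 intro: min.coboundedI1 min.coboundedI2)
        finally show "(\<Sum>m<2 ^ M. (if m < 2 ^ k then 1 else 0) * ?R ^ m) \<le> 2 * 2 ^ min j k" .
      qed
      finally have "\<Phi> j * gam p ^ j \<le> 2 * (\<Sum>k\<le>M. \<beta> k * (2 * 2 ^ min j k)) * gam p ^ j"
        unfolding \<Phi>_def using gp by (intro mult_right_mono mult_left_mono) auto
      also have "\<dots> = 4 * (\<Sum>k\<le>M. \<beta> k * 2 ^ min j k * gam p ^ j)"
        by (simp add: sum_distrib_left sum_distrib_right mult_ac)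
      also have "\<dots> \<le> 4 * (\<Sum>k\<le>M. q ^ ndist j k * v k)" by (intro mult_left_mono sum_mono kern) auto
      finally have "ennreal (\<Phi> j * gam p ^ j) \<le> ennreal (4 * (\<Sum>k\<le>M. q ^ ndist j k * v k))" by (rule ennreal_leI)
      also have "\<dots> = ennreal 4 * z j" unfolding zfin using q v by (intro ennreal_mult sum_nonneg) auto
      finally show ?thesis .
    qed
    have s1: "(\<Sum>j. ennreal (\<Phi> j powr p * (1 / 2) ^ j)) \<le> ennreal ((4 * 2 / (1 - q)) powr p) * (\<Sum>k. epowr (x k) p)"
    proof -
      have "(\<Sum>j. ennreal (\<Phi> j powr p * (1 / 2) ^ j)) = (\<Sum>j. epowr (ennreal (\<Phi> j * gam p ^ j)) p)"
        using \<Phi>0 gp p by (intro suminf_cong) (simp add: powr_mult gam_power_powr)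
      also have "\<dots> \<le> ennreal ((4 * 2 / (1 - q)) powr p) * (\<Sum>k. epowr (x k) p)"
        using q p \<Phi>z by (intro geometric_convolution) (auto simp: z_def)
      finally show ?thesis .
    qed
    have s2: "ennreal (norm (test_fun p v M 0) powr p) \<le> ennreal ((1 * 2 / (1 - q)) powr p) * (\<Sum>k. epowr (x k) p)"
    proof -
      have "norm (test_fun p v M 0) = norm (taylor_coeff (test_fun p v M) 0)" by (simp add: taylor_coeff_def)
      also have "\<dots> = b 0" using b0[of 0] by (simp add: taylor_coeff_test_fun b_def)
      also have "\<dots> = (\<Sum>k\<le>M. \<beta> k * 2 ^ min 0 k * gam p ^ 0)" by (simp add: b)
      also have "\<dots> \<le> (\<Sum>k\<le>M. q ^ ndist 0 k * v k)" by (intro sum_mono kern)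
      finally have "ennreal (norm (test_fun p v M 0)) \<le> z 0" unfolding zfin by (rule ennreal_leI)
      then have "epowr (ennreal (norm (test_fun p v M 0))) p \<le> epowr (z 0) p" using p by (intro epowr_mono) auto
      also have "\<dots> \<le> (\<Sum>j. epowr (z j) p)" by (rule ennreal_le_suminf)
      also have "\<dots> \<le> ennreal ((1 * 2 / (1 - q)) powr p) * (\<Sum>k. epowr (x k) p)"
        using q p by (intro geometric_convolution) (auto simp: z_def)
      finally show ?thesis by simp
    qed
    have "dom_sum p (test_fun p v M) \<Phi> \<le> ennreal ((1 * 2 / (1 - q)) powr p) * (\<Sum>k. epowr (x k) p) + ennreal ((4 * 2 / (1 - q)) powr p) * (\<Sum>k. epowr (x k) p)"
      unfolding dom_sum_def by (intro add_mono s1 s2)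
    also have "\<dots> = ennreal C * (\<Sum>k. epowr (x k) p)"
      unfolding C_def by (simp add: distrib_right[symmetric] ennreal_plus[symmetric] del: ennreal_plus)
    also have "\<dots> = ennreal (C * (\<Sum>k\<le>M. v k powr p))"
      unfolding xs using C0 by (intro ennreal_mult[symmetric] sum_nonneg) auto
    finally show ?thesis using dom by blast
  qed
  with C0 show ?thesis by blast
qed

context radial
begin

section \<open>Images of the test functions\<close>

text \<open>The \<open>n\<close>-th moment of the test function with respect to
  \<open>\<mu>\<close>, grouped by its constituent polynomials.\<close>

definition test_moment :: "real \<Rightarrow> (nat \<Rightarrow> real) \<Rightarrow> nat \<Rightarrow> nat \<Rightarrow> real" where
  "test_moment p v M n = (\<Sum>k\<le>M. v k / (2 * gam p) ^ k * (\<Sum>m<2 ^ k. mom (n + m)))"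

lemma test_moment_nonneg: "(\<And>k. 0 \<le> v k) \<Longrightarrow> 0 \<le> test_moment p v M n"
  unfolding test_moment_def using gam_pos[of p] mom_pos
  by (intro sum_nonneg mult_nonneg_nonneg) (auto intro: less_imp_le)

lemma test_moment_eq: "test_moment p v M n = (\<Sum>m<2 ^ M. test_coeff p v M m * mom (n + m))"
proof -
  have "(\<Sum>m<2 ^ M. test_coeff p v M m * mom (n + m)) = (\<Sum>k\<le>M. v k / (2 * gam p) ^ k * (\<Sum>m<2 ^ M. (if m < 2 ^ k then 1 else 0) * mom (n + m)))"
    unfolding test_coeff_def sum_distrib_right sum_distrib_left by (subst sum.swap) (simp add: mult.assoc)
  also have "\<dots> = test_moment p v M n"
    unfolding test_moment_def
  proof (rule sum.cong[OF refl])
    fix k assume "k \<in> {..M}"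
    then have "(2::nat) ^ k \<le> 2 ^ M" by (intro power_increasing) auto
    then have "(\<Sum>m<2 ^ M. (if m < 2 ^ k then 1 else 0) * mom (n + m)) = (\<Sum>m<2 ^ k. mom (n + m))"
      by (intro sum.mono_neutral_cong_right) auto
    then show "v k / (2 * gam p) ^ k * (\<Sum>m<2 ^ M. (if m < 2 ^ k then 1 else 0) * mom (n + m)) = v k / (2 * gam p) ^ k * (\<Sum>m<2 ^ k. mom (n + m))"
      by (simp only:)
  qed
  finally show ?thesis ..
qed

text \<open>Test functions are nonnegative on the interval, so taking absolute values there changes
  nothing and both operators yield the same image.\<close>

lemma test_fun_image:
  assumes v: "\<And>k. 0 \<le> v k"
    and T: "T \<in> {hilbert_op \<omega>, sublinear_hilbert_op \<omega>}" and Tg: "T (test_fun p v M) = Some g"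
  shows "g holomorphic_on ball 0 1" "taylor_coeff g n = of_real (multiplier n * test_moment p v M n)"
proof -
  define f where "f t = (\<Sum>n<2 ^ M. test_coeff p v M n * t ^ n)" for t :: real
  have f0: "0 \<le> f t" if "0 \<le> t" for t unfolding f_def using that test_coeff_nonneg[OF v] by (intro sum_nonneg) auto
  define G :: "real \<Rightarrow> complex" where
    "G = (if T = hilbert_op \<omega> then (\<lambda>t. test_fun p v M (of_real t)) else (\<lambda>t. of_real (norm (test_fun p v M (of_real t)))))"
  have TG: "kernel_op (averaged_kernel \<omega>) \<omega> G = Some g"
    using T Tg by (auto simp: G_def hilbert_op_def sublinear_hilbert_op_def)
  have Gf: "G t = of_real (f t)" if "0 \<le> t" for t
    using f0[OF that] by (auto simp: G_def test_fun_real f_def[symmetric])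
  have cont: "continuous_on {0..<1} G"
  proof -
    have "continuous_on {0..<1} (\<lambda>t. complex_of_real (f t))" unfolding f_def by (intro continuous_intros)
    then show ?thesis by (rule continuous_on_eq) (use Gf in auto)
  qed
  have "(\<integral>\<^sup>+t. ennreal (norm (G t) * indicator {0..<1} t) \<partial>\<mu>) \<le> (\<integral>\<^sup>+t. ennreal (\<Sum>n<2 ^ M. test_coeff p v M n) \<partial>\<mu>)"
  proof (intro nn_integral_mono ennreal_leI)
    fix t
    have "f t \<le> (\<Sum>n<2 ^ M. test_coeff p v M n * 1)" if "0 \<le> t" "t < 1"
      unfolding f_def using that test_coeff_nonneg[OF v] by (intro sum_mono mult_left_mono power_le_one) auto
    then show "norm (G t) * indicator {0..<1} t \<le> (\<Sum>n<2 ^ M. test_coeff p v M n)"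
      using Gf[of t] f0[of t] test_coeff_nonneg[OF v] by (auto split: split_indicator intro: sum_nonneg)
  qed
  also have "\<dots> < \<infinity>"
    by (simp add: \<mu>.emeasure_eq_measure ennreal_mult_less_top)
  finally have fin: "(\<integral>\<^sup>+t. ennreal (norm (G t) * indicator {0..<1} t) \<partial>\<mu>) < \<infinity>" .
  from kernel_op_series[OF cont fin] TG
  have g: "g holomorphic_on ball 0 1" "taylor_coeff g n = of_real (multiplier n) * (\<integral>t. (indicator {0..<1} t *\<^sub>R G t) * of_real (t ^ n) \<partial>\<mu>)" for n
    by auto
  show "g holomorphic_on ball 0 1" by (rule g(1))
  have Gm: "(\<lambda>t. (indicator {0..<1} t *\<^sub>R G t) * of_real (t ^ n)) \<in> borel_measurable borel" for n
    using borel_measurable_continuous_on_indicator[OF _ cont] by measurable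
  have "(\<integral>t. (indicator {0..<1} t *\<^sub>R G t) * of_real (t ^ n) \<partial>\<mu>) = (\<integral>t. complex_of_real (f t * t ^ n) \<partial>\<mu>)"
    by (intro integral_cong_AE eventually_mono[OF AE_\<mu>]) (use Gf Gm in \<open>auto simp: f_def\<close>)
  also have "\<dots> = of_real (\<integral>t. f t * t ^ n \<partial>\<mu>)" by (rule integral_complex_of_real)
  also have "(\<integral>t. f t * t ^ n \<partial>\<mu>) = (\<integral>t. (\<Sum>m<2 ^ M. test_coeff p v M m * t ^ (n + m)) \<partial>\<mu>)"
  proof (intro Bochner_Integration.integral_cong refl)
    fix t :: real
    show "f t * t ^ n = (\<Sum>m<2 ^ M. test_coeff p v M m * t ^ (n + m))"
      unfolding f_def sum_distrib_right by (intro sum.cong refl) (simp add: power_add)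
  qed
  also have "\<dots> = test_moment p v M n"
    unfolding test_moment_eq mom_def
    by (subst Bochner_Integration.integral_sum) (auto intro!: integrable_mult_right integrable_power)
  finally show "taylor_coeff g n = of_real (multiplier n * test_moment p v M n)" by (simp add: g(2))
qed

text \<open>What is extracted from boundedness: the image of a test function at the point
  \<open>dyad j\<close>, bounded through the coefficients \<open>v\<close> alone. Spaces and
  operator no longer occur. The finite set \<open>I\<close> permits selecting the relevant
  frequencies.\<close>

definition test_bound :: "real \<Rightarrow> bool" where
  "test_bound p \<longleftrightarrow> (\<exists>C>0. \<forall>v M j I. (\<forall>k. 0 \<le> v k) \<longrightarrow> finite I \<longrightarrow>
    (\<Sum>n\<in>I. multiplier n * test_moment p v M n * dyad j ^ n) powr p * (1 / 2) ^ j \<le> C * (\<Sum>k\<le>M. v k powr p))"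

text \<open>The test function is dominated, hence small in \<open>X\<close>; its image is evaluated
  on the positive axis, where \<open>dyad_norm\<close> and therefore the norm of \<open>Y\<close>
  controls it. The Taylor coefficients of the image are nonnegative, so any finite partial sum is
  below the value.\<close>

lemma necessity_bound:
  assumes p: "1 < p" and X: "X \<in> admissible_norms p" and Y: "Y \<in> admissible_norms p"
    and T: "T \<in> {hilbert_op \<omega>, sublinear_hilbert_op \<omega>}" and bd: "bounded_op T X Y"
  shows "test_bound p"
proof -
  obtain C0 where C0: "0 < C0" and test: "\<And>v M. \<forall>k. 0 \<le> v k \<Longrightarrow> \<exists>\<Phi>. dominated (test_fun p v M) \<Phi> \<and>
    dom_sum p (test_fun p v M) \<Phi> \<le> ennreal (C0 * (\<Sum>k\<le>M. v k powr p))"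
    using test_fun_dominated[OF p] by metis
  obtain CX where CX: "0 < CX" and domX: "\<And>g \<Phi>. dominated g \<Phi> \<Longrightarrow> epowr (X g) p \<le> ennreal CX * dom_sum p g \<Phi>"
    using norm_le_dominated[OF p X] by metis
  obtain CY where CY: "0 < CY" and domY: "\<And>f. f holomorphic_on ball 0 1 \<Longrightarrow> dyad_norm p f \<le> ennreal CY * epowr (Y f) p"
    using norm_dominates_dyad_norm[OF p Y] by metis
  define S where "S = (SUP f\<in>{f \<in> disc_space X. X f \<le> 1}. Y (the (T f)))"
  have "S < \<infinity>" using bd by (simp add: bounded_op_def S_def)
  then obtain s where s: "S = ennreal s" "0 \<le> s" by (cases S) auto
  \<comment> \<open>The supremum \<open>s\<close> may be \<open>0\<close>; a positive bound keeps
    the final constant positive.\<close>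
  define s1 where "s1 = s + 1"
  have s1: "0 < s1" "s \<le> s1" using s by (auto simp: s1_def)
  \<comment> \<open>Chosen so that test functions whose coefficients have \<open>p\<close>-th powers
    summing to at most \<open>\<epsilon>\<close> lie in the unit ball of \<open>X\<close>.\<close>
  define \<epsilon> where "\<epsilon> = 1 / (CX * C0)"
  have \<epsilon>: "0 < \<epsilon>" using CX C0 by (simp add: \<epsilon>_def)
  define C where "C = CY * s1 powr p / \<epsilon>"
  have Cp: "0 < C" using CY s1 \<epsilon> by (simp add: C_def)
  have norm1: "(\<Sum>n\<in>I. multiplier n * test_moment p v M n * dyad j ^ n) powr p * (1 / 2) ^ j \<le> CY * s1 powr p"
    if v: "\<And>k. 0 \<le> v k" and V: "(\<Sum>k\<le>M. v k powr p) \<le> \<epsilon>" and I: "finite I" for v M j I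
  proof -
    let ?f = "test_fun p v M"
    obtain \<Phi> where \<Phi>: "dominated ?f \<Phi>" "dom_sum p ?f \<Phi> \<le> ennreal (C0 * (\<Sum>k\<le>M. v k powr p))"
      using test[of v M] v by auto
    have "epowr (X ?f) p \<le> ennreal CX * ennreal (C0 * (\<Sum>k\<le>M. v k powr p))"
      by (rule order.trans[OF domX[OF \<Phi>(1)]]) (intro mult_left_mono \<Phi>(2), simp)
    also have "\<dots> \<le> ennreal CX * ennreal (C0 * \<epsilon>)"
      using C0 V by (intro mult_left_mono ennreal_leI) auto
    also have "\<dots> = 1" using CX C0 by (simp add: \<epsilon>_def ennreal_mult[symmetric])
    finally have "X ?f \<le> epowr 1 (1 / p)" using p by (intro epowr_le_imp_le) auto
    then have Xf: "X ?f \<le> 1" using epowr_ennreal[of 1 "1 / p"] by simp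
    then have fX: "?f \<in> disc_space X"
      by (auto simp: disc_space_def test_fun_holomorphic intro: le_less_trans)
    then obtain g where g: "T ?f = Some g" "g \<in> disc_space Y" using bd by (auto simp: bounded_op_def)
    have "Y (the (T ?f)) \<le> S" unfolding S_def using fX Xf by (intro SUP_upper) auto
    then have "Y g \<le> ennreal s" using g s by simp
    also have "\<dots> \<le> ennreal s1" by (rule ennreal_leI) (rule s1(2))
    finally have Yg: "Y g \<le> ennreal s1" .
    have gh: "g holomorphic_on ball 0 1" and tay: "\<And>n. taylor_coeff g n = of_real (multiplier n * test_moment p v M n)"
      using test_fun_image[OF v T g(1)] by auto
    have "ennreal (max_mean (dyad j) g powr p * (1 / 2) ^ j) \<le> dyad_norm p g"
      unfolding dyad_norm_def by (rule ennreal_le_suminf)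
    also have "\<dots> \<le> ennreal CY * epowr (Y g) p" by (rule domY[OF gh])
    also have "\<dots> \<le> ennreal CY * epowr (ennreal s1) p"
      using p by (intro mult_left_mono epowr_mono Yg) auto
    also have "\<dots> = ennreal (CY * s1 powr p)" using CY s1 by (simp add: ennreal_mult)
    finally have 1: "max_mean (dyad j) g powr p * (1 / 2) ^ j \<le> CY * s1 powr p"
      using CY by (subst (asm) ennreal_le_iff) auto
    have t0: "0 \<le> multiplier n * test_moment p v M n * dyad j ^ n" for n
    proof -
      have "0 \<le> test_moment p v M n" by (rule test_moment_nonneg[OF v])
      then show ?thesis using multiplier_pos[of n] by simp
    qed
    have "(\<lambda>n. taylor_coeff g n * of_real (dyad j) ^ n) sums g (of_real (dyad j))"
      by (rule taylor_sums[OF gh]) simp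
    then have "(\<lambda>n. complex_of_real (multiplier n * test_moment p v M n * dyad j ^ n)) sums g (of_real (dyad j))"
      by (simp add: tay)
    then have "(\<lambda>n. Re (complex_of_real (multiplier n * test_moment p v M n * dyad j ^ n))) sums Re (g (of_real (dyad j)))"
      by (rule sums_Re)
    then have sm: "(\<lambda>n. multiplier n * test_moment p v M n * dyad j ^ n) sums Re (g (of_real (dyad j)))"
      by (simp only: Re_complex_of_real)
    have "(\<Sum>n\<in>I. multiplier n * test_moment p v M n * dyad j ^ n) \<le> (\<Sum>n. multiplier n * test_moment p v M n * dyad j ^ n)"
      using sm t0 I by (intro sum_le_suminf) (auto simp: sums_iff)
    also have "\<dots> = Re (g (of_real (dyad j)))" using sm by (simp add: sums_iff)
    also have "\<dots> \<le> norm (g (of_real (dyad j)))" by (rule complex_Re_le_cmod)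
    also have "\<dots> \<le> max_mean (dyad j) g"
      using norm_le_max_mean[OF gh, of "of_real (dyad j)"] by simp
    finally have "(\<Sum>n\<in>I. multiplier n * test_moment p v M n * dyad j ^ n) powr p * (1 / 2) ^ j \<le> max_mean (dyad j) g powr p * (1 / 2) ^ j"
      using p t0 by (intro mult_right_mono powr_mono2) (auto intro: sum_nonneg)
    with 1 show ?thesis by linarith
  qed
  have "(\<Sum>n\<in>I. multiplier n * test_moment p v M n * dyad j ^ n) powr p * (1 / 2) ^ j \<le> C * (\<Sum>k\<le>M. v k powr p)"
    if v: "\<And>k. 0 \<le> v k" and I: "finite I" for v M j I
  proof (cases "(\<Sum>k\<le>M. v k powr p) = 0")
    case True
    then have "v k = 0" if "k \<le> M" for k
      using that sum_nonneg_eq_0_iff[of "{..M}" "\<lambda>k. v k powr p"] by auto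
    then have "test_moment p v M n = 0" for n unfolding test_moment_def by (intro sum.neutral) auto
    then show ?thesis using True p by simp
  next
    case False
    define V where "V = (\<Sum>k\<le>M. v k powr p)"
    have V0: "0 < V" using False unfolding V_def by (simp add: sum_nonneg order_less_le)
    \<comment> \<open>Homogeneity: the coefficients are scaled until their \<open>p\<close>-th
      powers sum to \<open>\<epsilon>\<close>.\<close>
    define c where "c = (\<epsilon> / V) powr (1 / p)"
    have c0: "0 < c" using \<epsilon> V0 by (simp add: c_def)
    have cp: "c powr p = \<epsilon> / V" using \<epsilon> V0 p by (simp add: c_def powr_powr)
    have "(\<Sum>k\<le>M. (c * v k) powr p) = c powr p * V"
      using c0 v by (simp add: V_def powr_mult sum_distrib_left)
    then have Vc: "(\<Sum>k\<le>M. (c * v k) powr p) \<le> \<epsilon>" using V0 by (simp add: cp)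
    have sc: "test_moment p (\<lambda>k. c * v k) M n = c * test_moment p v M n" for n
      unfolding test_moment_def by (simp add: sum_distrib_left mult_ac)
    define Q where "Q = (\<Sum>n\<in>I. multiplier n * test_moment p v M n * dyad j ^ n)"
    have Q0: "0 \<le> Q" unfolding Q_def
      using multiplier_pos test_moment_nonneg[OF v] by (intro sum_nonneg mult_nonneg_nonneg) (auto intro: less_imp_le)
    have "(\<Sum>n\<in>I. multiplier n * test_moment p (\<lambda>k. c * v k) M n * dyad j ^ n) powr p * (1 / 2) ^ j \<le> CY * s1 powr p"
      using v c0 Vc I by (intro norm1) auto
    also have "(\<Sum>n\<in>I. multiplier n * test_moment p (\<lambda>k. c * v k) M n * dyad j ^ n) = c * Q"
      unfolding sc Q_def by (simp add: sum_distrib_left mult_ac)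
    finally have "\<epsilon> / V * (Q powr p * (1 / 2) ^ j) \<le> CY * s1 powr p"
      using c0 Q0 by (simp add: powr_mult cp)
    then have "Q powr p * (1 / 2) ^ j \<le> C * V"
      using \<epsilon> V0 by (simp add: C_def field_simps)
    then show ?thesis by (simp add: Q_def V_def)
  qed
  with Cp show ?thesis unfolding test_bound_def by blast
qed

subsection \<open>Necessary conditions\<close>

text \<open>Tested on the single polynomial of length \<open>2 ^ K\<close>. For indices in
  \<open>I\<close> the multipliers are bounded below through \<open>mom (2 * a * 2 ^ K)\<close> and
  the test moments through \<open>mom ((a + 2) * 2 ^ K)\<close>; the powers of 2 and of
  \<open>gam p\<close> cancel. For \<open>a > 2\<close> a moment is thus bounded by one of higher
  order.\<close>

lemma moment_step:
  assumes p: "1 < p" and tb: "test_bound p"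
  shows "\<exists>C>0. \<forall>K. mom ((a + 2) * 2 ^ K) \<le> C * mom (2 * a * 2 ^ K)"
proof -
  obtain C where C: "0 < C" and tb: "\<forall>v M j I. (\<forall>k. 0 \<le> v k) \<longrightarrow> finite I \<longrightarrow>
    (\<Sum>n\<in>I. multiplier n * test_moment p v M n * dyad j ^ n) powr p * (1 / 2) ^ j \<le> C * (\<Sum>k\<le>M. v k powr p)"
    using tb unfolding test_bound_def by (elim exE conjE) (rule that)
  define c where "c = (1 / 4) ^ (a + 1) / (2 * (real a + 1))"
  have c0: "0 < c" by (simp add: c_def)
  have gp: "0 < gam p" by (rule gam_pos)
  have "mom ((a + 2) * 2 ^ K) \<le> ((2 * C) powr (1 / p) / c) * mom (2 * a * 2 ^ K)" for K
  proof -
    define v where "v k = (if k = K then 1 else 0 :: real)" for k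
    define I where "I = {a * 2 ^ K..<(a + 1) * 2 ^ K}"
    define m1 where "m1 = mom ((a + 2) * 2 ^ K)"
    define m2 where "m2 = mom (2 * a * 2 ^ K)"
    have m0: "0 < m1" "0 < m2" by (simp_all add: m1_def m2_def mom_pos)
    \<comment> \<open>\<open>L\<close> bounds the multipliers on \<open>I\<close> from below, and
      \<open>S\<close> the test moments.\<close>
    define L where "L = 1 / (2 * ((real a + 1) * 2 ^ K) * m2)"
    define S where "S = m1 / gam p ^ K"
    have L0: "0 \<le> L" using m0 by (simp add: L_def)
    have S0: "0 \<le> S" using m0 gp by (simp add: S_def)
    have summand: "L * S * (1 / 4) ^ (a + 1) \<le> multiplier n * test_moment p v K n * dyad (Suc K) ^ n" if n: "n \<in> I" for n
    proof (intro mult_mono)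
      have n': "a * 2 ^ K \<le> n" "n + 1 \<le> (a + 1) * 2 ^ K" using n by (auto simp: I_def)
      have "real (n + 1) \<le> real ((a + 1) * 2 ^ K)" using n'(2) by (simp only: of_nat_le_iff)
      then have n1: "real n + 1 \<le> (real a + 1) * 2 ^ K" by (simp add: algebra_simps)
      have "mom (2 * n + 1) \<le> m2" unfolding m2_def using n'(1) by (intro mom_antimono) simp
      then show "L \<le> multiplier n"
        unfolding L_def multiplier_def using n1 mom_pos[of "2 * n + 1"] m0
        by (intro divide_left_mono mult_mono mult_pos_pos) auto
      have "test_moment p v K n = (1 / (2 * gam p) ^ K) * (\<Sum>m<2 ^ K. mom (n + m))"
        unfolding test_moment_def v_def by (subst sum.remove[of _ K]) (auto intro: sum.neutral)
      moreover have "(\<Sum>m<(2::nat) ^ K. m1) \<le> (\<Sum>m<2 ^ K. mom (n + m))"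
      proof (rule sum_mono)
        fix m :: nat assume "m \<in> {..<2 ^ K}"
        then have "n + m \<le> (a + 1) * 2 ^ K + 2 ^ K" using n'(2) by auto
        then show "m1 \<le> mom (n + m)" unfolding m1_def by (intro mom_antimono) (simp add: algebra_simps)
      qed
      then have "(1 / (2 * gam p) ^ K) * (\<Sum>m<(2::nat) ^ K. m1) \<le> (1 / (2 * gam p) ^ K) * (\<Sum>m<2 ^ K. mom (n + m))"
        using gp by (intro mult_left_mono) auto
      moreover have "(1 / (2 * gam p) ^ K) * (\<Sum>m<(2::nat) ^ K. m1) = S"
        using gp by (simp add: S_def power_mult_distrib)
      ultimately show "S \<le> test_moment p v K n" by simp
      have "(1 / 4) ^ (a + 1) \<le> (dyad (Suc K) ^ (2 ^ Suc K)) ^ (a + 1)"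
        by (intro power_mono dyad_power_ge) auto
      also have "\<dots> = dyad (Suc K) ^ (2 ^ Suc K * (a + 1))" by (simp only: power_mult)
      also have "\<dots> \<le> dyad (Suc K) ^ n"
        proof (rule power_decreasing)
          have "(a + 1) * 2 ^ K \<le> 2 ^ Suc K * (a + 1)" by simp
          then show "n \<le> 2 ^ Suc K * (a + 1)" using n'(2) by linarith
        qed (auto intro: less_imp_le)
      finally show "(1 / 4) ^ (a + 1) \<le> dyad (Suc K) ^ n" .
    qed (use L0 S0 multiplier_pos[of n] test_moment_nonneg[of v p K n] in \<open>auto simp: v_def less_imp_le\<close>)
    have cI: "card I = 2 ^ K" by (simp add: I_def)
    have "2 ^ K * (L * S * (1 / 4) ^ (a + 1)) = (\<Sum>n\<in>I. L * S * (1 / 4) ^ (a + 1))" by (simp add: cI)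
    also have "\<dots> \<le> (\<Sum>n\<in>I. multiplier n * test_moment p v K n * dyad (Suc K) ^ n)" by (intro sum_mono summand)
    finally have 1: "2 ^ K * (L * S * (1 / 4) ^ (a + 1)) \<le> (\<Sum>n\<in>I. multiplier n * test_moment p v K n * dyad (Suc K) ^ n)" .
    have rescale: "k * (1 / (2 * (A * k) * y) * (x / z) * E) = E / (2 * A) * (x / y) / z" if "k \<noteq> 0" for k A x y z E :: real
      using that by (simp add: mult_ac)
    have "2 ^ K * (L * S * (1 / 4) ^ (a + 1)) = c * (m1 / m2) / gam p ^ K"
      unfolding L_def S_def c_def by (rule rescale) simp
    with 1 have "c * (m1 / m2) / gam p ^ K \<le> (\<Sum>n\<in>I. multiplier n * test_moment p v K n * dyad (Suc K) ^ n)" by (simp only:)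
    then have "(c * (m1 / m2) / gam p ^ K) powr p * (1 / 2) ^ Suc K \<le> (\<Sum>n\<in>I. multiplier n * test_moment p v K n * dyad (Suc K) ^ n) powr p * (1 / 2) ^ Suc K"
      using p c0 m0 gp by (intro mult_right_mono powr_mono2) (auto intro!: divide_nonneg_nonneg mult_nonneg_nonneg)
    also have "\<dots> \<le> C * (\<Sum>k\<le>K. v k powr p)"
      by (rule tb[rule_format]) (auto simp: v_def I_def)
    also have "(\<Sum>k\<le>K. v k powr p) = 1"
      unfolding v_def by (subst sum.remove[of _ K]) (auto intro: sum.neutral)
    finally have "(c * (m1 / m2) / gam p ^ K) powr p * (1 / 2) ^ Suc K \<le> C" by simp
    moreover have "(c * (m1 / m2) / gam p ^ K) powr p * (1 / 2) ^ Suc K = (c * (m1 / m2)) powr p / 2"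
      using p by (subst powr_divide) (simp add: gam_power_powr)
    ultimately have "(c * (m1 / m2)) powr p \<le> 2 * C" by simp
    then have "((c * (m1 / m2)) powr p) powr (1 / p) \<le> (2 * C) powr (1 / p)"
      using p by (intro powr_mono2) auto
    then have "c * (m1 / m2) \<le> (2 * C) powr (1 / p)" using p c0 m0 by (simp add: powr_powr)
    then have "m1 \<le> (2 * C) powr (1 / p) / c * m2" using c0 m0 by (simp add: field_simps)
    then show ?thesis by (simp add: m1_def m2_def)
  qed
  moreover have "0 < (2 * C) powr (1 / p) / c" using C c0 by simp
  ultimately show ?thesis by blast
qed

text \<open>The point is that \<open>mom (2 ^ k)\<close> is at most a constant times
  \<open>w k\<close>. After \<open>J\<close> doublings of the order, the radii below
  \<open>dyad k\<close> contribute only a small multiple of \<open>mom (2 ^ k)\<close> itself, which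
  is absorbed; what remains is the tail.\<close>

lemma moment_doubling_imp:
  assumes C: "\<And>k. mom (2 ^ k) \<le> C * mom (2 ^ Suc k)"
  shows tail_doubling
proof -
  define D where "D = max 1 C"
  have D1: "1 \<le> D" by (simp add: D_def)
  have D: "mom (2 ^ k) \<le> D * mom (2 ^ Suc k)" for k
  proof -
    have "C * mom (2 ^ Suc k) \<le> D * mom (2 ^ Suc k)"
      using mom_pos[of "2 ^ Suc k"] by (intro mult_right_mono) (auto simp: D_def)
    then show ?thesis using C[of k] by linarith
  qed
  have iter: "mom (2 ^ k) \<le> D ^ J * mom (2 ^ (k + J))" for k J
  proof (induction J)
    case 0
    then show ?case by simp
  next
    case (Suc J)
    have "D ^ J * mom (2 ^ (k + J)) \<le> D ^ J * (D * mom (2 ^ Suc (k + J)))"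
      using D1 by (intro mult_left_mono D) auto
    then show ?case using Suc by (simp add: mult_ac)
  qed
  obtain B where B: "0 < B" "\<And>d. (2 * D) ^ d * exp (- (2 ^ d)) \<le> B" using power_exp_bounded[of "2 * D"] by auto
  \<comment> \<open>The doublings cost \<open>D ^ J\<close> and the exponential gains
    \<open>exp (- (2 ^ J))\<close>; \<open>J\<close> is so large that the product, with the extra
    factor \<open>exp 1\<close>, is at most \<open>1 / 2\<close>.\<close>
  obtain J where J: "2 * exp 1 * B < 2 ^ J" using real_arch_pow[of 2 "2 * exp 1 * B"] by auto
  have DJ: "D ^ J * (exp 1 * exp (- (2 ^ J))) \<le> 1 / 2"
  proof -
    have "2 ^ J * (D ^ J * exp (- (2 ^ J))) \<le> B" using B(2)[of J] by (simp add: power_mult_distrib mult.assoc)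
    then have "2 * exp 1 * (2 ^ J * (D ^ J * exp (- (2 ^ J)))) \<le> 2 * exp 1 * B" by (intro mult_left_mono) auto
    also have "\<dots> \<le> 2 ^ J" using J by simp
    finally have "2 ^ J * (2 * (D ^ J * (exp 1 * exp (- (2 ^ J))))) \<le> 2 ^ J * 1" by (simp add: mult_ac)
    then have "2 * (D ^ J * (exp 1 * exp (- (2 ^ J)))) \<le> 1" by (rule mult_left_le_imp_le) simp
    then show ?thesis by simp
  qed
  have up: "mom (2 ^ k) \<le> 2 * D ^ J * w k" for k
  proof -
    have i1: "integrable \<mu> (\<lambda>t. exp 1 * exp (- (2 ^ J)) * t ^ (2 ^ k))"
      by (intro integrable_mult_right integrable_power)
    have i2: "integrable \<mu> (\<lambda>t. indicator {dyad k..<1} t :: real)"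
      by (rule integrable_bounded[where B = 1]) (auto split: split_indicator)
    have "mom (2 ^ (k + J)) \<le> (\<integral>t. exp 1 * exp (- (2 ^ J)) * t ^ (2 ^ k) + indicator {dyad k..<1} t \<partial>\<mu>)"
      unfolding mom_def
    proof (rule integral_mono_AE[OF integrable_power Bochner_Integration.integrable_add[OF i1 i2]])
      show "AE t in \<mu>. t ^ 2 ^ (k + J) \<le> exp 1 * exp (- (2 ^ J)) * t ^ (2 ^ k) + indicator {dyad k..<1} t"
      proof (rule eventually_mono[OF AE_\<mu>])
        fix t :: real assume t: "0 \<le> t \<and> t < 1"
        show "t ^ 2 ^ (k + J) \<le> exp 1 * exp (- (2 ^ J)) * t ^ (2 ^ k) + indicator {dyad k..<1} t"
        proof (cases "dyad k \<le> t")
          case True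
          have "t ^ 2 ^ (k + J) \<le> 1" using t by (intro power_le_one) auto
          moreover have "0 \<le> exp 1 * exp (- (2 ^ J)) * t ^ (2 ^ k)" using t by simp
          moreover have "indicator {dyad k..<1} t = (1::real)" using True t by simp
          ultimately show ?thesis by linarith
        next
          case False
          have "(1::nat) \<le> 2 ^ J" by simp
          \<comment> \<open>One factor \<open>t ^ 2 ^ k\<close> is kept; the other
            \<open>2 ^ J - 1\<close> factors give the exponential, and the missing one accounts for
            \<open>exp 1\<close>.\<close>
          then have e: "2 ^ (k + J) = 2 ^ k * (2 ^ J - 1) + (2::nat) ^ k"
            by (simp add: power_add algebra_simps diff_mult_distrib2)
          have "t ^ (2 ^ k * (2 ^ J - 1)) \<le> dyad k ^ (2 ^ k * (2 ^ J - 1))"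
            using t False by (intro power_mono) auto
          also have "\<dots> \<le> exp (- (real (2 ^ k * (2 ^ J - 1)) * (1 / 2) ^ k))" by (rule dyad_power_le_exp)
          also have "real (2 ^ k * (2 ^ J - 1)) * (1 / 2) ^ k = 2 ^ J - 1"
            by (simp add: power_one_over of_nat_diff)
          also have "exp (- (2 ^ J - 1)) = exp 1 * exp (- (2 ^ J :: real))" by (simp add: exp_diff exp_minus field_simps)
          finally have "t ^ (2 ^ k * (2 ^ J - 1)) * t ^ (2 ^ k) \<le> exp 1 * exp (- (2 ^ J)) * t ^ (2 ^ k)"
            using t by (intro mult_right_mono) auto
          moreover have "t ^ 2 ^ (k + J) = t ^ (2 ^ k * (2 ^ J - 1)) * t ^ (2 ^ k)" unfolding e by (rule power_add)
          moreover have "indicator {dyad k..<1} t = (0::real)" using False by simp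
          ultimately show ?thesis by linarith
        qed
      qed
    qed
    also have "\<dots> = exp 1 * exp (- (2 ^ J)) * mom (2 ^ k) + w k"
      unfolding mom_def w_def by (subst Bochner_Integration.integral_add[OF i1 i2]) (simp add: tl_eq)
    finally have "D ^ J * mom (2 ^ (k + J)) \<le> D ^ J * (exp 1 * exp (- (2 ^ J)) * mom (2 ^ k) + w k)"
      using D1 by (intro mult_left_mono) auto
    then have "mom (2 ^ k) \<le> (D ^ J * (exp 1 * exp (- (2 ^ J)))) * mom (2 ^ k) + D ^ J * w k"
      using iter[of k J] by (simp add: algebra_simps)
    also have "\<dots> \<le> 1 / 2 * mom (2 ^ k) + D ^ J * w k"
      using mom_pos[of "2 ^ k"] by (intro add_right_mono mult_right_mono DJ) auto
    finally show ?thesis by simp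
  qed
  \<comment> \<open>For \<open>k = 0\<close> the moment bounds of \<open>w k\<close> from below the
    next radius start too late, so the first ratio enters the constant directly.\<close>
  define E where "E = max (w 0 / w 1) (8 * D * D ^ J)"
  have "w k \<le> E * w (Suc k)" for k
  proof (cases k)
    case 0
    have "w 0 = w 0 / w 1 * w 1" using w_pos[of 1] by simp
    also have "\<dots> \<le> E * w 1" using w_pos[of 1] by (intro mult_right_mono) (auto simp: E_def)
    finally show ?thesis using 0 by simp
  next
    case (Suc i)
    have "w k / 4 \<le> mom (2 ^ k)" unfolding Suc by (rule mom_ge_w) simp
    also have "\<dots> \<le> D * mom (2 ^ Suc k)" by (rule D)
    also have "\<dots> \<le> D * (2 * D ^ J * w (Suc k))" using D1 by (intro mult_left_mono up) auto
    finally have "w k \<le> 8 * D * D ^ J * w (Suc k)" by simp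
    also have "\<dots> \<le> E * w (Suc k)" using w_pos[of "Suc k"] by (intro mult_right_mono) (auto simp: E_def)
    finally show ?thesis .
  qed
  then show ?thesis by (auto simp: tail_doubling_def)
qed

text \<open>Two steps double the order: in units of \<open>2 ^ K\<close>, \<open>a = 6\<close> leads
  from 8 to 12, and \<open>a = 4\<close> at the next scale from 12 to 16.\<close>

lemma test_bound_imp_tail_doubling:
  assumes p: "1 < p" and tb: "test_bound p"
  shows tail_doubling
proof -
  obtain C6 where C6: "0 < C6" "\<And>K. mom ((6 + 2) * 2 ^ K) \<le> C6 * mom (2 * 6 * 2 ^ K)"
    using moment_step[OF p tb, of 6] by metis
  obtain C4 where C4: "0 < C4" "\<And>K. mom ((4 + 2) * 2 ^ K) \<le> C4 * mom (2 * 4 * 2 ^ K)"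
    using moment_step[OF p tb, of 4] by metis
  have big: "mom (2 ^ (K + 3)) \<le> C6 * C4 * mom (2 ^ Suc (K + 3))" for K
  proof -
    have "mom (2 ^ (K + 3)) \<le> C6 * mom (12 * 2 ^ K)" using C6(2)[of K] by (simp add: power_add mult.commute)
    also have "mom (12 * 2 ^ K) \<le> C4 * mom (2 ^ Suc (K + 3))" using C4(2)[of "Suc K"] by (simp add: power_add mult.commute)
    finally show ?thesis using C6(1) by simp
  qed
  \<comment> \<open>The orders 1, 2 and 4 lie below the reach of \<open>big\<close> and enter with
    their own ratios.\<close>
  define C where "C = Max {C6 * C4, mom 1 / mom 2, mom 2 / mom 4, mom 4 / mom 8}"
  have Cge: "C6 * C4 \<le> C" "mom 1 / mom 2 \<le> C" "mom 2 / mom 4 \<le> C" "mom 4 / mom 8 \<le> C" by (simp_all add: C_def)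
  have sm: "x \<le> C * y" if "x / y \<le> C" "0 < y" for x y :: real using that by (simp add: divide_le_eq)
  have "mom (2 ^ k) \<le> C * mom (2 ^ Suc k)" for k
  proof -
    consider "k = 0" | "k = 1" | "k = 2" | K where "k = K + 3"
      by (metis One_nat_def Suc_1 add.commute add_2_eq_Suc' le_add_diff_inverse less_Suc0 linorder_not_less not_less_eq numeral_3_eq_3 nat_neq_iff)
    then show ?thesis
    proof cases
      case 1 then show ?thesis using sm[OF Cge(2)] mom_pos by simp
    next
      case 2 then show ?thesis using sm[OF Cge(3)] mom_pos by simp
    next
      case 3 then show ?thesis using sm[OF Cge(4)] mom_pos by simp
    next
      case (4 K)
      have "C6 * C4 * mom (2 ^ Suc (K + 3)) \<le> C * mom (2 ^ Suc (K + 3))"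
        using mom_pos[of "2 ^ Suc (K + 3)"] by (intro mult_right_mono Cge) auto
      then show ?thesis using big[of K] 4 by simp
    qed
  qed
  then show ?thesis by (rule moment_doubling_imp)
qed

text \<open>For \<open>n\<close> in block \<open>i\<close> the order \<open>2 * n + 1\<close> lies
  between \<open>2 ^ i\<close> and \<open>2 ^ (i + 2)\<close>; the upper end costs two doubling
  steps.\<close>

lemma moment_comparable:
  assumes tail_doubling
  obtains c C where "0 < c" "0 < C" "\<And>n i. n \<in> dblock i \<Longrightarrow> c * w i \<le> mom (2 * n + 1)" "\<And>n i. n \<in> dblock i \<Longrightarrow> mom (2 * n + 1) \<le> C * w i"
proof -
  obtain D where D: "1 \<le> D" "\<And>j k. j \<le> k \<Longrightarrow> w j \<le> D ^ (k - j) * w k" using tail_doublingD[OF assms] by auto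
  obtain C where C: "0 < C" "\<And>k. mom (2 ^ k) \<le> C * w k" using mom_le[OF assms] by metis
  have "1 / (4 * D\<^sup>2) * w i \<le> mom (2 * n + 1)" if "n \<in> dblock i" for n i
  proof -
    have "2 * n + 1 \<le> 2 ^ Suc (Suc i)" using that by (auto simp: mem_dblock)
    then have "w (Suc (Suc i)) / 4 \<le> mom (2 * n + 1)" by (rule mom_ge_w)
    moreover have "w i \<le> D\<^sup>2 * w (Suc (Suc i))" using D(2)[of i "Suc (Suc i)"] by (simp add: numeral_2_eq_2)
    then have "1 / (4 * D\<^sup>2) * w i \<le> 1 / (4 * D\<^sup>2) * (D\<^sup>2 * w (Suc (Suc i)))" by (intro mult_left_mono) auto
    moreover have "1 / (4 * D\<^sup>2) * (D\<^sup>2 * w (Suc (Suc i))) = w (Suc (Suc i)) / 4" using D(1) by simp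
    ultimately show ?thesis by linarith
  qed
  moreover have "mom (2 * n + 1) \<le> C * w i" if "n \<in> dblock i" for n i
  proof -
    have "2 ^ i \<le> 2 * n + 1" using that by (auto simp: mem_dblock)
    then have "mom (2 * n + 1) \<le> mom (2 ^ i)" by (rule mom_antimono)
    then show ?thesis using C(2)[of i] by linarith
  qed
  ultimately show thesis using D(1) C(1) by (intro that[of "1 / (4 * D\<^sup>2)" C]) auto
qed

section \<open>The sum condition in terms of dyadic blocks\<close>

text \<open>With \<open>u = w i * 2 powr (i / p)\<close> this is \<open>u powr (- p)\<close>, and
  for conjugate exponents \<open>tail_block\<close> is \<open>u powr q\<close>. For doubling weights
  these are the sizes of the dyadic blocks in the two factors of both suprema.\<close>

definition head_block :: "real \<Rightarrow> nat \<Rightarrow> real" where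
  "head_block p i = (1 / 2) ^ i * w i powr (- p)"

definition tail_block :: "real \<Rightarrow> nat \<Rightarrow> real" where
  "tail_block q i = w i powr q * 2 powr (real i * (q - 1))"

lemma head_block_pos: "0 < head_block p i"
  using w_pos[of i] by (simp add: head_block_def)

lemma tail_block_pos: "0 < tail_block q i"
  using w_pos[of i] by (simp add: tail_block_def)

lemma conjugate_exponent_div: "1 < p \<Longrightarrow> 1 / p + 1 / q = 1 \<Longrightarrow> 1 < q \<Longrightarrow> q / p = q - (1::real)"
  by (simp add: field_simps)

lemma head_block_tail_block:
  assumes pq: "1 < p" "1 < q" "1 / p + 1 / q = 1"
  shows "tail_block q i = head_block p i powr (- (q / p))" "head_block p i powr (1 / p) * tail_block q i powr (1 / q) = 1"
proof -
  have "head_block p i powr (- (q / p)) = (2 powr (- real i)) powr (- (q / p)) * (w i powr (- p)) powr (- (q / p))"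
    unfolding head_block_def half_power using w_pos[of i] by (simp add: powr_mult)
  also have "\<dots> = 2 powr (real i * (q / p)) * w i powr q"
    using pq by (simp add: powr_powr)
  also have "\<dots> = tail_block q i" unfolding conjugate_exponent_div[OF pq(1,3,2)] by (simp add: tail_block_def)
  finally show b: "tail_block q i = head_block p i powr (- (q / p))" ..
  have "head_block p i powr (1 / p) * tail_block q i powr (1 / q) = head_block p i powr (1 / p) * head_block p i powr (- (1 / p))"
    unfolding b using pq by (simp add: powr_powr)
  also have "\<dots> = 1" using head_block_pos[of p i] by (simp add: powr_add[symmetric])
  finally show "head_block p i powr (1 / p) * tail_block q i powr (1 / q) = 1" .
qed

text \<open>Raising to the power \<open>q\<close> and dividing by the head turns the product into
  the sum condition, as \<open>tail_block q j\<close> is the power \<open>- q / p\<close> of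
  \<open>head_block p j\<close>. The blocks \<open>j\<close> and \<open>Suc j\<close> are added by
  monotonicity of \<open>w\<close>; leaving them out of the hypothesis gives room at the splitting
  point.\<close>

lemma tail_sum_boundI:
  assumes pq: "1 < p" "1 < q" "1 / p + 1 / q = 1"
    and C: "\<And>j M. head_block p j powr (1 / p) * (\<Sum>k=j+2..M. tail_block q k) powr (1 / q) \<le> C"
  shows "tail_sum_bound q"
proof -
  define D where "D = max 0 C"
  have bound: "(\<Sum>k=j+2..M. tail_block q k) \<le> D powr q * tail_block q j" for j M
  proof -
    define s where "s = (\<Sum>k=j+2..M. tail_block q k)"
    have s0: "0 \<le> s" unfolding s_def by (intro sum_nonneg less_imp_le tail_block_pos)
    have "(head_block p j powr (1 / p) * s powr (1 / q)) powr q \<le> D powr q"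
      using C[of j M] pq unfolding s_def[symmetric] by (intro powr_mono2) (auto simp: D_def)
    moreover have "(head_block p j powr (1 / p) * s powr (1 / q)) powr q = head_block p j powr (q / p) * s"
      using pq s0 by (simp add: powr_mult powr_powr)
    ultimately have "head_block p j powr (q / p) * s * head_block p j powr (- (q / p)) \<le> D powr q * head_block p j powr (- (q / p))"
      by (intro mult_right_mono) auto
    moreover have "head_block p j powr (q / p) * s * head_block p j powr (- (q / p)) = s"
      using head_block_pos[of p j] by (simp add: powr_minus)
    ultimately have "s \<le> D powr q * tail_block q j" unfolding head_block_tail_block(1)[OF pq, of j] by (simp only:)
    then show ?thesis by (simp only: s_def)
  qed
  have nxt: "tail_block q (Suc j) \<le> 2 powr (q - 1) * tail_block q j" for j
  proof -
    have "w (Suc j) powr q \<le> w j powr q" using w_antimono[of j "Suc j"] w_pos[of "Suc j"] pq by (intro powr_mono2) auto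
    then have "w (Suc j) powr q * (2 powr (q - 1) * 2 powr (real j * (q - 1))) \<le> w j powr q * (2 powr (q - 1) * 2 powr (real j * (q - 1)))"
      by (intro mult_right_mono) auto
    moreover have "2 powr (real (Suc j) * (q - 1)) = 2 powr (q - 1) * 2 powr (real j * (q - 1))"
      by (subst powr_add[symmetric]) (simp add: algebra_simps)
    ultimately show ?thesis unfolding tail_block_def by (simp only: mult.left_commute)
  qed
  have "(\<Sum>k=j..M. tail_block q k) \<le> (1 + 2 powr (q - 1) + D powr q) * tail_block q j" for j M
  proof -
    have "{j..M} \<subseteq> {j, Suc j} \<union> {j+2..M}" by auto
    then have "(\<Sum>k=j..M. tail_block q k) \<le> (\<Sum>k\<in>{j, Suc j} \<union> {j+2..M}. tail_block q k)"
      by (intro sum_mono2) (auto intro: less_imp_le tail_block_pos)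
    also have "\<dots> = (tail_block q j + tail_block q (Suc j)) + (\<Sum>k=j+2..M. tail_block q k)"
      by (subst sum.union_disjoint) auto
    also have "\<dots> \<le> (tail_block q j + 2 powr (q - 1) * tail_block q j) + D powr q * tail_block q j"
      by (intro add_mono nxt bound order.refl)
    finally show ?thesis by (simp add: algebra_simps)
  qed
  then show ?thesis unfolding tail_sum_bound_def tail_block_def by (intro exI allI)
qed

text \<open>The tail sums are the condition itself. The head sums need its improvement: as
  \<open>w i * 2 powr (i / p)\<close> decays geometrically up to a constant,
  \<open>head_block\<close> grows in the same way and its last term dominates.\<close>

lemma tail_sum_bound_sums:
  assumes pq: "1 < p" "1 < q" "1 / p + 1 / q = 1" and G: "tail_sum_bound q"
  obtains C where "0 < C" "\<And>j. (\<Sum>i\<le>j. head_block p i) \<le> C * head_block p j"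
    "\<And>j. (\<Sum>i. if j \<le> i then ennreal (tail_block q i) else 0) \<le> ennreal (C * tail_block q j)"
proof -
  obtain C1 \<theta> where C1: "0 < C1" and \<theta>: "0 < \<theta>" "\<theta> < 1"
    and decay: "\<And>j k. j \<le> k \<Longrightarrow> w k \<le> C1 * (\<theta> ^ (k - j) * gam p ^ (k - j)) * w j"
    using tail_sum_bound_decay[OF pq G] by metis
  obtain C0 where C0: "\<And>j M. (\<Sum>k=j..M. tail_block q k) \<le> C0 * tail_block q j" using G by (auto simp: tail_sum_bound_def tail_block_def)
  have gp: "0 < gam p" by (rule gam_pos)
  define t where "t = \<theta> powr p"
  have t: "0 < t" "t < 1" using \<theta> pq powr_less_mono2[of p \<theta> 1] by (auto simp: t_def)
  have aleq: "head_block p i = (gam p ^ i / w i) powr p" for i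
    using w_pos[of i] gp pq by (simp add: head_block_def powr_divide gam_power_powr powr_minus_divide)
  have ale: "head_block p i \<le> C1 powr p * t ^ (j - i) * head_block p j" if "i \<le> j" for i j
  proof -
    have "gam p ^ i / w i \<le> C1 * \<theta> ^ (j - i) * (gam p ^ j / w j)"
    proof -
      have "gam p ^ i * w j \<le> gam p ^ i * (C1 * (\<theta> ^ (j - i) * gam p ^ (j - i)) * w i)"
        using gp by (intro mult_left_mono decay that) auto
      also have "\<dots> = C1 * \<theta> ^ (j - i) * (gam p ^ i * gam p ^ (j - i)) * w i" by (simp only: mult_ac)
      also have "gam p ^ i * gam p ^ (j - i) = gam p ^ j" using that by (simp add: power_add[symmetric])
      finally show ?thesis using w_pos[of i] w_pos[of j] by (simp add: field_simps)
    qed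
    then have "(gam p ^ i / w i) powr p \<le> (C1 * \<theta> ^ (j - i) * (gam p ^ j / w j)) powr p"
      using gp w_pos[of i] pq by (intro powr_mono2) auto
    also have "\<dots> = C1 powr p * (\<theta> ^ (j - i)) powr p * (gam p ^ j / w j) powr p"
      by (simp only: powr_mult)
    also have "(\<theta> ^ (j - i)) powr p = t ^ (j - i)"
      using \<theta> by (simp add: t_def powr_powr mult.commute flip: powr_realpow)
    finally show ?thesis by (simp add: aleq)
  qed
  define C where "C = max (C1 powr p / (1 - t)) (max 0 C0)"
  have Cp: "0 < C" using C1 t by (auto simp: C_def less_max_iff_disj)
  have 1: "(\<Sum>i\<le>j. head_block p i) \<le> C * head_block p j" for j
  proof -
    have "(\<Sum>i\<le>j. head_block p i) \<le> (\<Sum>i\<le>j. C1 powr p * t ^ (j - i) * head_block p j)" by (intro sum_mono ale) auto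
    also have "\<dots> = C1 powr p * head_block p j * (\<Sum>i\<le>j. t ^ (j - i))" by (simp add: sum_distrib_left mult_ac)
    also have "(\<Sum>i\<le>j. t ^ (j - i)) = (\<Sum>i<Suc j. t ^ i)"
      using sum.nat_diff_reindex[of "\<lambda>i. t ^ i" "Suc j"] by (simp only: lessThan_Suc_atMost diff_Suc_Suc)
    also have "C1 powr p * head_block p j * (\<Sum>i<Suc j. t ^ i) \<le> C1 powr p * head_block p j * (1 / (1 - t))"
      using sum_power_le_min[of t "Suc j"] t head_block_pos[of p j] by (intro mult_left_mono) auto
    also have "\<dots> = (C1 powr p / (1 - t)) * head_block p j" by simp
    also have "\<dots> \<le> C * head_block p j" using head_block_pos[of p j] by (intro mult_right_mono) (auto simp: C_def)
    finally show ?thesis .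
  qed
  have 2: "(\<Sum>i. if j \<le> i then ennreal (tail_block q i) else 0) \<le> ennreal (C * tail_block q j)" for j
  proof (rule suminf_le_const[OF summableI])
    fix n
    have "(\<Sum>i<n. if j \<le> i then ennreal (tail_block q i) else 0) \<le> (\<Sum>i\<in>{j..n}. ennreal (tail_block q i))"
    proof -
      have "(\<Sum>i<n. if j \<le> i then ennreal (tail_block q i) else 0) = (\<Sum>i\<in>{j..<n}. ennreal (tail_block q i))"
        by (intro sum.mono_neutral_cong_right) auto
      also have "\<dots> \<le> (\<Sum>i\<in>{j..n}. ennreal (tail_block q i))" by (intro sum_mono2) auto
      finally show ?thesis .
    qed
    also have "\<dots> = ennreal (\<Sum>i\<in>{j..n}. tail_block q i)" using tail_block_pos by (intro sum_ennreal) (auto intro: less_imp_le)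
    also have "\<dots> \<le> ennreal (C * tail_block q j)"
    proof (rule ennreal_leI)
      have "C0 * tail_block q j \<le> C * tail_block q j" using tail_block_pos[of q j] by (intro mult_right_mono) (auto simp: C_def)
      then show "(\<Sum>i\<in>{j..n}. tail_block q i) \<le> C * tail_block q j" using C0[of j n] by linarith
    qed
    finally show "(\<Sum>i<n. if j \<le> i then ennreal (tail_block q i) else 0) \<le> ennreal (C * tail_block q j)" .
  qed
  show thesis by (rule that[OF Cp 1 2])
qed

text \<open>For the extremal \<open>v k = u k powr (q - 1)\<close> both \<open>v k powr p\<close>
  and \<open>v k * u k\<close> equal \<open>tail_block q k\<close>, so the norm and the image are
  governed by the same sum \<open>S\<close>. Block \<open>j\<close> of the image shows that
  \<open>(S / w j) powr p * (1 / 2) ^ j\<close> is at most a constant times \<open>S\<close>;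
  dividing by \<open>S\<close> leaves the product of head and tail.\<close>

lemma test_bound_imp_tail_sum_bound:
  assumes pq: "1 < p" "1 < q" "1 / p + 1 / q = 1" and tb: "test_bound p" and dbl: tail_doubling
  shows "tail_sum_bound q"
proof -
  obtain C where C: "0 < C" and tb: "\<forall>v M j I. (\<forall>k. 0 \<le> v k) \<longrightarrow> finite I \<longrightarrow>
    (\<Sum>n\<in>I. multiplier n * test_moment p v M n * dyad j ^ n) powr p * (1 / 2) ^ j \<le> C * (\<Sum>k\<le>M. v k powr p)"
    using tb unfolding test_bound_def by (elim exE conjE) (rule that)
  obtain D where D: "1 \<le> D" "\<And>j k. j \<le> k \<Longrightarrow> w j \<le> D ^ (k - j) * w k" using tail_doublingD[OF dbl] by auto
  obtain C3 where C3: "0 < C3" "\<And>n i. n \<in> dblock i \<Longrightarrow> mom (2 * n + 1) \<le> C3 * w i"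
    using moment_comparable[OF dbl] by metis
  have gp: "0 < gam p" by (rule gam_pos)
  \<comment> \<open>The lower bounds for the multipliers, the test moments and the power of the
    radius, in this order, without the factors that depend on \<open>j\<close>.\<close>
  define c where "c = 1 / (4 * C3) * (1 / (4 * D\<^sup>2)) * (1 / 4)"
  have c0: "0 < c" using C3(1) D(1) by (simp add: c_def)
  have uq: "(w k / gam p ^ k) powr q = tail_block q k" for k
  proof -
    have "(w k / gam p ^ k) powr q = w k powr q * (2 powr (real k / p)) powr q"
      unfolding gam_power using w_pos[of k] by (simp add: powr_divide powr_minus divide_inverse powr_mult powr_powr)
    also have "(2 powr (real k / p)) powr q = 2 powr (real k * (q / p))" by (simp add: powr_powr)
    finally show ?thesis unfolding conjugate_exponent_div[OF pq(1,3,2)] tail_block_def .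
  qed
  have main: "head_block p j powr (1 / p) * (\<Sum>k=j+2..M. tail_block q k) powr (1 / q) \<le> ((2 * C) powr (1 / p)) / c" for j M
  proof -
    define u where "u k = w k / gam p ^ k" for k
    have u0: "0 < u k" for k using w_pos[of k] gp by (simp add: u_def)
    \<comment> \<open>From \<open>k = j + 2\<close> on, indices \<open>n\<close> of block
      \<open>j\<close> are smaller than \<open>2 ^ k\<close>, so moments of order
      \<open>n + m\<close> with \<open>m < 2 ^ k\<close> are still bounded below by
      \<open>w k\<close>, up to a constant.\<close>
    define v where "v k = (if j + 2 \<le> k then u k powr (q - 1) else 0)" for k
    have v0: "0 \<le> v k" for k by (simp add: v_def)
    define S where "S = (\<Sum>k=j+2..M. tail_block q k)"
    have S0: "0 \<le> S" unfolding S_def by (intro sum_nonneg less_imp_le tail_block_pos)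
    have vS: "(\<Sum>k\<le>M. v k powr p) = S"
    proof -
      have "(q - 1) * p = q" using pq by (simp add: field_simps)
      then have "v k powr p = tail_block q k" if "j + 2 \<le> k" for k
        using that uq[of k] by (simp add: v_def powr_powr u_def)
      moreover have "v k powr p = 0" if "\<not> j + 2 \<le> k" for k using that by (simp add: v_def)
      ultimately show ?thesis unfolding S_def
        by (intro sum.mono_neutral_cong_right) auto
    qed
    have tm: "1 / (4 * D\<^sup>2) * S \<le> test_moment p v M n" if n: "n \<in> dblock j" for n
    proof -
      have "1 / (4 * D\<^sup>2) * S = (\<Sum>k=j+2..M. 1 / (4 * D\<^sup>2) * tail_block q k)" by (simp add: S_def sum_distrib_left)
      also have "\<dots> \<le> (\<Sum>k=j+2..M. v k / (2 * gam p) ^ k * (\<Sum>m<2 ^ k. mom (n + m)))"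
      proof (rule sum_mono)
        fix k assume k: "k \<in> {j+2..M}"
        have "w k \<le> D\<^sup>2 * w (Suc (Suc k))" using D(2)[of k "Suc (Suc k)"] by (simp add: numeral_2_eq_2)
        moreover have "w (Suc (Suc k)) / 4 \<le> mom (n + m)" if "m < 2 ^ k" for m
        proof (rule mom_ge_w)
          have "(2::nat) ^ Suc j \<le> 2 ^ k" using k by (intro power_increasing) auto
          then show "n + m \<le> 2 ^ Suc (Suc k)" using n that by (auto simp: mem_dblock)
        qed
        ultimately have "1 / (4 * D\<^sup>2) * w k \<le> mom (n + m)" if "m < 2 ^ k" for m
        proof -
          have "1 / (4 * D\<^sup>2) * w k \<le> 1 / (4 * D\<^sup>2) * (D\<^sup>2 * w (Suc (Suc k)))"
            using \<open>w k \<le> D\<^sup>2 * w (Suc (Suc k))\<close> by (intro mult_left_mono) auto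
          also have "\<dots> = w (Suc (Suc k)) / 4" using D(1) by simp
          also have "\<dots> \<le> mom (n + m)" using that by (rule \<open>\<And>m. m < 2 ^ k \<Longrightarrow> w (Suc (Suc k)) / 4 \<le> mom (n + m)\<close>)
          finally show ?thesis .
        qed
        then have "(\<Sum>m<(2::nat) ^ k. 1 / (4 * D\<^sup>2) * w k) \<le> (\<Sum>m<2 ^ k. mom (n + m))" by (intro sum_mono) auto
        then have "v k / (2 * gam p) ^ k * (\<Sum>m<(2::nat) ^ k. 1 / (4 * D\<^sup>2) * w k) \<le> v k / (2 * gam p) ^ k * (\<Sum>m<2 ^ k. mom (n + m))"
          using v0 gp by (intro mult_left_mono) auto
        moreover have "v k / (2 * gam p) ^ k * (\<Sum>m<(2::nat) ^ k. 1 / (4 * D\<^sup>2) * w k) = 1 / (4 * D\<^sup>2) * (v k * u k)"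
          using gp by (simp add: power_mult_distrib u_def)
        moreover have "v k * u k = tail_block q k"
          using k u0[of k] powr_mult_base[of "u k" "q - 1"] uq[of k] by (simp add: v_def u_def mult.commute)
        ultimately show "1 / (4 * D\<^sup>2) * tail_block q k \<le> v k / (2 * gam p) ^ k * (\<Sum>m<2 ^ k. mom (n + m))" by simp
      qed
      also have "\<dots> \<le> test_moment p v M n"
        unfolding test_moment_def using v0 gp mom_pos
        by (intro sum_mono2) (auto intro!: mult_nonneg_nonneg divide_nonneg_nonneg sum_nonneg intro: less_imp_le)
      finally show ?thesis .
    qed
    define I where "I = dblock j"
    have summand: "1 / (4 * C3 * 2 ^ j * w j) * (1 / (4 * D\<^sup>2) * S) * (1 / 4) \<le> multiplier n * test_moment p v M n * dyad (Suc j) ^ n" if n: "n \<in> I" for n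
    proof (intro mult_mono)
      have n': "n \<in> dblock j" using n by (simp add: I_def)
      have "real n + 1 \<le> 2 ^ Suc j" using real_mem_dblock[OF n'] by simp
      then have "2 * (real n + 1) * mom (2 * n + 1) \<le> 2 * 2 ^ Suc j * (C3 * w j)"
        using C3(2)[OF n'] mom_pos[of "2 * n + 1"] by (intro mult_mono) auto
      then have "2 * (real n + 1) * mom (2 * n + 1) \<le> 4 * C3 * 2 ^ j * w j" by (simp add: mult_ac)
      then show "1 / (4 * C3 * 2 ^ j * w j) \<le> multiplier n"
        unfolding multiplier_def using mom_pos[of "2 * n + 1"] C3(1) w_pos[of j]
        by (intro divide_left_mono mult_pos_pos) auto
      show "1 / (4 * D\<^sup>2) * S \<le> test_moment p v M n" by (rule tm[OF n'])
      have "n \<le> 2 ^ Suc j" using n' by (auto simp: mem_dblock)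
      then show "1 / 4 \<le> dyad (Suc j) ^ n" by (rule dyad_power_ge)
    qed (use C3(1) w_pos[of j] S0 D(1) multiplier_pos[of n] test_moment_nonneg[of v p M n] v0 in \<open>auto simp: less_imp_le\<close>)
    have "2 ^ j * (1 / (4 * C3 * 2 ^ j * w j) * (1 / (4 * D\<^sup>2) * S) * (1 / 4)) = (\<Sum>n\<in>I. 1 / (4 * C3 * 2 ^ j * w j) * (1 / (4 * D\<^sup>2) * S) * (1 / 4))"
      by (simp add: I_def card_dblock)
    also have "\<dots> \<le> (\<Sum>n\<in>I. multiplier n * test_moment p v M n * dyad (Suc j) ^ n)" by (intro sum_mono summand)
    finally have 1: "2 ^ j * (1 / (4 * C3 * 2 ^ j * w j) * (1 / (4 * D\<^sup>2) * S) * (1 / 4)) \<le> (\<Sum>n\<in>I. multiplier n * test_moment p v M n * dyad (Suc j) ^ n)" .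
    have "2 ^ j * (1 / (4 * C3 * 2 ^ j * w j) * (1 / (4 * D\<^sup>2) * S) * (1 / 4)) = c * (S / w j)"
      by (simp add: c_def)
    with 1 have "(c * (S / w j)) powr p * (1 / 2) ^ Suc j \<le> (\<Sum>n\<in>I. multiplier n * test_moment p v M n * dyad (Suc j) ^ n) powr p * (1 / 2) ^ Suc j"
      using pq c0 S0 w_pos[of j] by (intro mult_right_mono powr_mono2) auto
    also have "\<dots> \<le> C * S" unfolding vS[symmetric] by (rule tb[rule_format]) (auto simp: v0 I_def)
    finally have "(c * (S / w j)) powr p * (1 / 2) ^ j \<le> 2 * C * S" by simp
    moreover have "(c * (S / w j)) powr p * (1 / 2) ^ j = c powr p * (S powr p * head_block p j)"
      by (simp add: head_block_def powr_mult powr_divide powr_minus_divide)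
    ultimately have 2: "c powr p * (S powr p * head_block p j) \<le> 2 * C * S" by simp
    show "head_block p j powr (1 / p) * S powr (1 / q) \<le> ((2 * C) powr (1 / p)) / c"
    proof (cases "S = 0")
      case True
      then show ?thesis using c0 by simp
    next
      case False
      with S0 have Sp: "0 < S" by simp
      have "S powr p = S powr (p - 1) * S" using Sp powr_add[of S "p - 1" 1] by simp
      with 2 have "c powr p * (S powr (p - 1) * head_block p j) * S \<le> 2 * C * S" by (simp add: mult_ac)
      then have "c powr p * (S powr (p - 1) * head_block p j) \<le> 2 * C" using Sp by (rule mult_right_le_imp_le)
      then have "(c powr p * (S powr (p - 1) * head_block p j)) powr (1 / p) \<le> (2 * C) powr (1 / p)"
        using pq head_block_pos[of p j] by (intro powr_mono2) auto
      moreover have "(c powr p * (S powr (p - 1) * head_block p j)) powr (1 / p) = c * (S powr (1 / q) * head_block p j powr (1 / p))"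
      proof -
        have "(p - 1) / p = 1 / q" using pq by (simp add: field_simps)
        then show ?thesis using c0 Sp head_block_pos[of p j] pq by (simp add: powr_mult powr_powr)
      qed
      ultimately show ?thesis using c0 by (simp add: pos_le_divide_eq mult_ac)
    qed
  qed
  show ?thesis by (rule tail_sum_boundI[OF pq main])
qed

subsection \<open>The suprema of the theorem\<close>

text \<open>Shared by the discrete and the continuous supremum: \<open>A\<close> and
  \<open>B\<close> stand for the two factors before their roots are taken, at one splitting point.
  As \<open>1 / p + 1 / q = 1\<close>, the constant \<open>K\<close> comes out to the first
  power.\<close>

lemma tail_sum_bound_of_products:
  assumes pq: "1 < p" "1 < q" "1 / p + 1 / q = 1" and K: "0 < K" and C: "0 \<le> C"
    and AB: "\<And>j M. \<exists>A B. ennreal (head_block p j) \<le> ennreal K * A \<and> ennreal (\<Sum>k=j+2..M. tail_block q k) \<le> ennreal K * B \<and>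
      epowr A (1 / p) * epowr B (1 / q) \<le> ennreal C"
  shows "tail_sum_bound q"
proof (rule tail_sum_boundI[OF pq])
  fix j M
  obtain A B where A: "ennreal (head_block p j) \<le> ennreal K * A" and B: "ennreal (\<Sum>k=j+2..M. tail_block q k) \<le> ennreal K * B"
    and le: "epowr A (1 / p) * epowr B (1 / q) \<le> ennreal C"
    using AB by blast
  have S0: "0 \<le> (\<Sum>k=j+2..M. tail_block q k)" by (intro sum_nonneg less_imp_le tail_block_pos)
  have "ennreal (head_block p j powr (1 / p) * (\<Sum>k=j+2..M. tail_block q k) powr (1 / q))
      = epowr (ennreal (head_block p j)) (1 / p) * epowr (ennreal (\<Sum>k=j+2..M. tail_block q k)) (1 / q)"
    using S0 head_block_pos[of p j] by (simp add: ennreal_mult less_imp_le)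
  also have "\<dots> \<le> epowr (ennreal K * A) (1 / p) * epowr (ennreal K * B) (1 / q)"
    using pq by (intro mult_mono epowr_mono A B) auto
  also have "\<dots> = ennreal (K powr (1 / p)) * ennreal (K powr (1 / q)) * (epowr A (1 / p) * epowr B (1 / q))"
    using pq K by (simp add: epowr_mult mult_ac)
  also have "ennreal (K powr (1 / p)) * ennreal (K powr (1 / q)) = ennreal K"
    using K pq by (simp add: ennreal_mult[symmetric] powr_add[symmetric])
  also have "ennreal K * (epowr A (1 / p) * epowr B (1 / q)) \<le> ennreal K * ennreal C"
    by (intro mult_left_mono le) auto
  also have "\<dots> = ennreal (K * C)" using K C by (simp add: ennreal_mult)
  finally show "head_block p j powr (1 / p) * (\<Sum>k=j+2..M. tail_block q k) powr (1 / q) \<le> K * C"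
    using K C by (subst (asm) ennreal_le_iff) auto
qed

text \<open>Head and tail sums are bounded by constant multiples of their terms at the splitting
  index \<open>j\<close>, and there the product of the roots is exactly 1; hence the bound is
  uniform in \<open>j\<close>.\<close>

lemma products_of_tail_sum_bound:
  assumes pq: "1 < p" "1 < q" "1 / p + 1 / q = 1" and K: "0 < K" and G: "tail_sum_bound q"
  shows "\<exists>C. \<forall>A B j. A \<le> ennreal (K * (\<Sum>i\<le>j. head_block p i)) \<longrightarrow>
    B \<le> ennreal K * (\<Sum>i. if j \<le> i then ennreal (tail_block q i) else 0) \<longrightarrow>
    epowr A (1 / p) * epowr B (1 / q) \<le> ennreal C"
proof -
  obtain C where C: "0 < C" "\<And>j. (\<Sum>i\<le>j. head_block p i) \<le> C * head_block p j"
    "\<And>j. (\<Sum>i. if j \<le> i then ennreal (tail_block q i) else 0) \<le> ennreal (C * tail_block q j)"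
    using tail_sum_bound_sums[OF pq G] by metis
  have "epowr A (1 / p) * epowr B (1 / q) \<le> ennreal (K * C)"
    if A: "A \<le> ennreal (K * (\<Sum>i\<le>j. head_block p i))" and B: "B \<le> ennreal K * (\<Sum>i. if j \<le> i then ennreal (tail_block q i) else 0)" for A B j
  proof -
    have "K * (\<Sum>i\<le>j. head_block p i) \<le> K * (C * head_block p j)" using K C(2) by (intro mult_left_mono) auto
    then have A': "A \<le> ennreal (K * C * head_block p j)" using A by (metis ennreal_leI mult.assoc order.trans)
    have "B \<le> ennreal K * ennreal (C * tail_block q j)" using B C(3)[of j] by (meson mult_left_mono order.trans zero_le)
    also have "\<dots> = ennreal (K * C * tail_block q j)"
      using K C(1) tail_block_pos[of q j] by (simp add: ennreal_mult[symmetric] mult.assoc)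
    finally have B': "B \<le> ennreal (K * C * tail_block q j)" .
    have "epowr A (1 / p) * epowr B (1 / q) \<le> epowr (ennreal (K * C * head_block p j)) (1 / p) * epowr (ennreal (K * C * tail_block q j)) (1 / q)"
      using pq by (intro mult_mono epowr_mono A' B') auto
    also have "\<dots> = ennreal ((K * C * head_block p j) powr (1 / p) * (K * C * tail_block q j) powr (1 / q))"
      using K C(1) tail_block_pos[of q j] head_block_pos[of p j] by (subst ennreal_mult) simp_all
    also have "(K * C * head_block p j) powr (1 / p) * (K * C * tail_block q j) powr (1 / q)
        = (K * C) powr (1 / p) * (K * C) powr (1 / q) * (head_block p j powr (1 / p) * tail_block q j powr (1 / q))"
      by (simp only: powr_mult mult_ac)
    also have "\<dots> = K * C" using K C(1) pq(3) by (simp add: head_block_tail_block(2)[OF pq] powr_add[symmetric])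
    finally show ?thesis .
  qed
  then show ?thesis by blast
qed

definition head_term :: "real \<Rightarrow> nat \<Rightarrow> real" where
  "head_term p n = 1 / ((real n + 1)\<^sup>2 * mom (2 * n + 1) powr p)"

definition tail_term :: "real \<Rightarrow> nat \<Rightarrow> real" where
  "tail_term q n = mom (2 * n + 1) powr q * (real n + 1) powr (q - 2)"

lemma head_term_nonneg: "0 \<le> head_term p n"
  by (simp add: head_term_def)

lemma tail_term_nonneg: "0 \<le> tail_term q n"
  by (simp add: tail_term_def)

lemma M_discrete_eq:
  "M_discrete p q \<omega> = (SUP N\<in>{1::nat..}.
     epowr (\<Sum>n=0..N. ennreal (head_term p n)) (1 / p) * epowr (\<Sum>k. ennreal (tail_term q (k + N))) (1 / q))"
  unfolding M_discrete_def head_term_def tail_term_def Let_def moment_eq ..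

text \<open>A block has \<open>2 ^ i\<close> indices, on which \<open>n + 1\<close> is of order
  \<open>2 ^ i\<close> and the moments are of order \<open>w i\<close>. The exponents of 2 are
  \<open>i - 2 * i\<close> for the head and \<open>i + i * (q - 2)\<close> for the tail.\<close>

lemma block_sums_comparable:
  assumes p: "1 < p" "1 < q" and dbl: tail_doubling
  shows "\<exists>K>0. \<forall>i. (\<Sum>n\<in>dblock i. head_term p n) \<le> K * head_block p i \<and> head_block p i \<le> K * (\<Sum>n\<in>dblock i. head_term p n) \<and>
    (\<Sum>n\<in>dblock i. tail_term q n) \<le> K * tail_block q i \<and> tail_block q i \<le> K * (\<Sum>n\<in>dblock i. tail_term q n)"
proof -
  obtain c C where c: "0 < c" "0 < C" "\<And>n i. n \<in> dblock i \<Longrightarrow> c * w i \<le> mom (2 * n + 1)"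
    "\<And>n i. n \<in> dblock i \<Longrightarrow> mom (2 * n + 1) \<le> C * w i"
    using moment_comparable[OF dbl] by metis
  have card: "(\<Sum>n\<in>dblock i. x) = 2 ^ i * x" for i and x :: real by (simp add: card_dblock)
  have a1: "(\<Sum>n\<in>dblock i. head_term p n) \<le> c powr (- p) * head_block p i" for i
  proof -
    have "head_term p n \<le> 1 / ((2 ^ i)\<^sup>2 * (c * w i) powr p)" if n: "n \<in> dblock i" for n
      unfolding head_term_def using real_mem_dblock[OF n] c(1) c(3)[OF n] p w_pos[of i] mom_pos[of "2 * n + 1"]
      by (intro divide_left_mono mult_mono power_mono powr_mono2 mult_pos_pos) auto
    then have "(\<Sum>n\<in>dblock i. head_term p n) \<le> (\<Sum>n\<in>dblock i. 1 / ((2 ^ i)\<^sup>2 * (c * w i) powr p))" by (rule sum_mono)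
    also have "\<dots> = c powr (- p) * head_block p i"
      unfolding card head_block_def powr_minus_divide powr_mult power_one_over by (simp add: power2_eq_square)
    finally show ?thesis .
  qed
  have a2: "head_block p i \<le> 4 * C powr p * (\<Sum>n\<in>dblock i. head_term p n)" for i
  proof -
    have "1 / ((2 ^ Suc i)\<^sup>2 * (C * w i) powr p) \<le> head_term p n" if n: "n \<in> dblock i" for n
      unfolding head_term_def using real_mem_dblock[OF n] c(2) c(4)[OF n] p w_pos[of i] mom_pos[of "2 * n + 1"]
      by (intro divide_left_mono mult_mono power_mono powr_mono2 mult_pos_pos) auto
    then have "(\<Sum>n\<in>dblock i. 1 / ((2 ^ Suc i)\<^sup>2 * (C * w i) powr p)) \<le> (\<Sum>n\<in>dblock i. head_term p n)" by (rule sum_mono)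
    then have "4 * C powr p * (\<Sum>n\<in>dblock i. 1 / ((2 ^ Suc i)\<^sup>2 * (C * w i) powr p)) \<le> 4 * C powr p * (\<Sum>n\<in>dblock i. head_term p n)"
      by (rule mult_left_mono) simp
    moreover have "4 * C powr p * (\<Sum>n\<in>dblock i. 1 / ((2 ^ Suc i)\<^sup>2 * (C * w i) powr p)) = head_block p i"
      unfolding card head_block_def powr_minus_divide powr_mult power_one_over using c(2) by (simp add: power2_eq_square)
    ultimately show ?thesis by simp
  qed
  have e: "2 ^ i * 2 powr (real i * (q - 2)) = 2 powr (real i * (q - 1))" for i
  proof -
    have "(2::real) ^ i = 2 powr real i" by (simp add: powr_realpow)
    then show ?thesis by (simp only: powr_add[symmetric]) (simp add: algebra_simps)
  qed
  have b1: "(\<Sum>n\<in>dblock i. tail_term q n) \<le> C powr q * 2 powr \<bar>q - 2\<bar> * tail_block q i" for i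
  proof -
    have "tail_term q n \<le> (C * w i) powr q * (2 powr \<bar>q - 2\<bar> * 2 powr (real i * (q - 2)))" if n: "n \<in> dblock i" for n
      unfolding tail_term_def using c(4)[OF n] p mom_pos[of "2 * n + 1"]
      by (intro mult_mono powr_mono2 dblock_powr_le[OF n]) auto
    then have "(\<Sum>n\<in>dblock i. tail_term q n) \<le> (\<Sum>n\<in>dblock i. (C * w i) powr q * (2 powr \<bar>q - 2\<bar> * 2 powr (real i * (q - 2))))"
      by (rule sum_mono)
    also have "\<dots> = C powr q * 2 powr \<bar>q - 2\<bar> * tail_block q i"
      unfolding card tail_block_def e[symmetric] powr_mult by (simp only: mult_ac)
    finally show ?thesis .
  qed
  have b2: "tail_block q i \<le> c powr (- q) * 2 powr \<bar>q - 2\<bar> * (\<Sum>n\<in>dblock i. tail_term q n)" for i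
  proof -
    have "(c * w i) powr q * (2 powr (- \<bar>q - 2\<bar>) * 2 powr (real i * (q - 2))) \<le> tail_term q n" if n: "n \<in> dblock i" for n
      unfolding tail_term_def using c(1) c(3)[OF n] p w_pos[of i]
      by (intro mult_mono powr_mono2 dblock_powr_ge[OF n]) auto
    then have "(\<Sum>n\<in>dblock i. (c * w i) powr q * (2 powr (- \<bar>q - 2\<bar>) * 2 powr (real i * (q - 2)))) \<le> (\<Sum>n\<in>dblock i. tail_term q n)"
      by (rule sum_mono)
    then have "c powr (- q) * 2 powr \<bar>q - 2\<bar> * (\<Sum>n\<in>dblock i. (c * w i) powr q * (2 powr (- \<bar>q - 2\<bar>) * 2 powr (real i * (q - 2))))
        \<le> c powr (- q) * 2 powr \<bar>q - 2\<bar> * (\<Sum>n\<in>dblock i. tail_term q n)"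
      by (rule mult_left_mono) simp
    moreover have "c powr (- q) * 2 powr \<bar>q - 2\<bar> * (\<Sum>n\<in>dblock i. (c * w i) powr q * (2 powr (- \<bar>q - 2\<bar>) * 2 powr (real i * (q - 2))))
        = (c powr (- q) * c powr q) * (2 powr \<bar>q - 2\<bar> * 2 powr (- \<bar>q - 2\<bar>)) * tail_block q i"
      unfolding card tail_block_def e[symmetric] powr_mult by (simp only: mult_ac)
    moreover have "c powr (- q) * c powr q = 1" "2 powr \<bar>q - 2\<bar> * 2 powr (- \<bar>q - 2\<bar>) = (1::real)"
      using c(1) by (simp_all add: powr_add[symmetric])
    ultimately show ?thesis by (simp only: mult_1_left)
  qed
  define K where "K = c powr (- p) + 4 * C powr p + C powr q * 2 powr \<bar>q - 2\<bar> + c powr (- q) * 2 powr \<bar>q - 2\<bar>"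
  have K: "c powr (- p) \<le> K" "4 * C powr p \<le> K" "C powr q * 2 powr \<bar>q - 2\<bar> \<le> K" "c powr (- q) * 2 powr \<bar>q - 2\<bar> \<le> K" "0 < K"
    using c(1,2) by (auto simp: K_def intro!: add_nonneg_nonneg add_pos_pos)
  have up: "x \<le> K * y" if "x \<le> k * y" "k \<le> K" "0 \<le> y" for x y k
    using that mult_right_mono[of k K y] by linarith
  have s0: "0 \<le> (\<Sum>n\<in>dblock i. head_term p n)" "0 \<le> (\<Sum>n\<in>dblock i. tail_term q n)" for i
    by (intro sum_nonneg head_term_nonneg tail_term_nonneg)+
  show ?thesis
    by (rule exI[of _ K]) (use up[OF a1 K(1)] up[OF a2 K(2)] up[OF b1 K(3)] up[OF b2 K(4)] K(5) s0 head_block_pos tail_block_pos in \<open>auto simp: less_imp_le\<close>)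
qed

lemma suminf_tail:
  fixes f :: "nat \<Rightarrow> ennreal"
  shows "(\<Sum>k. f (k + N)) = (\<Sum>n. if N \<le> n then f n else 0)"
proof -
  have "(\<Sum>n. if N \<le> n then f n else 0) = (\<Sum>i. if N \<le> i + N then f (i + N) else 0) + (\<Sum>i<N. if N \<le> i then f i else 0)"
    by (rule suminf_offset) simp
  also have "(\<Sum>i<N. if N \<le> i then f i else 0) = 0" by (intro sum.neutral) auto
  finally show ?thesis by simp
qed

lemma M_discrete_imp_tail_sum_bound:
  assumes pq: "1 < p" "1 < q" "1 / p + 1 / q = 1" and dbl: tail_doubling and M: "M_discrete p q \<omega> < \<infinity>"
  shows "tail_sum_bound q"
proof -
  obtain K where K: "0 < K" "\<And>i. head_block p i \<le> K * (\<Sum>n\<in>dblock i. head_term p n)" "\<And>i. tail_block q i \<le> K * (\<Sum>n\<in>dblock i. tail_term q n)"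
    using block_sums_comparable[OF pq(1,2) dbl] by metis
  obtain C where C: "0 \<le> C" "M_discrete p q \<omega> = ennreal C" using M by (cases "M_discrete p q \<omega>") auto
  have "\<exists>A B. ennreal (head_block p j) \<le> ennreal K * A \<and> ennreal (\<Sum>k=j+2..M. tail_block q k) \<le> ennreal K * B \<and>
      epowr A (1 / p) * epowr B (1 / q) \<le> ennreal C" for j M
  proof -
    \<comment> \<open>Block \<open>Suc j\<close> starts at the index \<open>N - 1\<close>, so only
      the blocks from \<open>j + 2\<close> on lie wholly in the tail sum.\<close>
    define N :: nat where "N = 2 ^ Suc j"
    define A where "A = (\<Sum>n=0..N. ennreal (head_term p n))"
    define B where "B = (\<Sum>k. ennreal (tail_term q (k + N)))"
    have "epowr A (1 / p) * epowr B (1 / q) \<le> ennreal C"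
      unfolding C(2)[symmetric] M_discrete_eq A_def B_def by (rule SUP_upper) (simp add: N_def)
    moreover have "ennreal (head_block p j) \<le> ennreal K * A"
    proof -
      have "dblock j \<subseteq> {0..N}" by (auto simp: mem_dblock N_def)
      then have "(\<Sum>n\<in>dblock j. head_term p n) \<le> (\<Sum>n=0..N. head_term p n)" by (intro sum_mono2) (auto simp: head_term_nonneg)
      then have "K * (\<Sum>n\<in>dblock j. head_term p n) \<le> K * (\<Sum>n=0..N. head_term p n)" using K(1) by simp
      then have "ennreal (head_block p j) \<le> ennreal (K * (\<Sum>n=0..N. head_term p n))" using K(2)[of j] by (intro ennreal_leI) linarith
      also have "\<dots> = ennreal K * A"
        unfolding A_def using K(1) by (simp add: ennreal_mult sum_nonneg head_term_nonneg)
      finally show ?thesis .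
    qed
    moreover have "ennreal (\<Sum>k=j+2..M. tail_block q k) \<le> ennreal K * B"
    proof -
      have "(\<Sum>k=j+2..M. tail_block q k) \<le> (\<Sum>k=j+2..M. K * (\<Sum>n\<in>dblock k. tail_term q n))" by (intro sum_mono K(3))
      then have "ennreal (\<Sum>k=j+2..M. tail_block q k) \<le> ennreal (K * (\<Sum>k=j+2..M. \<Sum>n\<in>dblock k. tail_term q n))"
        by (intro ennreal_leI) (simp add: sum_distrib_left)
      also have "\<dots> = ennreal K * (\<Sum>k=j+2..M. \<Sum>n\<in>dblock k. ennreal (tail_term q n))"
        using K(1) by (simp add: ennreal_mult sum_nonneg tail_term_nonneg)
      also have "(\<Sum>k=j+2..M. \<Sum>n\<in>dblock k. ennreal (tail_term q n)) = (\<Sum>k=j+2..M. \<Sum>n\<in>dblock k. if N \<le> n then ennreal (tail_term q n) else 0)"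
      proof (intro sum.cong refl)
        fix k n assume k: "k \<in> {j+2..M}" and n: "n \<in> dblock k"
        have "(2::nat) ^ Suc (Suc j) \<le> 2 ^ k" using k by (intro power_increasing) auto
        moreover have "(1::nat) \<le> 2 ^ Suc j" by simp
        ultimately have "N \<le> n" using n unfolding N_def mem_dblock power_Suc[of 2 "Suc j"] by linarith
        then show "ennreal (tail_term q n) = (if N \<le> n then ennreal (tail_term q n) else 0)" by simp
      qed
      also have "\<dots> \<le> (\<Sum>k. \<Sum>n\<in>dblock k. if N \<le> n then ennreal (tail_term q n) else 0)"
        by (rule sum_le_suminf) auto
      also have "\<dots> = B" unfolding B_def suminf_tail[of "\<lambda>n. ennreal (tail_term q n)"] by (rule suminf_dblock[symmetric])
      finally show ?thesis by (simp add: mult_left_mono)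
    qed
    ultimately show ?thesis by blast
  qed
  then show ?thesis by (rule tail_sum_bound_of_products[OF pq K(1) C(1)])
qed

text \<open>Both sums are enlarged to whole blocks, so the block containing \<open>N\<close> is
  counted in the head and in the tail; the bound for products allows this.\<close>

lemma tail_sum_bound_imp_M_discrete:
  assumes pq: "1 < p" "1 < q" "1 / p + 1 / q = 1" and dbl: tail_doubling and G: "tail_sum_bound q"
  shows "M_discrete p q \<omega> < \<infinity>"
proof -
  obtain K where K: "0 < K" "\<And>i. (\<Sum>n\<in>dblock i. head_term p n) \<le> K * head_block p i" "\<And>i. (\<Sum>n\<in>dblock i. tail_term q n) \<le> K * tail_block q i"
    using block_sums_comparable[OF pq(1,2) dbl] by metis
  obtain C where C: "\<forall>A B j. A \<le> ennreal (K * (\<Sum>i\<le>j. head_block p i)) \<longrightarrow>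
    B \<le> ennreal K * (\<Sum>i. if j \<le> i then ennreal (tail_block q i) else 0) \<longrightarrow>
    epowr A (1 / p) * epowr B (1 / q) \<le> ennreal C"
    using products_of_tail_sum_bound[OF pq K(1) G] by blast
  have "M_discrete p q \<omega> \<le> ennreal C"
    unfolding M_discrete_eq
  proof (rule SUP_least)
    fix N :: nat
    obtain j where j: "N \<in> dblock j" using dblock_cover by blast
    have "(\<Sum>n=0..N. ennreal (head_term p n)) \<le> ennreal (K * (\<Sum>i\<le>j. head_block p i))"
    proof -
      have "{0..N} \<subseteq> (\<Union>i\<in>{..j}. dblock i)"
      proof
        fix n assume n: "n \<in> {0..N}"
        obtain i where i: "n \<in> dblock i" using dblock_cover by blast
        have "(2::nat) ^ i < 2 ^ Suc j" using i j n unfolding mem_dblock atLeastAtMost_iff by linarith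
        then have "i < Suc j" by (rule power_less_imp_less_exp[rotated]) simp
        then show "n \<in> (\<Union>i\<in>{..j}. dblock i)" using i by auto
      qed
      then have "(\<Sum>n=0..N. head_term p n) \<le> (\<Sum>n\<in>(\<Union>i\<in>{..j}. dblock i). head_term p n)"
        by (intro sum_mono2) (auto simp: head_term_nonneg)
      also have "\<dots> = (\<Sum>i\<le>j. \<Sum>n\<in>dblock i. head_term p n)"
        using dblock_disjoint by (intro sum.UNION_disjoint) (auto simp: disjoint_family_on_def)
      also have "\<dots> \<le> (\<Sum>i\<le>j. K * head_block p i)" by (intro sum_mono K(2))
      finally have "(\<Sum>n=0..N. head_term p n) \<le> K * (\<Sum>i\<le>j. head_block p i)" by (simp add: sum_distrib_left)
      then show ?thesis by (simp add: head_term_nonneg ennreal_leI)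
    qed
    moreover have "(\<Sum>k. ennreal (tail_term q (k + N))) \<le> ennreal K * (\<Sum>i. if j \<le> i then ennreal (tail_block q i) else 0)"
    proof -
      have "(\<Sum>k. ennreal (tail_term q (k + N))) = (\<Sum>i. \<Sum>n\<in>dblock i. if N \<le> n then ennreal (tail_term q n) else 0)"
        unfolding suminf_tail[of "\<lambda>n. ennreal (tail_term q n)"] by (rule suminf_dblock)
      also have "\<dots> \<le> (\<Sum>i. ennreal K * (if j \<le> i then ennreal (tail_block q i) else 0))"
      proof (intro suminf_le summableI)
        fix i
        show "(\<Sum>n\<in>dblock i. if N \<le> n then ennreal (tail_term q n) else 0) \<le> ennreal K * (if j \<le> i then ennreal (tail_block q i) else 0)"
        proof (cases "j \<le> i")
          case True
          have "(\<Sum>n\<in>dblock i. if N \<le> n then ennreal (tail_term q n) else 0) \<le> (\<Sum>n\<in>dblock i. ennreal (tail_term q n))"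
            by (intro sum_mono) auto
          also have "\<dots> = ennreal (\<Sum>n\<in>dblock i. tail_term q n)" by (simp add: tail_term_nonneg)
          also have "\<dots> \<le> ennreal (K * tail_block q i)" by (intro ennreal_leI K(3))
          also have "\<dots> = ennreal K * ennreal (tail_block q i)" using K(1) tail_block_pos[of q i] by (simp add: ennreal_mult less_imp_le)
          finally show ?thesis using True by simp
        next
          case False
          have "\<not> N \<le> n" if "n \<in> dblock i" for n
          proof -
            have "(2::nat) ^ Suc i \<le> 2 ^ j" using False by (intro power_increasing) auto
            then show ?thesis using that j unfolding mem_dblock by linarith
          qed
          then show ?thesis by (simp add: sum.neutral)
        qed
      qed
      also have "\<dots> = ennreal K * (\<Sum>i. if j \<le> i then ennreal (tail_block q i) else 0)" by (rule ennreal_suminf_cmult)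
      finally show ?thesis .
    qed
    ultimately show "epowr (\<Sum>n=0..N. ennreal (head_term p n)) (1 / p) * epowr (\<Sum>k. ennreal (tail_term q (k + N))) (1 / q) \<le> ennreal C"
      using C by blast
  qed
  then show ?thesis by (simp add: order.strict_trans1)
qed

section \<open>The continuous supremum\<close>

lemma emeasure_dyad_interval:
  "emeasure lborel {dyad k..<dyad (Suc k)} = ennreal ((1 / 2) ^ Suc k)"
  "emeasure lborel {dyad k<..<dyad (Suc k)} = ennreal ((1 / 2) ^ Suc k)"
  using dyad_mono[of k "Suc k"] dyad_Suc_diff[of k] by simp_all

lemma dyad_pos: "0 < dyad (Suc k)"
  using dyad_strict_mono[of 0 "Suc k"] by simp

lemma dyad_powr_integral: "(w k * 2 ^ j) powr q * (1 / 2) ^ j = w k powr q * 2 powr (real j * (q - 1))"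
proof -
  have "(w k * 2 ^ j) powr q * (1 / 2) ^ j = w k powr q * ((2 powr real j) powr q * 2 powr (- real j))"
    unfolding half_power by (simp add: powr_mult powr_realpow)
  also have "(2 powr real j) powr q * 2 powr (- real j) = 2 powr (real j * (q - 1))"
    by (simp add: powr_powr powr_add[symmetric] algebra_simps)
  finally show ?thesis .
qed

text \<open>As the tail decreases, it is at most \<open>w j\<close> on the interval after
  \<open>dyad j\<close> and at least \<open>w k\<close> on the interval before
  \<open>dyad k\<close>; each factor needs exactly one of these.\<close>

lemma M_continuous_imp_tail_sum_bound:
  assumes pq: "1 < p" "1 < q" "1 / p + 1 / q = 1" and M: "M_continuous p q \<omega> < \<infinity>"
  shows "tail_sum_bound q"
proof -
  obtain C where C: "0 \<le> C" "M_continuous p q \<omega> = ennreal C" using M by (cases "M_continuous p q \<omega>") auto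
  define K where "K = max 2 (2 * 2 powr (q - 1))"
  have K0: "0 < K" by (simp add: K_def)
  have "\<exists>A B. ennreal (head_block p j) \<le> ennreal K * A \<and> ennreal (\<Sum>k=j+2..M. tail_block q k) \<le> ennreal K * B \<and>
      epowr A (1 / p) * epowr B (1 / q) \<le> ennreal C" for j M
  proof -
    define r where "r = dyad (Suc j)"
    define A where "A = (\<integral>\<^sup>+t\<in>{0<..<r}. ennreal (1 / tl t powr p) \<partial>lborel)"
    define B where "B = (\<integral>\<^sup>+t\<in>{r<..<1}. ennreal ((tl t / (1 - t)) powr q) \<partial>lborel)"
    have r: "r \<in> {0<..<1}" using dyad_pos by (simp add: r_def)
    have "epowr A (1 / p) * epowr B (1 / q) \<le> ennreal C"
      unfolding C(2)[symmetric] M_continuous_def A_def B_def tl_def by (rule SUP_upper[OF r])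
    moreover have "ennreal (head_block p j) \<le> ennreal K * A"
    proof -
      have "ennreal (head_block p j) = ennreal 2 * ennreal (1 / w j powr p * (1 / 2) ^ Suc j)"
        by (subst ennreal_mult[symmetric]) (simp_all add: head_block_def powr_minus_divide)
      also have "ennreal (1 / w j powr p * (1 / 2) ^ Suc j) = ennreal (1 / w j powr p) * emeasure lborel {dyad j<..<r}"
        unfolding r_def emeasure_dyad_interval by (rule ennreal_mult) simp_all
      also have "\<dots> = (\<integral>\<^sup>+t\<in>{dyad j<..<r}. ennreal (1 / w j powr p) \<partial>lborel)"
        by (rule nn_integral_cmult_indicator[symmetric]) simp
      also have "\<dots> \<le> A"
        unfolding A_def
      proof (rule nn_integral_mono)
        fix t
        show "ennreal (1 / w j powr p) * indicator {dyad j<..<r} t \<le> ennreal (1 / tl t powr p) * indicator {0<..<r} t"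
        proof (cases "t \<in> {dyad j<..<r}")
          case True
          then have t: "dyad j < t" "t < 1" using r by auto
          then have t0: "0 < t" using dyad_nonneg[of j] by linarith
          have "tl t \<le> w j" unfolding w_def using t t0 by (intro tl_antimono) auto
          then have "1 / w j powr p \<le> 1 / tl t powr p"
            using tl_pos[of t] t t0 pq w_pos[of j] by (intro divide_left_mono powr_mono2 mult_pos_pos) auto
          then show ?thesis using True t t0 by (simp add: ennreal_leI)
        qed simp
      qed
      finally have "ennreal (head_block p j) \<le> ennreal 2 * A" by (simp add: mult_left_mono)
      also have "\<dots> \<le> ennreal K * A" by (intro mult_right_mono ennreal_leI) (auto simp: K_def)
      finally show ?thesis .
    qed
    moreover have "ennreal (\<Sum>k=j+2..M. tail_block q k) \<le> ennreal K * B"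
    proof -
      \<comment> \<open>The interval ends at \<open>dyad k\<close>, which makes \<open>w k\<close> a
        lower bound for the tail. The shifted index costs \<open>2 powr (q - 1)\<close> in the block
        and 2 in the length, as recorded in \<open>K\<close>.\<close>
      define I where "I k = (if j + 2 \<le> k then {dyad (k - 1)<..<dyad k} else {})" for k
      define L where "L k = ennreal ((w k * 2 ^ (k - 1)) powr q)" for k
      have "(\<Sum>k. L k * emeasure lborel (I k)) \<le> B"
        unfolding B_def
      proof (rule nn_integral_ge_UN)
        show "(\<Union>k. I k) \<subseteq> {r<..<1}"
        proof
          fix t assume "t \<in> (\<Union>k. I k)"
          then obtain k where k: "j + 2 \<le> k" "dyad (k - 1) < t" "t < dyad k" by (auto simp: I_def split: if_splits)
          then have "r \<le> dyad (k - 1)" unfolding r_def by (intro dyad_mono) auto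
          moreover have "t < 1" using k(3) dyad_less_1[of k] by linarith
          ultimately show "t \<in> {r<..<1}" using k(2) by simp
        qed
        show "I k \<in> sets lborel" for k by (simp add: I_def)
        show "disjoint_family I"
        proof (unfold disjoint_family_on_def, intro ballI impI)
          fix m n :: nat assume "m \<noteq> n"
          then have "dyad m \<le> dyad (n - 1) \<or> dyad n \<le> dyad (m - 1)"
            using dyad_mono[of m "n - 1"] dyad_mono[of n "m - 1"] by linarith
          then show "I m \<inter> I n = {}" by (auto simp: I_def)
        qed
        show "L k \<le> ennreal ((tl t / (1 - t)) powr q)" if "t \<in> I k" for k t
        proof -
          have k: "j + 2 \<le> k" "dyad (k - 1) < t" "t < dyad k" using that by (auto simp: I_def split: if_splits)
          have t: "0 \<le> t" "t < 1" using k dyad_nonneg[of "k - 1"] dyad_less_1[of k] by linarith+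
          have w: "w k \<le> tl t" unfolding w_def using k t by (intro tl_antimono) auto
          have "(1 - t) * 2 ^ (k - 1) \<le> (1 / 2) ^ (k - 1) * 2 ^ (k - 1)"
            using k by (intro mult_right_mono) (auto simp: dyad_def)
          then have "(1 - t) * 2 ^ (k - 1) \<le> 1" by (simp add: power_one_over)
          then have "w k * ((1 - t) * 2 ^ (k - 1)) \<le> tl t * 1"
            using w w_pos[of k] t by (intro mult_mono) auto
          then have "w k * 2 ^ (k - 1) \<le> tl t / (1 - t)" using t by (simp add: pos_le_divide_eq mult_ac)
          then show ?thesis unfolding L_def using w_pos[of k] pq by (intro ennreal_leI powr_mono2) auto
        qed
      qed
      have "ennreal (\<Sum>k=j+2..M. tail_block q k) = ennreal (\<Sum>k=j+2..M. 2 powr (q - 1) * ((w k * 2 ^ (k - 1)) powr q * (1 / 2) ^ (k - 1)))"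
      proof (intro arg_cong[of _ _ ennreal] sum.cong refl)
        fix k assume "k \<in> {j+2..M}"
        then have k: "real k = real (k - 1) + 1" by auto
        have "2 powr (q - 1) * 2 powr (real (k - 1) * (q - 1)) = 2 powr (real k * (q - 1))"
          unfolding k by (subst powr_add[symmetric]) (simp add: algebra_simps)
        then show "tail_block q k = 2 powr (q - 1) * ((w k * 2 ^ (k - 1)) powr q * (1 / 2) ^ (k - 1))"
          unfolding dyad_powr_integral tail_block_def by (simp only: mult.left_commute)
      qed
      also have "\<dots> \<le> ennreal (2 * 2 powr (q - 1) * (\<Sum>k=j+2..M. (w k * 2 ^ (k - 1)) powr q * (1 / 2) ^ k))"
      proof -
        have "(1 / 2 :: real) ^ (k - 1) = 2 * (1 / 2) ^ k" if "k \<in> {j+2..M}" for k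
          using that by (cases k) auto
        then show ?thesis by (simp add: sum_distrib_left mult_ac)
      qed
      also have "\<dots> = ennreal (2 * 2 powr (q - 1)) * (\<Sum>k=j+2..M. L k * emeasure lborel (I k))"
      proof -
        have "L k * emeasure lborel (I k) = ennreal ((w k * 2 ^ (k - 1)) powr q * (1 / 2) ^ k)" if "k \<in> {j+2..M}" for k
        proof (cases k)
          case (Suc i)
          have "L k * emeasure lborel (I k) = L k * ennreal ((1 / 2) ^ k)"
            using that emeasure_dyad_interval(2)[of i] Suc by (simp add: I_def)
          then show ?thesis unfolding L_def by (subst ennreal_mult) auto
        qed (use that in auto)
        then have "(\<Sum>k=j+2..M. L k * emeasure lborel (I k)) = (\<Sum>k=j+2..M. ennreal ((w k * 2 ^ (k - 1)) powr q * (1 / 2) ^ k))"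
          by (rule sum.cong[OF refl])
        also have "\<dots> = ennreal (\<Sum>k=j+2..M. (w k * 2 ^ (k - 1)) powr q * (1 / 2) ^ k)"
          by (rule sum_ennreal) simp
        finally show ?thesis by (simp only:) (rule ennreal_mult, simp_all add: sum_nonneg)
      qed
      also have "\<dots> \<le> ennreal (2 * 2 powr (q - 1)) * (\<Sum>k. L k * emeasure lborel (I k))"
        by (intro mult_left_mono sum_le_suminf) auto
      also have "\<dots> \<le> ennreal (2 * 2 powr (q - 1)) * B" by (intro mult_left_mono \<open>(\<Sum>k. L k * emeasure lborel (I k)) \<le> B\<close>) auto
      also have "\<dots> \<le> ennreal K * B" by (intro mult_right_mono ennreal_leI) (auto simp: K_def)
      finally show ?thesis .
    qed
    ultimately show ?thesis by blast
  qed
  then show ?thesis by (rule tail_sum_bound_of_products[OF pq K0 C(1)])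
qed

text \<open>The head requires a lower bound for the tail in terms of the left end of an interval,
  which is what doubling supplies. The other factor uses monotonicity and
  \<open>1 - t \<ge> (1 / 2) ^ Suc k\<close>.\<close>

lemma tail_sum_bound_imp_M_continuous:
  assumes pq: "1 < p" "1 < q" "1 / p + 1 / q = 1" and dbl: tail_doubling and G: "tail_sum_bound q"
  shows "M_continuous p q \<omega> < \<infinity>"
proof -
  obtain D where D: "1 \<le> D" "\<And>j k. j \<le> k \<Longrightarrow> w j \<le> D ^ (k - j) * w k" using tail_doublingD[OF dbl] by auto
  define K where "K = max (D powr p) (2 powr (q - 1))"
  have K: "0 < K" "D powr p \<le> K" "2 powr (q - 1) \<le> K" using D(1) by (auto simp: K_def less_max_iff_disj)
  obtain C where C: "\<forall>A B j. A \<le> ennreal (K * (\<Sum>i\<le>j. head_block p i)) \<longrightarrow>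
    B \<le> ennreal K * (\<Sum>i. if j \<le> i then ennreal (tail_block q i) else 0) \<longrightarrow>
    epowr A (1 / p) * epowr B (1 / q) \<le> ennreal C"
    using products_of_tail_sum_bound[OF pq K(1) G] by blast
  have "M_continuous p q \<omega> \<le> ennreal C"
    unfolding M_continuous_def tl_def[symmetric]
  proof (rule SUP_least)
    fix r :: real assume r: "r \<in> {0<..<1}"
    then obtain j where j: "dyad j \<le> r" "r < dyad (Suc j)" using dyad_cover[of r] by auto
    have "(\<integral>\<^sup>+t\<in>{0<..<r}. ennreal (1 / tl t powr p) \<partial>lborel) \<le> ennreal (K * (\<Sum>i\<le>j. head_block p i))"
    proof -
      define I where "I k = (if k \<le> j then {dyad k..<dyad (Suc k)} else {})" for k
      have "(\<integral>\<^sup>+t\<in>{0<..<r}. ennreal (1 / tl t powr p) \<partial>lborel) \<le> (\<Sum>k. ennreal (1 / w (Suc k) powr p) * emeasure lborel (I k))"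
      proof (rule nn_integral_le_UN)
        show "{0<..<r} \<subseteq> (\<Union>k. I k)"
        proof
          fix t assume t: "t \<in> {0<..<r}"
          then obtain k where k: "dyad k \<le> t" "t < dyad (Suc k)" using dyad_cover[of t] r by auto
          have "k \<le> j"
          proof (rule ccontr)
            assume "\<not> k \<le> j"
            then have "dyad (Suc j) \<le> dyad k" by (intro dyad_mono) auto
            then show False using k t j by auto
          qed
          then show "t \<in> (\<Union>k. I k)" using k by (auto simp: I_def)
        qed
        show "I k \<in> sets lborel" for k by (simp add: I_def)
        show "ennreal (1 / tl t powr p) \<le> ennreal (1 / w (Suc k) powr p)" if "t \<in> I k" "t \<in> {0<..<r}" for k t
        proof -
          have t: "t < dyad (Suc k)" "0 < t" "t < 1" using that r by (auto simp: I_def split: if_splits)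
          have "w (Suc k) \<le> tl t" unfolding w_def using t by (intro tl_antimono) auto
          then show ?thesis using w_pos[of "Suc k"] tl_pos[of t] t pq
            by (intro ennreal_leI divide_left_mono powr_mono2 mult_pos_pos) auto
        qed
      qed
      also have "\<dots> = (\<Sum>k\<le>j. ennreal (1 / w (Suc k) powr p) * emeasure lborel (I k))"
        by (rule suminf_finite) (auto simp: I_def)
      also have "\<dots> \<le> (\<Sum>k\<le>j. ennreal (K * head_block p k))"
      proof (rule sum_mono)
        fix k assume "k \<in> {..j}"
        then have "ennreal (1 / w (Suc k) powr p) * emeasure lborel (I k) = ennreal (1 / w (Suc k) powr p * (1 / 2) ^ Suc k)"
          using emeasure_dyad_interval(1)[of k] by (subst ennreal_mult) (simp_all add: I_def)
        also have "\<dots> \<le> ennreal (K * head_block p k)"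
        proof (rule ennreal_leI)
          have "w k powr p \<le> (D * w (Suc k)) powr p" using D(2)[of k "Suc k"] w_pos[of k] pq by (intro powr_mono2) auto
          then have "w k powr p \<le> D powr p * w (Suc k) powr p" by (simp only: powr_mult)
          also have "\<dots> \<le> K * w (Suc k) powr p" by (intro mult_right_mono K) auto
          finally have "1 / w (Suc k) powr p \<le> K / w k powr p"
            using w_pos[of k] w_pos[of "Suc k"] by (simp add: field_simps)
          then have "1 / w (Suc k) powr p * (1 / 2) ^ Suc k \<le> K / w k powr p * (1 / 2) ^ k"
            by (intro mult_mono power_decreasing) (use K in auto)
          then show "1 / w (Suc k) powr p * (1 / 2) ^ Suc k \<le> K * head_block p k"
            by (simp add: head_block_def powr_minus_divide)
        qed
        finally show "ennreal (1 / w (Suc k) powr p) * emeasure lborel (I k) \<le> ennreal (K * head_block p k)" .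
      qed
      also have "\<dots> = ennreal (K * (\<Sum>i\<le>j. head_block p i))"
        using K(1) head_block_pos by (subst sum_ennreal) (auto simp: sum_distrib_left less_imp_le)
      finally show ?thesis .
    qed
    moreover have "(\<integral>\<^sup>+t\<in>{r<..<1}. ennreal ((tl t / (1 - t)) powr q) \<partial>lborel)
        \<le> ennreal K * (\<Sum>i. if j \<le> i then ennreal (tail_block q i) else 0)"
    proof -
      define I where "I k = (if j \<le> k then {dyad k..<dyad (Suc k)} else {})" for k
      have "(\<integral>\<^sup>+t\<in>{r<..<1}. ennreal ((tl t / (1 - t)) powr q) \<partial>lborel) \<le> (\<Sum>k. ennreal ((w k * 2 ^ Suc k) powr q) * emeasure lborel (I k))"
      proof (rule nn_integral_le_UN)
        show "{r<..<1} \<subseteq> (\<Union>k. I k)"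
        proof
          fix t assume t: "t \<in> {r<..<1}"
          then obtain k where k: "dyad k \<le> t" "t < dyad (Suc k)" using dyad_cover[of t] r by auto
          have "j \<le> k"
          proof (rule ccontr)
            assume "\<not> j \<le> k"
            then have "dyad (Suc k) \<le> dyad j" by (intro dyad_mono) auto
            then show False using k t j by auto
          qed
          then show "t \<in> (\<Union>k. I k)" using k by (auto simp: I_def)
        qed
        show "I k \<in> sets lborel" for k by (simp add: I_def)
        show "ennreal ((tl t / (1 - t)) powr q) \<le> ennreal ((w k * 2 ^ Suc k) powr q)" if "t \<in> I k" "t \<in> {r<..<1}" for k t
        proof -
          have t: "dyad k \<le> t" "t < dyad (Suc k)" "0 < t" "t < 1" using that r by (auto simp: I_def split: if_splits)
          have w: "tl t \<le> w k" unfolding w_def using t by (intro tl_antimono) auto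
          have "(1 / 2) ^ Suc k * 2 ^ Suc k \<le> (1 - t) * 2 ^ Suc k"
            using t by (intro mult_right_mono) (auto simp: dyad_def)
          then have "1 \<le> (1 - t) * 2 ^ Suc k" by (simp add: power_one_over)
          then have "tl t * 1 \<le> w k * ((1 - t) * 2 ^ Suc k)"
            using w w_pos[of k] t by (intro mult_mono) auto
          then have "tl t / (1 - t) \<le> w k * 2 ^ Suc k" using t by (simp add: pos_divide_le_eq mult_ac)
          then show ?thesis using tl_pos[of t] t pq by (intro ennreal_leI powr_mono2) auto
        qed
      qed
      also have "\<dots> \<le> (\<Sum>k. ennreal K * (if j \<le> k then ennreal (tail_block q k) else 0))"
      proof (intro suminf_le summableI)
        fix k
        show "ennreal ((w k * 2 ^ Suc k) powr q) * emeasure lborel (I k) \<le> ennreal K * (if j \<le> k then ennreal (tail_block q k) else 0)"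
        proof (cases "j \<le> k")
          case True
          then have "ennreal ((w k * 2 ^ Suc k) powr q) * emeasure lborel (I k) = ennreal ((w k * 2 ^ Suc k) powr q * (1 / 2) ^ Suc k)"
            unfolding I_def using emeasure_dyad_interval(1)[of k] by (subst ennreal_mult) simp_all
          also have "(w k * 2 ^ Suc k) powr q * (1 / 2) ^ Suc k = 2 powr (q - 1) * tail_block q k"
          proof -
            have "2 powr (real (Suc k) * (q - 1)) = 2 powr (q - 1) * 2 powr (real k * (q - 1))"
              by (subst powr_add[symmetric]) (simp add: algebra_simps)
            then show ?thesis unfolding dyad_powr_integral tail_block_def by (simp only: mult.left_commute)
          qed
          also have "ennreal (2 powr (q - 1) * tail_block q k) \<le> ennreal (K * tail_block q k)"
            using K(3) tail_block_pos[of q k] by (intro ennreal_leI mult_right_mono) auto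
          also have "\<dots> = ennreal K * ennreal (tail_block q k)" using K(1) tail_block_pos[of q k] by (intro ennreal_mult) auto
          finally show ?thesis using True by simp
        qed (simp add: I_def)
      qed
      also have "\<dots> = ennreal K * (\<Sum>i. if j \<le> i then ennreal (tail_block q i) else 0)" by (rule ennreal_suminf_cmult)
      finally show ?thesis .
    qed
    ultimately show "epowr (\<integral>\<^sup>+t\<in>{0<..<r}. ennreal (1 / tl t powr p) \<partial>lborel) (1 / p) *
        epowr (\<integral>\<^sup>+t\<in>{r<..<1}. ennreal ((tl t / (1 - t)) powr q) \<partial>lborel) (1 / q) \<le> ennreal C"
      using C by blast
  qed
  then show ?thesis by (simp add: order.strict_trans1)
qed

section \<open>Reverse doubling and boundedness\<close>

text \<open>Geometric decay of \<open>w\<close> halves it within a fixed number of dyadic steps, so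
  \<open>D_check\<close> holds with \<open>K = 2 ^ m\<close> and \<open>C = 2\<close>.\<close>

lemma tail_sum_bound_imp_D_check:
  assumes pq: "1 < p" "1 < q" "1 / p + 1 / q = 1" and G: "tail_sum_bound q"
  shows "\<omega> \<in> D_check"
proof -
  obtain C g where C: "0 < C" and g: "0 < g" "g < 1"
    and decay: "\<And>j k. j \<le> k \<Longrightarrow> w k \<le> C * (g ^ (k - j) * gam p ^ (k - j)) * w j"
    using tail_sum_bound_decay[OF pq G] by metis
  have gp: "0 < gam p" "gam p < 1" using pq powr_less_mono[of "- (1 / p)" 0 2] by (simp_all add: gam_def)
  have "g * gam p < 1" using g gp mult_strict_mono[of g 1 "gam p" 1] by simp
  then obtain n where n: "(g * gam p) ^ n < 1 / (2 * C)" using real_arch_pow_inv[of "1 / (2 * C)" "g * gam p"] C by auto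
  \<comment> \<open>One step more than halving takes, because \<open>r\<close> is only known to lie
    between \<open>dyad j\<close> and \<open>dyad (Suc j)\<close>.\<close>
  define m where "m = Suc n"
  have half: "w (j + m) \<le> 1 / 2 * w (Suc j)" for j
  proof -
    have "w (j + m) \<le> C * (g ^ n * gam p ^ n) * w (Suc j)" using decay[of "Suc j" "j + m"] by (simp add: m_def)
    also have "\<dots> \<le> 1 / 2 * w (Suc j)"
    proof (rule mult_right_mono)
      have "C * (g * gam p) ^ n \<le> C * (1 / (2 * C))" using n C by (intro mult_left_mono) auto
      then show "C * (g ^ n * gam p ^ n) \<le> 1 / 2" using C by (simp add: power_mult_distrib)
    qed (use w_pos[of "Suc j"] in simp)
    finally show ?thesis .
  qed
  have "2 * tl (1 - (1 - r) / 2 ^ m) \<le> tl r" if r: "r \<in> {0..<1}" for r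
  proof -
    obtain j where j: "dyad j \<le> r" "r < dyad (Suc j)" using dyad_cover[of r] r by auto
    have "(1 - r) / 2 ^ m \<le> (1 / 2) ^ j / 2 ^ m" using j(1) by (intro divide_right_mono) (auto simp: dyad_def)
    then have "dyad (j + m) \<le> 1 - (1 - r) / 2 ^ m" by (simp add: dyad_def power_add power_one_over)
    then have "tl (1 - (1 - r) / 2 ^ m) \<le> w (j + m)" unfolding w_def by (intro tl_antimono) auto
    moreover have "w (Suc j) \<le> tl r" unfolding w_def using r j(2) by (intro tl_antimono) auto
    ultimately show ?thesis using half[of j] by linarith
  qed
  moreover have "(1::real) < 2 ^ m" by (rule one_less_power) (simp_all add: m_def)
  ultimately show ?thesis unfolding D_check_def tl_def
    by (intro CollectI exI[of _ "2 ^ m :: real"] exI[of _ "2 :: real"] conjI ballI) auto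
qed

text \<open>Both operators apply the same kernel to a function \<open>h\<close> on the interval with
  \<open>norm (h t) = norm (f t)\<close>, and the sufficiency estimate depends on this absolute
  value only.\<close>

lemma bounded_op_of_tail_sum_bound:
  assumes pq: "1 < p" "1 < q" "1 / p + 1 / q = 1" and dbl: tail_doubling and G: "tail_sum_bound q"
    and X: "X \<in> admissible_norms p" and Y: "Y \<in> admissible_norms p"
    and T: "T \<in> {hilbert_op \<omega>, sublinear_hilbert_op \<omega>}"
  shows "bounded_op T X Y"
proof -
  obtain CX where CX: "0 < CX" "\<And>f. f holomorphic_on ball 0 1 \<Longrightarrow> dyad_norm p f \<le> ennreal CX * epowr (X f) p"
    using norm_dominates_dyad_norm[OF pq(1) X] by auto
  obtain CY where CY: "0 < CY" "\<forall>g \<Phi>. dominated g \<Phi> \<longrightarrow> epowr (Y g) p \<le> ennreal CY * dom_sum p g \<Phi>"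
    using norm_le_dominated[OF pq(1) Y] by (elim exE conjE) (rule that)
  obtain K where K: "0 < K" and suff: "\<forall>f F. continuous_on {0..<1} f \<longrightarrow> (\<forall>k. 0 \<le> F k) \<longrightarrow>
    (\<forall>k t. dyad k \<le> t \<longrightarrow> t < dyad (Suc k) \<longrightarrow> norm (f t) \<le> F k) \<longrightarrow>
    (\<Sum>k. epowr (ennreal (F k * gam p ^ k)) p) < \<infinity> \<longrightarrow>
    (\<exists>g \<Phi>. kernel_op (averaged_kernel \<omega>) \<omega> f = Some g \<and> dominated g \<Phi> \<and>
      dom_sum p g \<Phi> \<le> ennreal K * (\<Sum>k. epowr (ennreal (F k * gam p ^ k)) p))"
    using sufficiency[OF dbl pq G] by (elim exE conjE) (rule that)
  define D where "D = CY * K * 2 * CX"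
  have D0: "0 < D" using CY(1) K CX(1) by (simp add: D_def)
  have main: "\<exists>g\<in>disc_space Y. T f = Some g \<and> epowr (Y g) p \<le> ennreal D * epowr (X f) p" if f: "f \<in> disc_space X" for f
  proof -
    have hol: "f holomorphic_on ball 0 1" and fin: "X f < \<infinity>" using f by (auto simp: disc_space_def)
    have cont: "continuous_on {0..<1} (\<lambda>t. f (of_real t))"
      by (rule continuous_on_compose2[OF holomorphic_on_imp_continuous_on[OF hol]]) (auto intro!: continuous_intros)
    obtain h where h: "continuous_on {0..<1} h" "\<And>t. norm (h t) = norm (f (of_real t))"
      and Th: "T f = kernel_op (averaged_kernel \<omega>) \<omega> h"
    proof (cases "T = hilbert_op \<omega>")
      case True
      show thesis by (rule that[of "\<lambda>t. f (of_real t)"]) (use cont in \<open>auto simp: True hilbert_op_def\<close>)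
    next
      case False
      then have "T = sublinear_hilbert_op \<omega>" using T by auto
      then show thesis
        by (intro that[of "\<lambda>t. of_real (norm (f (of_real t)))"]) (use cont in \<open>auto simp: sublinear_hilbert_op_def intro!: continuous_intros\<close>)
    qed
    \<comment> \<open>The maximum at the right end of the dyadic interval; the shift of the index
      costs the factor 2 in \<open>Sle\<close>.\<close>
    define F where "F k = max_mean (dyad (Suc k)) f" for k
    define S where "S = (\<Sum>k. epowr (ennreal (F k * gam p ^ k)) p)"
    have F0: "0 \<le> F k" for k unfolding F_def by (rule max_mean_nonneg[OF hol]) auto
    have Sle: "S \<le> ennreal 2 * dyad_norm p f"
    proof -
      have "epowr (ennreal (F k * gam p ^ k)) p = ennreal 2 * ennreal (F k powr p * (1 / 2) ^ Suc k)" for k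
      proof -
        have "epowr (ennreal (F k * gam p ^ k)) p = ennreal (F k powr p * (1 / 2) ^ k)"
          using F0[of k] gam_pos[of p] pq by (simp add: powr_mult gam_power_powr)
        also have "F k powr p * (1 / 2) ^ k = 2 * (F k powr p * (1 / 2) ^ Suc k)" by simp
        also have "ennreal \<dots> = ennreal 2 * ennreal (F k powr p * (1 / 2) ^ Suc k)" by (rule ennreal_mult) auto
        finally show ?thesis .
      qed
      then have "S = ennreal 2 * (\<Sum>k. ennreal (F k powr p * (1 / 2) ^ Suc k))"
        unfolding S_def by (simp only: ennreal_suminf_cmult)
      also have "(\<Sum>k. ennreal (F k powr p * (1 / 2) ^ Suc k)) \<le> dyad_norm p f"
        using suminf_tail[of "\<lambda>k. ennreal (max_mean (dyad k) f powr p * (1 / 2) ^ k)" 1]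
        unfolding dyad_norm_def F_def by (auto intro!: suminf_le summableI)
      finally show ?thesis by (simp add: mult_left_mono)
    qed
    also have "\<dots> \<le> ennreal 2 * (ennreal CX * epowr (X f) p)" by (intro mult_left_mono CX(2) hol) auto
    finally have S2: "S \<le> ennreal 2 * (ennreal CX * epowr (X f) p)" .
    have "ennreal 2 * (ennreal CX * epowr (X f) p) < \<infinity>" using fin by (simp add: ennreal_mult_less_top)
    with S2 have Sfin: "S < \<infinity>" by (rule order.strict_trans1)
    have bd: "norm (h t) \<le> F k" if t: "dyad k \<le> t" "t < dyad (Suc k)" for k t
    proof -
      have "0 \<le> t" using t dyad_nonneg[of k] by linarith
      then show ?thesis unfolding h(2) F_def using t by (intro norm_le_max_mean'[OF hol]) auto
    qed
    have "\<exists>g \<Phi>. kernel_op (averaged_kernel \<omega>) \<omega> h = Some g \<and> dominated g \<Phi> \<and> dom_sum p g \<Phi> \<le> ennreal K * S"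
      using suff[rule_format, of h F] h(1) F0 bd Sfin unfolding S_def by simp
    then obtain g \<Phi> where g: "T f = Some g" "dominated g \<Phi>" "dom_sum p g \<Phi> \<le> ennreal K * S"
      unfolding Th by blast
    have "epowr (Y g) p \<le> ennreal CY * dom_sum p g \<Phi>" using CY(2) g(2) by blast
    also have "\<dots> \<le> ennreal CY * (ennreal K * (ennreal 2 * (ennreal CX * epowr (X f) p)))"
      by (intro mult_left_mono order.trans[OF g(3)] S2) auto
    also have "\<dots> = ennreal D * epowr (X f) p"
      unfolding D_def using CY(1) K CX(1) by (simp add: ennreal_mult mult_ac)
    finally have le: "epowr (Y g) p \<le> ennreal D * epowr (X f) p" .
    also have "\<dots> < \<infinity>" using fin by (simp add: ennreal_mult_less_top)
    finally have "Y g < \<infinity>" by simp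
    then have "g \<in> disc_space Y" using g(2) by (auto simp: disc_space_def dominated_def)
    then show ?thesis using g(1) le by blast
  qed
  have "(SUP f\<in>{f \<in> disc_space X. X f \<le> 1}. Y (the (T f))) \<le> epowr (ennreal D) (1 / p)"
  proof (rule SUP_least)
    fix f assume f: "f \<in> {f \<in> disc_space X. X f \<le> 1}"
    then obtain g where g: "T f = Some g" "epowr (Y g) p \<le> ennreal D * epowr (X f) p" using main[of f] by blast
    have "epowr (X f) p \<le> epowr (ennreal 1) p" using f pq by (intro epowr_mono) auto
    also have "\<dots> = 1" by (subst epowr_ennreal) auto
    finally have "epowr (X f) p \<le> 1" .
    then have "ennreal D * epowr (X f) p \<le> ennreal D * 1" by (intro mult_left_mono) simp_all
    with g(2) have "epowr (Y g) p \<le> ennreal D" by simp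
    then show "Y (the (T f)) \<le> epowr (ennreal D) (1 / p)" using g(1) pq epowr_le_imp_le[of "Y g" p] by simp
  qed
  also have "\<dots> < \<infinity>" by simp
  finally show ?thesis unfolding bounded_op_def using main by blast
qed

end

theorem theorem1:
  fixes \<omega> :: "real \<Rightarrow> real" and p p' :: real
    and X Y :: "(complex \<Rightarrow> complex) \<Rightarrow> ennreal"
    and T :: "(complex \<Rightarrow> complex) \<rightharpoonup> (complex \<Rightarrow> complex)"
  assumes "radial_weight \<omega>"
    and "1 < p" and "1 / p + 1 / p' = 1"
    and "X \<in> {Hinf_norm p, Hardy_norm p, Dirichlet_norm p, HL_norm p}"
    and "Y \<in> {Hinf_norm p, Hardy_norm p, Dirichlet_norm p, HL_norm p}"
    and "T \<in> {hilbert_op \<omega>, sublinear_hilbert_op \<omega>}"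
  shows "(bounded_op T X Y \<longleftrightarrow> \<omega> \<in> D_class \<and> M_discrete p p' \<omega> < \<infinity>) \<and>
    (\<omega> \<in> D_class \<and> M_discrete p p' \<omega> < \<infinity> \<longleftrightarrow> \<omega> \<in> D_hat \<and> M_discrete p p' \<omega> < \<infinity>) \<and>
    (\<omega> \<in> D_hat \<and> M_discrete p p' \<omega> < \<infinity> \<longleftrightarrow> \<omega> \<in> D_hat \<and> M_continuous p p' \<omega> < \<infinity>)"
proof -
  interpret radial \<omega> by unfold_locales fact
  have inv: "0 < 1 / p" "1 / p < 1" using assms(2) by auto
  then have "0 < 1 / p'" "1 / p' < 1" using assms(3) by linarith+
  then have q: "1 < p'" by (simp add: zero_less_divide_iff divide_less_eq)
  note pq = assms(2) q assms(3)
  have X: "X \<in> admissible_norms p" and Y: "Y \<in> admissible_norms p"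
    using assms(4,5) by (simp_all add: admissible_norms_def)
  have discrete: "M_discrete p p' \<omega> < \<infinity> \<longleftrightarrow> tail_sum_bound p'" if "tail_doubling"
    using M_discrete_imp_tail_sum_bound[OF pq that] tail_sum_bound_imp_M_discrete[OF pq that] by blast
  have continuous: "M_continuous p p' \<omega> < \<infinity> \<longleftrightarrow> tail_sum_bound p'" if "tail_doubling"
    using M_continuous_imp_tail_sum_bound[OF pq] tail_sum_bound_imp_M_continuous[OF pq that] by blast
  \<comment> \<open>Doubling is obtained first and is then available for the sum condition.\<close>
  have necessary: "tail_doubling \<and> tail_sum_bound p'" if "bounded_op T X Y"
    using necessity_bound[OF assms(2) X Y assms(6) that] test_bound_imp_tail_doubling[OF assms(2)]
      test_bound_imp_tail_sum_bound[OF pq] by blast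
  have sufficient: "bounded_op T X Y" if "tail_doubling" "tail_sum_bound p'"
    by (rule bounded_op_of_tail_sum_bound[OF pq that X Y assms(6)])
  \<comment> \<open>This joins the statement with \<open>D_class\<close> to the one with
    \<open>D_hat\<close>: reverse doubling follows from the sum condition.\<close>
  have "tail_sum_bound p' \<Longrightarrow> \<omega> \<in> D_check" by (rule tail_sum_bound_imp_D_check[OF pq])
  then show ?thesis
    unfolding D_class_def Int_iff D_hat_iff using discrete continuous necessary sufficient by blast
qed

end
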